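(* Let $\Delta=\Delta^o\cup\{0\}$ and let $P$ be a transition kernel on $\Delta$ such that the substochastic matrix $P^o$ given by $P^o_{x,y}=P_{x,y}$, $x,y\in\Delta^o$, is irreducible. Define $G:\mathcal P(\Delta^o)\to\mathcal K(\Delta^o)$ by $$G(m)_{x,y}=P_{x,y}+P_{x,0}\,m_y,\qquad x,y\in\Delta^o,\ m\in\mathcal P(\Delta^o),$$ and let $\{L^{n+1}\}_{n\in\mathbb N_0}$ be the empirical measures of the associated self-interacting chain. Let $A$ be the adjacency matrix $A_{x,y}=\mathbf 1_{\{P_{x,y}+P_{x,0}>0\}}$. Then $\{L^{n+1}\}$ satisfies a large deviation principle on $\mathcal P(\Delta^o)$ with rate function $I_A$: $I_A$ has compact sublevel sets, for each closed $F\subseteq\mathcal P(\Delta^o)$, $\limsup_{n\to\infty}n^{-1}\log P(L^{n+1}\in F)\le-\inf_{m\in F}I_A(m)$, and for each open $U\subseteq\mathcal P(\Delta^o)$, $\liminf_{n\to\infty}n^{-1}\log P(L^{n+1}\in U)\ge-\inf_{m\in U}I_A(m)$.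
   Context: Setting. Fix $d\in\mathbb N$, $\Delta^o=\{1,\dots,d\}$. For a finite set $S$, $\mathcal P(S)$ is the set of probability measures on $S$ with the weak topology; $m(x)=m_x$ denotes $m(\{x\})$, and $\|\cdot\|$ is the $\ell^1$ norm. $\mathcal K(\Delta^o)$ is the set of transition kernels on $\Delta^o$ ($d\times d$ stochastic matrices). $P^o$ irreducible means that for all $x,y\in\Delta^o$ there is $m\in\mathbb N$ with $((P^o)^m)_{x,y}>0$. $R(\nu\|\mu)=\int\log\frac{d\nu}{d\mu}\,d\nu$ if $\nu\ll\mu$ and $+\infty$ otherwise. For $\lambda\in\mathcal P(\Delta^o\times\Delta^o)$, $\lambda_{(1)},\lambda_{(2)}$ denote its marginals. Process. Fix $x_0\in\Delta^o$. $\{X_n\}_{n\in\mathbb N_0}$ is a sequence of $\Delta^o$-valued random variables with $X_0=x_0$ and $P(X_{n+1}=y\mid X_0,\dots,X_n)=G(L^{n+1})_{X_n,y}$, where $L^{n+1}=\frac1{n+1}\sum_{i=0}^n\delta_{X_i}$. (This is the Aldous–Flannery–Palacios scheme for approximating the quasi-stationary distribution of the chain with kernel $P$.) Adjacency matrices. $A_+=\{(x,y)\in\Delta^o\times\Delta^o:A_{x,y}=1\}$ and $(A_+)^c$ is its complement in $\Delta^o\times\Delta^o$. Function $I_A$. Let $\mathcal U$ be the set of measurable maps $\eta:\mathbb R_+\to\mathcal P(\Delta^o\times\Delta^o)$, written $\eta(s)=\eta(\cdot\mid s)$, with disintegration $\eta(x,y\mid s)=\eta_{(1)}(x\mid s)\,\eta_{2|1}(y\mid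 s,x)$. For $m\in\mathcal P(\Delta^o)$ and $\eta\in\mathcal U$ let $M\in C([0,\infty):\mathbb R^d)$ be the unique solution of $$M(t)=m-\int_0^t\eta_{(1)}(s)\,ds+\int_0^tM(s)\,ds,\quad t\ge0.$$ $\mathcal U(m)$ is the set of $\eta\in\mathcal U$ such that: (a) $\eta(x,y\mid t)=0$ for all $(x,y)\in(A_+)^c$ and a.e. $t$; (b) $\eta_{(1)}(\cdot\mid s)=\eta_{(2)}(\cdot\mid s)$ for a.e. $s$; (c) $M(t)\in\mathcal P(\Delta^o)$ for all $t$, and there is $M_{\rm pair}\in C(\mathbb R_+:\mathcal P(\Delta^o\times\Delta^o))$ with $\|M_{\rm pair}(t)-M_{\rm pair}(s)\|\le2|t-s|$, $(M_{\rm pair}(t))_{(1)}=(M_{\rm pair}(t))_{(2)}=M(t)$, and $M_{\rm pair}(t)(x,y)=0$ for all $(x,y)\in(A_+)^c$, for all $s,t\in\mathbb R_+$. For $\eta\in\mathcal U(m)$, the function $M$ is said to solve $\mathcal U(m,\eta)$. Define $$I_A(m)=\inf_{\eta\in\mathcal U(m)}\int_0^\infty e^{-s}\sum_{x\in\Delta^o}\eta_{(1)}(x\mid s)\,R\big(\eta_{2|1}(\cdot\mid s,x)\,\|\,G(M(s))(x,\cdot)\big)\,ds,$$ where $M$ solves $\mathcal U(m,\eta)$ (infimum over the empty set is $+\infty$; terms with $\eta_{(1)}(x\mid s)=0$ are $0$). *)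

theory Defs
  imports "HOL-Probability.Probability"
begin

text \<open>
  The state space \<open>{1, \<dots>, d}\<close>, with \<open>d \<ge> 1\<close> arbitrary, is a finite type \<open>'s\<close>, and adjoining
  the extra state \<open>0\<close> gives \<open>'s option\<close>, with \<open>None\<close> for \<open>0\<close>. A probability measure \<open>m\<close> on a
  finite type is identified with the vector of its point masses \<open>m $ x\<close>.
\<close>

section \<open>Probability measures on a finite set\<close>

definition prob_simplex :: "(real ^ 'a::finite) set" where
  "prob_simplex = {m. (\<forall>x. 0 \<le> m $ x) \<and> (\<Sum>x\<in>UNIV. m $ x) = 1}"

text \<open>The coarsest topology for which \<open>m \<mapsto> \<integral> f dm\<close> is continuous for every \<open>f\<close>.\<close>

definition weak_topology :: "(real ^ 'a::finite) topology" where
  "weak_topology = topology_generated_by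
     {{m \<in> prob_simplex. (\<Sum>x\<in>UNIV. f x * m $ x) \<in> V} | f V. open (V :: real set)}"

lemma weak_topology_eq: "weak_topology = top_of_set (prob_simplex :: (real ^ 'a::finite) set)"
proof -
  let ?B = "{{m \<in> prob_simplex. (\<Sum>x\<in>UNIV. f x * m $ x) \<in> V} | f V. open (V :: real set)}
    :: (real ^ 'a) set set"
  have B: "openin (top_of_set prob_simplex) W" if W: "W \<in> ?B" for W :: "(real ^ 'a) set"
  proof -
    obtain f V where V: "open (V :: real set)"
      and W_eq: "W = {m \<in> prob_simplex. (\<Sum>x\<in>UNIV. f x * m $ x) \<in> V}"
      using W by blast
    have "continuous_on prob_simplex (\<lambda>m :: real ^ 'a. \<Sum>x\<in>UNIV. f x * m $ x)"
      by (intro continuous_intros)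
    moreover have "W = prob_simplex \<inter> (\<lambda>m. \<Sum>x\<in>UNIV. f x * m $ x) -` V"
      unfolding W_eq by auto
    ultimately show ?thesis
      using V continuous_openin_preimage_gen by metis
  qed
  have coord: "openin weak_topology {m \<in> prob_simplex. m $ i \<in> V}" if "open V"
    for V :: "real set" and i :: 'a
  proof -
    have "(\<Sum>x\<in>UNIV. (if x = i then 1 else 0) * m $ x) = m $ i" for m :: "real ^ 'a"
      by (simp add: if_distrib[of "\<lambda>c. c * _"] cong: if_cong)
    then have "{m \<in> prob_simplex. m $ i \<in> V} \<in> ?B"
      using that by (intro CollectI exI[of _ "\<lambda>x. if x = i then 1 else 0"] exI[of _ V]) auto
    then show ?thesis
      unfolding weak_topology_def by (rule topology_generated_by_Basis)
  qed
  have "openin weak_topology W \<longleftrightarrow> openin (top_of_set prob_simplex) W" for W :: "(real ^ 'a) set"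
  proof
    assume "openin weak_topology W"
    then have "generate_topology_on ?B W"
      unfolding weak_topology_def openin_topology_generated_by_iff .
    then show "openin (top_of_set prob_simplex) W"
    proof induction
      case (UN K)
      then show ?case by (metis openin_Union)
    qed (use B in auto)
  next
    assume "openin (top_of_set prob_simplex) W"
    then obtain T where T: "open T" and W: "W = prob_simplex \<inter> T"
      unfolding openin_open by blast
    show "openin weak_topology W"
    proof (subst openin_subopen, intro ballI)
      fix m assume m: "m \<in> W"
      then obtain A where A: "\<And>i. open (A i)" "\<And>i. m $ i \<in> A i"
        and AT: "\<And>y. (\<And>i. y $ i \<in> A i) \<Longrightarrow> y \<in> T"
        using T unfolding W open_vec_def by (metis IntD2)
      let ?N = "\<Inter>i\<in>UNIV. {m \<in> prob_simplex. m $ i \<in> A i}"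
      have "openin weak_topology ?N"
        by (intro openin_Inter) (auto intro: coord A)
      moreover have "m \<in> ?N" "?N \<subseteq> W"
        using m A AT by (auto simp: W)
      ultimately show "\<exists>U. openin weak_topology U \<and> m \<in> U \<and> U \<subseteq> W"
        by blast
    qed
  qed
  then show ?thesis by (simp add: topology_eq)
qed

definition l1_norm :: "real ^ 'a::finite \<Rightarrow> real" where
  "l1_norm v = (\<Sum>x\<in>UNIV. \<bar>v $ x\<bar>)"

definition marginal1 :: "real ^ ('s::finite \<times> 's) \<Rightarrow> real ^ 's" where
  "marginal1 \<mu> = (\<chi> x. \<Sum>y\<in>UNIV. \<mu> $ (x, y))"

definition marginal2 :: "real ^ ('s::finite \<times> 's) \<Rightarrow> real ^ 's" where
  "marginal2 \<mu> = (\<chi> y. \<Sum>x\<in>UNIV. \<mu> $ (x, y))"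

text \<open>The conditional law of the second coordinate; it is the zero vector when
  \<open>marginal1 \<mu> $ x = 0\<close>, in which case it only appears with the weight \<open>0\<close>.\<close>

definition conditional :: "real ^ ('s::finite \<times> 's) \<Rightarrow> 's \<Rightarrow> real ^ 's" where
  "conditional \<mu> x = (\<chi> y. \<mu> $ (x, y) / marginal1 \<mu> $ x)"

definition measure_of_vec :: "real ^ 'a::finite \<Rightarrow> 'a measure" where
  "measure_of_vec m = point_measure UNIV (\<lambda>x. ennreal (m $ x))"

text \<open>Relative entropy \<open>R(\<nu> \<parallel> \<mu>)\<close>. The library's \<^const>\<open>KL_divergence\<close> has the reference measure
  first. It is nonnegative for probability measures, so \<^const>\<open>ennreal\<close> cuts nothing off.\<close>

definition relative_entropy :: "real ^ 'a::finite \<Rightarrow> real ^ 'a \<Rightarrow> ennreal" where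
  "relative_entropy \<nu> \<mu> =
     (if absolutely_continuous (measure_of_vec \<mu>) (measure_of_vec \<nu>)
      then ennreal (KL_divergence (exp 1) (measure_of_vec \<mu>) (measure_of_vec \<nu>))
      else \<infinity>)"


section \<open>Transition kernels\<close>

definition transition_kernel :: "real ^ 'a ^ 'a::finite \<Rightarrow> bool" where
  "transition_kernel K \<longleftrightarrow> (\<forall>x. K $ x \<in> prob_simplex)"

text \<open>The exponent is at least 1. The overloaded power on \<open>real ^ 'a ^ 'a\<close> would be entrywise,
  hence the iterated matrix product.\<close>

definition irreducible_matrix :: "real ^ 'a ^ 'a::finite \<Rightarrow> bool" where
  "irreducible_matrix K \<longleftrightarrow> (\<forall>x y. \<exists>k\<ge>1. (((**) K ^^ k) (mat 1)) $ x $ y > 0)"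

definition interior_part :: "real ^ 's option ^ 's option \<Rightarrow> real ^ 's ^ 's::finite" where
  "interior_part P = (\<chi> x y. P $ Some x $ Some y)"

text \<open>The kernel \<open>G(m)\<close> and adjacency matrix of the Aldous-Flannery-Palacios scheme.\<close>

definition afp_kernel :: "real ^ 's option ^ 's option \<Rightarrow> real ^ 's \<Rightarrow> real ^ 's ^ 's::finite" where
  "afp_kernel P m = (\<chi> x y. P $ Some x $ Some y + P $ Some x $ None * m $ y)"

definition afp_adjacency :: "real ^ 's option ^ 's option \<Rightarrow> real ^ 's ^ 's::finite" where
  "afp_adjacency P = (\<chi> x y. if P $ Some x $ Some y + P $ Some x $ None > 0 then 1 else 0)"


section \<open>Self-interacting chains\<close>

text \<open>The mean of the Dirac masses at the first \<open>n\<close> values \<open>X 0, \<dots>, X (n - 1)\<close>, for \<open>n \<ge> 1\<close>.\<close>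

definition empirical_measure :: "(nat \<Rightarrow> 'w \<Rightarrow> 's::finite) \<Rightarrow> nat \<Rightarrow> 'w \<Rightarrow> real ^ 's" where
  "empirical_measure X n \<omega> = (1 / real n) *\<^sub>R (\<Sum>i<n. axis (X i \<omega>) 1)"

definition past :: "'w measure \<Rightarrow> (nat \<Rightarrow> 'w \<Rightarrow> 's) \<Rightarrow> nat \<Rightarrow> 'w measure" where
  "past \<Omega> X n = sigma (space \<Omega>) {X i -` B \<inter> space \<Omega> | i B. i \<le> n}"

definition self_interacting_chain ::
  "'w measure \<Rightarrow> (real ^ 's \<Rightarrow> real ^ 's ^ 's::finite) \<Rightarrow> 's \<Rightarrow> (nat \<Rightarrow> 'w \<Rightarrow> 's) \<Rightarrow> bool" where
  "self_interacting_chain \<Omega> G x\<^sub>0 X \<longleftrightarrow>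
     prob_space \<Omega> \<and>
     (\<forall>n. X n \<in> \<Omega> \<rightarrow>\<^sub>M count_space UNIV) \<and>
     (AE \<omega> in \<Omega>. X 0 \<omega> = x\<^sub>0) \<and>
     (\<forall>n y. AE \<omega> in \<Omega>.
        real_cond_exp \<Omega> (past \<Omega> X n) (indicator {\<omega> \<in> space \<Omega>. X (Suc n) \<omega> = y}) \<omega>
          = G (empirical_measure X (Suc n) \<omega>) $ X n \<omega> $ y)"


section \<open>The rate function\<close>

definition adj_support :: "real ^ 's ^ 's::finite \<Rightarrow> ('s \<times> 's) set" where
  "adj_support A = {(x, y). A $ x $ y = 1}"

text \<open>Only the restrictions of \<open>\<eta>\<close> and \<open>M\<close> to \<open>{0..}\<close> matter, here and below.\<close>

definition controls :: "(real \<Rightarrow> real ^ ('s::finite \<times> 's)) set" where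
  "controls = (restrict_space borel {0..} \<rightarrow>\<^sub>M restrict_space borel prob_simplex)"

text \<open>For a control \<open>\<eta>\<close>, such an \<open>M\<close> exists and is unique on \<open>{0..}\<close>.\<close>

definition solves ::
  "real ^ 's \<Rightarrow> (real \<Rightarrow> real ^ ('s::finite \<times> 's)) \<Rightarrow> (real \<Rightarrow> real ^ 's) \<Rightarrow> bool" where
  "solves m \<eta> M \<longleftrightarrow>
     continuous_on {0..} M \<and>
     (\<forall>t\<ge>0. M t = m - (LINT s:{0..t}|lborel. marginal1 (\<eta> s)) + (LINT s:{0..t}|lborel. M s))"

definition admissible_controls ::
  "real ^ 's ^ 's \<Rightarrow> real ^ 's \<Rightarrow> (real \<Rightarrow> real ^ ('s::finite \<times> 's)) set" where
  "admissible_controls A m = {\<eta> \<in> controls.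
     (AE t\<in>{0..} in lborel. \<forall>p \<in> - adj_support A. \<eta> t $ p = 0) \<and>
     (AE s\<in>{0..} in lborel. marginal1 (\<eta> s) = marginal2 (\<eta> s)) \<and>
     (\<exists>M. solves m \<eta> M \<and>
        (\<forall>t\<ge>0. M t \<in> prob_simplex) \<and>
        (\<exists>Mpair. continuous_map (top_of_set {0..}) weak_topology Mpair \<and>
           (\<forall>s\<ge>0. \<forall>t\<ge>0. l1_norm (Mpair t - Mpair s) \<le> 2 * \<bar>t - s\<bar>) \<and>
           (\<forall>t\<ge>0. marginal1 (Mpair t) = M t \<and> marginal2 (Mpair t) = M t) \<and>
           (\<forall>t\<ge>0. \<forall>p \<in> - adj_support A. Mpair t $ p = 0)))}"

definition control_cost ::
  "(real ^ 's \<Rightarrow> real ^ 's ^ 's) \<Rightarrow> (real \<Rightarrow> real ^ ('s::finite \<times> 's)) \<Rightarrow> (real \<Rightarrow> real ^ 's) \<Rightarrow> ennreal"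
  where
  "control_cost G \<eta> M =
     (\<integral>\<^sup>+ s\<in>{0..}. ennreal (exp (- s)) *
        (\<Sum>x\<in>UNIV. ennreal (marginal1 (\<eta> s) $ x) *
           relative_entropy (conditional (\<eta> s) x) (G (M s) $ x)) \<partial>lborel)"

definition rate_function ::
  "real ^ 's ^ 's \<Rightarrow> (real ^ 's \<Rightarrow> real ^ 's ^ 's::finite) \<Rightarrow> real ^ 's \<Rightarrow> ennreal" where
  "rate_function A G m =
     (INF (\<eta>, M) \<in> {(\<eta>, M). \<eta> \<in> admissible_controls A m \<and> solves m \<eta> M}. control_cost G \<eta> M)"


section \<open>Large deviation principles\<close>

definition log_prob :: "real \<Rightarrow> ereal" where
  "log_prob p = (if p = 0 then - \<infinity> else ereal (ln p))"

definition large_deviation_principle ::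
  "'w measure \<Rightarrow> 'a topology \<Rightarrow> (nat \<Rightarrow> 'w \<Rightarrow> 'a) \<Rightarrow> ('a \<Rightarrow> ennreal) \<Rightarrow> bool" where
  "large_deviation_principle \<Omega> T Y I \<longleftrightarrow>
     (\<forall>c::real. compactin T {m \<in> topspace T. I m \<le> ennreal c}) \<and>
     (\<forall>F. closedin T F \<longrightarrow>
        limsup (\<lambda>n. ereal (1 / real n) * log_prob (measure \<Omega> {\<omega> \<in> space \<Omega>. Y n \<omega> \<in> F}))
          \<le> - (INF m\<in>F. enn2ereal (I m))) \<and>
     (\<forall>U. openin T U \<longrightarrow>
        liminf (\<lambda>n. ereal (1 / real n) * log_prob (measure \<Omega> {\<omega> \<in> space \<Omega>. Y n \<omega> \<in> U}))
          \<ge> - (INF m\<in>U. enn2ereal (I m)))"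

end

theory Submission
  imports Defs
begin

text \<open>
  In logarithmic time \<open>u = exp (- s)\<close> a control becomes a path \<open>\<zeta>\<close> of pair measures on \<open>(0, 1]\<close>,
  the function \<open>M\<close> becomes the running average \<open>(1 / u) \<integral>\<^sub>0\<^sup>u \<zeta>\<^sub>1\<close>, and the cost becomes the integral over
  \<open>u\<close> of the relative entropy of \<open>\<zeta> u\<close> with respect to the kernel at that average. The path \<open>\<zeta>\<close>
  describes the transitions of the chain: \<open>n \<integral>\<^sub>0\<^sup>u \<zeta>\<close> counts the pairs seen up to time \<open>n u\<close>.

  Upper bound: the rescaled pair counts lie in a compact space of functions, so it suffices to bound
  the probability of being near one function \<open>\<integral>\<^sub>0\<^sup>u \<zeta>\<close>. A change of measure to kernels that are
  constant on \<open>K\<close> blocks of time gives a discretised cost. If all these lower bounds of the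
  rate are at most \<open>a\<close>, then choosing the kernels close to the conditionals of \<open>\<zeta>\<close> shows that the
  cost of \<open>\<zeta>\<close> is at most \<open>a\<close>.

  Lower bound: average \<open>\<zeta>\<close> over blocks and mix it with a stationary pair measure of the
  irreducible matrix \<open>P\<^sup>o\<close>. The chain with these block kernels follows \<open>\<zeta>\<close> by a law of large
  numbers, and the density with respect to it is controlled because within block \<open>b\<close> the
  empirical measure loses at most a factor \<open>b / (b + 1)\<close>.
\<close>

section \<open>Entropy\<close>

text \<open>The obstacle is that the kernel degenerates at the boundary of the simplex: where
  \<open>Po x y = 0\<close> its entry is \<open>Pz x * m $ y\<close>, so its logarithm is unbounded,
  and the chain starts at a Dirac mass. In the upper bound a floor \<delta> is added to the kernel.
  This enlarges the dominating kernel, so each discretised cost stays a valid lower estimate, and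
  Fatou's lemma removes \<delta> at the end. In the lower bound the chain itself has to create
  positivity: \<open>G m\<close> dominates \<open>P\<^sup>o\<close> whatever \<open>m\<close> is, so
  a first block driven by \<open>P\<^sup>o\<close> has a cost of order 1/K and, by irreducibility,
  visits every state a number of times proportional to \<open>n\<close>. Afterwards counts never
  decrease, so a coordinate of the empirical measure can shrink only through the growing
  denominator; the losses ln ((b + 1) / b) sum to o(K). The compact space of functions carries the
  product topology, so a neighbourhood tests finitely many values of a path, and limit points need
  no regularity beyond what their constraints give.\<close>

lemma ln_ge_one_minus_inverse:
  fixes a b :: real
  assumes "0 \<le> a" "0 < b"
  shows "a - b \<le> a * ln (a / b)"
proof (cases "a = 0")
  case False
  then have a: "a > 0" using assms by simp
  have "ln (b / a) \<le> b / a - 1" using a assms by (intro ln_le_minus_one) auto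
  then have "a * ln (b / a) \<le> a * (b / a - 1)" using a by (intro mult_left_mono) auto
  then show ?thesis using a assms by (simp add: ln_div algebra_simps)
qed (use assms in auto)

lemma gibbs_sum:
  fixes \<nu> \<mu> :: "'a::finite \<Rightarrow> real"
  assumes "\<And>y. 0 \<le> \<nu> y" "\<And>y. 0 \<le> \<mu> y" "\<And>y. \<mu> y = 0 \<Longrightarrow> \<nu> y = 0"
  shows "(\<Sum>y\<in>UNIV. \<nu> y) - (\<Sum>y\<in>UNIV. \<mu> y) \<le> (\<Sum>y\<in>UNIV. \<nu> y * ln (\<nu> y / \<mu> y))"
proof -
  have "\<nu> y - \<mu> y \<le> \<nu> y * ln (\<nu> y / \<mu> y)" for y
  proof (cases "\<mu> y = 0")
    case False
    then show ?thesis using ln_ge_one_minus_inverse[of "\<nu> y" "\<mu> y"] assms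
      by (simp add: less_le)
  qed (use assms in auto)
  then show ?thesis
    by (subst sum_subtractf[symmetric]) (rule sum_mono)
qed

lemma emeasure_measure_of_vec:
  fixes m :: "real ^ 'a::finite"
  shows "emeasure (measure_of_vec m) A = (\<Sum>x\<in>A. ennreal (m $ x))"
  unfolding measure_of_vec_def
  by (simp add: emeasure_point_measure_finite)

lemma sets_measure_of_vec [simp]: "sets (measure_of_vec m) = UNIV"
  and space_measure_of_vec [simp]: "space (measure_of_vec m) = UNIV"
  unfolding measure_of_vec_def by (auto simp: sets_point_measure space_point_measure)

lemma absolutely_continuous_measure_of_vec:
  fixes \<mu> \<nu> :: "real ^ 'a::finite"
  assumes "\<And>y. 0 \<le> \<nu> $ y" "\<And>y. 0 \<le> \<mu> $ y"
  shows "absolutely_continuous (measure_of_vec \<mu>) (measure_of_vec \<nu>)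
    \<longleftrightarrow> (\<forall>y. \<mu> $ y = 0 \<longrightarrow> \<nu> $ y = 0)"
proof
  assume ac: "absolutely_continuous (measure_of_vec \<mu>) (measure_of_vec \<nu>)"
  show "\<forall>y. \<mu> $ y = 0 \<longrightarrow> \<nu> $ y = 0"
  proof (intro allI impI)
    fix y assume "\<mu> $ y = 0"
    then have "{y} \<in> null_sets (measure_of_vec \<mu>)"
      by (simp add: null_sets_def emeasure_measure_of_vec)
    then have "{y} \<in> null_sets (measure_of_vec \<nu>)"
      using ac unfolding absolutely_continuous_def by auto
    then show "\<nu> $ y = 0" using assms(1)[of y]
      by (auto simp: null_sets_def emeasure_measure_of_vec ennreal_eq_0_iff)
  qed
next
  assume *: "\<forall>y. \<mu> $ y = 0 \<longrightarrow> \<nu> $ y = 0"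
  show "absolutely_continuous (measure_of_vec \<mu>) (measure_of_vec \<nu>)"
    unfolding absolutely_continuous_def
  proof
    fix A assume "A \<in> null_sets (measure_of_vec \<mu>)"
    then have "(\<Sum>x\<in>A. \<mu> $ x) = 0"
      using assms(2) by (auto simp: null_sets_def emeasure_measure_of_vec ennreal_eq_0_iff intro: antisym sum_nonneg)
    then have "\<forall>x\<in>A. \<mu> $ x = 0"
      using assms(2) by (subst (asm) sum_nonneg_eq_0_iff) auto
    then have "\<forall>x\<in>A. \<nu> $ x = 0" using * by auto
    then show "A \<in> null_sets (measure_of_vec \<nu>)"
      by (simp add: null_sets_def emeasure_measure_of_vec)
  qed
qed

lemma relative_entropy_eq:
  fixes \<mu> \<nu> :: "real ^ 'a::finite"
  assumes nn: "\<And>y. 0 \<le> \<nu> $ y" "\<And>y. 0 \<le> \<mu> $ y"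
  shows "relative_entropy \<nu> \<mu> = (if \<forall>y. \<mu> $ y = 0 \<longrightarrow> \<nu> $ y = 0
    then ennreal (\<Sum>y\<in>UNIV. \<nu> $ y * ln (\<nu> $ y / \<mu> $ y)) else \<infinity>)"
proof (cases "\<forall>y. \<mu> $ y = 0 \<longrightarrow> \<nu> $ y = 0")
  case True
  let ?M = "measure_of_vec \<mu>"
  have fin: "finite_measure ?M"
    by (rule finite_measureI) (simp add: emeasure_measure_of_vec)
  interpret finite_measure ?M by (rule fin)
  \<comment> \<open>The density is the quotient of the point masses. Where \<open>\<mu>\<close>
    vanishes the quotient is 0 by convention, in agreement with \<open>\<nu>\<close> there.\<close>
  let ?f = "\<lambda>y. \<nu> $ y / \<mu> $ y"
  have d: "measure_of_vec \<nu> = density ?M ?f"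
  proof (rule measure_eqI)
    fix A assume "A \<in> sets (measure_of_vec \<nu>)"
    have "emeasure (density ?M ?f) A = (\<integral>\<^sup>+ x. ennreal (?f x) * indicator A x \<partial>?M)"
      by (subst emeasure_density) (auto simp: measure_of_vec_def)
    also have "\<dots> = (\<Sum>x\<in>UNIV. ennreal (?f x) * indicator A x * ennreal (\<mu> $ x))"
      unfolding measure_of_vec_def
      by (subst nn_integral_point_measure_finite) (auto simp: mult.commute)
    also have "\<dots> = (\<Sum>x\<in>UNIV. ennreal (\<nu> $ x) * indicator A x)"
    proof (rule sum.cong)
      fix x
      have "ennreal (?f x) * ennreal (\<mu> $ x) = ennreal (\<nu> $ x)"
        using True nn by (cases "\<mu> $ x = 0") (auto simp: ennreal_mult[symmetric])
      then show "ennreal (?f x) * indicator A x * ennreal (\<mu> $ x) = ennreal (\<nu> $ x) * indicator A x"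
        by (simp add: mult.commute mult.left_commute)
    qed auto
    also have "\<dots> = (\<Sum>x\<in>A. ennreal (\<nu> $ x))"
      by (simp add: indicator_def sum.If_cases if_distrib cong: if_cong)
    finally show "emeasure (measure_of_vec \<nu>) A = emeasure (density ?M ?f) A"
      by (simp add: emeasure_measure_of_vec)
  qed simp
  have "KL_divergence (exp 1) ?M (measure_of_vec \<nu>) = (\<integral>x. ?f x * log (exp 1) (?f x) \<partial>?M)"
    unfolding d by (rule KL_density) (auto simp: measure_of_vec_def nn)
  also have "\<dots> = (\<Sum>y\<in>UNIV. \<mu> $ y * (?f y * log (exp 1) (?f y)))"
    unfolding measure_of_vec_def
    by (subst lebesgue_integral_point_measure_finite) (auto simp: nn)
  also have "\<dots> = (\<Sum>y\<in>UNIV. \<nu> $ y * ln (\<nu> $ y / \<mu> $ y))"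
    using True by (intro sum.cong) (auto simp: log_def)
  finally show ?thesis
    unfolding relative_entropy_def using absolutely_continuous_measure_of_vec[OF nn] True by auto
next
  case False
  then show ?thesis
    unfolding relative_entropy_def using absolutely_continuous_measure_of_vec[OF nn] by auto
qed

lemma prob_simplexD:
  assumes "m \<in> prob_simplex"
  shows "0 \<le> m $ x" "(\<Sum>x\<in>UNIV. m $ x) = 1" "m $ x \<le> 1"
proof -
  show nn: "0 \<le> m $ x" and s: "(\<Sum>x\<in>UNIV. m $ x) = 1" 
    using assms unfolding prob_simplex_def by blast+
  have "m $ x \<le> (\<Sum>x\<in>UNIV. m $ x)"
    using assms by (intro member_le_sum[of x UNIV "\<lambda>x. m $ x"]) (simp_all add: prob_simplex_def)
  then show "m $ x \<le> 1" using s by simp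
qed

lemma sum_pairs: "(\<Sum>p\<in>UNIV. f p) = (\<Sum>x\<in>UNIV. \<Sum>y\<in>(UNIV::'b::finite set). f (x::'a::finite, y))"
  by (simp add: sum.cartesian_product flip: UNIV_Times_UNIV)

lemma marginal_nth: 
  "marginal1 \<mu> $ x = (\<Sum>y\<in>UNIV. \<mu> $ (x, y))"
  "marginal2 \<mu> $ y = (\<Sum>x\<in>UNIV. \<mu> $ (x, y))"
  by (simp_all add: marginal1_def marginal2_def)

lemma conditional_nth: "conditional \<mu> x $ y = \<mu> $ (x, y) / marginal1 \<mu> $ x"
  by (simp add: conditional_def)

lemma marginal1_simplex: "\<mu> \<in> prob_simplex \<Longrightarrow> marginal1 \<mu> \<in> prob_simplex"
  unfolding prob_simplex_def by (auto simp: marginal_nth sum_pairs intro!: sum_nonneg)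

lemma le_marginal1: 
  assumes "\<mu> \<in> prob_simplex" shows "\<mu> $ (x, y) \<le> marginal1 \<mu> $ x"
  unfolding marginal_nth using assms by (intro member_le_sum[of y _ "\<lambda>y. \<mu> $ (x,y)"]) (auto simp: prob_simplexD)

text \<open>The summands with \<open>\<nu> $ (x, y) = 0\<close> vanish, also where the logarithm is taken at \<open>0\<close> or at
  a quotient with denominator \<open>0\<close>.\<close>

definition pair_entropy :: "real ^ ('s::finite \<times> 's) \<Rightarrow> ('s \<Rightarrow> 's \<Rightarrow> real) \<Rightarrow> real" where
  "pair_entropy \<nu> g = (\<Sum>x\<in>UNIV. \<Sum>y\<in>UNIV. \<nu> $ (x, y) * ln (\<nu> $ (x, y) / marginal1 \<nu> $ x / g x y))"

text \<open>The weight cancels the denominator of the conditional, so a row of weight 0 fits the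
  same formula. Nonnegativity of each row is recorded because \<open>ennreal\<close> cuts off
  negative values, and only nonnegative rows can be added through it.\<close>

lemma pair_entropy_row:
  fixes \<nu> :: "real ^ ('s::finite \<times> 's)"
  assumes \<nu>: "\<nu> \<in> prob_simplex" and K: "K \<in> prob_simplex"
    and ac: "\<And>y. K $ y = 0 \<Longrightarrow> \<nu> $ (x, y) = 0"
  shows "0 \<le> (\<Sum>y\<in>UNIV. \<nu> $ (x, y) * ln (\<nu> $ (x, y) / marginal1 \<nu> $ x / K $ y))" (is "0 \<le> ?S")
    and "ennreal (marginal1 \<nu> $ x) * relative_entropy (conditional \<nu> x) K =
    ennreal (\<Sum>y\<in>UNIV. \<nu> $ (x, y) * ln (\<nu> $ (x, y) / marginal1 \<nu> $ x / K $ y))"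
proof -
  let ?m = "marginal1 \<nu> $ x"
  have nn: "0 \<le> \<nu> $ p" for p using \<nu> by (simp add: prob_simplexD)
  have m0: "0 \<le> ?m" unfolding marginal_nth by (intro sum_nonneg nn)
  have "0 \<le> ?S \<and> ennreal ?m * relative_entropy (conditional \<nu> x) K = ennreal ?S"
  proof (cases "?m = 0")
    case True
    then have "\<nu> $ (x, y) = 0" for y using le_marginal1[OF \<nu>, of x y] nn[of "(x,y)"] by simp
    then show ?thesis using True by simp
  next
    case False
    then have m: "?m > 0" using m0 by simp
    let ?R = "\<Sum>y\<in>UNIV. conditional \<nu> x $ y * ln (conditional \<nu> x $ y / K $ y)"
    have "(\<Sum>y\<in>UNIV. conditional \<nu> x $ y) = 1"
      unfolding conditional_nth sum_divide_distrib[symmetric] marginal_nth[symmetric] using m by simp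
    moreover have "(\<Sum>y\<in>UNIV. conditional \<nu> x $ y) - (\<Sum>y\<in>UNIV. K $ y) \<le> ?R"
      using ac m nn K by (intro gibbs_sum) (auto simp: conditional_nth prob_simplexD)
    ultimately have R: "0 \<le> ?R" using K by (simp add: prob_simplexD)
    have RS: "?m * ?R = ?S" unfolding sum_distrib_left
      using m by (intro sum.cong) (auto simp: conditional_nth)
    have "relative_entropy (conditional \<nu> x) K = ennreal ?R"
      using ac m nn K by (subst relative_entropy_eq) (auto simp: conditional_nth prob_simplexD)
    then have "ennreal ?m * relative_entropy (conditional \<nu> x) K = ennreal (?m * ?R)"
      using m R by (simp add: ennreal_mult)
    moreover have "0 \<le> ?S" using RS R m by (metis mult_nonneg_nonneg less_imp_le)
    ultimately show ?thesis using RS by metis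
  qed
  then show "0 \<le> ?S" "ennreal ?m * relative_entropy (conditional \<nu> x) K = ennreal ?S" by auto
qed

lemma relative_entropy_row_infinite:
  fixes \<nu> :: "real ^ ('s::finite \<times> 's)"
  assumes \<nu>: "\<nu> \<in> prob_simplex" and K: "K \<in> prob_simplex" and "K $ y = 0" "\<nu> $ (x, y) \<noteq> 0"
  shows "ennreal (marginal1 \<nu> $ x) * relative_entropy (conditional \<nu> x) K = \<infinity>"
proof -
  have nn: "0 \<le> \<nu> $ p" for p using \<nu> by (simp add: prob_simplexD)
  have m: "marginal1 \<nu> $ x > 0" using le_marginal1[OF \<nu>, of x y] nn[of "(x,y)"] assms(4) by simp
  then have "relative_entropy (conditional \<nu> x) K = \<infinity>"
    using assms nn K by (subst relative_entropy_eq) (auto simp: conditional_nth prob_simplexD)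
  then show ?thesis using m by (simp add: ennreal_mult_eq_top_iff)
qed

definition step_cost :: "(real ^ 's \<Rightarrow> real ^ 's ^ 's) \<Rightarrow> real ^ ('s::finite \<times> 's) \<Rightarrow> real ^ 's \<Rightarrow> ennreal" where
  "step_cost G \<nu> m = (\<Sum>x\<in>UNIV. ennreal (marginal1 \<nu> $ x) * relative_entropy (conditional \<nu> x) (G m $ x))"

lemma step_cost_eq:
  fixes \<nu> :: "real ^ ('s::finite \<times> 's)"
  assumes \<nu>: "\<nu> \<in> prob_simplex" and K: "transition_kernel (G m)"
  shows "step_cost G \<nu> m = (if \<forall>x y. G m $ x $ y = 0 \<longrightarrow> \<nu> $ (x, y) = 0
    then ennreal (pair_entropy \<nu> (\<lambda>x y. G m $ x $ y)) else \<infinity>)"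
proof (cases "\<forall>x y. G m $ x $ y = 0 \<longrightarrow> \<nu> $ (x, y) = 0")
  case True
  have K': "G m $ x \<in> prob_simplex" for x using K by (simp add: transition_kernel_def)
  show ?thesis unfolding step_cost_def pair_entropy_def
    using True pair_entropy_row[OF \<nu> K'] by (auto simp: sum_ennreal)
next
  case False
  then obtain x y where xy: "G m $ x $ y = 0" "\<nu> $ (x, y) \<noteq> 0" by auto
  have K': "G m $ x \<in> prob_simplex" for x using K by (simp add: transition_kernel_def)
  have "step_cost G \<nu> m \<ge> ennreal (marginal1 \<nu> $ x) * relative_entropy (conditional \<nu> x) (G m $ x)"
    unfolding step_cost_def by (intro member_le_sum) auto
  then have "step_cost G \<nu> m = \<infinity>"
    using relative_entropy_row_infinite[OF \<nu> K' xy] by (simp add: top_unique)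
  then show ?thesis using False by auto
qed

lemma pair_entropy_nonneg:
  fixes \<nu> :: "real ^ ('s::finite \<times> 's)"
  assumes \<nu>: "\<nu> \<in> prob_simplex" and K: "transition_kernel K"
    and "\<And>x y. K $ x $ y = 0 \<Longrightarrow> \<nu> $ (x, y) = 0"
  shows "0 \<le> pair_entropy \<nu> (\<lambda>x y. K $ x $ y)"
  unfolding pair_entropy_def
  using assms by (intro sum_nonneg pair_entropy_row) (auto simp: transition_kernel_def)

lemma control_cost_eq:
  "control_cost G \<eta> M = (\<integral>\<^sup>+ s\<in>{0..}. ennreal (exp (- s)) * step_cost G (\<eta> s) (M s) \<partial>lborel)"
  unfolding control_cost_def step_cost_def ..

section \<open>Expectations along a history-dependent kernel\<close>

text \<open>The expectation over the first \<open>n\<close> transitions, as a finite sum in which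
  the last transition is integrated out first. Paths are infinite sequences padded with
  \<open>x0\<close>, so the path space does not depend on \<open>n\<close>. Changes of measure
  become inequalities between finite sums.\<close>

primrec path_exp ::
  "(nat \<Rightarrow> (nat \<Rightarrow> 's) \<Rightarrow> 's \<Rightarrow> real) \<Rightarrow> 's::finite \<Rightarrow> nat \<Rightarrow> ((nat \<Rightarrow> 's) \<Rightarrow> real) \<Rightarrow> real" where
  "path_exp k x0 0 \<Phi> = \<Phi> (\<lambda>_. x0)"
| "path_exp k x0 (Suc n) \<Phi> = path_exp k x0 n (\<lambda>x. \<Sum>y\<in>UNIV. k n x y * \<Phi> (x(Suc n := y)))"

definition adapted :: "(nat \<Rightarrow> (nat \<Rightarrow> 's) \<Rightarrow> 'b) \<Rightarrow> bool" where
  "adapted k \<longleftrightarrow> (\<forall>n x x'. (\<forall>i\<le>n. x i = x' i) \<longrightarrow> k n x = k n x')"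

lemma adapted_upd: "adapted k \<Longrightarrow> i \<le> n \<Longrightarrow> k i (x(Suc n := y)) = k i x"
  unfolding adapted_def by (metis fun_upd_other not_less_eq_eq)

lemma path_exp_mono:
  assumes "\<And>n x y. 0 \<le> k n x y" "\<And>x. \<Phi> x \<le> \<Psi> x"
  shows "path_exp k x0 n \<Phi> \<le> path_exp k x0 n \<Psi>"
  using assms(2)
proof (induction n arbitrary: \<Phi> \<Psi>)
  case (Suc n)
  show ?case unfolding path_exp.simps
    by (rule Suc.IH) (intro sum_mono mult_left_mono Suc.prems assms(1))
qed simp

lemma path_exp_add: "path_exp k x0 n (\<lambda>x. \<Phi> x + \<Psi> x) = path_exp k x0 n \<Phi> + path_exp k x0 n \<Psi>"
proof (induction n arbitrary: \<Phi> \<Psi>)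
  case (Suc n)
  show ?case unfolding path_exp.simps Suc.IH[symmetric]
    by (simp add: algebra_simps sum.distrib)
qed simp

lemma path_exp_cmult: "path_exp k x0 n (\<lambda>x. c * \<Phi> x) = c * path_exp k x0 n \<Phi>"
proof (induction n arbitrary: \<Phi>)
  case (Suc n)
  show ?case unfolding path_exp.simps Suc.IH[symmetric]
    by (simp add: algebra_simps sum_distrib_left)
qed simp

lemma path_exp_sum:
  "finite A \<Longrightarrow> path_exp k x0 n (\<lambda>x. \<Sum>a\<in>A. \<Phi> a x) = (\<Sum>a\<in>A. path_exp k x0 n (\<Phi> a))"
proof (induction A rule: finite_induct)
  case empty
  show ?case using path_exp_cmult[of k x0 n 0 "\<lambda>_. 0"] by simp
qed (simp add: path_exp_add)

lemma path_exp_const: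
  assumes "\<And>n x. (\<Sum>y\<in>UNIV. k n x y) = 1"
  shows "path_exp k x0 n (\<lambda>_. c) = c"
  using assms by (induction n) (simp_all flip: sum_distrib_right)

text \<open>A change of measure with a bound in place of a density: any \<open>r\<close> with
  \<open>k \<le> q * r\<close> serves. Adaptedness matters because the recursion overwrites the path
  at time \<open>Suc n\<close>, and the earlier factors of the product must not notice this.\<close>

lemma path_exp_change_le:
  assumes k: "\<And>n x y. 0 \<le> k n x y" and r: "adapted r" "\<And>n x y. 0 \<le> r n x y"
    and kq: "\<And>n x y. k n x y \<le> q n x y * r n x y" and \<Phi>: "\<And>x. 0 \<le> \<Phi> x"
  shows "path_exp k x0 n \<Phi> \<le> path_exp q x0 n (\<lambda>x. (\<Prod>i<n. r i x (x (Suc i))) * \<Phi> x)"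
  using \<Phi>
proof (induction n arbitrary: \<Phi>)
  case (Suc n)
  have "path_exp k x0 (Suc n) \<Phi> \<le> path_exp k x0 n (\<lambda>x. \<Sum>y\<in>UNIV. q n x y * r n x y * \<Phi> (x(Suc n := y)))"
    unfolding path_exp.simps
    by (intro path_exp_mono k sum_mono mult_right_mono kq Suc.prems)
  also have "\<dots> \<le> path_exp q x0 n (\<lambda>x. (\<Prod>i<n. r i x (x (Suc i))) *
      (\<Sum>y\<in>UNIV. q n x y * r n x y * \<Phi> (x(Suc n := y))))"
    by (intro Suc.IH sum_nonneg mult_nonneg_nonneg Suc.prems order_trans[OF k kq])
  also have "\<dots> = path_exp q x0 (Suc n) (\<lambda>x. (\<Prod>i<Suc n. r i x (x (Suc i))) * \<Phi> x)"
    by (simp add: adapted_upd[OF r(1)] sum_distrib_left mult_ac)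
  finally show ?case .
qed simp

text \<open>Here only \<open>q * r \<le> k\<close> is asked for, so \<open>k\<close> may make
  transitions that \<open>q\<close> never makes, and \<open>r\<close> can take any nonnegative value
  where \<open>q\<close> vanishes.\<close>

lemma path_exp_change_ge:
  assumes q: "\<And>n x y. 0 \<le> q n x y" and k: "\<And>n x y. 0 \<le> k n x y"
    and r: "adapted r" "\<And>n x y. 0 \<le> r n x y"
    and kq: "\<And>n x y. q n x y * r n x y \<le> k n x y" and \<Phi>: "\<And>x. 0 \<le> \<Phi> x"
  shows "path_exp q x0 n (\<lambda>x. (\<Prod>i<n. r i x (x (Suc i))) * \<Phi> x) \<le> path_exp k x0 n \<Phi>"
  using \<Phi>
proof (induction n arbitrary: \<Phi>)
  case (Suc n)
  have "path_exp q x0 (Suc n) (\<lambda>x. (\<Prod>i<Suc n. r i x (x (Suc i))) * \<Phi> x) =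
    path_exp q x0 n (\<lambda>x. (\<Prod>i<n. r i x (x (Suc i))) *
      (\<Sum>y\<in>UNIV. q n x y * r n x y * \<Phi> (x(Suc n := y))))"
    by (simp add: adapted_upd[OF r(1)] sum_distrib_left mult_ac)
  also have "\<dots> \<le> path_exp k x0 n (\<lambda>x. \<Sum>y\<in>UNIV. q n x y * r n x y * \<Phi> (x(Suc n := y)))"
    by (intro Suc.IH sum_nonneg mult_nonneg_nonneg Suc.prems q r(2))
  also have "\<dots> \<le> path_exp k x0 (Suc n) \<Phi>"
    unfolding path_exp.simps
    by (intro path_exp_mono k sum_mono mult_right_mono kq Suc.prems)
  finally show ?case .
qed simp

text \<open>Each increment has conditional mean 0 given the path so far, so the mixed terms vanish
  and one step adds at most \<open>B\<^sup>2\<close> to the second moment.\<close>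

lemma path_exp_martingale_square:
  assumes q: "\<And>n x y. 0 \<le> q n x y" "\<And>n x. (\<Sum>y\<in>UNIV. q n x y) = 1"
    and D: "\<And>n x. (\<Sum>y\<in>UNIV. q n x y * D n (x n) y) = 0" "\<And>n a b. \<bar>D n a b\<bar> \<le> B"
  shows "path_exp q x0 n (\<lambda>x. (\<Sum>i<n. D i (x i) (x (Suc i)))\<^sup>2) \<le> B\<^sup>2 * real n"
proof (induction n)
  case (Suc n)
  let ?S = "\<lambda>x. \<Sum>i<n. D i (x i) (x (Suc i))"
  have "(\<Sum>y\<in>UNIV. q n x y * (\<Sum>i<Suc n. D i ((x(Suc n := y)) i) ((x(Suc n := y)) (Suc i)))\<^sup>2)
     \<le> (?S x)\<^sup>2 + B\<^sup>2" for x
  proof -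
    have "(\<Sum>y\<in>UNIV. q n x y * (\<Sum>i<Suc n. D i ((x(Suc n := y)) i) ((x(Suc n := y)) (Suc i)))\<^sup>2)
      = (\<Sum>y\<in>UNIV. q n x y * (?S x + D n (x n) y)\<^sup>2)" by simp
    also have "\<dots> = (\<Sum>y\<in>UNIV. (?S x)\<^sup>2 * q n x y + 2 * ?S x * (q n x y * D n (x n) y) + q n x y * (D n (x n) y)\<^sup>2)"
      by (intro sum.cong) (auto simp: power2_eq_square algebra_simps)
    also have "\<dots> = (?S x)\<^sup>2 * (\<Sum>y\<in>UNIV. q n x y) + 2 * ?S x * (\<Sum>y\<in>UNIV. q n x y * D n (x n) y)
        + (\<Sum>y\<in>UNIV. q n x y * (D n (x n) y)\<^sup>2)"
      by (simp only: sum.distrib sum_distrib_left)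
    also have "\<dots> = (?S x)\<^sup>2 + (\<Sum>y\<in>UNIV. q n x y * (D n (x n) y)\<^sup>2)"
      by (simp add: D q)
    also have "(\<Sum>y\<in>UNIV. q n x y * (D n (x n) y)\<^sup>2) \<le> (\<Sum>y\<in>UNIV. q n x y * B\<^sup>2)"
      by (intro sum_mono mult_left_mono q) (metis D(2) abs_le_square_iff abs_ge_self order_trans)
    also have "\<dots> = B\<^sup>2" by (simp add: q flip: sum_distrib_right)
    finally show ?thesis by simp
  qed
  then have "path_exp q x0 (Suc n) (\<lambda>x. (\<Sum>i<Suc n. D i (x i) (x (Suc i)))\<^sup>2)
    \<le> path_exp q x0 n (\<lambda>x. (?S x)\<^sup>2 + B\<^sup>2)"
    unfolding path_exp.simps by (intro path_exp_mono q)
  also have "\<dots> \<le> B\<^sup>2 * real n + B\<^sup>2"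
    unfolding path_exp_add using Suc by (simp add: path_exp_const q)
  finally show ?case by (simp add: algebra_simps)
qed simp

section \<open>Empirical measures and the law of the chain\<close>

definition emp :: "(nat \<Rightarrow> 's::finite) \<Rightarrow> nat \<Rightarrow> real ^ 's" where
  "emp x n = (1 / real n) *\<^sub>R (\<Sum>i<n. axis (x i) 1)"

lemma empirical_measure_eq_emp: "empirical_measure X n \<omega> = emp (\<lambda>i. X i \<omega>) n"
  by (simp add: empirical_measure_def emp_def)

lemma emp_nth: "emp x n $ y = (\<Sum>i<n. of_bool (x i = y)) / real n"
  by (simp add: emp_def axis_def of_bool_def eq_commute)

lemma emp_simplex: "n > 0 \<Longrightarrow> emp x n \<in> prob_simplex"
proof -
  assume n: "n > 0"
  have "(\<Sum>y\<in>UNIV. \<Sum>i<n. of_bool (x i = y)) = (\<Sum>i<n. \<Sum>y\<in>UNIV. of_bool (x i = y) :: real)"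
    by (rule sum.swap)
  also have "\<dots> = real n" by (simp add: of_bool_def sum.If_cases)
  finally show ?thesis using n
    by (auto simp: prob_simplex_def emp_nth simp flip: sum_divide_distrib intro!: divide_nonneg_nonneg sum_nonneg)
qed

definition self_kernel :: "(real ^ 's \<Rightarrow> real ^ 's ^ 's::finite) \<Rightarrow> nat \<Rightarrow> (nat \<Rightarrow> 's) \<Rightarrow> 's \<Rightarrow> real" where
  "self_kernel G n x y = G (emp x (Suc n)) $ x n $ y"

lemma adapted_self_kernel: "adapted (self_kernel (G :: real ^ 's \<Rightarrow> real ^ 's ^ 's::finite))"
  unfolding adapted_def
proof (intro allI impI ext)
  fix n y and x x' :: "nat \<Rightarrow> 's" assume *: "\<forall>i\<le>n. x i = x' i"
  then have "emp x (Suc n) = emp x' (Suc n)"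
    unfolding emp_def by (intro arg_cong2[where f="(*\<^sub>R)"] sum.cong) auto
  then show "self_kernel G n x y = self_kernel G n x' y"
    using * by (simp add: self_kernel_def)
qed

lemma self_kernel_cong:
  fixes G :: "real ^ 's \<Rightarrow> real ^ 's ^ 's::finite"
  assumes "\<forall>i\<le>n. x i = x' i"
  shows "self_kernel G n x = self_kernel G n x'"
  using assms adapted_self_kernel[of G] unfolding adapted_def by blast

lemma past_subalgebra:
  assumes "\<And>n. X n \<in> \<Omega> \<rightarrow>\<^sub>M count_space UNIV"
  shows "subalgebra \<Omega> (past \<Omega> X n)"
proof -
  have *: "{X i -` B \<inter> space \<Omega> | i B. i \<le> n} \<subseteq> sets \<Omega>"
    using measurable_sets[OF assms] by auto
  then show ?thesis unfolding subalgebra_def past_def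
    by (simp add: space_measure_of_conv sets.sigma_sets_subset sets_measure_of_conv)
qed

text \<open>The first \<open>n + 1\<close> states take values in a finite set, on which every
  function is measurable, and \<open>\<Phi>\<close> factors through them.\<close>

lemma measurable_past:
  fixes X :: "nat \<Rightarrow> 'w \<Rightarrow> 's::finite" and \<Phi> :: "(nat \<Rightarrow> 's) \<Rightarrow> real"
  assumes X: "\<And>n. X n \<in> \<Omega> \<rightarrow>\<^sub>M count_space UNIV"
    and \<Phi>: "\<And>x x'. (\<forall>i\<le>n. x i = x' i) \<Longrightarrow> \<Phi> x = \<Phi> x'"
  shows "(\<lambda>\<omega>. \<Phi> (\<lambda>i. X i \<omega>)) \<in> borel_measurable (past \<Omega> X n)"
proof -
  have sp: "space (past \<Omega> X n) = space \<Omega>" by (simp add: past_def space_measure_of_conv)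
  have XP: "X i \<in> past \<Omega> X n \<rightarrow>\<^sub>M count_space UNIV" if "i \<le> n" for i
  proof (rule measurableI)
    fix B :: "'s set"
    have "X i -` B \<inter> space \<Omega> \<in> sets (past \<Omega> X n)"
      unfolding past_def using that by (intro in_measure_of) auto
    then show "X i -` B \<inter> space (past \<Omega> X n) \<in> sets (past \<Omega> X n)" by (simp add: sp)
  qed simp
  have "(\<lambda>\<omega>. \<lambda>i\<in>{..n}. X i \<omega>) \<in> past \<Omega> X n \<rightarrow>\<^sub>M Pi\<^sub>M {..n} (\<lambda>_. count_space UNIV)"
    by (intro measurable_restrict XP) auto
  moreover have "Pi\<^sub>M {..n} (\<lambda>_. count_space UNIV) = count_space (Pi\<^sub>E {..n} (\<lambda>_. UNIV :: 's set))"
    by (intro count_space_PiM_finite) (auto intro: countable_finite)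
  ultimately have "(\<lambda>\<omega>. \<lambda>i\<in>{..n}. X i \<omega>) \<in> past \<Omega> X n \<rightarrow>\<^sub>M count_space (Pi\<^sub>E {..n} (\<lambda>_. UNIV))"
    by simp
  then have "(\<lambda>\<omega>. \<Phi> (\<lambda>i\<in>{..n}. X i \<omega>)) \<in> borel_measurable (past \<Omega> X n)"
    by (rule measurable_compose) simp
  moreover have "\<Phi> (\<lambda>i\<in>{..n}. X i \<omega>) = \<Phi> (\<lambda>i. X i \<omega>)" for \<omega>
    by (rule \<Phi>) simp
  ultimately show ?thesis by simp
qed

lemma bounded_of_finite_dependence:
  fixes \<Phi> :: "(nat \<Rightarrow> 's::finite) \<Rightarrow> real"
  assumes \<Phi>: "\<And>x x'. (\<forall>i\<le>n. x i = x' i) \<Longrightarrow> \<Phi> x = \<Phi> x'"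
  shows "\<exists>B. \<forall>x. \<bar>\<Phi> x\<bar> \<le> B"
proof -
  have fin: "finite (Pi\<^sub>E {..n} (\<lambda>_. UNIV :: 's set))" by (intro finite_PiE) auto
  have "\<bar>\<Phi> x\<bar> \<le> (\<Sum>z\<in>Pi\<^sub>E {..n} (\<lambda>_. UNIV). \<bar>\<Phi> z\<bar>)" for x
  proof -
    have "\<Phi> x = \<Phi> (restrict x {..n})" by (rule \<Phi>) simp
    moreover have "restrict x {..n} \<in> Pi\<^sub>E {..n} (\<lambda>_. UNIV)" by auto
    ultimately show ?thesis
      using member_le_sum[OF _ _ fin, of "restrict x {..n}" "\<lambda>z. \<bar>\<Phi> z\<bar>"] by simp
  qed
  then show ?thesis by blast
qed

text \<open>Splitting over the value \<open>y\<close> of the last state writes \<open>\<Phi>\<close>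
  as a sum of factors measurable in the past times indicators. Conditioning on the past replaces
  each indicator by the kernel and leaves an expectation over one transition less. From here on the
  law of the chain is a finite computation.\<close>

lemma integral_chain_eq_path_exp:
  fixes X :: "nat \<Rightarrow> 'w \<Rightarrow> 's::finite" and \<Phi> :: "(nat \<Rightarrow> 's) \<Rightarrow> real"
  assumes chain: "self_interacting_chain \<Omega> G x0 X"
    and \<Phi>: "\<And>x x'. (\<forall>i\<le>n. x i = x' i) \<Longrightarrow> \<Phi> x = \<Phi> x'"
  shows "(\<integral>\<omega>. \<Phi> (\<lambda>i. X i \<omega>) \<partial>\<Omega>) = path_exp (self_kernel G) x0 n \<Phi>"
  using \<Phi>
proof (induction n arbitrary: \<Phi>)
  case 0
  interpret prob_space \<Omega> using chain by (simp add: self_interacting_chain_def)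
  have "AE \<omega> in \<Omega>. \<Phi> (\<lambda>i. X i \<omega>) = \<Phi> (\<lambda>_. x0)"
    using chain by (auto simp: self_interacting_chain_def elim!: eventually_mono intro!: 0)
  moreover have "(\<lambda>\<omega>. \<Phi> (\<lambda>i. X i \<omega>)) \<in> borel_measurable \<Omega>"
  proof -
    have X: "X n \<in> \<Omega> \<rightarrow>\<^sub>M count_space UNIV" for n using chain by (simp add: self_interacting_chain_def)
    show ?thesis by (rule measurable_from_subalg[OF past_subalgebra[OF X] measurable_past[OF X 0]])
  qed
  ultimately have "(\<integral>\<omega>. \<Phi> (\<lambda>i. X i \<omega>) \<partial>\<Omega>) = (\<integral>\<omega>. \<Phi> (\<lambda>_. x0) \<partial>\<Omega>)"
    by (intro integral_cong_AE) auto
  then show ?case by (simp add: prob_space)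
next
  case (Suc n)
  interpret prob_space \<Omega> using chain by (simp add: self_interacting_chain_def)
  have X: "X n \<in> \<Omega> \<rightarrow>\<^sub>M count_space UNIV" for n using chain by (simp add: self_interacting_chain_def)
  have sub: "subalgebra \<Omega> (past \<Omega> X n)" for n by (rule past_subalgebra[OF X])
  interpret finite_measure_subalgebra \<Omega> "past \<Omega> X n"
    by unfold_locales (rule sub)
  have "\<exists>B. \<forall>x. \<bar>\<Phi> x\<bar> \<le> B" by (rule bounded_of_finite_dependence[OF Suc.prems])
  then obtain B where B: "\<bar>\<Phi> x\<bar> \<le> B" for x by blast
  have B0: "0 \<le> B" using B[of undefined] by simp
  let ?E = "\<lambda>y. indicator {\<omega> \<in> space \<Omega>. X (Suc n) \<omega> = y} :: 'w \<Rightarrow> real"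
  let ?f = "\<lambda>y \<omega>. \<Phi> ((\<lambda>i. X i \<omega>)(Suc n := y))"
  have E[measurable]: "?E y \<in> borel_measurable \<Omega>" for y
    using measurable_sets[OF X, of "{y}" "Suc n"]
    by (intro borel_measurable_indicator) (simp add: vimage_def Int_def conj_commute)
  have fP: "?f y \<in> borel_measurable (past \<Omega> X n)" for y
    by (rule measurable_past[OF X, where \<Phi>="\<lambda>x. \<Phi> (x(Suc n := y))"]) (auto intro!: Suc.prems)
  have f[measurable]: "?f y \<in> borel_measurable \<Omega>" for y
    by (rule measurable_from_subalg[OF sub fP])
  have int: "integrable \<Omega> (\<lambda>\<omega>. ?f y \<omega> * ?E y \<omega>)" for y
  proof (rule integrable_const_bound[of _ B])
    show "AE \<omega> in \<Omega>. norm (?f y \<omega> * ?E y \<omega>) \<le> B" using B by (auto simp: indicator_def B0)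
    show "(\<lambda>\<omega>. ?f y \<omega> * ?E y \<omega>) \<in> borel_measurable \<Omega>" using f E by (rule borel_measurable_times)
  qed
  have int2: "integrable \<Omega> (\<lambda>\<omega>. ?f y \<omega> * real_cond_exp \<Omega> (past \<Omega> X n) (?E y) \<omega>)" for y
    by (rule real_cond_exp_intg(1)[OF int fP E])
  have ce: "AE \<omega> in \<Omega>. real_cond_exp \<Omega> (past \<Omega> X n) (?E y) \<omega> = self_kernel G n (\<lambda>i. X i \<omega>) y" for y
    using chain by (simp add: self_interacting_chain_def empirical_measure_eq_emp self_kernel_def)
  have kP: "(\<lambda>\<omega>. self_kernel G n (\<lambda>i. X i \<omega>) y) \<in> borel_measurable \<Omega>" for y
  proof -
    have "(\<lambda>\<omega>. self_kernel G n (\<lambda>i. X i \<omega>) y) \<in> borel_measurable (past \<Omega> X n)"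
      by (rule measurable_past[where X=X and n=n and \<Phi>="\<lambda>x. self_kernel G n x y", OF X])
         (simp only: self_kernel_cong)
    then show ?thesis by (rule measurable_from_subalg[OF sub])
  qed
  have eq: "(\<integral>\<omega>. ?f y \<omega> * ?E y \<omega> \<partial>\<Omega>) = (\<integral>\<omega>. self_kernel G n (\<lambda>i. X i \<omega>) y * ?f y \<omega> \<partial>\<Omega>)"
    and int3: "integrable \<Omega> (\<lambda>\<omega>. self_kernel G n (\<lambda>i. X i \<omega>) y * ?f y \<omega>)" for y
  proof -
    have ae: "AE \<omega> in \<Omega>. ?f y \<omega> * real_cond_exp \<Omega> (past \<Omega> X n) (?E y) \<omega> = self_kernel G n (\<lambda>i. X i \<omega>) y * ?f y \<omega>"
      using ce[of y] by eventually_elim simp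
    have m: "(\<lambda>\<omega>. self_kernel G n (\<lambda>i. X i \<omega>) y * ?f y \<omega>) \<in> borel_measurable \<Omega>"
      using kP by measurable
    have "(\<integral>\<omega>. ?f y \<omega> * ?E y \<omega> \<partial>\<Omega>) = (\<integral>\<omega>. ?f y \<omega> * real_cond_exp \<Omega> (past \<Omega> X n) (?E y) \<omega> \<partial>\<Omega>)"
      by (rule real_cond_exp_intg(2)[OF int fP E, symmetric])
    also have "\<dots> = (\<integral>\<omega>. self_kernel G n (\<lambda>i. X i \<omega>) y * ?f y \<omega> \<partial>\<Omega>)"
      using ae m int2 by (intro integral_cong_AE) auto
    finally show "(\<integral>\<omega>. ?f y \<omega> * ?E y \<omega> \<partial>\<Omega>) = (\<integral>\<omega>. self_kernel G n (\<lambda>i. X i \<omega>) y * ?f y \<omega> \<partial>\<Omega>)" .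
    show "integrable \<Omega> (\<lambda>\<omega>. self_kernel G n (\<lambda>i. X i \<omega>) y * ?f y \<omega>)"
      by (rule integrable_cong_AE_imp[OF int2 m ae])
  qed
  have "(\<integral>\<omega>. \<Phi> (\<lambda>i. X i \<omega>) \<partial>\<Omega>) = (\<integral>\<omega>. (\<Sum>y\<in>UNIV. ?f y \<omega> * ?E y \<omega>) \<partial>\<Omega>)"
  proof (rule Bochner_Integration.integral_cong)
    fix \<omega> assume "\<omega> \<in> space \<Omega>"
    then have "(\<Sum>y\<in>UNIV. ?f y \<omega> * ?E y \<omega>) = (\<Sum>y\<in>UNIV. if y = X (Suc n) \<omega> then ?f y \<omega> else 0)"
      by (intro sum.cong) (auto simp: indicator_def)
    also have "\<dots> = \<Phi> ((\<lambda>i. X i \<omega>)(Suc n := X (Suc n) \<omega>))" by simp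
    also have "\<dots> = \<Phi> (\<lambda>i. X i \<omega>)" by (rule arg_cong[of _ _ \<Phi>]) auto
    finally show "\<Phi> (\<lambda>i. X i \<omega>) = (\<Sum>y\<in>UNIV. ?f y \<omega> * ?E y \<omega>)" by simp
  qed simp
  also have "\<dots> = (\<Sum>y\<in>UNIV. \<integral>\<omega>. ?f y \<omega> * ?E y \<omega> \<partial>\<Omega>)"
    by (rule Bochner_Integration.integral_sum) (rule int)
  also have "\<dots> = (\<integral>\<omega>. (\<Sum>y\<in>UNIV. self_kernel G n (\<lambda>i. X i \<omega>) y * ?f y \<omega>) \<partial>\<Omega>)"
    unfolding eq by (rule Bochner_Integration.integral_sum[symmetric]) (rule int3)
  also have "\<dots> = path_exp (self_kernel G) x0 n (\<lambda>x. \<Sum>y\<in>UNIV. self_kernel G n x y * \<Phi> (x(Suc n := y)))"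
  proof (rule Suc.IH)
    fix x x' :: "nat \<Rightarrow> 's" assume *: "\<forall>i\<le>n. x i = x' i"
    then have "self_kernel G n x = self_kernel G n x'"
      using adapted_self_kernel[of G] by (simp add: adapted_def)
    moreover have "\<Phi> (x(Suc n := y)) = \<Phi> (x'(Suc n := y))" for y
      by (rule Suc.prems) (use * in auto)
    ultimately show "(\<Sum>y\<in>UNIV. self_kernel G n x y * \<Phi> (x(Suc n := y)))
      = (\<Sum>y\<in>UNIV. self_kernel G n x' y * \<Phi> (x'(Suc n := y)))" by simp
  qed
  finally show ?case by simp
qed

lemma prob_chain_eq_path_exp:
  fixes X :: "nat \<Rightarrow> 'w \<Rightarrow> 's::finite"
  assumes chain: "self_interacting_chain \<Omega> G x0 X"
    and C: "\<And>x x'. (\<forall>i\<le>n. x i = x' i) \<Longrightarrow> C x = C x'"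
  shows "measure \<Omega> {\<omega> \<in> space \<Omega>. C (\<lambda>i. X i \<omega>)} = path_exp (self_kernel G) x0 n (\<lambda>x. of_bool (C x))"
    and "{\<omega> \<in> space \<Omega>. C (\<lambda>i. X i \<omega>)} \<in> sets \<Omega>"
proof -
  interpret prob_space \<Omega> using chain by (simp add: self_interacting_chain_def)
  have X: "X n \<in> \<Omega> \<rightarrow>\<^sub>M count_space UNIV" for n using chain by (simp add: self_interacting_chain_def)
  have C': "of_bool (C x) = (of_bool (C x') :: real)" if "\<forall>i\<le>n. x i = x' i" for x x'
    using C[OF that] by simp
  have m: "(\<lambda>\<omega>. of_bool (C (\<lambda>i. X i \<omega>)) :: real) \<in> borel_measurable \<Omega>"
    by (rule measurable_from_subalg[OF past_subalgebra[OF X] measurable_past[OF X]]) (rule C')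
  have "{\<omega> \<in> space \<Omega>. C (\<lambda>i. X i \<omega>)} = (\<lambda>\<omega>. of_bool (C (\<lambda>i. X i \<omega>)) :: real) -` {1} \<inter> space \<Omega>"
    by auto
  then show *: "{\<omega> \<in> space \<Omega>. C (\<lambda>i. X i \<omega>)} \<in> sets \<Omega>"
    using measurable_sets[OF m, of "{1}"] by simp
  have "measure \<Omega> {\<omega> \<in> space \<Omega>. C (\<lambda>i. X i \<omega>)} = (\<integral>\<omega>. indicator {\<omega> \<in> space \<Omega>. C (\<lambda>i. X i \<omega>)} \<omega> \<partial>\<Omega>)"
    using * by simp
  also have "\<dots> = (\<integral>\<omega>. of_bool (C (\<lambda>i. X i \<omega>)) \<partial>\<Omega>)"
    by (intro Bochner_Integration.integral_cong) (auto simp: indicator_def)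
  also have "\<dots> = path_exp (self_kernel G) x0 n (\<lambda>x. of_bool (C x))"
    by (rule integral_chain_eq_path_exp[OF chain C'])
  finally show "measure \<Omega> {\<omega> \<in> space \<Omega>. C (\<lambda>i. X i \<omega>)} = path_exp (self_kernel G) x0 n (\<lambda>x. of_bool (C x))" .
qed

section \<open>Measurability of vector-valued functions\<close>

lemma borel_measurable_vec_nth [measurable (raw)]:
  fixes f :: "'b \<Rightarrow> real ^ 'n::finite"
  assumes "f \<in> borel_measurable M"
  shows "(\<lambda>x. f x $ i) \<in> borel_measurable M"
  using assms
  by (rule measurable_compose)
     (intro borel_measurable_continuous_onI linear_continuous_on bounded_linear_vec_nth)

lemma borel_measurable_vec_lambda:
  fixes f :: "'b \<Rightarrow> 'n::finite \<Rightarrow> real"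
  assumes "\<And>i. (\<lambda>x. f x i) \<in> borel_measurable M"
  shows "(\<lambda>x. (\<chi> i. f x i) :: real ^ 'n) \<in> borel_measurable M"
proof (subst borel_measurable_iff_halfspace_le, intro ballI allI)
  fix a and i :: "real ^ 'n" assume "i \<in> Basis"
  then obtain j where "i = axis j 1" by (auto simp: Basis_vec_def)
  then show "{w \<in> space M. (\<chi> i. f w i) \<bullet> i \<le> a} \<in> sets M"
    using assms[of j] by (simp add: inner_axis)
qed

section \<open>Logarithmic time\<close>

lemma nn_integral_exp_uminus_atLeast:
  "(\<integral>\<^sup>+s. ennreal (exp (- s)) * indicator {0..} s \<partial>lborel) = 1"
proof -
  have "((\<lambda>s::real. exp (- s)) \<longlongrightarrow> 0) at_top"
    by (rule filterlim_compose[OF exp_at_bot filterlim_uminus_at_bot_at_top])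
  then have "((\<lambda>s::real. - exp (- s)) \<longlongrightarrow> - 0) at_top" by (rule tendsto_minus)
  then have "(\<integral>\<^sup>+s. ennreal (exp (- s)) * indicator {0..} s \<partial>lborel) = ennreal (- 0 - - exp (- 0))"
    by (intro nn_integral_FTC_atLeast) (auto intro!: derivative_eq_intros)
  then show ?thesis by simp
qed

text \<open>If \<open>s\<close> has the exponential law of rate 1, then \<open>exp (- s)\<close> is
  uniform on (0, 1]. This is what absorbs the discount factor of the cost. The two finite measures
  are compared on half-lines.\<close>

lemma distr_exp_uminus:
  "distr (density lborel (\<lambda>s. ennreal (exp (- s)) * indicator {0..} s)) borel (\<lambda>s. exp (- s)) =
   density lborel (\<lambda>u::real. indicator {0<..1} u)" (is "distr ?\<mu> borel ?e = ?\<nu>")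
proof (rule measure_eqI_lessThan)
  have mE: "emeasure (distr ?\<mu> borel ?e) {x<..} = (\<integral>\<^sup>+s. ennreal (exp (- s)) * indicator {0..} s * indicator {x<..} (exp (- s)) \<partial>lborel)" for x
  proof -
    have "emeasure (distr ?\<mu> borel ?e) {x<..} = (\<integral>\<^sup>+u. indicator {x<..} u \<partial>distr ?\<mu> borel ?e)"
      by (subst nn_integral_indicator) auto
    also have "\<dots> = (\<integral>\<^sup>+s. indicator {x<..} (exp (- s)) \<partial>?\<mu>)"
      by (subst nn_integral_distr) auto
    also have "\<dots> = (\<integral>\<^sup>+s. ennreal (exp (- s)) * indicator {0..} s * indicator {x<..} (exp (- s)) \<partial>lborel)"
      by (subst nn_integral_density) auto
    finally show ?thesis .
  qed
  have mN: "emeasure ?\<nu> {x<..} = emeasure lborel ({0<..1} \<inter> {x<..})" for x :: real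
    by (subst emeasure_density) (auto simp flip: indicator_inter_arith)
  fix x :: real
  consider "x \<le> 0" | "0 < x" "x < 1" | "1 \<le> x" by linarith
  then show "emeasure (distr ?\<mu> borel ?e) {x<..} = emeasure ?\<nu> {x<..}"
  proof cases
    case 1
    then have "x < exp (- s)" for s :: real by (smt (verit) exp_gt_zero)
    then have "emeasure (distr ?\<mu> borel ?e) {x<..} = 1"
      unfolding mE nn_integral_exp_uminus_atLeast[symmetric] by (intro nn_integral_cong) (auto simp: indicator_def)
    moreover have "{0<..1} \<inter> {x<..} = {0<..1}" using 1 by auto
    ultimately show ?thesis unfolding mN by simp
  next
    case 2
    have ex: "x < exp (- s) \<longleftrightarrow> s < - ln x" for s
      using exp_less_cancel_iff[of "ln x" "- s"] 2 by auto
    have "emeasure (distr ?\<mu> borel ?e) {x<..} = (\<integral>\<^sup>+s. ennreal (exp (- s)) * indicator {0..- ln x} s \<partial>lborel)"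
      unfolding mE
    proof (rule nn_integral_cong_AE)
      show "AE s in lborel. ennreal (exp (- s)) * indicator {0..} s * indicator {x<..} (exp (- s))
          = ennreal (exp (- s)) * indicator {0..- ln x} s"
        using AE_lborel_singleton[of "- ln x"] by eventually_elim (auto simp: indicator_def ex)
    qed
    also have "\<dots> = ennreal (- exp (- (- ln x)) - - exp (- 0))"
    proof (rule nn_integral_FTC_Icc[where F="\<lambda>s. - exp (- s)"])
      show "((\<lambda>s. - exp (- s)) has_real_derivative exp (- s)) (at s)" for s :: real
        by (auto intro!: derivative_eq_intros)
      show "0 \<le> - ln x" using 2 by (simp add: ln_le_zero_iff)
    qed auto
    also have "\<dots> = ennreal (1 - x)" using 2 by simp
    finally have "emeasure (distr ?\<mu> borel ?e) {x<..} = ennreal (1 - x)" .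
    moreover have "{0<..1} \<inter> {x<..} = {x<..1}" using 2 by auto
    ultimately show ?thesis unfolding mN using 2 by simp
  next
    case 3
    then have "{0<..1} \<inter> {x<..} = {}" by auto
    moreover have "emeasure (distr ?\<mu> borel ?e) {x<..} = (\<integral>\<^sup>+(s::real). 0 \<partial>lborel)"
      unfolding mE
    proof (rule nn_integral_cong)
      fix s :: real
      have "0 \<le> s \<Longrightarrow> exp (- s) \<le> x" using 3 by (intro order_trans[of "exp (- s)" 1 x]) auto
      then show "ennreal (exp (- s)) * indicator {0..} s * indicator {x<..} (exp (- s)) = 0"
        by (auto simp: indicator_def)
    qed
    ultimately show ?thesis unfolding mN by simp
  qed
next
  fix x :: real
  have "emeasure (distr ?\<mu> borel ?e) {x<..} \<le> emeasure (distr ?\<mu> borel ?e) UNIV"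
    by (intro emeasure_mono) auto
  also have "\<dots> = (\<integral>\<^sup>+s. ennreal (exp (- s)) * indicator {0..} s \<partial>lborel)"
    by (subst emeasure_distr, simp, simp, subst emeasure_density) auto
  also have "\<dots> = 1" by (rule nn_integral_exp_uminus_atLeast)
  finally show "emeasure (distr ?\<mu> borel ?e) {x<..} < \<infinity>" by (rule le_less_trans) simp
qed auto

lemma nn_integral_exp_uminus:
  assumes [measurable]: "f \<in> borel_measurable borel"
  shows "(\<integral>\<^sup>+ s\<in>{0..}. ennreal (exp (- s)) * f (exp (- s)) \<partial>lborel) = (\<integral>\<^sup>+ u\<in>{0<..1}. f u \<partial>lborel)"
proof -
  have "(\<integral>\<^sup>+ u\<in>{0<..1}. f u \<partial>lborel) = (\<integral>\<^sup>+ u. f u \<partial>density lborel (\<lambda>u::real. indicator {0<..1} u))"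
    by (subst nn_integral_density) (auto simp: mult.commute)
  also have "\<dots> = (\<integral>\<^sup>+ s. f (exp (- s)) \<partial>density lborel (\<lambda>s. ennreal (exp (- s)) * indicator {0..} s))"
    unfolding distr_exp_uminus[symmetric] by (subst nn_integral_distr) auto
  also have "\<dots> = (\<integral>\<^sup>+ s\<in>{0..}. ennreal (exp (- s)) * f (exp (- s)) \<partial>lborel)"
    by (subst nn_integral_density) (auto simp: mult_ac)
  finally show ?thesis by simp
qed

lemma AE_exp_uminus:
  fixes Q :: "real \<Rightarrow> bool"
  assumes "{u. Q u} \<in> sets borel"
  shows "(AE s\<in>{0..} in lborel. Q (exp (- s))) \<longleftrightarrow> (AE u\<in>{0<..1} in lborel. Q u)"
proof -
  have "(AE u\<in>{0<..1} in lborel. Q u) \<longleftrightarrow> (AE u in density lborel (\<lambda>u::real. indicator {0<..1} u). Q u)"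
    by (subst AE_density) (auto simp: indicator_def)
  also have "\<dots> \<longleftrightarrow> (AE s in density lborel (\<lambda>s. ennreal (exp (- s)) * indicator {0..} s). Q (exp (- s)))"
    unfolding distr_exp_uminus[symmetric] by (subst AE_distr_iff) (use assms in auto)
  also have "\<dots> \<longleftrightarrow> (AE s\<in>{0..} in lborel. Q (exp (- s)))"
    by (subst AE_density) (auto simp: indicator_def ennreal_zero_less_mult_iff)
  finally show ?thesis by simp
qed

lemma integral_exp_uminus:
  fixes f :: "real \<Rightarrow> real"
  assumes [measurable]: "f \<in> borel_measurable borel" and t: "0 \<le> t"
  shows "(LINT s:{0..t}|lborel. exp (- s) * f (exp (- s))) = (LINT u:{exp (- t)..1}|lborel. f u)"
proof -
  let ?h = "\<lambda>u. indicator {exp (- t)..1} u * f u"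
  have "(LINT u:{exp (- t)..1}|lborel. f u) = (\<integral>u. indicator {0<..1} u *\<^sub>R ?h u \<partial>lborel)"
    unfolding set_lebesgue_integral_def
  proof (rule Bochner_Integration.integral_cong)
    fix u :: real
    have "exp (- t) \<le> u \<Longrightarrow> 0 < u" by (rule less_le_trans[OF exp_gt_zero])
    then show "indicat_real {exp (- t)..1} u *\<^sub>R f u = indicat_real {0<..1} u *\<^sub>R ?h u"
      by (simp add: indicator_def)
  qed simp
  also have "\<dots> = (\<integral>u. ?h u \<partial>density lborel (\<lambda>u::real. indicator {0<..1} u))"
    by (subst integral_density[symmetric]) (auto simp: ennreal_indicator)
  also have "\<dots> = (\<integral>s. ?h (exp (- s)) \<partial>density lborel (\<lambda>s. ennreal (exp (- s) * indicator {0..} s)))"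
    using distr_exp_uminus by (subst integral_distr[symmetric, where N=borel])
      (auto simp: ennreal_mult' ennreal_indicator)
  also have "\<dots> = (\<integral>s. (exp (- s) * indicator {0..} s) *\<^sub>R ?h (exp (- s)) \<partial>lborel)"
    by (subst integral_density) auto
  also have "\<dots> = (LINT s:{0..t}|lborel. exp (- s) * f (exp (- s)))"
    unfolding set_lebesgue_integral_def
    by (intro Bochner_Integration.integral_cong) (auto simp: indicator_def)
  finally show ?thesis by simp
qed

section \<open>The linear integral equation for \<open>M\<close>\<close>

lemma bounded_set_integrable:
  fixes f :: "'a::euclidean_space \<Rightarrow> 'b::euclidean_space"
  assumes [measurable]: "f \<in> borel_measurable borel" and A: "A \<in> sets borel" "bounded A"
    and B: "\<And>s. s \<in> A \<Longrightarrow> norm (f s) \<le> B"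
  shows "set_integrable lborel A f"
  unfolding set_integrable_def
  using A B emeasure_bounded_finite[OF A(2)]
  by (intro integrableI_bounded_set_indicator[where B=B]) (auto simp: less_top)

lemma integral_exp_Icc: "r \<le> t \<Longrightarrow> (LINT s:{r..t}|lborel. exp s) = exp t - exp (r::real)"
  unfolding set_lebesgue_integral_def
  using integral_FTC_Icc_real[of r t exp exp] by (simp add: mult.commute)

text \<open>Variation of constants: \<open>exp t * (c - integral)\<close> solves the equation for
  \<open>M\<close>. The double integral runs over the triangle
  \<open>0 \<le> r \<le> s \<le> t\<close>, and after Fubini the inner integral of
  \<open>exp s\<close> over \<open>{r..t}\<close> is \<open>exp t - exp r\<close>.\<close>

lemma volterra_integral:
  fixes f :: "real \<Rightarrow> real"
  assumes f[measurable]: "f \<in> borel_measurable borel" and B: "\<And>s. \<bar>f s\<bar> \<le> B" and t: "0 \<le> t"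
  shows "(LINT s:{0..t}|lborel. exp s * (c - (LINT r:{0..s}|lborel. exp (- r) * f r)))
    = exp t * (c - (LINT r:{0..t}|lborel. exp (- r) * f r)) - c + (LINT s:{0..t}|lborel. f s)"
proof -
  let ?a = "\<lambda>s. LINT r:{0..s}|lborel. exp (- r) * f r"
  let ?h = "\<lambda>s r. indicator {0..t} s * (indicator {0..s} r * (exp s * (exp (- r) * f r))) :: real"
  have int1: "set_integrable lborel {0..t} (\<lambda>r. exp (- r) * f r)" for t
  proof (rule bounded_set_integrable[where B=B])
    fix r assume "r \<in> {0..t}"
    then have "exp (- r) * \<bar>f r\<bar> \<le> 1 * B" by (intro mult_mono B) auto
    then show "norm (exp (- r) * f r) \<le> B" by (simp add: abs_mult)
  qed auto
  have int2: "set_integrable lborel {0..t} f"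
    by (rule bounded_set_integrable[where B=B]) (auto simp: B)
  have B0: "0 \<le> B" using B[of 0] by linarith
  have hm[measurable]: "case_prod ?h \<in> borel_measurable (lborel \<Otimes>\<^sub>M lborel)"
  proof -
    have [measurable]: "f \<in> borel_measurable lborel" using f by simp
    have "case_prod ?h = (\<lambda>(s, r). if 0 \<le> s \<and> s \<le> t \<and> 0 \<le> r \<and> r \<le> s
        then exp s * (exp (- r) * f r) else 0)"
      by (auto simp: indicator_def fun_eq_iff)
    also have "\<dots> \<in> borel_measurable (lborel \<Otimes>\<^sub>M lborel)" by measurable
    finally show ?thesis .
  qed
  have "integrable (lborel \<Otimes>\<^sub>M lborel) (case_prod ?h)"
  proof (rule integrableI_bounded_set[where A="{0..t} \<times> {0..t}" and B="exp t * B"])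
    show "emeasure (lborel \<Otimes>\<^sub>M lborel) ({0..t} \<times> {0..t}) < \<infinity>"
      by (subst lborel.emeasure_pair_measure_Times) (auto simp: t ennreal_mult_less_top)
    have "\<bar>?h s r\<bar> \<le> exp t * B" for s r
    proof (cases "s \<in> {0..t} \<and> r \<in> {0..s}")
      case True
      have "\<bar>?h s r\<bar> = exp s * (exp (- r) * \<bar>f r\<bar>)" using True by (simp add: abs_mult)
      also have "\<dots> \<le> exp t * (1 * B)" using True B0 by (intro mult_mono B) auto
      finally show ?thesis by simp
    qed (auto simp: B0)
    then show "AE x in lborel \<Otimes>\<^sub>M lborel. x \<in> {0..t} \<times> {0..t} \<longrightarrow> norm (case_prod ?h x) \<le> exp t * B"
      by (auto simp: split_beta)
  qed (auto simp: indicator_def)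
  from lborel_pair.Fubini_integral[OF this]
  have fub: "(\<integral>r. \<integral>s. ?h s r \<partial>lborel \<partial>lborel) = (\<integral>s. \<integral>r. ?h s r \<partial>lborel \<partial>lborel)" .
  have J: "(\<integral>r. ?h s r \<partial>lborel) = indicator {0..t} s *\<^sub>R (exp s * ?a s)" for s
  proof -
    have "(\<integral>r. ?h s r \<partial>lborel)
        = (\<integral>r. (indicator {0..t} s * exp s) * (indicator {0..s} r *\<^sub>R (exp (- r) * f r)) \<partial>lborel)"
      by (intro Bochner_Integration.integral_cong) auto
    then show ?thesis by (simp add: set_lebesgue_integral_def)
  qed
  have L: "(\<integral>s. \<integral>r. ?h s r \<partial>lborel \<partial>lborel) = (LINT s:{0..t}|lborel. exp s * ?a s)"
    unfolding J set_lebesgue_integral_def ..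
  have inner: "(\<integral>s. ?h s r \<partial>lborel) = indicator {0..t} r * (exp t * (exp (- r) * f r) - f r)" for r
  proof (cases "r \<in> {0..t}")
    case True
    have "(\<integral>s. ?h s r \<partial>lborel) = (\<integral>s. (exp (- r) * f r) * (indicator {r..t} s * exp s) \<partial>lborel)"
      using True by (intro Bochner_Integration.integral_cong) (auto simp: indicator_def)
    also have "\<dots> = (exp (- r) * f r) * (exp t - exp r)"
      using integral_exp_Icc[of r t] True by (simp add: set_lebesgue_integral_def)
    also have "\<dots> = exp t * (exp (- r) * f r) - f r"
      by (simp add: algebra_simps mult_exp_exp flip: exp_add)
    finally show ?thesis using True by simp
  next
    case False
    then have z: "?h s r = 0" for s by (auto simp: indicator_def)
    show ?thesis unfolding z using False by simp
  qed
  have R: "(\<integral>r. \<integral>s. ?h s r \<partial>lborel \<partial>lborel) = exp t * ?a t - (LINT s:{0..t}|lborel. f s)"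
  proof -
    have "(\<integral>r. \<integral>s. ?h s r \<partial>lborel \<partial>lborel) = (LINT r:{0..t}|lborel. exp t * (exp (- r) * f r) - f r)"
      unfolding inner set_lebesgue_integral_def by simp
    also have "\<dots> = (LINT r:{0..t}|lborel. exp t * (exp (- r) * f r)) - (LINT s:{0..t}|lborel. f s)"
      by (rule set_integral_diff(2)) (use int1 int2 in auto)
    finally show ?thesis by simp
  qed
  have cont: "set_integrable lborel {0..t} (\<lambda>s. exp s * ?a s)"
  proof -
    have "integrable lborel (\<lambda>s. \<integral>r. ?h s r \<partial>lborel)"
      using lborel_pair.integrable_fst' [OF \<open>integrable (lborel \<Otimes>\<^sub>M lborel) (case_prod ?h)\<close>] by simp
    then show ?thesis unfolding set_integrable_def J .
  qed
  have ex: "set_integrable lborel {0..t} (\<lambda>s. c * exp s)"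
    by (intro set_integrable_mult_right borel_integrable_atLeastAtMost') (auto intro!: continuous_intros)
  have "(LINT s:{0..t}|lborel. exp s * (c - ?a s)) = (LINT s:{0..t}|lborel. c * exp s - exp s * ?a s)"
    by (simp add: algebra_simps)
  also have "\<dots> = (LINT s:{0..t}|lborel. c * exp s) - (LINT s:{0..t}|lborel. exp s * ?a s)"
    by (rule set_integral_diff(2)[OF ex cont])
  also have "\<dots> = c * (exp t - 1) - (exp t * ?a t - (LINT s:{0..t}|lborel. f s))"
    using fub L R integral_exp_Icc[OF t] by simp
  finally show ?thesis by (simp add: algebra_simps)
qed

text \<open>Such a \<open>D\<close> satisfies D' = D and D 0 = 0, so \<open>exp (- s) * D s\<close>
  is constant and vanishes at 0.\<close>

lemma volterra_unique:
  fixes D :: "real \<Rightarrow> real"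
  assumes cont: "continuous_on {0..} D" and eq: "\<And>t. 0 \<le> t \<Longrightarrow> D t = (LINT s:{0..t}|lborel. D s)"
    and t: "0 \<le> t"
  shows "D t = 0"
proof -
  have c: "continuous_on {0..t} D" by (rule continuous_on_subset[OF cont]) auto
  have HK: "D s = integral {0..s} D" if "s \<in> {0..t}" for s
  proof -
    have "set_integrable lborel {0..s} D"
      using that by (intro borel_integrable_atLeastAtMost' continuous_on_subset[OF c]) auto
    then show ?thesis using eq[of s] that by (simp add: set_borel_integral_eq_integral(2))
  qed
  have D: "(D has_real_derivative D s) (at s within {0..t})" if "s \<in> {0..t}" for s
    using integral_has_real_derivative[OF c that]
    by (rule has_field_derivative_transform_within[OF _ zero_less_one that]) (use HK in auto)
  have "\<exists>k. \<forall>s\<in>{0..t}. exp (- s) * D s = k"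
    by (rule has_field_derivative_zero_constant)
       (auto intro!: derivative_eq_intros D simp: convex_real_interval)
  then obtain k where k: "\<And>s. s \<in> {0..t} \<Longrightarrow> exp (- s) * D s = k" by blast
  have "D 0 = 0" using HK[of 0] t by simp
  then have "k = 0" using k[of 0] t by simp
  then show ?thesis using k[of t] t by simp
qed

section \<open>Paths of probability vectors and their integrals\<close>

definition simplex_path :: "(real \<Rightarrow> real ^ 'n::finite) \<Rightarrow> bool" where
  "simplex_path \<zeta> \<longleftrightarrow> \<zeta> \<in> borel_measurable borel \<and> (\<forall>u. \<zeta> u \<in> prob_simplex)"

definition cumulative :: "(real \<Rightarrow> real ^ 'n::finite) \<Rightarrow> real \<Rightarrow> real ^ 'n" where
  "cumulative \<zeta> u = (\<chi> i. LINT v:{0<..u}|lborel. \<zeta> v $ i)"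

definition path_cost ::
  "(real ^ 's \<Rightarrow> real ^ 's ^ 's) \<Rightarrow> (real \<Rightarrow> real ^ ('s::finite \<times> 's)) \<Rightarrow> ennreal" where
  "path_cost G \<zeta> =
    (\<integral>\<^sup>+u\<in>{0<..1}. step_cost G (\<zeta> u) ((1 / u) *\<^sub>R marginal1 (cumulative \<zeta> u)) \<partial>lborel)"

lemma measurable_marginal1:
  fixes f :: "'b \<Rightarrow> real ^ ('s::finite \<times> 's)"
  assumes [measurable]: "f \<in> borel_measurable M"
  shows "(\<lambda>u. marginal1 (f u)) \<in> borel_measurable M"
  unfolding marginal1_def by (rule borel_measurable_vec_lambda) measurable

lemma simplex_pathD:
  assumes "simplex_path \<zeta>"
  shows "\<zeta> \<in> borel_measurable borel" "\<zeta> u \<in> prob_simplex" "0 \<le> \<zeta> u $ i" "\<zeta> u $ i \<le> 1"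
    "(\<lambda>u. \<zeta> u $ i) \<in> borel_measurable borel"
  using assms by (auto simp: simplex_path_def prob_simplexD)

lemma simplex_path_marginal1: "simplex_path \<zeta> \<Longrightarrow> simplex_path (\<lambda>u. marginal1 (\<zeta> u))"
  by (simp add: simplex_path_def measurable_marginal1 marginal1_simplex)

lemma simplex_path_integrable:
  assumes "simplex_path \<zeta>" "A \<in> sets borel" "bounded A"
  shows "set_integrable lborel A (\<lambda>v. \<zeta> v $ i)"
  using assms simplex_pathD(3,4)[OF assms(1), of _ i]
  by (intro bounded_set_integrable[where B=1] simplex_pathD(5)) auto

lemma cumulative_diff:
  assumes \<zeta>: "simplex_path \<zeta>" and uv: "0 \<le> u" "u \<le> v"
  shows "cumulative \<zeta> v $ i - cumulative \<zeta> u $ i = (LINT w:{u<..v}|lborel. \<zeta> w $ i)"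
proof -
  have "{0<..v} = {0<..u} \<union> {u<..v}" using uv by auto
  moreover have "(LINT w:{0<..u} \<union> {u<..v}|lborel. \<zeta> w $ i)
      = (LINT w:{0<..u}|lborel. \<zeta> w $ i) + (LINT w:{u<..v}|lborel. \<zeta> w $ i)"
    by (rule set_integral_Un) (auto intro!: simplex_path_integrable[OF \<zeta>])
  ultimately show ?thesis by (simp add: cumulative_def)
qed

lemma set_integral_const_Ioc: "u \<le> v \<Longrightarrow> (LINT w:{u<..v}|lborel. c) = (v - u) * (c::real)"
  by (simp add: set_lebesgue_integral_def)

lemma cumulative_diff_bounds:
  assumes \<zeta>: "simplex_path \<zeta>" and uv: "0 \<le> u" "u \<le> v"
  shows "cumulative \<zeta> u $ i \<le> cumulative \<zeta> v $ i" "cumulative \<zeta> v $ i - cumulative \<zeta> u $ i \<le> v - u"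
proof -
  have "0 \<le> (LINT w:{u<..v}|lborel. \<zeta> w $ i)"
    unfolding set_lebesgue_integral_def
    by (intro integral_nonneg_AE AE_I2) (simp add: simplex_pathD[OF \<zeta>])
  then show "cumulative \<zeta> u $ i \<le> cumulative \<zeta> v $ i"
    using cumulative_diff[OF assms, of i] by simp
  have "(LINT w:{u<..v}|lborel. \<zeta> w $ i) \<le> (LINT w:{u<..v}|lborel. 1)"
    by (intro set_integral_mono simplex_path_integrable[OF \<zeta>] bounded_set_integrable[where B=1])
       (auto simp: simplex_pathD[OF \<zeta>])
  then show "cumulative \<zeta> v $ i - cumulative \<zeta> u $ i \<le> v - u"
    using cumulative_diff[OF assms, of i] uv by (simp add: set_integral_const_Ioc)
qed

lemma cumulative_0: "cumulative \<zeta> 0 = 0"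
  by (simp add: cumulative_def vec_eq_iff set_lebesgue_integral_def)

lemma cumulative_nonneg: "simplex_path \<zeta> \<Longrightarrow> 0 \<le> u \<Longrightarrow> 0 \<le> cumulative \<zeta> u $ i"
  using cumulative_diff_bounds(1)[of \<zeta> 0 u i] by (simp add: cumulative_0)

lemma cumulative_le: "simplex_path \<zeta> \<Longrightarrow> 0 \<le> u \<Longrightarrow> cumulative \<zeta> u $ i \<le> u"
  using cumulative_diff_bounds(2)[of \<zeta> 0 u i] by (simp add: cumulative_0)

lemma cumulative_sum:
  assumes \<zeta>: "simplex_path \<zeta>" and u: "0 \<le> u"
  shows "(\<Sum>i\<in>UNIV. cumulative \<zeta> u $ i) = u"
proof -
  have "(\<Sum>i\<in>UNIV. cumulative \<zeta> u $ i) = (\<integral>v. (\<Sum>i\<in>UNIV. indicator {0<..u} v *\<^sub>R \<zeta> v $ i) \<partial>lborel)"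
    unfolding cumulative_def set_lebesgue_integral_def
    using simplex_path_integrable[OF \<zeta>, of "{0<..u}"]
    by (subst Bochner_Integration.integral_sum) (auto simp: set_integrable_def)
  also have "\<dots> = (LINT v:{0<..u}|lborel. 1)"
    unfolding set_lebesgue_integral_def
    by (intro Bochner_Integration.integral_cong)
       (auto simp: prob_simplexD(2)[OF simplex_pathD(2)[OF \<zeta>]] simp flip: sum_distrib_left)
  finally show ?thesis using u by (simp add: set_integral_const_Ioc)
qed

lemma cumulative_marginal1:
  assumes \<zeta>: "simplex_path \<zeta>"
  shows "cumulative (\<lambda>u. marginal1 (\<zeta> u)) u = marginal1 (cumulative \<zeta> u)"
proof -
  have "(LINT v:{0<..u}|lborel. marginal1 (\<zeta> v) $ x)
      = (\<Sum>y\<in>UNIV. LINT v:{0<..u}|lborel. \<zeta> v $ (x, y))" for x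
    unfolding marginal_nth set_lebesgue_integral_def scaleR_sum_right
    using simplex_path_integrable[OF \<zeta>, of "{0<..u}"]
    by (subst Bochner_Integration.integral_sum) (auto simp: set_integrable_def)
  then show ?thesis by (simp add: cumulative_def vec_eq_iff marginal_nth)
qed

lemma average_simplex:
  assumes \<zeta>: "simplex_path \<zeta>" and u: "0 < u"
  shows "(1 / u) *\<^sub>R cumulative \<zeta> u \<in> prob_simplex"
  using cumulative_sum[OF \<zeta>, of u] cumulative_nonneg[OF \<zeta>, of u] u
  by (simp add: prob_simplex_def sum_divide_distrib[symmetric])

lemma average_marginal_simplex:
  fixes \<zeta> :: "real \<Rightarrow> real ^ ('s::finite \<times> 's)"
  assumes \<zeta>: "simplex_path \<zeta>" and u: "0 < u"
  shows "(1 / u) *\<^sub>R marginal1 (cumulative \<zeta> u) \<in> prob_simplex"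
  using average_simplex[OF simplex_path_marginal1[OF \<zeta>] u] by (simp add: cumulative_marginal1[OF \<zeta>])

lemma cumulative_continuous:
  assumes \<zeta>: "simplex_path \<zeta>"
  shows "continuous_on {0..} (cumulative \<zeta>)"
proof -
  have "1-lipschitz_on {0..} (\<lambda>u. cumulative \<zeta> u $ i)" for i
  proof (rule lipschitz_onI)
    fix u v :: real assume "u \<in> {0..}" "v \<in> {0..}"
    then show "dist (cumulative \<zeta> u $ i) (cumulative \<zeta> v $ i) \<le> 1 * dist u v"
      using cumulative_diff_bounds[OF \<zeta>, of u v i] cumulative_diff_bounds[OF \<zeta>, of v u i]
      by (cases "u \<le> v") (auto simp: dist_real_def)
  qed simp
  then have c: "continuous_on {0..} (\<lambda>u. cumulative \<zeta> u $ i)" for i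
    by (rule lipschitz_on_continuous_on)
  have "continuous_on {0..} (\<lambda>u. \<chi> i. cumulative \<zeta> u $ i)"
    by (rule continuous_on_vec_lambda) (rule c)
  then show ?thesis by simp
qed

lemma norm_simplex: "m \<in> prob_simplex \<Longrightarrow> norm m \<le> 1"
  using norm_le_l1_cart[of m] by (simp add: prob_simplexD)

lemma compact_prob_simplex: "compact (prob_simplex :: (real ^ 'n::finite) set)"
proof -
  let ?S = "prob_simplex :: (real ^ 'n) set"
  have "?S = (\<Inter>x. {m. 0 \<le> m $ x}) \<inter> {m. (\<Sum>x\<in>UNIV. m $ x) = 1}" by (auto simp: prob_simplex_def)
  also have "closed \<dots>" by (intro closed_Int closed_INT ballI closed_Collect_le closed_Collect_eq continuous_intros)
  finally have "closed ?S" .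
  moreover have "bounded ?S" using norm_simplex by (auto simp: bounded_iff)
  ultimately show ?thesis by (simp add: compact_eq_bounded_closed)
qed

lemma set_integral_vec_nth:
  fixes f :: "real \<Rightarrow> real ^ 'n::finite"
  assumes "set_integrable lborel A f"
  shows "(LINT s:A|lborel. f s) $ i = (LINT s:A|lborel. f s $ i)"
  using integral_bounded_linear[OF bounded_linear_vec_nth[of i] assms[unfolded set_integrable_def]]
  by (simp add: set_lebesgue_integral_def)

lemma exp_weighted_integral:
  fixes \<zeta> :: "real \<Rightarrow> real ^ 'n::finite"
  assumes \<zeta>: "simplex_path \<zeta>" and t: "0 \<le> t"
  shows "(LINT r:{0..t}|lborel. exp (- r) * \<zeta> (exp (- r)) $ i)
    = cumulative \<zeta> 1 $ i - cumulative \<zeta> (exp (- t)) $ i"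
proof -
  have m[measurable]: "(\<lambda>u. \<zeta> u $ i) \<in> borel_measurable borel" by (rule simplex_pathD(5)[OF \<zeta>])
  have "(LINT r:{0..t}|lborel. exp (- r) * \<zeta> (exp (- r)) $ i) = (LINT u:{exp (- t)..1}|lborel. \<zeta> u $ i)"
    by (rule integral_exp_uminus[OF m t])
  also have "\<dots> = (LINT u:{exp (- t)<..1}|lborel. \<zeta> u $ i)"
    unfolding set_lebesgue_integral_def
  proof (rule integral_cong_AE)
    show "AE u in lborel. indicat_real {exp (- t)..1} u *\<^sub>R \<zeta> u $ i = indicat_real {exp (- t)<..1} u *\<^sub>R \<zeta> u $ i"
      using AE_lborel_singleton[of "exp (- t)"] by eventually_elim (auto simp: indicator_def)
  qed auto
  also have "\<dots> = cumulative \<zeta> 1 $ i - cumulative \<zeta> (exp (- t)) $ i"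
    by (rule cumulative_diff[OF \<zeta>, symmetric]) (use t in auto)
  finally show ?thesis .
qed

section \<open>Correspondence between controls and paths\<close>

lemma solves_iff_components:
  fixes \<eta> :: "real \<Rightarrow> real ^ ('s::finite \<times> 's)"
  assumes \<zeta>: "simplex_path \<zeta>" and \<eta>: "\<forall>s\<ge>0. \<eta> s = \<zeta> (exp (- s))"
    and M: "continuous_on {0..} M"
  shows "solves m \<eta> M \<longleftrightarrow> (\<forall>t\<ge>0. \<forall>x. M t $ x = m $ x
    - (LINT s:{0..t}|lborel. marginal1 (\<zeta> (exp (- s))) $ x) + (LINT s:{0..t}|lborel. M s $ x))"
proof -
  have meas: "(\<lambda>s. marginal1 (\<zeta> (exp (- s)))) \<in> borel_measurable borel"
    by (intro measurable_marginal1 measurable_compose[OF _ simplex_pathD(1)[OF \<zeta>]]) auto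
  have int1: "set_integrable lborel {0..t} (\<lambda>s. marginal1 (\<zeta> (exp (- s))))" for t
    by (rule bounded_set_integrable[OF meas, where B=1])
       (auto intro!: norm_simplex marginal1_simplex simplex_pathD[OF \<zeta>])
  have int2: "set_integrable lborel {0..t} M" for t
    by (intro borel_integrable_atLeastAtMost' continuous_on_subset[OF M]) auto
  have eq: "(LINT s:{0..t}|lborel. marginal1 (\<eta> s)) = (LINT s:{0..t}|lborel. marginal1 (\<zeta> (exp (- s))))" for t
    by (rule set_lebesgue_integral_cong) (auto simp: \<eta>)
  show ?thesis unfolding solves_def eq
    using M by (simp add: vec_eq_iff set_integral_vec_nth[OF int1] set_integral_vec_nth[OF int2])
qed

text \<open>This is \<open>volterra_integral\<close> with the weighted integral rewritten as an
  increment of the cumulative path. For \<open>c\<close> equal to the cumulative value at 1 the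
  bracket collapses to the value at \<open>exp (- t)\<close>, which gives existence; for general
  \<open>c\<close> it serves uniqueness.\<close>

lemma exp_average_components:
  fixes \<zeta> :: "real \<Rightarrow> real ^ ('s::finite \<times> 's)"
  assumes \<zeta>: "simplex_path \<zeta>" and t: "0 \<le> t"
  shows "exp t * (c - (cumulative (\<lambda>u. marginal1 (\<zeta> u)) 1 $ x - cumulative (\<lambda>u. marginal1 (\<zeta> u)) (exp (- t)) $ x))
    = c - (LINT s:{0..t}|lborel. marginal1 (\<zeta> (exp (- s))) $ x)
      + (LINT s:{0..t}|lborel. exp s * (c - (cumulative (\<lambda>u. marginal1 (\<zeta> u)) 1 $ x - cumulative (\<lambda>u. marginal1 (\<zeta> u)) (exp (- s)) $ x)))"
proof -
  note \<xi> = simplex_path_marginal1[OF \<zeta>]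
  have m: "(\<lambda>s. marginal1 (\<zeta> (exp (- s))) $ x) \<in> borel_measurable borel"
    by (intro measurable_compose[OF _ simplex_pathD(5)[OF \<xi>]]) auto
  have "(LINT s:{0..t}|lborel. exp s * (c - (LINT r:{0..s}|lborel. exp (- r) * marginal1 (\<zeta> (exp (- r))) $ x)))
      = (LINT s:{0..t}|lborel. exp s * (c - (cumulative (\<lambda>u. marginal1 (\<zeta> u)) 1 $ x - cumulative (\<lambda>u. marginal1 (\<zeta> u)) (exp (- s)) $ x)))"
    by (rule set_lebesgue_integral_cong) (auto simp: exp_weighted_integral[OF \<xi>])
  then show ?thesis
    using volterra_integral[OF m, of 1 t c] t simplex_pathD(3,4)[OF \<xi>]
    by (simp add: exp_weighted_integral[OF \<xi>] abs_le_iff)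
qed

lemma solves_exp_average:
  fixes \<zeta> :: "real \<Rightarrow> real ^ ('s::finite \<times> 's)"
  assumes \<zeta>: "simplex_path \<zeta>" and \<eta>: "\<forall>s\<ge>0. \<eta> s = \<zeta> (exp (- s))"
  shows "solves (marginal1 (cumulative \<zeta> 1)) \<eta> (\<lambda>s. exp s *\<^sub>R marginal1 (cumulative \<zeta> (exp (- s))))"
proof -
  note \<xi> = simplex_path_marginal1[OF \<zeta>]
  have "continuous_on {0..} (\<lambda>s. exp s *\<^sub>R cumulative (\<lambda>u. marginal1 (\<zeta> u)) (exp (- s)))"
    by (intro continuous_intros continuous_on_compose2[OF cumulative_continuous[OF \<xi>]]) auto
  then have c: "continuous_on {0..} (\<lambda>s. exp s *\<^sub>R marginal1 (cumulative \<zeta> (exp (- s))))"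
    by (simp add: cumulative_marginal1[OF \<zeta>])
  show ?thesis
    unfolding solves_iff_components[OF \<zeta> \<eta> c]
  proof (intro allI impI)
    fix t :: real and x assume t: "0 \<le> t"
    show "(exp t *\<^sub>R marginal1 (cumulative \<zeta> (exp (- t)))) $ x = marginal1 (cumulative \<zeta> 1) $ x
      - (LINT s:{0..t}|lborel. marginal1 (\<zeta> (exp (- s))) $ x)
      + (LINT s:{0..t}|lborel. (exp s *\<^sub>R marginal1 (cumulative \<zeta> (exp (- s)))) $ x)"
      using exp_average_components[OF \<zeta> t, of "marginal1 (cumulative \<zeta> 1) $ x" x]
      by (simp add: cumulative_marginal1[OF \<zeta>])
  qed
qed

text \<open>Uniqueness for the equation forces \<open>M t\<close> to be \<open>exp t\<close> times
  \<open>m - N 1 + N (exp (- t))\<close>, where \<open>N\<close> is the cumulative first marginal.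
  Staying in the simplex keeps this product bounded while \<open>N (exp (- t))\<close> tends to 0,
  so the initial value \<open>m\<close> must be \<open>N 1\<close>: the control determines its
  starting point.\<close>

lemma solves_unique:
  fixes \<zeta> :: "real \<Rightarrow> real ^ ('s::finite \<times> 's)"
  assumes \<zeta>: "simplex_path \<zeta>" and \<eta>: "\<forall>s\<ge>0. \<eta> s = \<zeta> (exp (- s))"
    and M: "solves m \<eta> M" "\<And>t. 0 \<le> t \<Longrightarrow> M t \<in> prob_simplex"
  shows "m = marginal1 (cumulative \<zeta> 1)"
    and "0 \<le> t \<Longrightarrow> M t = exp t *\<^sub>R marginal1 (cumulative \<zeta> (exp (- t)))"
proof -
  note \<xi> = simplex_path_marginal1[OF \<zeta>]
  let ?N = "cumulative (\<lambda>u. marginal1 (\<zeta> u))"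
  have c: "continuous_on {0..} M" using M(1) by (simp add: solves_def)
  note comp = M(1)[unfolded solves_iff_components[OF \<zeta> \<eta> c], rule_format]
  let ?C = "\<lambda>x s. exp s * (m $ x - (?N 1 $ x - ?N (exp (- s)) $ x))"
  have cN: "continuous_on {0..} (\<lambda>s. ?N (exp (- s)) $ x)" for x
    by (intro continuous_on_component continuous_on_compose2[OF cumulative_continuous[OF \<xi>]] continuous_intros) auto
  have cM: "continuous_on {0..} (\<lambda>s. M s $ x)" for x
    by (intro continuous_on_component c)
  have cC: "continuous_on {0..} (?C x)" for x by (intro continuous_intros cN)
  have MC: "M t $ x = ?C x t" if "0 \<le> t" for t x
  proof -
    have "M t $ x - ?C x t = 0"
    proof (rule volterra_unique[OF _ _ that])
      show "continuous_on {0..} (\<lambda>s. M s $ x - ?C x s)" by (intro continuous_intros cM cC)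
      fix t :: real assume t: "0 \<le> t"
      have i: "set_integrable lborel {0..t} (\<lambda>s. M s $ x)" "set_integrable lborel {0..t} (?C x)"
        by (intro borel_integrable_atLeastAtMost' continuous_on_subset[OF cM] continuous_on_subset[OF cC]; auto)+
      show "M t $ x - ?C x t = (LINT s:{0..t}|lborel. M s $ x - ?C x s)"
        unfolding set_integral_diff(2)[OF i]
        using comp[OF t, of x] exp_average_components[OF \<zeta> t, of "m $ x" x] by simp
    qed
    then show ?thesis by simp
  qed
  have m: "m $ x = ?N 1 $ x" for x
  proof -
    \<comment> \<open>One \<open>exp (- t)\<close> bounds the rescaled \<open>M t\<close>, the other
      bounds the cumulative value at \<open>exp (- t)\<close>.\<close>
    have "\<bar>m $ x - ?N 1 $ x\<bar> \<le> 2 * exp (- t)" if t: "0 \<le> t" for t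
    proof -
      have "exp (- t) * M t $ x = m $ x - (?N 1 $ x - ?N (exp (- t)) $ x)"
        unfolding MC[OF t] by (simp add: exp_minus field_simps)
      moreover have "\<bar>exp (- t) * M t $ x\<bar> \<le> exp (- t) * 1"
        unfolding abs_mult using prob_simplexD(1,3)[OF M(2)[OF t], of x] by (intro mult_mono) auto
      ultimately show ?thesis
        using cumulative_nonneg[OF \<xi>, of "exp (- t)" x] cumulative_le[OF \<xi>, of "exp (- t)" x] by simp
    qed
    moreover have "((\<lambda>t::real. 2 * exp (- t)) \<longlongrightarrow> 2 * 0) at_top"
      by (intro tendsto_mult tendsto_const filterlim_compose[OF exp_at_bot filterlim_uminus_at_bot_at_top])
    ultimately have "\<bar>m $ x - ?N 1 $ x\<bar> \<le> 0"
      by (intro tendsto_lowerbound[of "\<lambda>t::real. 2 * exp (- t)" _ at_top])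
         (auto intro!: eventually_mono[OF eventually_ge_at_top[of 0]])
    then show ?thesis by simp
  qed
  then show "m = marginal1 (cumulative \<zeta> 1)" by (simp add: vec_eq_iff cumulative_marginal1[OF \<zeta>])
  show "M t = exp t *\<^sub>R marginal1 (cumulative \<zeta> (exp (- t)))" if "0 \<le> t"
    using MC[OF that] m by (simp add: vec_eq_iff cumulative_marginal1[OF \<zeta>])
qed

text \<open>With \<open>u = exp (- t)\<close> and \<open>v = exp (- s)\<close>, the difference of
  the averages splits into a rescaling of the integral up to \<open>u\<close> and the increment from
  \<open>u\<close> to \<open>v\<close>. Each part has total mass
  \<open>1 - u / v \<le> t - s\<close>, whence the constant 2.\<close>

lemma cumulative_l1_lipschitz:
  assumes \<zeta>: "simplex_path \<zeta>" and st: "0 \<le> s" "s \<le> t"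
  shows "l1_norm (exp t *\<^sub>R cumulative \<zeta> (exp (- t)) - exp s *\<^sub>R cumulative \<zeta> (exp (- s))) \<le> 2 * (t - s)"
proof -
  define u v where "u = exp (- t)" and "v = exp (- s)"
  have uv: "0 < u" "u \<le> v" using st by (auto simp: u_def v_def)
  have e: "exp t = 1 / u" "exp s = 1 / v" by (auto simp: u_def v_def exp_minus field_simps)
  have "\<bar>((1 / u) *\<^sub>R cumulative \<zeta> u - (1 / v) *\<^sub>R cumulative \<zeta> v) $ i\<bar>
      \<le> (1 / u - 1 / v) * cumulative \<zeta> u $ i + (1 / v) * (cumulative \<zeta> v $ i - cumulative \<zeta> u $ i)" for i
  proof -
    have eq: "((1 / u) *\<^sub>R cumulative \<zeta> u - (1 / v) *\<^sub>R cumulative \<zeta> v) $ i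
      = (1 / u - 1 / v) * cumulative \<zeta> u $ i - (1 / v) * (cumulative \<zeta> v $ i - cumulative \<zeta> u $ i)"
      by (simp add: algebra_simps)
    have "0 \<le> (1 / u - 1 / v) * cumulative \<zeta> u $ i"
      using uv cumulative_nonneg[OF \<zeta>, of u i] by (intro mult_nonneg_nonneg) (auto simp: frac_le)
    moreover have "0 \<le> (1 / v) * (cumulative \<zeta> v $ i - cumulative \<zeta> u $ i)"
      using uv cumulative_diff_bounds(1)[OF \<zeta>, of u v i] by (intro mult_nonneg_nonneg) auto
    ultimately show ?thesis unfolding eq by linarith
  qed
  then have "l1_norm ((1 / u) *\<^sub>R cumulative \<zeta> u - (1 / v) *\<^sub>R cumulative \<zeta> v)
     \<le> (\<Sum>i\<in>UNIV. (1 / u - 1 / v) * cumulative \<zeta> u $ i + (1 / v) * (cumulative \<zeta> v $ i - cumulative \<zeta> u $ i))"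
    unfolding l1_norm_def by (intro sum_mono)
  also have "\<dots> = (1 / u - 1 / v) * u + (1 / v) * (v - u)"
    using cumulative_sum[OF \<zeta>, of u] cumulative_sum[OF \<zeta>, of v] uv
    by (simp only: sum.distrib sum_distrib_left[symmetric] sum_subtractf less_imp_le order_trans[OF less_imp_le])
  also have "\<dots> = 2 * (1 - u / v)" using uv by (simp add: field_simps)
  also have "u / v = exp (- (t - s))" by (simp add: u_def v_def exp_diff[symmetric])
  also have "2 * (1 - exp (- (t - s))) \<le> 2 * (t - s)"
    by (smt (verit) exp_ge_add_one_self)
  finally show ?thesis by (simp add: e u_def[symmetric] v_def[symmetric])
qed

lemma cumulative_marginal2:
  assumes \<zeta>: "simplex_path \<zeta>" and bal: "\<forall>u. marginal1 (\<zeta> u) = marginal2 (\<zeta> u)"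
  shows "marginal2 (cumulative \<zeta> u) = marginal1 (cumulative \<zeta> u)"
proof -
  have "(LINT v:{0<..u}|lborel. marginal2 (\<zeta> v) $ x)
      = (\<Sum>y\<in>UNIV. LINT v:{0<..u}|lborel. \<zeta> v $ (y, x))" for x
    unfolding marginal_nth set_lebesgue_integral_def scaleR_sum_right
    using simplex_path_integrable[OF \<zeta>, of "{0<..u}"]
    by (subst Bochner_Integration.integral_sum) (auto simp: set_integrable_def)
  then have "marginal2 (cumulative \<zeta> u) = cumulative (\<lambda>u. marginal2 (\<zeta> u)) u"
    by (simp add: cumulative_def vec_eq_iff marginal_nth)
  also have "\<dots> = cumulative (\<lambda>u. marginal1 (\<zeta> u)) u" using bal by simp
  finally show ?thesis by (simp add: cumulative_marginal1[OF \<zeta>])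
qed

lemma path_cost_exp:
  assumes \<zeta>: "simplex_path \<zeta>" and \<eta>: "\<forall>s\<ge>0. \<eta> s = \<zeta> (exp (- s))"
    and M: "\<forall>s\<ge>0. M s = exp s *\<^sub>R marginal1 (cumulative \<zeta> (exp (- s)))"
    and meas: "(\<lambda>u. step_cost G (\<zeta> u) ((1 / u) *\<^sub>R marginal1 (cumulative \<zeta> u)) * indicator {0<..1} u) \<in> borel_measurable borel"
  shows "control_cost G \<eta> M = path_cost G \<zeta>"
proof -
  let ?f = "\<lambda>u. step_cost G (\<zeta> u) ((1 / u) *\<^sub>R marginal1 (cumulative \<zeta> u)) * indicator {0<..1} u"
  have "control_cost G \<eta> M = (\<integral>\<^sup>+ s\<in>{0..}. ennreal (exp (- s)) * ?f (exp (- s)) \<partial>lborel)"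
    unfolding control_cost_eq
  proof (rule nn_integral_cong)
    fix s :: real
    have "1 / exp (- s) = exp s" by (simp add: exp_minus field_simps)
    then show "ennreal (exp (- s)) * step_cost G (\<eta> s) (M s) * indicator {0..} s
      = ennreal (exp (- s)) * ?f (exp (- s)) * indicator {0..} s"
      using \<eta> M by (auto simp: indicator_def)
  qed
  also have "\<dots> = (\<integral>\<^sup>+ u\<in>{0<..1}. ?f u \<partial>lborel)"
    by (rule nn_integral_exp_uminus[OF meas])
  also have "\<dots> = path_cost G \<zeta>"
    unfolding path_cost_def by (intro nn_integral_cong) (auto simp: indicator_def)
  finally show ?thesis .
qed

lemma rate_function_le_path_cost:
  fixes \<zeta> :: "real \<Rightarrow> real ^ ('s::finite \<times> 's)"
  assumes \<zeta>: "simplex_path \<zeta>" and bal: "\<forall>u. marginal1 (\<zeta> u) = marginal2 (\<zeta> u)"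
    and supp: "\<forall>u. \<forall>p\<in>- adj_support A. \<zeta> u $ p = 0"
    and meas: "(\<lambda>u. step_cost G (\<zeta> u) ((1 / u) *\<^sub>R marginal1 (cumulative \<zeta> u)) * indicator {0<..1} u) \<in> borel_measurable borel"
  shows "rate_function A G (marginal1 (cumulative \<zeta> 1)) \<le> path_cost G \<zeta>"
proof -
  define \<eta> where "\<eta> = (\<lambda>s. \<zeta> (exp (- s)))"
  define M where "M = (\<lambda>s. exp s *\<^sub>R marginal1 (cumulative \<zeta> (exp (- s))))"
  \<comment> \<open>The running average of \<open>\<zeta>\<close> itself is the pair-valued function
    that admissibility asks for.\<close>
  define Mp where "Mp = (\<lambda>s. exp s *\<^sub>R cumulative \<zeta> (exp (- s)))"
  let ?m = "marginal1 (cumulative \<zeta> 1)"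
  have eta: "\<forall>s\<ge>0. \<eta> s = \<zeta> (exp (- s))" by (simp add: \<eta>_def)
  have sol: "solves ?m \<eta> M" unfolding M_def by (rule solves_exp_average[OF \<zeta> eta])
  have e: "exp s = 1 / exp (- s)" for s :: real by (simp add: exp_minus field_simps)
  have "\<eta> \<in> borel \<rightarrow>\<^sub>M borel"
    unfolding \<eta>_def by (intro measurable_compose[OF _ simplex_pathD(1)[OF \<zeta>]]) auto
  then have ctrl: "\<eta> \<in> controls" unfolding controls_def
    by (intro measurable_restrict_space2 measurable_restrict_space1) (auto simp: \<eta>_def simplex_pathD[OF \<zeta>])
  have Msimp: "M t \<in> prob_simplex" for t
    unfolding M_def e[of t] by (rule average_marginal_simplex[OF \<zeta>]) simp
  have Mpsimp: "Mp t \<in> prob_simplex" for t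
    unfolding Mp_def e[of t] by (rule average_simplex[OF \<zeta>]) simp
  have "continuous_on {0..} Mp" unfolding Mp_def
    by (intro continuous_intros continuous_on_compose2[OF cumulative_continuous[OF \<zeta>]]) auto
  then have Mpc: "continuous_map (top_of_set {0..}) weak_topology Mp"
    using Mpsimp unfolding weak_topology_eq by (simp add: continuous_map_in_subtopology image_subset_iff)
  have lip: "l1_norm (Mp t - Mp s) \<le> 2 * \<bar>t - s\<bar>" if "0 \<le> s" "0 \<le> t" for s t
  proof (cases "s \<le> t")
    case True
    then show ?thesis using cumulative_l1_lipschitz[OF \<zeta>, of s t] that by (simp add: Mp_def)
  next
    case False
    have "l1_norm (Mp t - Mp s) = l1_norm (Mp s - Mp t)" by (simp add: l1_norm_def abs_minus_commute)
    then show ?thesis using cumulative_l1_lipschitz[OF \<zeta>, of t s] that False by (simp add: Mp_def)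
  qed
  have marg: "marginal1 (Mp t) = M t" "marginal2 (Mp t) = M t" for t
    using cumulative_marginal2[OF \<zeta> bal, of "exp (- t)"]
    by (auto simp: Mp_def M_def vec_eq_iff marginal_nth simp flip: sum_distrib_left)
  have "cumulative \<zeta> u $ p = 0" if "p \<in> - adj_support A" for u p
    using supp that by (simp add: cumulative_def set_lebesgue_integral_def)
  then have Mps: "\<forall>p\<in>- adj_support A. Mp t $ p = 0" for t by (simp add: Mp_def)
  have adm: "\<eta> \<in> admissible_controls A ?m"
    unfolding admissible_controls_def using ctrl sol Msimp Mpc lip marg Mps bal supp
    by (auto simp: \<eta>_def intro!: exI[of _ M] exI[of _ Mp])
  have "rate_function A G ?m \<le> control_cost G \<eta> M"
    unfolding rate_function_def using adm sol by (intro INF_lower2[of "(\<eta>, M)"]) auto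
  also have "\<dots> = path_cost G \<zeta>"
    by (rule path_cost_exp[OF \<zeta> eta _ meas]) (simp add: M_def)
  finally show ?thesis .
qed

lemma admissible_control_path:
  fixes \<eta> :: "real \<Rightarrow> real ^ ('s::finite \<times> 's)"
  assumes \<eta>: "\<eta> \<in> admissible_controls A m" and M: "solves m \<eta> M"
    and meas: "\<And>\<zeta>. simplex_path \<zeta> \<Longrightarrow>
      (\<lambda>u. step_cost G (\<zeta> u) ((1 / u) *\<^sub>R marginal1 (cumulative \<zeta> u)) * indicator {0<..1} u) \<in> borel_measurable borel"
  obtains \<zeta> where "simplex_path \<zeta>" "AE u\<in>{0<..1} in lborel. marginal1 (\<zeta> u) = marginal2 (\<zeta> u)"
    "AE u\<in>{0<..1} in lborel. \<forall>p\<in>- adj_support A. \<zeta> u $ p = 0"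
    "m = marginal1 (cumulative \<zeta> 1)" "control_cost G \<eta> M = path_cost G \<zeta>"
proof -
  \<comment> \<open>The inverse time change \<open>s = - ln u\<close>. The truncation at 0 has no
    effect on (0, 1] and keeps the argument inside the domain of \<open>\<eta>\<close>.\<close>
  define \<zeta> where "\<zeta> = (\<lambda>u. \<eta> (max 0 (- ln u)))"
  have "(\<lambda>u. max 0 (- ln u)) \<in> borel \<rightarrow>\<^sub>M restrict_space borel {0::real..}"
    by (intro measurable_restrict_space2) auto
  moreover have "\<eta> \<in> restrict_space borel {0..} \<rightarrow>\<^sub>M restrict_space borel prob_simplex"
    using \<eta> by (simp add: admissible_controls_def controls_def)
  ultimately have *: "\<zeta> \<in> borel \<rightarrow>\<^sub>M restrict_space borel prob_simplex"
    unfolding \<zeta>_def by (rule measurable_compose)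
  have \<zeta>: "simplex_path \<zeta>"
    using measurable_restrict_space2_iff[THEN iffD1, OF *] by (auto simp: simplex_path_def)
  have eta: "\<forall>s\<ge>0. \<eta> s = \<zeta> (exp (- s))" by (simp add: \<zeta>_def)
  obtain M' where M': "solves m \<eta> M'" "\<forall>t\<ge>0. M' t \<in> prob_simplex"
    using \<eta> by (auto simp: admissible_controls_def)
  have m: "m = marginal1 (cumulative \<zeta> 1)" by (rule solves_unique(1)[OF \<zeta> eta M'(1)]) (use M' in auto)
  \<comment> \<open>Only the solution hidden in admissibility is known to stay in the simplex;
    uniqueness transfers this to the given \<open>M\<close>.\<close>
  have MM': "M t = M' t" if t: "0 \<le> t" for t
  proof (rule vec_eq_iff[THEN iffD2], rule allI)
    fix x
    have c: "continuous_on {0..} (\<lambda>s. M s $ x)" "continuous_on {0..} (\<lambda>s. M' s $ x)"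
      using M M'(1) by (auto simp: solves_def intro: continuous_on_component)
    have c': "continuous_on {0..} M" "continuous_on {0..} M'"
      using M M'(1) by (auto simp: solves_def)
    have "M t $ x - M' t $ x = 0"
    proof (rule volterra_unique[OF _ _ t])
      show "continuous_on {0..} (\<lambda>s. M s $ x - M' s $ x)" by (intro continuous_intros c)
      fix t :: real assume t: "0 \<le> t"
      have i: "set_integrable lborel {0..t} (\<lambda>s. M s $ x)" "set_integrable lborel {0..t} (\<lambda>s. M' s $ x)"
        by (intro borel_integrable_atLeastAtMost' continuous_on_subset[OF c(1)] continuous_on_subset[OF c(2)]; auto)+
      show "M t $ x - M' t $ x = (LINT s:{0..t}|lborel. M s $ x - M' s $ x)"
        unfolding set_integral_diff(2)[OF i]
        using M[unfolded solves_iff_components[OF \<zeta> eta c'(1)], rule_format, OF t, of x]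
          M'(1)[unfolded solves_iff_components[OF \<zeta> eta c'(2)], rule_format, OF t, of x] by simp
    qed
    then show "M t $ x = M' t $ x" by simp
  qed
  have Mf: "\<forall>s\<ge>0. M s = exp s *\<^sub>R marginal1 (cumulative \<zeta> (exp (- s)))"
    using solves_unique(2)[OF \<zeta> eta M'(1)] M'(2) MM' by auto
  have [measurable]: "\<zeta> \<in> borel_measurable borel" by (rule simplex_pathD(1)[OF \<zeta>])
  have "{u. marginal1 (\<zeta> u) = marginal2 (\<zeta> u)} \<in> sets borel"
    unfolding vec_eq_iff marginal_nth by measurable
  then have 1: "AE u\<in>{0<..1} in lborel. marginal1 (\<zeta> u) = marginal2 (\<zeta> u)"
    using \<eta> eta by (subst AE_exp_uminus[symmetric]) (auto simp: admissible_controls_def elim!: eventually_mono)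
  have "{u. \<forall>p\<in>- adj_support A. \<zeta> u $ p = 0} \<in> sets borel"
    by measurable
  then have 2: "AE u\<in>{0<..1} in lborel. \<forall>p\<in>- adj_support A. \<zeta> u $ p = 0"
    using \<eta> eta by (subst AE_exp_uminus[symmetric]) (auto simp: admissible_controls_def elim!: eventually_mono)
  show thesis
    by (rule that[OF \<zeta> 1 2 m path_cost_exp[OF \<zeta> eta Mf meas[OF \<zeta>]]])
qed

lemma borel_measurable_cumulative:
  assumes \<zeta>: "simplex_path \<zeta>"
  shows "cumulative \<zeta> \<in> borel_measurable borel"
proof -
  have "cumulative \<zeta> u = cumulative \<zeta> (max 0 u)" for u
    by (cases "0 \<le> u") (auto simp: cumulative_def)
  moreover have "continuous_on UNIV (\<lambda>u. cumulative \<zeta> (max 0 u))"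
    by (intro continuous_on_compose2[OF cumulative_continuous[OF \<zeta>]] continuous_intros) auto
  ultimately show ?thesis
    using borel_measurable_continuous_onI by (metis (no_types, lifting) ext)
qed

section \<open>Paths as distribution functions\<close>

lemma emeasure_interval_measure_Ioo:
  assumes "\<And>x y. x \<le> y \<Longrightarrow> F x \<le> F y" "continuous_on UNIV F" "a \<le> b"
  shows "emeasure (interval_measure F) {a<..<b} = F b - F a"
proof (cases "a = b")
  case False
  then have ab: "a < b" using assms(3) by simp
  have rc: "continuous (at_right x) F" for x
    using assms(2) by (simp add: continuous_on_eq_continuous_at continuous_at_imp_continuous_at_within)
  have "emeasure (interval_measure F) {b..b} = F b - F b"
    using assms by (intro emeasure_interval_measure_Icc) auto
  then have "{b} \<in> null_sets (interval_measure F)" by (simp add: null_sets_def)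
  then have "emeasure (interval_measure F) ({a<..b} - {b}) = emeasure (interval_measure F) {a<..b}"
    by (intro emeasure_Diff_null_set) auto
  also have "\<dots> = F b - F a"
    using assms rc by (intro emeasure_interval_measure_Ioc) auto
  also have "{a<..b} - {b} = {a<..<b}" using ab by auto
  finally show ?thesis .
qed simp

text \<open>The distribution functions add up to the identity, so the measures add up to length on
  intervals, and this determines Lebesgue measure. Each summand is therefore dominated by Lebesgue
  measure, hence absolutely continuous.\<close>

lemma sum_interval_measure_eq_lborel:
  fixes F :: "'p::finite \<Rightarrow> real \<Rightarrow> real"
  assumes mono: "\<And>p x y. x \<le> y \<Longrightarrow> F p x \<le> F p y" and cont: "\<And>p. continuous_on UNIV (F p)"
    and sum: "\<And>u. (\<Sum>p\<in>UNIV. F p u) = u" and A: "A \<in> sets borel"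
  shows "(\<Sum>p\<in>UNIV. emeasure (interval_measure (F p)) A) = emeasure lborel A"
proof -
  let ?\<mu> = "\<lambda>A. \<Sum>p\<in>UNIV. emeasure (interval_measure (F p)) A"
  define M where "M = measure_of UNIV (sets borel) ?\<mu>"
  have sM: "sets M = sets borel"
    using sets.sigma_sets_eq[of "borel :: real measure"] by (simp add: M_def sets_measure_of_conv)
  have eM: "emeasure M A = ?\<mu> A" if "A \<in> sets borel" for A
  proof (rule emeasure_measure_of[OF M_def])
    show "countably_additive (sets M) ?\<mu>"
      unfolding countably_additive_def
    proof (intro allI impI)
      fix B :: "nat \<Rightarrow> real set" assume B: "range B \<subseteq> sets M" "disjoint_family B" "\<Union> (range B) \<in> sets M"
      have "(\<Sum>i. ?\<mu> (B i)) = (\<Sum>p\<in>UNIV. \<Sum>i. emeasure (interval_measure (F p)) (B i))"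
        by (rule suminf_sum) simp
      also have "\<dots> = ?\<mu> (\<Union> (range B))"
        using B sM by (intro sum.cong refl suminf_emeasure) auto
      finally show "(\<Sum>i. ?\<mu> (B i)) = ?\<mu> (\<Union> (range B))" .
    qed
  qed (use that sM in \<open>auto simp: positive_def\<close>)
  have "lborel = M"
  proof (rule lborel_eqI)
    fix l u :: real assume lu: "\<And>b. b \<in> Basis \<Longrightarrow> l \<bullet> b \<le> u \<bullet> b"
    then have lu: "l \<le> u" by simp
    have "emeasure M (box l u) = (\<Sum>p\<in>UNIV. ennreal (F p u - F p l))"
      using lu mono cont by (subst eM) (auto simp: box_real emeasure_interval_measure_Ioo)
    also have "\<dots> = ennreal (\<Sum>p\<in>UNIV. F p u - F p l)" using lu mono by (simp add: sum_ennreal)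
    also have "\<dots> = ennreal (u - l)" by (simp add: sum_subtractf sum)
    finally show "emeasure M (box l u) = (\<Prod>b\<in>Basis. (u - l) \<bullet> b)" by simp
  qed (rule sM)
  then show ?thesis using eM[OF A] by metis
qed

text \<open>Each coordinate is the distribution function of a measure dominated by Lebesgue measure, and
  \<open>\<zeta>\<close> collects the Radon-Nikodym densities.\<close>

lemma simplex_path_of_monotone:
  fixes N :: "real \<Rightarrow> 'p::finite \<Rightarrow> real"
  assumes nn: "\<And>p. 0 \<le> N 0 p"
    and mono: "\<And>u v p. 0 \<le> u \<Longrightarrow> u \<le> v \<Longrightarrow> v \<le> 1 \<Longrightarrow> N u p \<le> N v p"
    and sum: "\<And>u. 0 \<le> u \<Longrightarrow> u \<le> 1 \<Longrightarrow> (\<Sum>p\<in>UNIV. N u p) = u"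
  obtains \<zeta> :: "real \<Rightarrow> real ^ 'p" where "simplex_path \<zeta>"
    "\<And>u p. 0 \<le> u \<Longrightarrow> u \<le> 1 \<Longrightarrow> cumulative \<zeta> u $ p = N u p"
proof -
  define d where "d = real CARD('p)"
  have d: "d > 0" by (simp add: d_def)
  have N0: "N 0 p = 0" for p
    using sum[of 0] nn by (simp add: sum_nonneg_eq_0_iff)
  \<comment> \<open>Outside [0, 1] all coordinates continue with the common slope
    \<open>1 / d\<close>, so monotonicity and the sum \<open>u\<close> persist on the whole
    line.\<close>
  define F where "F = (\<lambda>p u. if u < 0 then u / d else if u \<le> 1 then N u p else N 1 p + (u - 1) / d)"
  have Fmono: "F p x \<le> F p y" if "x \<le> y" for p x y
  proof -
    have "0 \<le> N y p" if "0 \<le> y" "y \<le> 1" using mono[of 0 y p] that N0 by simp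
    moreover have "0 \<le> N 1 p" using mono[of 0 1 p] N0 by simp
    moreover have "N x p \<le> N y p" if "0 \<le> x" "y \<le> 1" using mono[of x y p] that \<open>x \<le> y\<close> by simp
    moreover have "N x p \<le> N 1 p" if "0 \<le> x" "x \<le> 1" using mono[of x 1 p] that by simp
    moreover have "x < 0 \<Longrightarrow> x / d \<le> 0" using d by (simp add: divide_nonpos_pos)
    moreover have "y > 1 \<Longrightarrow> 0 \<le> (y - 1) / d" using d by simp
    moreover have "x / d \<le> y / d" "(x - 1) / d \<le> (y - 1) / d" using d that by (auto simp: divide_right_mono)
    ultimately show ?thesis using that unfolding F_def by (smt (verit))
  qed
  have Fsum: "(\<Sum>p\<in>UNIV. F p u) = u" for u
  proof -
    consider "u < 0" | "0 \<le> u" "u \<le> 1" | "1 < u" by linarith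
    then show ?thesis
    proof cases
      case 1
      then show ?thesis using d by (simp add: F_def d_def)
    next
      case 2
      then show ?thesis using sum[of u] by (simp add: F_def)
    next
      case 3
      then show ?thesis using d sum[of 1] by (simp add: F_def sum.distrib d_def)
    qed
  qed
  \<comment> \<open>Increments are nonnegative and add up to \<open>y - x\<close>, so the sum
    condition alone yields Lipschitz continuity.\<close>
  have Flip: "F p y - F p x \<le> y - x" if "x \<le> y" for p x y
  proof -
    have "F p y - F p x \<le> (\<Sum>p\<in>UNIV. F p y - F p x)"
      using Fmono[OF that] by (intro member_le_sum[of p UNIV "\<lambda>p. F p y - F p x"]) auto
    also have "\<dots> = y - x" by (simp add: sum_subtractf Fsum)
    finally show ?thesis .
  qed
  have Fcont: "continuous_on UNIV (F p)" for p
  proof (rule lipschitz_on_continuous_on[of 1], rule lipschitz_onI)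
    fix x y :: real
    show "dist (F p x) (F p y) \<le> 1 * dist x y"
      using Fmono[of x y p] Fmono[of y x p] Flip[of x y p] Flip[of y x p]
      by (cases "x \<le> y") (auto simp: dist_real_def)
  qed simp
  have Frc: "continuous (at_right x) (F p)" for p x
    using Fcont[of p] by (simp add: continuous_on_eq_continuous_at continuous_at_imp_continuous_at_within)
  have tot: "(\<Sum>p\<in>UNIV. emeasure (interval_measure (F p)) A) = emeasure lborel A" if "A \<in> sets borel" for A
    by (rule sum_interval_measure_eq_lborel) (use Fmono Fcont Fsum that in auto)
  have le: "emeasure (interval_measure (F p)) A \<le> emeasure lborel A" if "A \<in> sets borel" for A p
    unfolding tot[OF that, symmetric]
    by (rule member_le_sum[of p UNIV "\<lambda>p. emeasure (interval_measure (F p)) A"]) auto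
  have "absolutely_continuous lborel (interval_measure (F p))" for p
    unfolding absolutely_continuous_def
  proof
    fix A :: "real set" assume "A \<in> null_sets lborel"
    then show "A \<in> null_sets (interval_measure (F p))"
      using le[of A p] by (auto simp: null_sets_def)
  qed
  then have "\<exists>f\<in>borel_measurable lborel. density lborel f = interval_measure (F p)" for p
    by (intro sigma_finite_measure.Radon_Nikodym[OF lborel.sigma_finite_measure_axioms]) auto
  then obtain f where f: "\<And>p. f p \<in> borel_measurable lborel"
    and df: "\<And>p. density lborel (f p) = interval_measure (F p)" by metis
  have fb[measurable]: "f p \<in> borel_measurable borel" for p using f[of p] by simp
  have ef: "(\<integral>\<^sup>+u. f p u * indicator A u \<partial>lborel) = emeasure (interval_measure (F p)) A" if "A \<in> sets borel" for p A
    using that by (simp add: emeasure_density flip: df)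
  have "density lborel (\<lambda>u. \<Sum>p\<in>UNIV. f p u) = density lborel (\<lambda>u. 1)"
  proof (rule measure_eqI)
    fix A assume "A \<in> sets (density lborel (\<lambda>u. \<Sum>p\<in>UNIV. f p u))"
    then have A[measurable]: "A \<in> sets borel" by simp
    have "emeasure (density lborel (\<lambda>u. \<Sum>p\<in>UNIV. f p u)) A = (\<Sum>p\<in>UNIV. \<integral>\<^sup>+u. f p u * indicator A u \<partial>lborel)"
    proof -
      have "emeasure (density lborel (\<lambda>u. \<Sum>p\<in>UNIV. f p u)) A = (\<integral>\<^sup>+u. (\<Sum>p\<in>UNIV. f p u * indicator A u) \<partial>lborel)"
        by (subst emeasure_density) (auto simp: sum_distrib_right)
      also have "\<dots> = (\<Sum>p\<in>UNIV. \<integral>\<^sup>+u. f p u * indicator A u \<partial>lborel)"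
        by (rule nn_integral_sum) auto
      finally show ?thesis .
    qed
    then show "emeasure (density lborel (\<lambda>u. \<Sum>p\<in>UNIV. f p u)) A = emeasure (density lborel (\<lambda>u. 1)) A"
      using tot[OF A] by (simp add: ef[OF A] emeasure_density)
  qed simp
  then have one: "AE u in lborel. (\<Sum>p\<in>UNIV. f p u) = 1"
    by (intro sigma_finite_measure.density_unique[OF lborel.sigma_finite_measure_axioms]) auto
  \<comment> \<open>On the null set where the densities fail to add up to 1, the uniform vector
    keeps every value in the simplex.\<close>
  define \<zeta> where "\<zeta> = (\<lambda>u. (\<chi> p. if (\<Sum>p\<in>UNIV. f p u) = 1 then enn2real (f p u) else 1 / d))"
  have simp: "\<zeta> u \<in> prob_simplex" for u
  proof (cases "(\<Sum>p\<in>UNIV. f p u) = 1")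
    case True
    have "f p u \<le> (\<Sum>p\<in>UNIV. f p u)" for p by (rule member_le_sum[of p UNIV "\<lambda>p. f p u"]) auto
    then have fin: "f p u < \<top>" for p using True by (metis le_less_trans ennreal_one_less_top)
    have "(\<Sum>p\<in>UNIV. enn2real (f p u)) = enn2real (\<Sum>p\<in>UNIV. f p u)"
      by (subst enn2real_sum) (auto simp: fin)
    then show ?thesis using True by (simp add: prob_simplex_def \<zeta>_def)
  next
    case False
    then show ?thesis using d by (simp add: prob_simplex_def \<zeta>_def d_def)
  qed
  have meas: "\<zeta> \<in> borel_measurable borel"
    unfolding \<zeta>_def by (rule borel_measurable_vec_lambda) measurable
  have sp: "simplex_path \<zeta>" using simp meas by (simp add: simplex_path_def)
  have "cumulative \<zeta> u $ p = N u p" if u: "0 \<le> u" "u \<le> 1" for u p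
  proof -
    have "ennreal (cumulative \<zeta> u $ p) = (\<integral>\<^sup>+v. ennreal (indicator {0<..u} v *\<^sub>R \<zeta> v $ p) \<partial>lborel)"
      unfolding cumulative_def set_lebesgue_integral_def vec_lambda_beta
      by (rule nn_integral_eq_integral[symmetric])
         (use simplex_path_integrable[OF sp, of "{0<..u}" p] simplex_pathD(3)[OF sp] in
           \<open>auto simp: set_integrable_def\<close>)
    also have "\<dots> = (\<integral>\<^sup>+v. f p v * indicator {0<..u} v \<partial>lborel)"
    proof (rule nn_integral_cong_AE, use one in eventually_elim)
      fix v assume *: "(\<Sum>p\<in>UNIV. f p v) = 1"
      have "f p v \<le> (\<Sum>p\<in>UNIV. f p v)" by (rule member_le_sum[of p UNIV "\<lambda>p. f p v"]) auto
      then have "f p v < \<top>" using * by (metis le_less_trans ennreal_one_less_top)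
      then show "ennreal (indicat_real {0<..u} v *\<^sub>R \<zeta> v $ p) = f p v * indicator {0<..u} v"
        using * by (auto simp: indicator_def \<zeta>_def)
    qed
    also have "\<dots> = ennreal (F p u - F p 0)"
      using u Fmono Frc by (subst ef) (auto simp: emeasure_interval_measure_Ioc)
    also have "F p u - F p 0 = N u p" using u by (simp add: F_def N0)
    finally show ?thesis
      using cumulative_nonneg[OF sp u(1), of p] mono[of 0 u p] u N0[of p] by (simp add: ennreal_inj)
  qed
  then show thesis using that sp by blast
qed

text \<open>Equal tail integrals make the two densities define measures that agree on half-lines,
  and densities are unique almost everywhere.\<close>

lemma AE_eq_of_integral_Ioc_eq:
  fixes a b :: "real \<Rightarrow> real"
  assumes [measurable]: "a \<in> borel_measurable borel" "b \<in> borel_measurable borel"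
    and a: "\<And>u. 0 \<le> a u" "\<And>u. a u \<le> 1" and b: "\<And>u. 0 \<le> b u" "\<And>u. b u \<le> 1"
    and eq: "\<And>u. 0 \<le> u \<Longrightarrow> u \<le> 1 \<Longrightarrow> (LINT v:{u<..1}|lborel. a v) = (LINT v:{u<..1}|lborel. b v)"
  shows "AE u\<in>{0<..1} in lborel. a u = b u"
proof -
  have E: "emeasure (density lborel (\<lambda>u. ennreal (c u * indicator {0<..1} u))) {x<..}
      = ennreal (LINT v:{max 0 (min 1 x)<..1}|lborel. c v)"
    if c: "\<And>u. 0 \<le> c u" "\<And>u. c u \<le> 1" and [measurable]: "c \<in> borel_measurable borel" for c :: "real \<Rightarrow> real" and x
  proof -
    have "emeasure (density lborel (\<lambda>u. ennreal (c u * indicator {0<..1} u))) {x<..}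
      = (\<integral>\<^sup>+u. ennreal (indicator {max 0 (min 1 x)<..1} u *\<^sub>R c u) \<partial>lborel)"
      by (subst emeasure_density) (auto simp: indicator_def intro!: nn_integral_cong)
    also have "\<dots> = ennreal (LINT v:{max 0 (min 1 x)<..1}|lborel. c v)"
      unfolding set_lebesgue_integral_def
    proof (rule nn_integral_eq_integral)
      have "set_integrable lborel {max 0 (min 1 x)<..1} c"
        by (rule bounded_set_integrable[where B=1]) (use c in auto)
      then show "integrable lborel (\<lambda>u. indicat_real {max 0 (min 1 x)<..1} u *\<^sub>R c u)"
        by (simp add: set_integrable_def)
    qed (use c in auto)
    finally show ?thesis .
  qed
  have "density lborel (\<lambda>u. ennreal (a u * indicator {0<..1} u)) = density lborel (\<lambda>u. ennreal (b u * indicator {0<..1} u))"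
    by (rule measure_eqI_lessThan) (auto simp: E a b eq)
  then have "AE u in lborel. ennreal (a u * indicator {0<..1} u) = ennreal (b u * indicator {0<..1} u)"
    by (intro sigma_finite_measure.density_unique[OF lborel.sigma_finite_measure_axioms]) auto
  then show ?thesis
    by eventually_elim (use a b in \<open>auto simp: indicator_def\<close>)
qed

section \<open>The Aldous-Flannery-Palacios kernel\<close>

locale afp_chain =
  fixes P :: "real ^ 's option ^ 's::finite option"
  assumes kernel: "transition_kernel P"
    and irreducible: "irreducible_matrix (interior_part P)"
begin

abbreviation "Po x y \<equiv> P $ Some x $ Some y"
abbreviation "Pz x \<equiv> P $ Some x $ None"
abbreviation "G \<equiv> afp_kernel P"

lemma G_nth: "G m $ x $ y = Po x y + Pz x * m $ y"
  by (simp add: afp_kernel_def)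

lemma P_bounds: "0 \<le> P $ i $ j" "P $ i $ j \<le> 1"
  using kernel prob_simplexD[of "P $ i"] by (auto simp: transition_kernel_def)

lemma Po_sum: "(\<Sum>y\<in>UNIV. Po x y) + Pz x = 1"
proof -
  have "(\<Sum>j\<in>UNIV. P $ Some x $ j) = 1"
    using kernel prob_simplexD(2)[of "P $ Some x"] by (auto simp: transition_kernel_def)
  then show ?thesis
    by (simp add: UNIV_option_conv sum.reindex inj_on_def)
qed

lemma kernel_G:
  assumes m: "m \<in> prob_simplex"
  shows "transition_kernel (G m)"
  unfolding transition_kernel_def
proof
  fix x
  have "(\<Sum>y\<in>UNIV. G m $ x $ y) = (\<Sum>y\<in>UNIV. Po x y) + Pz x * (\<Sum>y\<in>UNIV. m $ y)"
    by (simp add: G_nth sum.distrib sum_distrib_left)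
  then show "G m $ x \<in> prob_simplex"
    using m by (simp add: prob_simplex_def G_nth P_bounds Po_sum)
qed

lemma adj_support_iff: "(x, y) \<in> adj_support (afp_adjacency P) \<longleftrightarrow> 0 < Po x y + Pz x"
  by (simp add: adj_support_def afp_adjacency_def)

text \<open>The kernel vanishes there for every \<open>m\<close>, so a path of finite cost satisfies
  the support condition on controls almost everywhere.\<close>

lemma G_off_support:
  assumes "(x, y) \<notin> adj_support (afp_adjacency P)"
  shows "G m $ x $ y = 0"
proof -
  have "Po x y + Pz x \<le> 0" using assms by (simp add: adj_support_iff)
  then have "Po x y = 0" "Pz x = 0"
    using P_bounds(1)[of "Some x" "Some y"] P_bounds(1)[of "Some x" None] by linarith+
  then show ?thesis by (simp add: G_nth)
qed

text \<open>The indicator is part of the claim because the explicit formula for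
  \<open>step_cost\<close> requires the average to lie in the simplex, which is meaningless for
  \<open>u \<le> 0\<close>.\<close>

lemma step_cost_measurable:
  fixes \<zeta> :: "real \<Rightarrow> real ^ ('s \<times> 's)"
  assumes \<zeta>: "simplex_path \<zeta>"
  shows "(\<lambda>u. step_cost G (\<zeta> u) ((1 / u) *\<^sub>R marginal1 (cumulative \<zeta> u)) * indicator {0<..1} u) \<in> borel_measurable borel"
proof -
  have [measurable]: "\<zeta> \<in> borel_measurable borel" by (rule simplex_pathD(1)[OF \<zeta>])
  have [measurable]: "cumulative \<zeta> \<in> borel_measurable borel" by (rule borel_measurable_cumulative[OF \<zeta>])
  let ?m = "\<lambda>u. (1 / u) *\<^sub>R marginal1 (cumulative \<zeta> u)"
  let ?f = "\<lambda>u. (if \<forall>x y. G (?m u) $ x $ y = 0 \<longrightarrow> \<zeta> u $ (x, y) = 0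
    then ennreal (pair_entropy (\<zeta> u) (\<lambda>x y. G (?m u) $ x $ y)) else \<infinity>) * indicator {0<..1} u"
  have "?f \<in> borel_measurable borel"
    unfolding pair_entropy_def G_nth vector_scaleR_component marginal_nth by measurable
  also have "?f = (\<lambda>u. step_cost G (\<zeta> u) (?m u) * indicator {0<..1} u)"
  proof
    fix u :: real
    show "?f u = step_cost G (\<zeta> u) (?m u) * indicator {0<..1} u"
    proof (cases "u \<in> {0<..1}")
      case True
      then have "transition_kernel (G (?m u))"
        by (intro kernel_G average_marginal_simplex[OF \<zeta>]) auto
      then show ?thesis using step_cost_eq[OF simplex_pathD(2)[OF \<zeta>], of G "?m u" u] by simp
    qed simp
  qed
  finally show ?thesis .
qed

end

section \<open>Smoothed conditional laws\<close>

definition smoothed_conditional :: "real \<Rightarrow> real ^ ('s::finite \<times> 's) \<Rightarrow> 's \<Rightarrow> 's \<Rightarrow> real" where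
  "smoothed_conditional \<epsilon> v x y = (v $ (x, y) + \<epsilon>) / (\<Sum>z\<in>UNIV. v $ (x, z) + \<epsilon>)"

text \<open>Adding \<open>\<epsilon>\<close> before normalising gives a kernel that is continuous in
  \<open>v\<close> even where a row vanishes, and bounded below: the numerator is at least
  \<open>\<epsilon>\<close> and the denominator at most \<open>CARD('s) * (1 + \<epsilon>)\<close>.
  This bounds all logarithms uniformly.\<close>

lemma smoothed_conditional_props:
  fixes v :: "real ^ ('s::finite \<times> 's)" and \<epsilon> :: real
  assumes \<epsilon>: "0 < \<epsilon>" and v: "\<And>p. 0 \<le> v $ p" "\<And>p. v $ p \<le> 1"
  shows "0 < smoothed_conditional \<epsilon> v x y" "smoothed_conditional \<epsilon> v x y \<le> 1"
    "\<epsilon> / (CARD('s) * (1 + \<epsilon>)) \<le> smoothed_conditional \<epsilon> v x y"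
    "(\<Sum>y\<in>UNIV. smoothed_conditional \<epsilon> v x y) = 1"
    "0 < (\<Sum>z\<in>UNIV. v $ (x, z) + \<epsilon>)"
proof -
  let ?S = "\<Sum>z\<in>UNIV. v $ (x, z) + \<epsilon>"
  have le: "v $ (x, y) + \<epsilon> \<le> ?S" for y
    using v \<epsilon> by (intro member_le_sum[of y UNIV "\<lambda>z. v $ (x, z) + \<epsilon>"]) auto
  have pos: "0 < v $ (x, y) + \<epsilon>" for y using v \<epsilon> by (simp add: add_nonneg_pos)
  show S: "0 < ?S" using le[of y] pos[of y] by linarith
  show "0 < smoothed_conditional \<epsilon> v x y" "smoothed_conditional \<epsilon> v x y \<le> 1"
    using S pos le by (auto simp: smoothed_conditional_def)
  have "?S \<le> (\<Sum>z\<in>(UNIV :: 's set). 1 + \<epsilon>)" by (intro sum_mono) (simp add: v)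
  then have S2: "?S \<le> CARD('s) * (1 + \<epsilon>)" by simp
  show "\<epsilon> / (CARD('s) * (1 + \<epsilon>)) \<le> smoothed_conditional \<epsilon> v x y"
    unfolding smoothed_conditional_def using S S2 v \<epsilon> by (intro frac_le) auto
  show "(\<Sum>y\<in>UNIV. smoothed_conditional \<epsilon> v x y) = 1"
    unfolding smoothed_conditional_def sum_divide_distrib[symmetric] using S by simp
qed

lemma set_integral_Ioc_blocks:
  fixes f :: "real \<Rightarrow> real"
  assumes f: "set_integrable lborel {0<..1} f" and K: "0 < K"
  shows "(LINT u:{0<..1}|lborel. f u) = (\<Sum>b<K. LINT u:{real b / K<..real (Suc b) / K}|lborel. f u)"
proof -
  have "(LINT u:{0<..real j / K}|lborel. f u) = (\<Sum>b<j. LINT u:{real b / K<..real (Suc b) / K}|lborel. f u)"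
    if "j \<le> K" for j
    using that
  proof (induction j)
    case (Suc j)
    have le: "real j / K \<le> real (Suc j) / K" "real (Suc j) / K \<le> 1" "0 \<le> real j / K"
      using Suc.prems K by (auto simp: divide_right_mono)
    have un: "{0<..real (Suc j) / K} = {0<..real j / K} \<union> {real j / K<..real (Suc j) / K}"
      using le le_less_trans[OF le(3)] order_trans[OF _ le(1)] by auto
    have "(LINT u:{0<..real (Suc j) / K}|lborel. f u)
      = (LINT u:{0<..real j / K}|lborel. f u) + (LINT u:{real j / K<..real (Suc j) / K}|lborel. f u)"
    proof -
      have "{0<..real j / K} \<subseteq> {0<..1}" "{real j / K<..real (Suc j) / K} \<subseteq> {0<..1}"
        unfolding subset_iff greaterThanAtMost_iff using le by linarith+
      then show ?thesis unfolding un
        by (intro set_integral_Un set_integrable_subset[OF f]) auto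
    qed
    then show ?case using Suc by simp
  qed (simp add: set_lebesgue_integral_def)
  from this[of K] show ?thesis using K by simp
qed

lemma set_integral_pair_sum:
  fixes \<zeta> :: "real \<Rightarrow> real ^ ('s::finite \<times> 's)"
  assumes \<zeta>: "simplex_path \<zeta>" and A: "A \<in> sets borel" "bounded A"
  shows "(LINT u:A|lborel. \<Sum>x\<in>UNIV. \<Sum>y\<in>UNIV. \<zeta> u $ (x, y) * c x y)
    = (\<Sum>x\<in>UNIV. \<Sum>y\<in>UNIV. (LINT u:A|lborel. \<zeta> u $ (x, y)) * c x y)"
proof -
  have i: "integrable lborel (\<lambda>u. (indicat_real A u * \<zeta> u $ (x, y)) * c x y)" for x y
    using simplex_path_integrable[OF \<zeta> A, of "(x, y)"]
    by (intro integrable_mult_left) (simp add: set_integrable_def)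
  have "(LINT u:A|lborel. \<Sum>x\<in>UNIV. \<Sum>y\<in>UNIV. \<zeta> u $ (x, y) * c x y)
    = (\<integral>u. (\<Sum>x\<in>UNIV. \<Sum>y\<in>UNIV. (indicat_real A u * \<zeta> u $ (x, y)) * c x y) \<partial>lborel)"
    unfolding set_lebesgue_integral_def
    by (intro Bochner_Integration.integral_cong) (simp_all only: real_scaleR_def sum_distrib_left mult.assoc)
  also have "\<dots> = (\<Sum>x\<in>UNIV. \<Sum>y\<in>UNIV. \<integral>u. (indicat_real A u * \<zeta> u $ (x, y)) * c x y \<partial>lborel)"
    by (simp only: Bochner_Integration.integral_sum Bochner_Integration.integrable_sum i)
  also have "\<dots> = (\<Sum>x\<in>UNIV. \<Sum>y\<in>UNIV. (LINT u:A|lborel. \<zeta> u $ (x, y)) * c x y)"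
    unfolding set_lebesgue_integral_def real_scaleR_def by (simp only: integral_mult_left_zero)
  finally show ?thesis .
qed

section \<open>Recovering the cost from block sums\<close>

context afp_chain
begin

text \<open>The exponential rates of the change of measure to block kernels \<open>q\<close>, in \<open>K\<close> equal blocks.
  The first block is left out, because the empirical measure is not controlled there.\<close>

definition block_sum :: "nat \<Rightarrow> real \<Rightarrow> (nat \<Rightarrow> 's \<Rightarrow> 's \<Rightarrow> real) \<Rightarrow> (real \<Rightarrow> real ^ ('s \<times> 's)) \<Rightarrow>
    (real \<Rightarrow> real ^ ('s \<times> 's)) \<Rightarrow> real" where
  "block_sum K \<delta> q N L = (\<Sum>b=1..<K. \<Sum>x\<in>UNIV. \<Sum>y\<in>UNIV.
     (N (real (Suc b) / K) $ (x, y) - N (real b / K) $ (x, y)) *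
     ln (q b x y / (G ((real K / real b) *\<^sub>R marginal1 (L (real (Suc b) / K))) $ x $ y + \<delta>)))"

definition stochastic_pos :: "(nat \<Rightarrow> 's \<Rightarrow> 's \<Rightarrow> real) \<Rightarrow> bool" where
  "stochastic_pos q \<longleftrightarrow> (\<forall>b x y. 0 < q b x y) \<and> (\<forall>b x. (\<Sum>y\<in>UNIV. q b x y) = 1)"

lemma ln_ratio_bound:
  fixes c q g \<delta> C :: real
  assumes "0 < c" "c \<le> q" "q \<le> 1" "0 < \<delta>" "\<delta> \<le> g" "g \<le> C"
  shows "\<bar>ln (q / g)\<bar> \<le> - ln c + \<bar>ln \<delta>\<bar> + \<bar>ln C\<bar>"
proof -
  have "ln (q / g) = ln q - ln g" using assms by (simp add: ln_div)
  moreover have "ln c \<le> ln q" "ln q \<le> 0" "ln \<delta> \<le> ln g" "ln g \<le> ln C" using assms by auto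
  ultimately show ?thesis by linarith
qed

lemma abs_pair_sum_le:
  fixes \<nu> :: "real ^ ('s \<times> 's)"
  assumes \<nu>: "\<nu> \<in> prob_simplex" and B: "\<And>x y. \<bar>l x y\<bar> \<le> B"
  shows "\<bar>\<Sum>x\<in>UNIV. \<Sum>y\<in>UNIV. \<nu> $ (x, y) * l x y\<bar> \<le> B"
proof -
  have "\<bar>\<Sum>x\<in>UNIV. \<Sum>y\<in>UNIV. \<nu> $ (x, y) * l x y\<bar> \<le> (\<Sum>x\<in>UNIV. \<Sum>y\<in>UNIV. \<bar>\<nu> $ (x, y) * l x y\<bar>)"
    by (intro order_trans[OF sum_abs] sum_mono sum_abs)
  also have "\<dots> \<le> (\<Sum>x\<in>UNIV. \<Sum>y\<in>UNIV. \<nu> $ (x, y) * B)"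
    using prob_simplexD(1)[OF \<nu>] B by (intro sum_mono) (auto simp: abs_mult intro!: mult_left_mono)
  also have "\<dots> = (\<Sum>p\<in>UNIV. \<nu> $ p) * B" by (simp add: sum_pairs sum_distrib_right)
  finally show ?thesis using prob_simplexD(2)[OF \<nu>] by simp
qed

text \<open>With \<open>K = Suc n\<close> and \<open>q b\<close> the smoothed conditional of
  \<open>g\<close> at \<open>b / K\<close>, the block sum is the integral of a step function. It
  approximates the integrand with \<open>u\<close> rounded down in the kernel and in the factor
  \<open>1 / u\<close>, and rounded up in the cumulative path. Refining the mesh, dominated
  convergence gives the integral.\<close>

lemma integral_continuous_kernel_le:
  fixes \<zeta> g :: "real \<Rightarrow> real ^ ('s \<times> 's)"
  assumes \<zeta>: "simplex_path \<zeta>"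
    and H: "\<And>K q. 0 < K \<Longrightarrow> stochastic_pos q \<Longrightarrow> block_sum K \<delta> q (cumulative \<zeta>) (cumulative \<zeta>) \<le> a"
    and \<delta>: "0 < \<delta>" and \<epsilon>: "0 < \<epsilon>"
    and g: "continuous_on UNIV g" "\<And>u p. 0 \<le> g u $ p" "\<And>u p. g u $ p \<le> 1"
  shows "(LINT u:{0<..1}|lborel. \<Sum>x\<in>UNIV. \<Sum>y\<in>UNIV. \<zeta> u $ (x, y) *
      ln (smoothed_conditional \<epsilon> (g u) x y / (G ((1 / u) *\<^sub>R marginal1 (cumulative \<zeta> u)) $ x $ y + \<delta>))) \<le> a"
proof -
  let ?N = "cumulative \<zeta>"
  define c where "c = \<epsilon> / (CARD('s) * (1 + \<epsilon>))"
  \<comment> \<open>In \<open>3 + \<delta>\<close>, the entry of \<open>P\<^sup>o\<close>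
    contributes at most 1 and the averaged part at most 2, since \<open>w \<le> 2 * v\<close>
    outside the first block.\<close>
  define B where "B = - ln c + \<bar>ln \<delta>\<bar> + \<bar>ln (3 + \<delta>)\<bar>"
  have c: "0 < c" using \<epsilon> by (simp add: c_def)
  note sc = smoothed_conditional_props[OF \<epsilon> g(2,3)]
  define l where "l = (\<lambda>v w x y. ln (smoothed_conditional \<epsilon> (g v) x y / (G ((1 / v) *\<^sub>R marginal1 (?N w)) $ x $ y + \<delta>)))"
  have lB: "\<bar>l v w x y\<bar> \<le> B" if "0 < v" "0 \<le> w" "w \<le> 2 * v" for v w x y
  proof -
    have N: "0 \<le> marginal1 (?N w) $ y" "marginal1 (?N w) $ y \<le> w"
      using cumulative_nonneg[OF simplex_path_marginal1[OF \<zeta>] that(2), of y]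
        cumulative_le[OF simplex_path_marginal1[OF \<zeta>] that(2), of y] by (auto simp: cumulative_marginal1[OF \<zeta>])
    have r: "marginal1 (?N w) $ y / v \<le> 2" "0 \<le> marginal1 (?N w) $ y / v"
      using N that by (auto simp: divide_le_eq)
    have "Pz x * (marginal1 (?N w) $ y / v) \<le> 1 * 2"
      by (rule mult_mono) (use r P_bounds in auto)
    moreover have "0 \<le> Pz x * (marginal1 (?N w) $ y / v)"
      by (rule mult_nonneg_nonneg[OF P_bounds(1) r(2)])
    ultimately have "\<delta> \<le> G ((1 / v) *\<^sub>R marginal1 (?N w)) $ x $ y + \<delta>" "G ((1 / v) *\<^sub>R marginal1 (?N w)) $ x $ y + \<delta> \<le> 3 + \<delta>"
      using P_bounds[of "Some x" "Some y"] by (simp_all add: G_nth)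
    then show ?thesis unfolding l_def B_def c_def
      using sc(2,3) c \<delta> by (intro ln_ratio_bound) (auto simp: c_def)
  qed
  have B0: "0 \<le> B" using lB[of 1 0 undefined undefined] by linarith
  \<comment> \<open>\<open>v n u\<close> and \<open>w n u\<close> are the end points of the block
    containing \<open>u\<close>; the ceiling fits blocks that are open on the left.\<close>
  define v where "v = (\<lambda>n u. (real_of_int \<lceil>real (Suc n) * u\<rceil> - 1) / real (Suc n))"
  define w where "w = (\<lambda>n u. real_of_int \<lceil>real (Suc n) * u\<rceil> / real (Suc n))"
  have vw: "u - 1 / real (Suc n) \<le> v n u" "v n u \<le> u" "u \<le> w n u" "w n u \<le> u + 1 / real (Suc n)" for n u
  proof -
    have "real (Suc n) * u \<le> \<lceil>real (Suc n) * u\<rceil>" "\<lceil>real (Suc n) * u\<rceil> < real (Suc n) * u + 1" by linarith+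
    then show "u - 1 / real (Suc n) \<le> v n u" "v n u \<le> u" "u \<le> w n u" "w n u \<le> u + 1 / real (Suc n)"
      unfolding v_def w_def by (simp_all add: field_simps del: of_nat_Suc)
  qed
  have vw2: "w n u \<le> 2 * v n u" if "0 < v n u" for n u
  proof -
    define z where "z = \<lceil>real (Suc n) * u\<rceil>"
    have "1 < z" unfolding z_def less_ceiling_iff using that by (simp add: v_def zero_less_divide_iff)
    then have "2 \<le> real_of_int z" by simp
    then have "real_of_int z \<le> 2 * (real_of_int z - 1)" by simp
    then have "real_of_int z / real (Suc n) \<le> 2 * (real_of_int z - 1) / real (Suc n)"
      by (rule divide_right_mono) simp
    then show ?thesis unfolding v_def w_def z_def by simp
  qed
  \<comment> \<open>For \<open>u\<close> in (0, 1] the left end point is 0 exactly in the first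
    block, which \<open>block_sum\<close> leaves out.\<close>
  define L where "L = (\<lambda>n u x y. if 0 < v n u then l (v n u) (w n u) x y else 0)"
  define s where "s = (\<lambda>n u. indicat_real {0<..1} u *\<^sub>R (\<Sum>x\<in>UNIV. \<Sum>y\<in>UNIV. \<zeta> u $ (x, y) * L n u x y))"
  have LB: "\<bar>L n u x y\<bar> \<le> B" if "u \<in> {0<..1}" for n u x y
    using lB[of "v n u" "w n u" x y] vw2[of n u] vw(3)[of u n] that B0 by (auto simp: L_def)
  have meas1: "\<zeta> \<in> borel_measurable borel" by (rule simplex_pathD(1)[OF \<zeta>])
  have meas2: "?N \<in> borel_measurable borel" by (rule borel_measurable_cumulative[OF \<zeta>])
  have meas3: "g \<in> borel_measurable borel" by (rule borel_measurable_continuous_onI[OF g(1)])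
  note [measurable] = meas1 meas2 meas3
  have [measurable]: "v n \<in> borel_measurable borel" "w n \<in> borel_measurable borel" for n
    unfolding v_def w_def by measurable
  have L_meas[measurable]: "(\<lambda>u. L n u x y) \<in> borel_measurable borel" for n x y
    unfolding L_def l_def smoothed_conditional_def G_nth vector_scaleR_component marginal_nth by measurable
  have s_meas: "s n \<in> borel_measurable lborel" for n
    unfolding s_def by measurable
  have sB: "norm (s n u) \<le> B * indicator {0<..1} u" for n u
  proof (cases "u \<in> {0<..1}")
    case True
    then show ?thesis
      using abs_pair_sum_le[OF simplex_pathD(2)[OF \<zeta>, of u], of "L n u" B] LB by (simp add: s_def)
  qed (simp add: s_def)
  have dom: "integrable lborel (\<lambda>u::real. B * indicator {0<..1} u)" by auto
  let ?f = "\<lambda>u. indicat_real {0<..1} u *\<^sub>R (\<Sum>x\<in>UNIV. \<Sum>y\<in>UNIV. \<zeta> u $ (x, y) * l u u x y)"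
  have f_meas: "?f \<in> borel_measurable lborel"
    unfolding l_def smoothed_conditional_def G_nth vector_scaleR_component marginal_nth by measurable
  have lim: "(\<lambda>n. s n u) \<longlonglongrightarrow> ?f u" for u
  proof (cases "u \<in> {0<..1}")
    case True
    have inv: "(\<lambda>n. 1 / real (Suc n)) \<longlonglongrightarrow> 0" using LIMSEQ_inverse_real_of_nat by (simp add: inverse_eq_divide)
    have v: "(\<lambda>n. v n u) \<longlonglongrightarrow> u"
      by (rule tendsto_sandwich[where f="\<lambda>n. u - 1 / real (Suc n)" and h="\<lambda>n. u"])
         (use vw inv tendsto_diff[OF tendsto_const inv, of u] in auto)
    have w: "(\<lambda>n. w n u) \<longlonglongrightarrow> u"
      by (rule tendsto_sandwich[where f="\<lambda>n. u" and h="\<lambda>n. u + 1 / real (Suc n)"])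
         (use vw inv tendsto_add[OF tendsto_const inv, of u] in auto)
    have vpos: "eventually (\<lambda>n. 0 < v n u) sequentially"
      using True by (intro order_tendstoD(1)[OF v]) auto
    have gv: "(\<lambda>n. g (v n u)) \<longlonglongrightarrow> g u"
      using continuous_on_tendsto_compose[OF g(1) v] by simp
    have Nw: "(\<lambda>n. ?N (w n u)) \<longlonglongrightarrow> ?N u"
    proof (rule continuous_on_tendsto_compose[OF cumulative_continuous[OF \<zeta>] w])
      show "eventually (\<lambda>n. w n u \<in> {0..}) sequentially"
        using True vw(3)[of u] by (intro always_eventually allI) (simp add: order_trans[of 0 u])
    qed (use True in auto)
    have "(\<lambda>n. l (v n u) (w n u) x y) \<longlonglongrightarrow> l u u x y" for x y
    proof -
      have num: "(\<lambda>n. smoothed_conditional \<epsilon> (g (v n u)) x y) \<longlonglongrightarrow> smoothed_conditional \<epsilon> (g u) x y"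
        unfolding smoothed_conditional_def
        using sc(5)[of u x] by (intro tendsto_intros gv) auto
      have den: "(\<lambda>n. G ((1 / v n u) *\<^sub>R marginal1 (?N (w n u))) $ x $ y + \<delta>)
          \<longlonglongrightarrow> G ((1 / u) *\<^sub>R marginal1 (?N u)) $ x $ y + \<delta>"
        unfolding G_nth vector_scaleR_component marginal_nth real_scaleR_def
        using True by (intro tendsto_intros v Nw) auto
      have "0 \<le> marginal1 (?N u) $ y"
        using cumulative_nonneg[OF simplex_path_marginal1[OF \<zeta>], of u y] True by (auto simp: cumulative_marginal1[OF \<zeta>])
      then have pos: "0 < G ((1 / u) *\<^sub>R marginal1 (?N u)) $ x $ y + \<delta>"
        using True \<delta> P_bounds by (auto simp: G_nth intro!: add_nonneg_pos add_nonneg_nonneg)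
      show ?thesis unfolding l_def
        using sc(1)[of u x y] pos by (intro tendsto_ln tendsto_divide num den) auto
    qed
    then have LL: "(\<lambda>n. L n u x y) \<longlonglongrightarrow> l u u x y" for x y
      by (rule Lim_transform_eventually) (use vpos in \<open>auto simp: L_def elim!: eventually_mono\<close>)
    show ?thesis unfolding s_def by (intro tendsto_intros LL)
  qed (simp add: s_def)
  have conv: "(\<lambda>n. integral\<^sup>L lborel (s n)) \<longlonglongrightarrow> integral\<^sup>L lborel ?f"
    by (rule integral_dominated_convergence[where w="\<lambda>u. B * indicator {0<..1} u"])
       (use s_meas f_meas dom lim sB in auto)
  have "integral\<^sup>L lborel (s n) \<le> a" for n
  proof -
    let ?K = "Suc n"
    let ?q = "\<lambda>b. smoothed_conditional \<epsilon> (g (real b / ?K))"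
    have sp: "stochastic_pos ?q" unfolding stochastic_pos_def using sc by auto
    have int: "set_integrable lborel {0<..1} (\<lambda>u. \<Sum>x\<in>UNIV. \<Sum>y\<in>UNIV. \<zeta> u $ (x, y) * L n u x y)"
      by (rule bounded_set_integrable[where B=B])
         (use abs_pair_sum_le[OF simplex_pathD(2)[OF \<zeta>]] LB in auto)
    have block: "(LINT u:{real b / ?K<..real (Suc b) / ?K}|lborel. \<Sum>x\<in>UNIV. \<Sum>y\<in>UNIV. \<zeta> u $ (x, y) * L n u x y)
      = (if b = 0 then 0 else \<Sum>x\<in>UNIV. \<Sum>y\<in>UNIV. (?N (real (Suc b) / ?K) $ (x, y) - ?N (real b / ?K) $ (x, y)) *
         l (real b / ?K) (real (Suc b) / ?K) x y)" for b
    proof -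
      let ?A = "{real b / ?K<..real (Suc b) / ?K}"
      have vb: "v n u = real b / ?K" "w n u = real (Suc b) / ?K" if "u \<in> ?A" for u
      proof -
        have "real b < real ?K * u" "real ?K * u \<le> real (Suc b)" using that by (auto simp: field_simps)
        then have "\<lceil>real ?K * u\<rceil> = int (Suc b)" by (intro ceiling_unique) auto
        then show "v n u = real b / ?K" "w n u = real (Suc b) / ?K" by (auto simp: v_def w_def)
      qed
      let ?c = "\<lambda>x y. if b = 0 then 0 else l (real b / ?K) (real (Suc b) / ?K) x y"
      have Lc: "L n u x y = ?c x y" if "u \<in> ?A" for u x y
        unfolding L_def vb[OF that] by (simp del: of_nat_Suc)
      have "(LINT u:?A|lborel. \<Sum>x\<in>UNIV. \<Sum>y\<in>UNIV. \<zeta> u $ (x, y) * L n u x y)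
         = (LINT u:?A|lborel. \<Sum>x\<in>UNIV. \<Sum>y\<in>UNIV. \<zeta> u $ (x, y) * ?c x y)"
        by (rule set_lebesgue_integral_cong, simp, intro allI impI) (simp only: Lc)
      also have "\<dots> = (\<Sum>x\<in>UNIV. \<Sum>y\<in>UNIV. (LINT u:?A|lborel. \<zeta> u $ (x, y)) * ?c x y)"
        by (rule set_integral_pair_sum[OF \<zeta>]) (simp_all del: of_nat_Suc)
      also have "\<dots> = (\<Sum>x\<in>UNIV. \<Sum>y\<in>UNIV. (?N (real (Suc b) / ?K) $ (x, y) - ?N (real b / ?K) $ (x, y)) * ?c x y)"
        by (subst cumulative_diff[OF \<zeta>]) (auto simp: divide_right_mono)
      finally show ?thesis by simp
    qed
    have "integral\<^sup>L lborel (s n) = (LINT u:{0<..1}|lborel. \<Sum>x\<in>UNIV. \<Sum>y\<in>UNIV. \<zeta> u $ (x, y) * L n u x y)"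
      by (simp add: s_def set_lebesgue_integral_def)
    also have "\<dots> = (\<Sum>b<?K. LINT u:{real b / ?K<..real (Suc b) / ?K}|lborel. \<Sum>x\<in>UNIV. \<Sum>y\<in>UNIV. \<zeta> u $ (x, y) * L n u x y)"
      by (rule set_integral_Ioc_blocks[OF int]) simp
    also have "\<dots> = (\<Sum>b\<in>{1..<?K}. \<Sum>x\<in>UNIV. \<Sum>y\<in>UNIV. (?N (real (Suc b) / ?K) $ (x, y) - ?N (real b / ?K) $ (x, y)) *
         l (real b / ?K) (real (Suc b) / ?K) x y)"
      unfolding block by (intro sum.mono_neutral_cong_right) auto
    also have "\<dots> = block_sum ?K \<delta> ?q ?N ?N"
      unfolding block_sum_def l_def by (simp del: of_nat_Suc)
    also have "\<dots> \<le> a" by (rule H[OF _ sp]) simp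
    finally show ?thesis .
  qed
  then have "integral\<^sup>L lborel ?f \<le> a" by (intro LIMSEQ_le_const2[OF conv]) auto
  then show ?thesis by (simp add: set_lebesgue_integral_def l_def)
qed

text \<open>A measurable path is almost everywhere a limit of continuous functions, so the kernel
  may be built from \<open>\<zeta>\<close> itself. The logarithms are bounded in terms of
  \<open>\<epsilon>\<close> and \<open>\<delta>\<close> only, which justifies dominated
  convergence.\<close>

lemma integral_measurable_kernel_le:
  fixes \<zeta> :: "real \<Rightarrow> real ^ ('s \<times> 's)"
  assumes \<zeta>: "simplex_path \<zeta>"
    and H: "\<And>K q. 0 < K \<Longrightarrow> stochastic_pos q \<Longrightarrow> block_sum K \<delta> q (cumulative \<zeta>) (cumulative \<zeta>) \<le> a"
    and \<delta>: "0 < \<delta>" and \<epsilon>: "0 < \<epsilon>"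
  defines "f \<equiv> \<lambda>u. \<Sum>x\<in>UNIV. \<Sum>y\<in>UNIV. \<zeta> u $ (x, y) *
      ln (smoothed_conditional \<epsilon> (\<zeta> u) x y / (G ((1 / u) *\<^sub>R marginal1 (cumulative \<zeta> u)) $ x $ y + \<delta>))"
  shows "(LINT u:{0<..1}|lborel. f u) \<le> a" "set_integrable lborel {0<..1} f"
proof -
  let ?N = "cumulative \<zeta>"
  let ?G = "\<lambda>u x y. G ((1 / u) *\<^sub>R marginal1 (?N u)) $ x $ y + \<delta>"
  define c where "c = \<epsilon> / (CARD('s) * (1 + \<epsilon>))"
  define B where "B = - ln c + \<bar>ln \<delta>\<bar> + \<bar>ln (2 + \<delta>)\<bar>"
  have c: "0 < c" using \<epsilon> by (simp add: c_def)
  have Gpos: "\<delta> \<le> ?G u x y" "?G u x y \<le> 2 + \<delta>" if "u \<in> {0<..1}" for u x y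
  proof -
    have "(1 / u) *\<^sub>R marginal1 (?N u) \<in> prob_simplex" using that by (intro average_marginal_simplex[OF \<zeta>]) auto
    then have "G ((1 / u) *\<^sub>R marginal1 (?N u)) $ x \<in> prob_simplex"
      using kernel_G by (simp add: transition_kernel_def)
    then show "\<delta> \<le> ?G u x y" "?G u x y \<le> 2 + \<delta>"
      using prob_simplexD(1,3)[of "G ((1 / u) *\<^sub>R marginal1 (?N u)) $ x" y] by auto
  qed
  have bd: "\<bar>ln (smoothed_conditional \<epsilon> v x y / ?G u x y)\<bar> \<le> B"
    if "u \<in> {0<..1}" "\<And>p. 0 \<le> v $ p" "\<And>p. v $ p \<le> 1" for u v x y
    unfolding B_def
    using smoothed_conditional_props[OF \<epsilon> that(2,3)] Gpos[OF that(1)] c \<delta>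
    by (intro ln_ratio_bound) (auto simp: c_def)
  have "\<zeta> \<in> borel_measurable lebesgue"
    using simplex_pathD(1)[OF \<zeta>] by (simp add: measurable_completion)
  then have "\<zeta> measurable_on UNIV" by (simp add: measurable_on_iff_borel_measurable)
  then obtain Nul g0 where Nul: "negligible Nul" and g0: "\<And>n. continuous_on UNIV (g0 n)"
    and lim0: "\<And>u. u \<notin> Nul \<Longrightarrow> (\<lambda>n. g0 n u) \<longlonglongrightarrow> \<zeta> u"
    by (auto simp: measurable_on_def)
  have ae: "AE u in lborel. u \<notin> Nul"
    using Nul AE_not_in[of Nul lebesgue] by (simp add: negligible_iff_null_sets AE_completion_iff)
  \<comment> \<open>Clipping leaves the limit unchanged, since the coordinates of
    \<open>\<zeta>\<close> lie in [0, 1], and provides the bounds required of the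
    approximations.\<close>
  define g where "g = (\<lambda>n u. \<chi> p. max 0 (min 1 (g0 n u $ p)))"
  have g: "continuous_on UNIV (g n)" "0 \<le> g n u $ p" "g n u $ p \<le> 1" for n u p
    unfolding g_def by (auto intro!: continuous_on_vec_lambda continuous_intros g0)
  have lim: "(\<lambda>n. g n u) \<longlonglongrightarrow> \<zeta> u" if "u \<notin> Nul" for u
  proof (rule vec_tendstoI)
    fix p
    have "(\<lambda>n. max 0 (min 1 (g0 n u $ p))) \<longlonglongrightarrow> max 0 (min 1 (\<zeta> u $ p))"
      by (intro tendsto_intros lim0 that)
    then show "(\<lambda>n. g n u $ p) \<longlonglongrightarrow> \<zeta> u $ p"
      by (simp add: g_def simplex_pathD[OF \<zeta>])
  qed
  have meas1: "\<zeta> \<in> borel_measurable borel" by (rule simplex_pathD(1)[OF \<zeta>])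
  have meas2: "?N \<in> borel_measurable borel" by (rule borel_measurable_cumulative[OF \<zeta>])
  have meas3: "g n \<in> borel_measurable borel" for n by (rule borel_measurable_continuous_onI[OF g(1)])
  note [measurable] = meas1 meas2 meas3
  define s where "s = (\<lambda>n u. indicat_real {0<..1} u *\<^sub>R (\<Sum>x\<in>UNIV. \<Sum>y\<in>UNIV. \<zeta> u $ (x, y) *
      ln (smoothed_conditional \<epsilon> (g n u) x y / ?G u x y)))"
  let ?f = "\<lambda>u. indicat_real {0<..1} u *\<^sub>R f u"
  have s_meas: "s n \<in> borel_measurable lborel" for n
    unfolding s_def smoothed_conditional_def G_nth vector_scaleR_component marginal_nth by measurable
  have f_meas: "?f \<in> borel_measurable lborel"
    unfolding f_def smoothed_conditional_def G_nth vector_scaleR_component marginal_nth by measurable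
  have sB: "norm (s n u) \<le> B * indicator {0<..1} u" for n u
  proof (cases "u \<in> {0<..1}")
    case True
    then show ?thesis
      using abs_pair_sum_le[OF simplex_pathD(2)[OF \<zeta>, of u], OF bd[OF True g(2,3)]] by (simp add: s_def)
  qed (simp add: s_def)
  have fB: "norm (?f u) \<le> B * indicator {0<..1} u" for u
  proof (cases "u \<in> {0<..1}")
    case True
    then show ?thesis
      using abs_pair_sum_le[OF simplex_pathD(2)[OF \<zeta>, of u], OF bd[OF True simplex_pathD(3,4)[OF \<zeta>]]] by (simp add: f_def)
  qed simp
  have dom: "integrable lborel (\<lambda>u::real. B * indicator {0<..1} u)" by auto
  show "set_integrable lborel {0<..1} f"
    unfolding set_integrable_def
  proof (rule Bochner_Integration.integrable_bound[OF dom f_meas], rule AE_I2)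
    fix u show "norm (?f u) \<le> norm (B * indicat_real {0<..1} u)"
      unfolding real_norm_def[of "B * _"] by (rule order_trans[OF fB abs_ge_self])
  qed
  have conv: "(\<lambda>n. integral\<^sup>L lborel (s n)) \<longlonglongrightarrow> integral\<^sup>L lborel ?f"
  proof (rule integral_dominated_convergence[where w="\<lambda>u. B * indicator {0<..1} u"])
    show "AE u in lborel. (\<lambda>n. s n u) \<longlonglongrightarrow> ?f u"
      using ae
    proof eventually_elim
      fix u assume u: "u \<notin> Nul"
      show "(\<lambda>n. s n u) \<longlonglongrightarrow> ?f u"
      proof (cases "u \<in> {0<..1}")
        case True
        have sm: "(\<lambda>n. smoothed_conditional \<epsilon> (g n u) x y) \<longlonglongrightarrow> smoothed_conditional \<epsilon> (\<zeta> u) x y" for x y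
          unfolding smoothed_conditional_def
          using smoothed_conditional_props(5)[OF \<epsilon> simplex_pathD(3,4)[OF \<zeta>], of u x]
          by (intro tendsto_intros lim u) auto
        show ?thesis unfolding s_def f_def
          using Gpos(1)[OF True] \<delta> smoothed_conditional_props(1)[OF \<epsilon> simplex_pathD(3,4)[OF \<zeta>], of u]
          by (intro tendsto_intros sm) (auto simp: less_le_trans[OF \<delta>] neq_iff)
      qed (simp add: s_def)
    qed
  qed (use s_meas f_meas dom sB in auto)
  have "integral\<^sup>L lborel (s n) \<le> a" for n
    using integral_continuous_kernel_le[OF \<zeta> H \<delta> \<epsilon> g, of n]
    by (simp add: s_def set_lebesgue_integral_def)
  then have "integral\<^sup>L lborel ?f \<le> a" by (intro LIMSEQ_le_const2[OF conv]) auto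
  then show "(LINT u:{0<..1}|lborel. f u) \<le> a" by (simp add: set_lebesgue_integral_def)
qed

text \<open>Compare \<open>\<nu> $ (x, y)\<close> with the reference mass \<open>S * g\<close>,
  where \<open>S\<close> is the enlarged row sum. Replacing \<open>\<nu> $ (x, y)\<close> by
  \<open>\<nu> $ (x, y) + \<epsilon>\<close> inside the logarithm only increases it.\<close>

lemma smoothed_entropy_term:
  fixes \<nu> :: "real ^ ('s \<times> 's)" and \<epsilon> g :: real
  assumes \<nu>: "\<nu> \<in> prob_simplex" and \<epsilon>: "0 < \<epsilon>" and g: "0 < g"
  shows "\<nu> $ (x, y) - (marginal1 \<nu> $ x + CARD('s) * \<epsilon>) * g
    \<le> \<nu> $ (x, y) * ln (smoothed_conditional \<epsilon> \<nu> x y / g)"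
proof -
  let ?S = "marginal1 \<nu> $ x + CARD('s) * \<epsilon>"
  have S: "(\<Sum>z\<in>UNIV. \<nu> $ (x, z) + \<epsilon>) = ?S" by (simp add: marginal_nth sum.distrib)
  have S0: "0 < ?S"
    using smoothed_conditional_props(5)[OF \<epsilon> prob_simplexD(1,3)[OF \<nu>], of x] by (simp only: S)
  have n0: "0 \<le> \<nu> $ (x, y)" using \<nu> by (simp add: prob_simplexD)
  show ?thesis
  proof (cases "\<nu> $ (x, y) = 0")
    case True
    then show ?thesis using S0 g by simp
  next
    case False
    then have n: "0 < \<nu> $ (x, y)" using n0 by simp
    have "\<nu> $ (x, y) - ?S * g \<le> \<nu> $ (x, y) * ln (\<nu> $ (x, y) / (?S * g))"
      by (rule ln_ge_one_minus_inverse) (use n0 S0 g in auto)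
    also have "\<dots> \<le> \<nu> $ (x, y) * ln (smoothed_conditional \<epsilon> \<nu> x y / g)"
    proof (intro mult_left_mono n0 ln_mono)
      show "0 < \<nu> $ (x, y) / (?S * g)" using n S0 g by simp
      have "\<nu> $ (x, y) / (?S * g) \<le> (\<nu> $ (x, y) + \<epsilon>) / (?S * g)"
        using S0 g \<epsilon> by (intro divide_right_mono) auto
      then show "\<nu> $ (x, y) / (?S * g) \<le> smoothed_conditional \<epsilon> \<nu> x y / g"
        by (simp add: smoothed_conditional_def S)
    qed
    finally show ?thesis .
  qed
qed

text \<open>With d = CARD('s) this is (1 + d^2 \<epsilon>) (1 + d \<epsilon>) - 1, the excess over 1
  of the reference mass: the enlarged row sums add up to 1 + d^2 \<epsilon>, and each row of the
  raised kernel has mass 1 + d \<epsilon>.\<close>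

definition smoothing_error :: "real \<Rightarrow> real" where
  "smoothing_error \<epsilon> = real CARD('s) * \<epsilon> + (real CARD('s))\<^sup>2 * \<epsilon> + (real CARD('s)) ^ 3 * \<epsilon>\<^sup>2"

definition smoothed_entropy :: "real \<Rightarrow> real ^ ('s \<times> 's) \<Rightarrow> real ^ 's \<Rightarrow> real" where
  "smoothed_entropy \<epsilon> \<nu> m = (\<Sum>x\<in>UNIV. \<Sum>y\<in>UNIV. \<nu> $ (x, y) *
      ln (smoothed_conditional \<epsilon> \<nu> x y / (G m $ x $ y + \<epsilon>)))"

lemma smoothed_entropy_ge:
  assumes \<nu>: "\<nu> \<in> prob_simplex" and \<epsilon>: "0 < \<epsilon>" and m: "m \<in> prob_simplex"
  shows "- smoothing_error \<epsilon> \<le> smoothed_entropy \<epsilon> \<nu> m"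
proof -
  let ?d = "real CARD('s)"
  have G0: "G m $ x \<in> prob_simplex" for x using kernel_G[OF m] by (simp add: transition_kernel_def)
  have row: "marginal1 \<nu> $ x - (marginal1 \<nu> $ x + ?d * \<epsilon>) * (1 + ?d * \<epsilon>)
     = (\<Sum>y\<in>UNIV. \<nu> $ (x, y) - (marginal1 \<nu> $ x + ?d * \<epsilon>) * (G m $ x $ y + \<epsilon>))" for x
    by (simp add: sum_subtractf sum.distrib marginal_nth prob_simplexD(2)[OF G0] flip: sum_distrib_left)
  have one: "(\<Sum>x\<in>UNIV. marginal1 \<nu> $ x) = 1" using marginal1_simplex[OF \<nu>] by (simp add: prob_simplexD)
  have "- smoothing_error \<epsilon> = (\<Sum>x\<in>UNIV. marginal1 \<nu> $ x) - ((\<Sum>x\<in>UNIV. marginal1 \<nu> $ x) + ?d * (?d * \<epsilon>)) * (1 + ?d * \<epsilon>)"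
    unfolding one smoothing_error_def by (simp add: algebra_simps power2_eq_square power3_eq_cube)
  also have "\<dots> = (\<Sum>x\<in>UNIV. marginal1 \<nu> $ x - (marginal1 \<nu> $ x + ?d * \<epsilon>) * (1 + ?d * \<epsilon>))"
    by (simp add: sum_subtractf sum.distrib flip: sum_distrib_right)
  also have "\<dots> \<le> smoothed_entropy \<epsilon> \<nu> m"
    unfolding row smoothed_entropy_def
    by (intro sum_mono smoothed_entropy_term[OF \<nu> \<epsilon>]) (use G0 \<epsilon> in \<open>auto simp: prob_simplexD intro!: add_nonneg_pos\<close>)
  finally show ?thesis .
qed

lemma tendsto_smoothing_error: "(\<lambda>j. smoothing_error (1 / real (Suc j))) \<longlonglongrightarrow> 0"
proof -
  have inv: "(\<lambda>n. 1 / real (Suc n)) \<longlonglongrightarrow> 0" using LIMSEQ_inverse_real_of_nat by (simp add: inverse_eq_divide)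
  have "(\<lambda>j. smoothing_error (1 / real (Suc j))) \<longlonglongrightarrow>
    real CARD('s) * 0 + (real CARD('s))\<^sup>2 * 0 + (real CARD('s)) ^ 3 * 0\<^sup>2"
    unfolding smoothing_error_def by (intro tendsto_intros inv)
  then show ?thesis by simp
qed

text \<open>The added error makes the approximations nonnegative, as Fatou's lemma will require. If
  the kernel charges every pair that \<open>\<nu>\<close> charges, they converge termwise; otherwise
  a term over a zero of the kernel diverges to infinity.\<close>

lemma step_cost_le_liminf:
  assumes \<nu>: "\<nu> \<in> prob_simplex" and m: "m \<in> prob_simplex"
  shows "step_cost G \<nu> m \<le> liminf (\<lambda>j. ennreal (smoothed_entropy (1 / real (Suc j)) \<nu> m + smoothing_error (1 / real (Suc j))))"
    (is "_ \<le> liminf (\<lambda>j. ennreal (?h j))")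
proof -
  let ?e = "\<lambda>j. 1 / real (Suc j)"
  have inv: "?e \<longlonglongrightarrow> 0" using LIMSEQ_inverse_real_of_nat by (simp add: inverse_eq_divide)
  have G0: "G m $ x \<in> prob_simplex" for x using kernel_G[OF m] by (simp add: transition_kernel_def)
  have n0: "0 \<le> \<nu> $ p" for p using \<nu> by (simp add: prob_simplexD)
  have S: "(\<Sum>z\<in>UNIV. \<nu> $ (x, z) + \<epsilon>) = marginal1 \<nu> $ x + real CARD('s) * \<epsilon>" for x \<epsilon>
    by (simp add: marginal_nth sum.distrib)
  show ?thesis
  proof (cases "\<forall>x y. G m $ x $ y = 0 \<longrightarrow> \<nu> $ (x, y) = 0")
    case True
    have t: "(\<lambda>j. \<nu> $ (x, y) * ln (smoothed_conditional (?e j) \<nu> x y / (G m $ x $ y + ?e j)))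
       \<longlonglongrightarrow> \<nu> $ (x, y) * ln (\<nu> $ (x, y) / marginal1 \<nu> $ x / G m $ x $ y)" for x y
    proof (cases "\<nu> $ (x, y) = 0")
      case False
      then have n: "0 < \<nu> $ (x, y)" using n0[of "(x, y)"] by simp
      then have m1: "0 < marginal1 \<nu> $ x" using le_marginal1[OF \<nu>, of x y] by simp
      have g: "0 < G m $ x $ y" using True False prob_simplexD(1)[OF G0, of x y] by (auto simp: less_le)
      have L: "(\<lambda>j. smoothed_conditional (?e j) \<nu> x y / (G m $ x $ y + ?e j))
        \<longlonglongrightarrow> (\<nu> $ (x, y) + 0) / (marginal1 \<nu> $ x + real CARD('s) * 0) / (G m $ x $ y + 0)"
        unfolding smoothed_conditional_def S using m1 g by (intro tendsto_intros inv) auto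
      show ?thesis
        by (intro tendsto_mult tendsto_const tendsto_ln) (use L n m1 g in simp_all)
    qed simp
    have "?h \<longlonglongrightarrow> pair_entropy \<nu> (\<lambda>x y. G m $ x $ y) + 0"
      unfolding smoothed_entropy_def pair_entropy_def
      by (intro tendsto_add tendsto_sum t tendsto_smoothing_error)
    then have "(\<lambda>j. ennreal (?h j)) \<longlonglongrightarrow> ennreal (pair_entropy \<nu> (\<lambda>x y. G m $ x $ y))"
      by (intro tendsto_ennrealI) simp
    then have "liminf (\<lambda>j. ennreal (?h j)) = ennreal (pair_entropy \<nu> (\<lambda>x y. G m $ x $ y))"
      by (intro lim_imp_Liminf) auto
    then show ?thesis using step_cost_eq[where G = G, OF \<nu> kernel_G[OF m]] True by simp
  next
    case False
    then obtain x0 y0 where xy: "G m $ x0 $ y0 = 0" "\<nu> $ (x0, y0) \<noteq> 0" by auto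
    have nxy: "0 < \<nu> $ (x0, y0)" using xy(2) n0[of "(x0, y0)"] by simp
    let ?d = "real CARD('s)"
    \<comment> \<open>A lower bound uniform in \<open>j\<close>: a smoothed conditional is at least
      \<open>\<nu> $ (x, y) / (1 + d)\<close>, and the denominators are at most 2.\<close>
    define C where "C = (\<lambda>x y. \<nu> $ (x, y) * ln (\<nu> $ (x, y) / (1 + ?d) / 2))"
    have d: "?d > 0" by simp
    have q: "\<nu> $ (x, y) / (1 + ?d) \<le> smoothed_conditional (?e j) \<nu> x y" for x y j
      unfolding smoothed_conditional_def S
    proof (rule frac_le)
      have "marginal1 \<nu> $ x \<le> 1" "0 \<le> marginal1 \<nu> $ x" using marginal1_simplex[OF \<nu>] by (auto simp: prob_simplexD)
      moreover have "?d * ?e j \<le> ?d" "0 < ?d * ?e j" by (auto simp: divide_le_eq)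
      ultimately show "marginal1 \<nu> $ x + ?d * ?e j \<le> 1 + ?d" "0 < marginal1 \<nu> $ x + ?d * ?e j" by linarith+
    qed (use n0 in auto)
    \<comment> \<open>The pair \<open>(x0, y0)\<close> has denominator exactly
      \<open>1 / Suc j\<close> and gains \<open>ln (Suc j)\<close>, which drives the sum to
      infinity; the other terms stay above their constants.\<close>
    have T: "C x y + (if x = x0 \<and> y = y0 then \<nu> $ (x, y) * ln (real (Suc j)) else 0)
      \<le> \<nu> $ (x, y) * ln (smoothed_conditional (?e j) \<nu> x y / (G m $ x $ y + ?e j))" for x y j
    proof (cases "\<nu> $ (x, y) = 0")
      case False
      then have n: "0 < \<nu> $ (x, y)" using n0[of "(x, y)"] by simp
      have a: "0 < \<nu> $ (x, y) / (1 + ?d)" using n d by simp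
      have a2: "0 < \<nu> $ (x, y) / (1 + ?d) / 2" by (rule divide_pos_pos[OF a]) simp
      have e: "0 < ?e j" "?e j \<le> 1" by auto
      have ge: "G m $ x $ y + ?e j \<le> 2" using e(2) prob_simplexD(3)[OF G0, of x y] by linarith
      have half: "z / 2 \<le> z" if "0 < z" for z :: real using that by simp
      show ?thesis
      proof (cases "x = x0 \<and> y = y0")
        case True
        then have "C x y + (if x = x0 \<and> y = y0 then \<nu> $ (x, y) * ln (real (Suc j)) else 0)
          = \<nu> $ (x, y) * (ln (\<nu> $ (x, y) / (1 + ?d) / 2) + ln (real (Suc j)))" by (simp add: C_def algebra_simps)
        also have "ln (\<nu> $ (x, y) / (1 + ?d) / 2) + ln (real (Suc j)) = ln (\<nu> $ (x, y) / (1 + ?d) / 2 * real (Suc j))"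
          by (rule ln_mult_pos[OF a2, symmetric]) simp
        also have "\<nu> $ (x, y) * ln (\<nu> $ (x, y) / (1 + ?d) / 2 * real (Suc j))
          \<le> \<nu> $ (x, y) * ln (smoothed_conditional (?e j) \<nu> x y / (G m $ x $ y + ?e j))"
        proof (intro mult_left_mono n0 ln_mono)
          show "0 < \<nu> $ (x, y) / (1 + ?d) / 2 * real (Suc j)" by (rule mult_pos_pos[OF a2]) simp
          have "\<nu> $ (x, y) / (1 + ?d) / 2 \<le> \<nu> $ (x, y) / (1 + ?d)" by (rule half[OF a])
          also have "\<dots> \<le> smoothed_conditional (?e j) \<nu> x y" by (rule q)
          finally have "\<nu> $ (x, y) / (1 + ?d) / 2 * real (Suc j) \<le> smoothed_conditional (?e j) \<nu> x y * real (Suc j)"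
            by (rule mult_right_mono) simp
          then show "\<nu> $ (x, y) / (1 + ?d) / 2 * real (Suc j) \<le> smoothed_conditional (?e j) \<nu> x y / (G m $ x $ y + ?e j)"
            using True xy(1) by simp
        qed
        finally show ?thesis .
      next
        case False
        have "\<nu> $ (x, y) * ln (\<nu> $ (x, y) / (1 + ?d) / 2)
          \<le> \<nu> $ (x, y) * ln (smoothed_conditional (?e j) \<nu> x y / (G m $ x $ y + ?e j))"
        proof (intro mult_left_mono n0 ln_mono)
          show "0 < \<nu> $ (x, y) / (1 + ?d) / 2" by (rule a2)
          show "\<nu> $ (x, y) / (1 + ?d) / 2 \<le> smoothed_conditional (?e j) \<nu> x y / (G m $ x $ y + ?e j)"
          proof (rule frac_le)
            show "0 < G m $ x $ y + ?e j" using e(1) prob_simplexD(1)[OF G0, of x y] by linarith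
            show "0 \<le> smoothed_conditional (?e j) \<nu> x y" using a q[of x y j] by linarith
          qed (rule q ge)+
        qed
        then show ?thesis using False by (auto simp: C_def)
      qed
    qed (use nxy in \<open>auto simp: C_def\<close>)
    have A1: "(\<Sum>x\<in>UNIV. \<Sum>y\<in>UNIV. C x y + (if x = x0 \<and> y = y0 then \<nu> $ (x, y) * ln (real (Suc j)) else 0))
      \<le> smoothed_entropy (?e j) \<nu> m" for j
      unfolding smoothed_entropy_def by (intro sum_mono T)
    have A2: "(\<Sum>x\<in>UNIV. \<Sum>y\<in>UNIV. C x y + (if x = x0 \<and> y = y0 then \<nu> $ (x, y) * ln (real (Suc j)) else 0))
      = (\<Sum>x\<in>UNIV. \<Sum>y\<in>UNIV. C x y) + \<nu> $ (x0, y0) * ln (real (Suc j))" for j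
    proof -
      have "(\<Sum>y\<in>UNIV. if x = x0 \<and> y = y0 then \<nu> $ (x, y) * ln (real (Suc j)) else 0)
        = (if x = x0 then \<nu> $ (x0, y0) * ln (real (Suc j)) else 0)" for x
        by (cases "x = x0") simp_all
      then show ?thesis by (simp add: sum.distrib)
    qed
    have A3: "0 \<le> smoothing_error (?e j)" for j by (auto simp: smoothing_error_def)
    have low: "(\<Sum>x\<in>UNIV. \<Sum>y\<in>UNIV. C x y) + \<nu> $ (x0, y0) * ln (real (Suc j)) \<le> ?h j" for j
      using A1[of j] A2[of j] A3[of j] by linarith
    have "filterlim (\<lambda>j. (\<Sum>x\<in>UNIV. \<Sum>y\<in>UNIV. C x y) + \<nu> $ (x0, y0) * ln (real (Suc j))) at_top sequentially"
      by (intro filterlim_tendsto_add_at_top[OF tendsto_const] filterlim_tendsto_pos_mult_at_top[OF tendsto_const nxy]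
          filterlim_compose[OF ln_at_top] filterlim_compose[OF filterlim_real_sequentially filterlim_Suc])
    then have "filterlim ?h at_top sequentially"
      by (rule filterlim_at_top_mono) (use low in auto)
    then have "(\<lambda>j. ennreal (?h j)) \<longlonglongrightarrow> top"
      unfolding tendsto_top_iff_ennreal filterlim_at_top_dense
      by (auto elim!: eventually_mono intro: ennreal_lessI simp: ennreal_less_iff)
    then have "liminf (\<lambda>j. ennreal (?h j)) = top" by (intro lim_imp_Liminf) auto
    then show ?thesis by simp
  qed
qed

text \<open>Smoothing parameter and floor are tied together as \<open>1 / Suc j\<close>. For each
  \<open>j\<close> the smoothed integral is at most \<open>a\<close>, and Fatou's lemma passes to
  the true cost.\<close>

lemma path_cost_le:
  fixes \<zeta> :: "real \<Rightarrow> real ^ ('s \<times> 's)"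
  assumes \<zeta>: "simplex_path \<zeta>"
    and H: "\<And>K \<delta> q. 0 < K \<Longrightarrow> 0 < \<delta> \<Longrightarrow> stochastic_pos q \<Longrightarrow> block_sum K \<delta> q (cumulative \<zeta>) (cumulative \<zeta>) \<le> a"
  shows "path_cost G \<zeta> \<le> ennreal a"
proof -
  let ?e = "\<lambda>j. 1 / real (Suc j)"
  let ?m = "\<lambda>u. (1 / u) *\<^sub>R marginal1 (cumulative \<zeta> u)"
  let ?h = "\<lambda>j u. smoothed_entropy (?e j) (\<zeta> u) (?m u) + smoothing_error (?e j)"
  have m: "?m u \<in> prob_simplex" if "u \<in> {0<..1}" for u
    using that by (intro average_marginal_simplex[OF \<zeta>]) auto
  have e: "0 < ?e j" for j by simp
  have h0: "0 \<le> ?h j u" if "u \<in> {0<..1}" for j u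
    using smoothed_entropy_ge[OF simplex_pathD(2)[OF \<zeta>] e m[OF that], of j u] by linarith
  have int0: "set_integrable lborel {0<..1} (\<lambda>u. smoothed_entropy (?e j) (\<zeta> u) (?m u))"
    and le0: "(LINT u:{0<..1}|lborel. smoothed_entropy (?e j) (\<zeta> u) (?m u)) \<le> a" for j
  proof -
    have H': "block_sum K (?e j) q (cumulative \<zeta>) (cumulative \<zeta>) \<le> a" if "0 < K" "stochastic_pos q" for K q
      by (rule H[OF that(1) e that(2)])
    note r = integral_measurable_kernel_le[where \<delta>="?e j" and \<epsilon>="?e j", OF \<zeta> H' e e, folded smoothed_entropy_def]
    show "set_integrable lborel {0<..1} (\<lambda>u. smoothed_entropy (?e j) (\<zeta> u) (?m u))" by (rule r(2), assumption+)
    show "(LINT u:{0<..1}|lborel. smoothed_entropy (?e j) (\<zeta> u) (?m u)) \<le> a" by (rule r(1), assumption+)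
  qed
  have intc: "set_integrable lborel {0<..1::real} (\<lambda>u. smoothing_error (?e j))" for j
    by (rule bounded_set_integrable[where B="\<bar>smoothing_error (?e j)\<bar>"]) auto
  have int: "set_integrable lborel {0<..1} (?h j)" for j
    by (rule set_integral_add(1)[OF int0 intc])
  have le: "(LINT u:{0<..1}|lborel. ?h j u) \<le> a + smoothing_error (?e j)" for j
    unfolding set_integral_add(2)[OF int0 intc] using le0[of j] set_integral_const_Ioc[of 0 1 "smoothing_error (?e j)"]
    by simp
  have nn: "(\<integral>\<^sup>+u. ennreal (indicat_real {0<..1} u *\<^sub>R ?h j u) \<partial>lborel) = ennreal (LINT u:{0<..1}|lborel. ?h j u)" for j
    unfolding set_lebesgue_integral_def
    by (rule nn_integral_eq_integral[OF int[unfolded set_integrable_def]])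
       (rule AE_I2, use h0 in \<open>auto simp: indicator_def\<close>)
  have "path_cost G \<zeta> \<le> (\<integral>\<^sup>+u. liminf (\<lambda>j. ennreal (indicat_real {0<..1} u *\<^sub>R ?h j u)) \<partial>lborel)"
    unfolding path_cost_def
  proof (rule nn_integral_mono)
    fix u :: real
    show "step_cost G (\<zeta> u) (?m u) * indicator {0<..1} u \<le> liminf (\<lambda>j. ennreal (indicat_real {0<..1} u *\<^sub>R ?h j u))"
    proof (cases "u \<in> {0<..1}")
      case True
      then show ?thesis using step_cost_le_liminf[OF simplex_pathD(2)[OF \<zeta>] m[OF True], of u] by simp
    qed simp
  qed
  also have "\<dots> \<le> liminf (\<lambda>j. \<integral>\<^sup>+u. ennreal (indicat_real {0<..1} u *\<^sub>R ?h j u) \<partial>lborel)"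
    by (rule nn_integral_liminf) (use int in \<open>auto simp: set_integrable_def dest: borel_measurable_integrable\<close>)
  also have "\<dots> \<le> liminf (\<lambda>j. ennreal (a + smoothing_error (?e j)))"
    unfolding nn by (intro Liminf_mono always_eventually allI ennreal_leI le)
  also have "\<dots> = ennreal a"
  proof (rule lim_imp_Liminf)
    have "(\<lambda>j. a + smoothing_error (?e j)) \<longlonglongrightarrow> a + 0" by (intro tendsto_intros tendsto_smoothing_error)
    then show "(\<lambda>j. ennreal (a + smoothing_error (?e j))) \<longlonglongrightarrow> ennreal a" by (intro tendsto_ennrealI) simp
  qed simp
  finally show ?thesis .
qed

end

section \<open>Blocks of time\<close>

definition block_of :: "(nat \<Rightarrow> nat) \<Rightarrow> nat \<Rightarrow> nat" where
  "block_of t i = (LEAST j. i < t (Suc j))"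

lemma block_of_eq:
  assumes "mono t" "t b \<le> i" "i < t (Suc b)"
  shows "block_of t i = b"
  unfolding block_of_def
proof (rule Least_equality)
  fix j assume j: "i < t (Suc j)"
  show "b \<le> j"
  proof (rule ccontr)
    assume "\<not> b \<le> j"
    then have "t (Suc j) \<le> t b" by (intro monoD[OF assms(1)]) simp
    then show False using assms(2) j by simp
  qed
qed (rule assms(3))

lemma block_of_bounds:
  assumes "mono t" "t 0 = 0" "i < t K"
  shows "block_of t i < K" "t (block_of t i) \<le> i" "i < t (Suc (block_of t i))"
proof -
  have "\<exists>b<K. t b \<le> i \<and> i < t (Suc b)"
    using assms(3)
  proof (induction K)
    case (Suc K)
    show ?case
    proof (cases "i < t K")
      case True
      then show ?thesis using Suc.IH less_SucI by blast
    qed (use Suc.prems in auto)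
  qed (simp add: assms(2))
  then obtain b where b: "b < K" "t b \<le> i" "i < t (Suc b)" by blast
  then have "block_of t i = b" by (intro block_of_eq[OF assms(1)]) auto
  then show "block_of t i < K" "t (block_of t i) \<le> i" "i < t (Suc (block_of t i))" using b by auto
qed

lemma sum_blocks:
  fixes g :: "nat \<Rightarrow> real"
  assumes "mono t" "t 0 = 0"
  shows "(\<Sum>i<t K. g i) = (\<Sum>b<K. \<Sum>i=t b..<t (Suc b). g i)"
proof (induction K)
  case (Suc K)
  have "t K \<le> t (Suc K)" using assms(1) by (simp add: monoD)
  then have "(\<Sum>i<t (Suc K). g i) = (\<Sum>i<t K. g i) + (\<Sum>i=t K..<t (Suc K). g i)"
    using sum.atLeastLessThan_concat[of 0 "t K" "t (Suc K)" g] by (simp add: atLeast0LessThan)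
  then show ?case using Suc by simp
qed (simp add: assms(2))

text \<open>\<open>K\<close> need not divide \<open>n\<close>. Boundaries are rounded down, and the
  last one is exactly \<open>n\<close>, so the blocks exhaust the path.\<close>

definition grid :: "nat \<Rightarrow> nat \<Rightarrow> nat \<Rightarrow> nat" where
  "grid n K b = n * b div K"

lemma mono_grid: "mono (grid n K)"
  by (auto simp: grid_def mono_def intro: div_le_mono)

lemma grid_0 [simp]: "grid n K 0 = 0"
  and grid_K: "0 < K \<Longrightarrow> grid n K K = n"
  by (auto simp: grid_def)

lemma grid_bounds:
  assumes "0 < K"
  shows "real (grid n K b) \<le> real n * real b / real K" "real n * real b / real K < real (grid n K b) + 1"
proof -
  have "grid n K b * K \<le> n * b" unfolding grid_def by simp
  then have "real (grid n K b) * real K \<le> real n * real b" by (metis of_nat_le_iff of_nat_mult)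
  then show "real (grid n K b) \<le> real n * real b / real K" using assms by (simp add: le_divide_eq)
  have "n * b < (grid n K b + 1) * K"
    unfolding grid_def using dividend_less_div_times[of K "n * b"] assms by (simp add: algebra_simps)
  then have "real n * real b < (real (grid n K b) + 1) * real K"
    by (metis of_nat_less_iff of_nat_mult of_nat_add of_nat_1)
  then show "real n * real b / real K < real (grid n K b) + 1" using assms by (simp add: divide_less_eq)
qed

text \<open>Rescaled transition counts up to time \<open>n * u\<close>, encoded as a single real
  function on times and pairs so that they are points of a product space. Capping \<open>u\<close>
  at 1 puts all values into the unit interval.\<close>

definition pair_path :: "nat \<Rightarrow> (nat \<Rightarrow> 's) \<Rightarrow> real \<times> ('s \<times> 's) \<Rightarrow> real" where
  "pair_path n x = (\<lambda>(u, p). (\<Sum>i<nat \<lfloor>real n * min 1 u\<rfloor>. of_bool ((x i, x (Suc i)) = p)) / real n)"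

definition vec_path :: "(real \<times> 'p \<Rightarrow> real) \<Rightarrow> real \<Rightarrow> real ^ 'p" where
  "vec_path N u = (\<chi> p. N (u, p))"

lemma nat_floor_le: "nat \<lfloor>real n * min 1 u\<rfloor> \<le> n"
proof -
  have "real n * min 1 u \<le> real n * 1" by (intro mult_left_mono) auto
  then have "\<lfloor>real n * min 1 u\<rfloor> \<le> int n" by linarith
  then show ?thesis by simp
qed

lemma pair_path_range: "0 \<le> pair_path n x i" "pair_path n x i \<le> 1"
proof -
  obtain u p where i: "i = (u, p)" by (metis surj_pair)
  show "0 \<le> pair_path n x i" unfolding i pair_path_def by (auto intro!: divide_nonneg_nonneg sum_nonneg)
  have "(\<Sum>i<nat \<lfloor>real n * min 1 u\<rfloor>. of_bool ((x i, x (Suc i)) = p)) \<le> (\<Sum>i<nat \<lfloor>real n * min 1 u\<rfloor>. 1 :: real)"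
    by (intro sum_mono) auto
  also have "\<dots> \<le> real n" using nat_floor_le[of n u] by simp
  finally show "pair_path n x i \<le> 1" unfolding i pair_path_def by (simp add: divide_le_eq)
qed

lemma pair_path_mono:
  assumes "0 \<le> u" "u \<le> v"
  shows "pair_path n x (u, p) \<le> pair_path n x (v, p)"
proof -
  have le: "real n * min 1 u \<le> real n * min 1 v" using assms by (intro mult_left_mono) auto
  have "nat \<lfloor>real n * min 1 u\<rfloor> \<le> nat \<lfloor>real n * min 1 v\<rfloor>" by (intro nat_mono floor_mono le)
  then show ?thesis unfolding pair_path_def prod.case
    by (intro divide_right_mono sum_mono2) auto
qed

lemma sum_of_bool_pair:
  fixes x :: "nat \<Rightarrow> 's::finite"
  shows "(\<Sum>z\<in>UNIV. of_bool ((x i, x (Suc i)) = (y, z))) = (of_bool (x i = y) :: real)"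
    and "(\<Sum>z\<in>UNIV. of_bool ((x i, x (Suc i)) = (z, y))) = (of_bool (x (Suc i) = y) :: real)"
    and "(\<Sum>p\<in>UNIV. of_bool ((x i, x (Suc i)) = p)) = (1 :: real)"
proof -
  show "(\<Sum>z\<in>UNIV. of_bool ((x i, x (Suc i)) = (y, z))) = (of_bool (x i = y) :: real)"
    by (cases "x i = y") (simp_all add: of_bool_def)
  show "(\<Sum>z\<in>UNIV. of_bool ((x i, x (Suc i)) = (z, y))) = (of_bool (x (Suc i) = y) :: real)"
    by (cases "x (Suc i) = y") (simp_all add: of_bool_def)
  show "(\<Sum>p\<in>UNIV. of_bool ((x i, x (Suc i)) = p)) = (1 :: real)"
    by (simp add: of_bool_def)
qed

lemma pair_path_marginals:
  fixes x :: "nat \<Rightarrow> 's::finite"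
  shows "(\<Sum>z\<in>UNIV. pair_path n x (u, (y, z))) = (\<Sum>i<nat \<lfloor>real n * min 1 u\<rfloor>. of_bool (x i = y)) / real n"
    and "(\<Sum>z\<in>UNIV. pair_path n x (u, (z, y))) = (\<Sum>i<nat \<lfloor>real n * min 1 u\<rfloor>. of_bool (x (Suc i) = y)) / real n"
    and "(\<Sum>p\<in>UNIV. pair_path n x (u, p)) = real (nat \<lfloor>real n * min 1 u\<rfloor>) / real n"
proof -
  have sw: "(\<Sum>z\<in>UNIV. pair_path n x (u, f z)) = (\<Sum>i<nat \<lfloor>real n * min 1 u\<rfloor>. \<Sum>z\<in>UNIV. of_bool ((x i, x (Suc i)) = f z)) / real n"
    for f :: "'c::finite \<Rightarrow> 's \<times> 's"
    unfolding pair_path_def prod.case sum_divide_distrib[symmetric] by (subst sum.swap) simp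
  show "(\<Sum>z\<in>UNIV. pair_path n x (u, (y, z))) = (\<Sum>i<nat \<lfloor>real n * min 1 u\<rfloor>. of_bool (x i = y)) / real n"
    unfolding sw[of "\<lambda>z. (y, z)"] sum_of_bool_pair(1) ..
  show "(\<Sum>z\<in>UNIV. pair_path n x (u, (z, y))) = (\<Sum>i<nat \<lfloor>real n * min 1 u\<rfloor>. of_bool (x (Suc i) = y)) / real n"
    unfolding sw[of "\<lambda>z. (z, y)"] sum_of_bool_pair(2) ..
  show "(\<Sum>p\<in>UNIV. pair_path n x (u, p)) = real (nat \<lfloor>real n * min 1 u\<rfloor>) / real n"
    unfolding sw[of "\<lambda>z. z"] sum_of_bool_pair(3) by simp
qed

lemma nat_floor_grid:
  assumes "0 < K" "b \<le> K"
  shows "nat \<lfloor>real n * min 1 (real b / real K)\<rfloor> = grid n K b"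
proof -
  have "real n * min 1 (real b / real K) = real (n * b) / real K" using assms by (simp add: min_def)
  then show ?thesis unfolding grid_def by (simp only: floor_divide_of_nat_eq nat_int)
qed

lemma pair_path_increment:
  assumes "0 < K" "b < K" "0 < n"
  shows "real n * (pair_path n x (real (Suc b) / real K, p) - pair_path n x (real b / real K, p))
    = (\<Sum>i=grid n K b..<grid n K (Suc b). of_bool ((x i, x (Suc i)) = p))"
proof -
  let ?f = "\<lambda>i. of_bool ((x i, x (Suc i)) = p) :: real"
  have "grid n K b \<le> grid n K (Suc b)" by (intro monoD[OF mono_grid]) simp
  then have "(\<Sum>i<grid n K (Suc b). ?f i) = (\<Sum>i<grid n K b. ?f i) + (\<Sum>i=grid n K b..<grid n K (Suc b). ?f i)"
    using sum.atLeastLessThan_concat[of 0 "grid n K b" "grid n K (Suc b)" ?f] by (simp add: atLeast0LessThan)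
  moreover have "real n * pair_path n x (real j / real K, p) = (\<Sum>i<grid n K j. ?f i)" if "j \<le> K" for j
    using assms nat_floor_grid[OF assms(1) that, of n] by (simp add: pair_path_def)
  from this[of b] this[of "Suc b"] have
    "real n * pair_path n x (real b / real K, p) = (\<Sum>i<grid n K b. ?f i)"
    "real n * pair_path n x (real (Suc b) / real K, p) = (\<Sum>i<grid n K (Suc b). ?f i)"
    using assms(2) by simp_all
  ultimately show ?thesis by (simp add: right_diff_distrib)
qed

text \<open>Weights that depend only on the block and the transition see the path only through its
  pair counts. This turns logarithms of densities into block sums.\<close>

lemma sum_over_blocks:
  fixes w :: "nat \<Rightarrow> 's::finite \<Rightarrow> 's \<Rightarrow> real"
  assumes K: "0 < K"
  shows "(\<Sum>i<n. w (block_of (grid n K) i) (x i) (x (Suc i)))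
    = (\<Sum>b<K. \<Sum>z\<in>UNIV. \<Sum>y\<in>UNIV. (\<Sum>i=grid n K b..<grid n K (Suc b). of_bool ((x i, x (Suc i)) = (z, y))) * w b z y)"
proof -
  have "(\<Sum>i<n. w (block_of (grid n K) i) (x i) (x (Suc i))) = (\<Sum>i<grid n K K. w (block_of (grid n K) i) (x i) (x (Suc i)))"
    by (simp add: grid_K[OF K])
  also have "\<dots> = (\<Sum>b<K. \<Sum>i=grid n K b..<grid n K (Suc b). w (block_of (grid n K) i) (x i) (x (Suc i)))"
    by (rule sum_blocks[OF mono_grid grid_0])
  also have "\<dots> = (\<Sum>b<K. \<Sum>i=grid n K b..<grid n K (Suc b). w b (x i) (x (Suc i)))"
  proof (intro sum.cong refl)
    fix b i assume "i \<in> {grid n K b..<grid n K (Suc b)}"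
    then have "block_of (grid n K) i = b" by (intro block_of_eq[OF mono_grid]) auto
    then show "w (block_of (grid n K) i) (x i) (x (Suc i)) = w b (x i) (x (Suc i))" by simp
  qed
  also have "\<dots> = (\<Sum>b<K. \<Sum>i=grid n K b..<grid n K (Suc b). \<Sum>z\<in>UNIV. \<Sum>y\<in>UNIV. of_bool ((x i, x (Suc i)) = (z, y)) * w b z y)"
  proof (intro sum.cong refl)
    fix b i
    have "(\<Sum>y\<in>UNIV. of_bool ((x i, x (Suc i)) = (z, y)) * w b z y)
      = (if z = x i then w b z (x (Suc i)) else 0)" for z
      by (cases "z = x i") (auto simp: of_bool_def if_distrib[of "\<lambda>c. c * _"] cong: if_cong)
    then show "w b (x i) (x (Suc i)) = (\<Sum>z\<in>UNIV. \<Sum>y\<in>UNIV. of_bool ((x i, x (Suc i)) = (z, y)) * w b z y)"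
      by simp
  qed
  also have "\<dots> = (\<Sum>b<K. \<Sum>z\<in>UNIV. \<Sum>y\<in>UNIV. (\<Sum>i=grid n K b..<grid n K (Suc b). of_bool ((x i, x (Suc i)) = (z, y))) * w b z y)"
    unfolding sum_distrib_right
    by (intro sum.cong refl) (simp only: sum.swap[of _ _ "{grid n K _..<grid n K (Suc _)}"])
  finally show ?thesis .
qed

section \<open>Exponential bounds by change of measure\<close>

context afp_chain
begin

lemma self_kernel_nonneg: "0 \<le> self_kernel G n x y"
  using kernel_G[OF emp_simplex[of "Suc n" x]] prob_simplexD(1)
  by (auto simp: self_kernel_def transition_kernel_def)

lemma self_kernel_sum: "(\<Sum>y\<in>UNIV. self_kernel G n x y) = 1"
  using kernel_G[OF emp_simplex[of "Suc n" x]] prob_simplexD(2)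
  by (auto simp: self_kernel_def transition_kernel_def)

text \<open>Off the first block the kernel is replaced by \<open>q\<close>. The occupation counts increase
  with time, which bounds the empirical measure inside a block by its values at the end points.\<close>

lemma block_change_of_measure:
  assumes K: "0 < K" and \<delta>: "0 < \<delta>" and q: "stochastic_pos q" and n: "0 < n"
    and N0: "\<And>u p. 0 \<le> N0 u $ p"
    and C: "\<And>x b y. C x \<Longrightarrow> b \<in> {1..<K} \<Longrightarrow>
       (real K / real b) * marginal1 (vec_path (pair_path n x) (real (Suc b) / K)) $ y
       \<le> (real K / real b) * marginal1 (N0 (real (Suc b) / K)) $ y + \<delta>"
    and Ca: "\<And>x. C x \<Longrightarrow> a \<le> block_sum K \<delta> q (vec_path (pair_path n x)) N0"
  shows "path_exp (self_kernel G) x0 n (\<lambda>x. of_bool (C x)) \<le> exp (- real n * a)"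
proof -
  let ?k = "self_kernel G"
  let ?t = "grid n K"
  let ?b = "block_of ?t"
  define U where "U = (\<lambda>b x y. G ((real K / real b) *\<^sub>R marginal1 (N0 (real (Suc b) / K))) $ x $ y + \<delta>)"
  \<comment> \<open>In block 0 the kernel is kept, so the density is 1 and its logarithm 0.\<close>
  define w where "w = (\<lambda>b x y. if b = 0 then 0 else ln (q b x y / U b x y))"
  define r where "r = (\<lambda>i x y. if ?b i = 0 then 1 else ?k i x y / q (?b i) (x i) y)"
  define q' where "q' = (\<lambda>i x y. if ?b i = 0 then ?k i x y else q (?b i) (x i) y)"
  have qpos: "0 < q b x y" for b x y using q by (simp add: stochastic_pos_def)
  have q'0: "0 \<le> q' i x y" for i x y using qpos self_kernel_nonneg by (simp add: q'_def less_imp_le)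
  have q'1: "(\<Sum>y\<in>UNIV. q' i x y) = 1" for i x
    using q self_kernel_sum[of i x] by (cases "?b i = 0") (auto simp: q'_def stochastic_pos_def)
  have r0: "0 \<le> r i x y" for i x y using qpos self_kernel_nonneg by (simp add: r_def less_imp_le)
  have r_adapted: "adapted r"
    unfolding adapted_def
  proof (intro allI impI)
    fix i and x x' :: "nat \<Rightarrow> 's" assume "\<forall>j\<le>i. x j = x' j"
    then show "r i x = r i x'"
      using self_kernel_cong[of i x x' G] by (simp add: r_def fun_eq_iff)
  qed
  have U0: "0 < U b x y" for b x y
  proof -
    have "0 \<le> marginal1 (N0 (real (Suc b) / K)) $ y" unfolding marginal_nth by (intro sum_nonneg N0)
    then have "0 \<le> Po x y + Pz x * (real K / real b * marginal1 (N0 (real (Suc b) / K)) $ y)"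
      by (intro add_nonneg_nonneg mult_nonneg_nonneg P_bounds) auto
    then show ?thesis using \<delta> by (simp add: U_def G_nth)
  qed
  have prodle: "(\<Prod>i<n. r i x (x (Suc i))) \<le> exp (- real n * a)" if x: "C x" for x
  proof -
    have ri: "r i x (x (Suc i)) \<le> exp (- w (?b i) (x i) (x (Suc i)))" if i: "i < n" for i
    proof (cases "?b i = 0")
      case False
      let ?y = "x (Suc i)"
      have b: "?b i < K" "?t (?b i) \<le> i" "i < ?t (Suc (?b i))"
        using block_of_bounds[OF mono_grid grid_0, of i n K K] i grid_K[OF K] by auto
      have b1: "?b i \<in> {1..<K}" using b(1) False by auto
      have bpos: "0 < real (?b i)" using False by simp
      \<comment> \<open>The start of the block is rounded down by less than 1, which the
        \<open>Suc\<close> compensates.\<close>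
      have den: "real n * real (?b i) / real K \<le> real (Suc i)"
        using grid_bounds(2)[OF K, of n "?b i"] b(2) by simp
      have cnt: "(\<Sum>j<Suc i. of_bool (x j = ?y)) \<le> (\<Sum>j<?t (Suc (?b i)). of_bool (x j = ?y) :: real)"
        using b(3) by (intro sum_mono2) auto
      have pos: "0 < real n * real (?b i) / real K" using n bpos K by simp
      have "emp x (Suc i) $ ?y \<le> (\<Sum>j<?t (Suc (?b i)). of_bool (x j = ?y)) / (real n * real (?b i) / real K)"
        unfolding emp_nth by (rule frac_le[OF _ cnt pos den]) (auto intro: sum_nonneg)
      also have "\<dots> = (real K / real (?b i)) * ((\<Sum>j<?t (Suc (?b i)). of_bool (x j = ?y)) / real n)"
        by (simp add: mult.commute)
      also have "(\<Sum>j<?t (Suc (?b i)). of_bool (x j = ?y)) / real n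
          = marginal1 (vec_path (pair_path n x) (real (Suc (?b i)) / K)) $ ?y"
        using nat_floor_grid[OF K, of "Suc (?b i)" n] b(1)
        by (simp add: marginal_nth vec_path_def pair_path_marginals(1) del: of_nat_Suc)
      also have "(real K / real (?b i)) * marginal1 (vec_path (pair_path n x) (real (Suc (?b i)) / K)) $ ?y
          \<le> (real K / real (?b i)) * marginal1 (N0 (real (Suc (?b i)) / K)) $ ?y + \<delta>"
        by (rule C[OF x b1])
      finally have e: "emp x (Suc i) $ ?y \<le> (real K / real (?b i)) * marginal1 (N0 (real (Suc (?b i)) / K)) $ ?y + \<delta>" .
      have "Pz (x i) * emp x (Suc i) $ ?y \<le> Pz (x i) * ((real K / real (?b i)) * marginal1 (N0 (real (Suc (?b i)) / K)) $ ?y + \<delta>)"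
        by (intro mult_left_mono e P_bounds)
      \<comment> \<open>Since \<open>Pz\<close> is at most 1, the tolerance on the occupation fits
        into the floor \<delta> already contained in \<open>U\<close>.\<close>
      also have "\<dots> \<le> Pz (x i) * ((real K / real (?b i)) * marginal1 (N0 (real (Suc (?b i)) / K)) $ ?y) + \<delta>"
        using P_bounds(2)[of "Some (x i)" None] \<delta> by (simp add: algebra_simps mult_left_le_one_le)
      finally have "?k i x ?y \<le> U (?b i) (x i) ?y"
        by (simp add: self_kernel_def U_def G_nth)
      then have "r i x ?y \<le> U (?b i) (x i) ?y / q (?b i) (x i) ?y"
        using False qpos by (simp add: r_def divide_right_mono less_imp_le)
      also have "\<dots> = exp (- w (?b i) (x i) ?y)"
        using False qpos U0 by (simp add: w_def exp_minus)
      finally show ?thesis .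
    qed (simp add: r_def w_def)
    have "(\<Prod>i<n. r i x (x (Suc i))) \<le> (\<Prod>i<n. exp (- w (?b i) (x i) (x (Suc i))))"
      by (intro prod_mono) (use ri r0 in auto)
    also have "\<dots> = exp (- (\<Sum>i<n. w (?b i) (x i) (x (Suc i))))"
      by (simp add: exp_sum sum_negf[symmetric] del: sum_negf)
    also have "(\<Sum>i<n. w (?b i) (x i) (x (Suc i))) = real n * block_sum K \<delta> q (vec_path (pair_path n x)) N0"
    proof -
      have "(\<Sum>i<n. w (?b i) (x i) (x (Suc i)))
        = (\<Sum>b<K. \<Sum>z\<in>UNIV. \<Sum>y\<in>UNIV. (\<Sum>i=?t b..<?t (Suc b). of_bool ((x i, x (Suc i)) = (z, y))) * w b z y)"
        by (rule sum_over_blocks[OF K])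
      also have "\<dots> = (\<Sum>b<K. \<Sum>z\<in>UNIV. \<Sum>y\<in>UNIV. real n * ((pair_path n x (real (Suc b) / real K, (z, y)) - pair_path n x (real b / real K, (z, y))) * w b z y))"
        by (intro sum.cong refl) (simp only: pair_path_increment[OF K _ n, symmetric] lessThan_iff mult.assoc)
      also have "\<dots> = real n * (\<Sum>b<K. \<Sum>z\<in>UNIV. \<Sum>y\<in>UNIV. (pair_path n x (real (Suc b) / real K, (z, y)) - pair_path n x (real b / real K, (z, y))) * w b z y)"
        by (simp only: sum_distrib_left)
      also have "(\<Sum>b<K. \<Sum>z\<in>UNIV. \<Sum>y\<in>UNIV. (pair_path n x (real (Suc b) / real K, (z, y)) - pair_path n x (real b / real K, (z, y))) * w b z y)
        = block_sum K \<delta> q (vec_path (pair_path n x)) N0"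
        unfolding block_sum_def
        by (rule sum.mono_neutral_cong_right) (auto simp: w_def U_def vec_path_def simp del: of_nat_Suc)
      finally show ?thesis .
    qed
    also have "exp (- (real n * block_sum K \<delta> q (vec_path (pair_path n x)) N0)) \<le> exp (- real n * a)"
      using Ca[OF x] by (simp add: mult_left_mono)
    finally show ?thesis .
  qed
  have "path_exp ?k x0 n (\<lambda>x. of_bool (C x)) \<le> path_exp q' x0 n (\<lambda>x. (\<Prod>i<n. r i x (x (Suc i))) * of_bool (C x))"
    by (rule path_exp_change_le[OF self_kernel_nonneg r_adapted r0])
       (use qpos in \<open>auto simp: q'_def r_def less_imp_neq[symmetric]\<close>)
  also have "\<dots> \<le> path_exp q' x0 n (\<lambda>x. exp (- real n * a))"
    by (rule path_exp_mono[OF q'0]) (use prodle in auto)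
  also have "\<dots> = exp (- real n * a)" by (rule path_exp_const[OF q'1])
  finally show ?thesis .
qed

subsection \<open>A stationary measure for the transitions that avoid the extra state\<close>

definition edges :: "('s \<times> 's) set" where
  "edges = {(x, y). 0 < Po x y}"

text \<open>A positive entry of the \<open>k\<close>-th power yields a walk of \<open>k\<close>
  edges, and \<open>k \<ge> 1\<close> makes it nonempty even from a state to itself. Hence every
  state has an outgoing edge.\<close>

lemma edges_trancl: "(x, y) \<in> edges\<^sup>+"
proof -
  let ?K = "interior_part P"
  let ?M = "\<lambda>k. ((**) ?K ^^ k) (mat 1)"
  have nth: "?M (Suc k) $ x $ y = (\<Sum>z\<in>UNIV. Po x z * ?M k $ z $ y)" for k x y
    by (simp add: matrix_matrix_mult_def interior_part_def)
  have nn: "0 \<le> ?M k $ x $ y" for k x y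
  proof (induction k arbitrary: x)
    case (Suc k)
    show ?case unfolding nth by (intro sum_nonneg mult_nonneg_nonneg P_bounds Suc)
  qed (simp add: mat_def)
  have pos: "0 < ?M k $ x $ y \<Longrightarrow> (x, y) \<in> edges ^^ k" for k x y
  proof (induction k arbitrary: x)
    case 0
    then show ?case by (auto simp: mat_def split: if_splits)
  next
    case (Suc k)
    have "\<exists>z. Po x z * ?M k $ z $ y > 0"
    proof (rule ccontr)
      assume "\<not> ?thesis"
      then have "(\<Sum>z\<in>UNIV. Po x z * ?M k $ z $ y) \<le> 0" by (intro sum_nonpos) (auto simp: not_less)
      then show False using Suc.prems unfolding nth by simp
    qed
    then obtain z where z: "Po x z * ?M k $ z $ y > 0" by blast
    then have "0 < Po x z" "0 < ?M k $ z $ y"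
      using P_bounds(1)[of "Some x" "Some z"] nn[of k z y] by (auto simp: zero_less_mult_iff)
    then have "(x, z) \<in> edges" "(z, y) \<in> edges ^^ k" using Suc.IH[of z] by (simp_all add: edges_def)
    then show ?case by (rule relpow_Suc_I2)
  qed
  obtain k where "k \<ge> 1" "0 < ?M k $ x $ y"
    using irreducible unfolding irreducible_matrix_def by blast
  then have "(x, y) \<in> edges ^^ k" "0 < k" using pos by auto
  then show ?thesis using trancl_power by blast
qed

lemma row_sum_pos: "0 < (\<Sum>y\<in>UNIV. Po x y)"
proof -
  obtain y where "(x, y) \<in> edges" using edges_trancl[of x x] by (meson tranclD)
  then have "0 < Po x y" by (simp add: edges_def)
  moreover have "Po x y \<le> (\<Sum>y\<in>UNIV. Po x y)" by (intro member_le_sum P_bounds) auto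
  ultimately show ?thesis by linarith
qed

text \<open>\<open>P\<^sup>o\<close> is substochastic, so its rows are normalised first. Brouwer's
  theorem on the simplex gives an invariant law, positivity spreads from one state to all along
  edges, and \<open>\<kappa>\<close> is the law of one stationary transition.\<close>

lemma stationary_pair_measure:
  obtains \<kappa> :: "real ^ ('s \<times> 's)" where "\<kappa> \<in> prob_simplex" "marginal1 \<kappa> = marginal2 \<kappa>"
    "\<And>x y. 0 < \<kappa> $ (x, y) \<longleftrightarrow> 0 < Po x y" "\<And>x. 0 < marginal1 \<kappa> $ x"
proof -
  define q where "q = (\<lambda>x y. Po x y / (\<Sum>y\<in>UNIV. Po x y))"
  have q0: "0 \<le> q x y" and qpos: "0 < q x y \<longleftrightarrow> 0 < Po x y" for x y
    using row_sum_pos[of x] P_bounds(1)[of "Some x" "Some y"] by (auto simp: q_def zero_less_divide_iff)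
  have q1: "(\<Sum>y\<in>UNIV. q x y) = 1" for x
    using row_sum_pos[of x] by (simp add: q_def flip: sum_divide_distrib)
  define T where "T = (\<lambda>\<mu> :: real ^ 's. \<chi> y. \<Sum>x\<in>UNIV. \<mu> $ x * q x y)"
  let ?S = "prob_simplex :: (real ^ 's) set"
  have "compact ?S" by (rule compact_prob_simplex)
  moreover have "convex ?S"
    by (auto simp: convex_def prob_simplex_def sum.distrib simp flip: sum_distrib_left)
  moreover have "(\<chi> x. 1 / CARD('s)) \<in> ?S" by (simp add: prob_simplex_def)
  then have "?S \<noteq> {}" by blast
  moreover have "continuous_on ?S T" unfolding T_def by (intro continuous_on_vec_lambda continuous_intros)
  moreover have "T \<in> ?S \<rightarrow> ?S"
  proof
    fix \<mu> assume \<mu>: "\<mu> \<in> ?S"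
    have "(\<Sum>y\<in>UNIV. T \<mu> $ y) = (\<Sum>x\<in>UNIV. \<mu> $ x * (\<Sum>y\<in>UNIV. q x y))"
      unfolding T_def sum_distrib_left by (simp add: sum.swap[of "\<lambda>y x. \<mu> $ x * q x y"])
    then show "T \<mu> \<in> ?S"
      using \<mu> q0 by (auto simp: prob_simplex_def T_def q1 intro!: sum_nonneg)
  qed
  ultimately obtain \<mu> where \<mu>: "\<mu> \<in> ?S" "T \<mu> = \<mu>" using brouwer[of ?S T] by blast
  have st: "(\<Sum>x\<in>UNIV. \<mu> $ x * q x y) = \<mu> $ y" for y using \<mu>(2) by (simp add: T_def vec_eq_iff)
  have m0: "0 \<le> \<mu> $ x" for x using \<mu>(1) by (simp add: prob_simplexD)
  have step: "0 < \<mu> $ y" if "0 < \<mu> $ x" "(x, y) \<in> edges" for x y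
  proof -
    have "0 < \<mu> $ x * q x y" using that qpos by (simp add: edges_def)
    also have "\<mu> $ x * q x y \<le> (\<Sum>x\<in>UNIV. \<mu> $ x * q x y)"
      by (rule member_le_sum[of x UNIV "\<lambda>x. \<mu> $ x * q x y"]) (auto simp: m0 q0)
    finally show ?thesis by (simp add: st)
  qed
  obtain x1 where x1: "0 < \<mu> $ x1"
  proof -
    have "\<exists>x. \<mu> $ x \<noteq> 0"
    proof (rule ccontr)
      assume "\<not> ?thesis"
      then show False using prob_simplexD(2)[OF \<mu>(1)] by simp
    qed
    then show thesis using that m0 by (metis less_le)
  qed
  have mpos: "0 < \<mu> $ y" for y
    using edges_trancl[of x1 y] by (induction rule: trancl_induct) (use step x1 in auto)
  define \<kappa> where "\<kappa> = (\<chi> p. \<mu> $ fst p * q (fst p) (snd p))"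
  have mar: "marginal1 \<kappa> = \<mu>" "marginal2 \<kappa> = \<mu>"
    by (auto simp: vec_eq_iff marginal_nth \<kappa>_def q1 st simp flip: sum_distrib_left)
  show thesis
  proof (rule that)
    have "(\<Sum>p\<in>UNIV. \<kappa> $ p) = (\<Sum>x\<in>UNIV. marginal1 \<kappa> $ x)" by (simp add: sum_pairs marginal_nth)
    also have "\<dots> = 1" unfolding mar(1) by (rule prob_simplexD(2)[OF \<mu>(1)])
    finally have s: "(\<Sum>p\<in>UNIV. \<kappa> $ p) = 1" .
    moreover have "0 \<le> \<kappa> $ p" for p by (simp add: \<kappa>_def m0 q0)
    ultimately show "\<kappa> \<in> prob_simplex" by (simp add: prob_simplex_def)
    show "0 < \<kappa> $ (x, y) \<longleftrightarrow> 0 < Po x y" for x y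
      using mpos[of x] qpos[of x y] by (simp add: \<kappa>_def zero_less_mult_iff)
  qed (auto simp: mar mpos)
qed

end

section \<open>The upper bound\<close>

lemma balanced_of_cumulative:
  fixes \<zeta> :: "real \<Rightarrow> real ^ ('s::finite \<times> 's)"
  assumes \<zeta>: "simplex_path \<zeta>"
    and bal: "\<And>u. 0 \<le> u \<Longrightarrow> u \<le> 1 \<Longrightarrow> marginal1 (cumulative \<zeta> u) = marginal2 (cumulative \<zeta> u)"
  shows "AE u\<in>{0<..1} in lborel. marginal1 (\<zeta> u) = marginal2 (\<zeta> u)"
proof -
  have [measurable]: "(\<lambda>u. \<zeta> u $ p) \<in> borel_measurable borel" for p by (rule simplex_pathD(5)[OF \<zeta>])
  have s2: "marginal2 (\<zeta> u) $ x \<le> 1" "0 \<le> marginal2 (\<zeta> u) $ x" for u x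
  proof -
    have "(\<Sum>x\<in>UNIV. marginal2 (\<zeta> u) $ x) = (\<Sum>p\<in>UNIV. \<zeta> u $ p)"
      unfolding marginal_nth sum_pairs by (rule sum.swap)
    moreover have nn: "0 \<le> marginal2 (\<zeta> u) $ x" for x
      unfolding marginal_nth by (intro sum_nonneg simplex_pathD(3)[OF \<zeta>])
    ultimately have "marginal2 (\<zeta> u) \<in> prob_simplex"
      using prob_simplexD(2)[OF simplex_pathD(2)[OF \<zeta>], of u] by (simp add: prob_simplex_def)
    then show "marginal2 (\<zeta> u) $ x \<le> 1" "0 \<le> marginal2 (\<zeta> u) $ x" by (simp_all add: prob_simplexD)
  qed
  have "AE u\<in>{0<..1} in lborel. marginal1 (\<zeta> u) $ x = marginal2 (\<zeta> u) $ x" for x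
  proof (rule AE_eq_of_integral_Ioc_eq)
    fix u :: real assume u: "0 \<le> u" "u \<le> 1"
    have int: "integrable lborel (\<lambda>v. indicat_real {u<..1} v *\<^sub>R \<zeta> v $ p)" for p
      using simplex_path_integrable[OF \<zeta>, of "{u<..1}" p] by (simp add: set_integrable_def)
    have "(LINT v:{u<..1}|lborel. marginal1 (\<zeta> v) $ x) = (\<Sum>y\<in>UNIV. LINT v:{u<..1}|lborel. \<zeta> v $ (x, y))"
      unfolding marginal_nth set_lebesgue_integral_def scaleR_sum_right
      by (rule Bochner_Integration.integral_sum) (rule int)
    also have "\<dots> = marginal1 (cumulative \<zeta> 1) $ x - marginal1 (cumulative \<zeta> u) $ x"
      by (simp add: cumulative_diff[OF \<zeta> u, symmetric] marginal_nth sum_subtractf)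
    also have "\<dots> = marginal2 (cumulative \<zeta> 1) $ x - marginal2 (cumulative \<zeta> u) $ x"
      using bal[OF u] bal[of 1] by simp
    also have "\<dots> = (\<Sum>y\<in>UNIV. LINT v:{u<..1}|lborel. \<zeta> v $ (y, x))"
      by (simp add: cumulative_diff[OF \<zeta> u, symmetric] marginal_nth sum_subtractf)
    also have "\<dots> = (LINT v:{u<..1}|lborel. marginal2 (\<zeta> v) $ x)"
      unfolding marginal_nth set_lebesgue_integral_def scaleR_sum_right
      by (rule Bochner_Integration.integral_sum[symmetric]) (rule int)
    finally show "(LINT v:{u<..1}|lborel. marginal1 (\<zeta> v) $ x) = (LINT v:{u<..1}|lborel. marginal2 (\<zeta> v) $ x)" .
  qed (use s2 simplex_pathD(3,4)[OF simplex_path_marginal1[OF \<zeta>]] in \<open>auto simp: marginal_nth\<close>)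
  then have "AE u in lborel. \<forall>x. u \<in> {0<..1} \<longrightarrow> marginal1 (\<zeta> u) $ x = marginal2 (\<zeta> u) $ x"
    unfolding AE_all_countable by blast
  then show ?thesis by eventually_elim (auto simp: vec_eq_iff)
qed

lemma tendsto_one_over_nat: "0 < (e::real) \<Longrightarrow> \<exists>n0>0. \<forall>n\<ge>n0. 1 / real n < e"
proof -
  assume e: "0 < e"
  obtain n0 where n0: "1 / e < real n0" using reals_Archimedean2 by blast
  have p: "0 < n0" using n0 e by (metis gr0I less_asym of_nat_0 zero_less_divide_1_iff)
  have "1 / real n < e" if "n \<ge> n0" for n
  proof -
    have "1 / e < real n" "0 < real n" using n0 that p by auto
    then show ?thesis using e by (simp add: field_simps)
  qed
  then show ?thesis using p by blast
qed

text \<open>The pair counts of \<open>n\<close> transitions record the states 0, ..., n - 1 as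
  starting points, while the empirical measure also includes state \<open>n\<close>. One extra state
  moves a frequency by at most \<open>1 / n\<close>.\<close>

lemma emp_Suc_near:
  fixes x :: "nat \<Rightarrow> 's::finite"
  assumes "0 < n"
  shows "\<bar>(\<Sum>i<n. of_bool (x i = y)) / real n - emp x (Suc n) $ y\<bar> \<le> 1 / real n"
proof -
  have np: "0 < real n" using assms by simp
  define S where "S = (\<Sum>i<n. of_bool (x i = y) :: real)"
  have S: "0 \<le> S" "S \<le> real n"
    unfolding S_def using sum_mono[of "{..<n}" "\<lambda>i. of_bool (x i = y) :: real" "\<lambda>_. 1"] by (auto intro: sum_nonneg)
  have em: "emp x (Suc n) $ y = (S + of_bool (x n = y)) / real (Suc n)"
    by (simp add: emp_nth S_def)
  have "S / real n - emp x (Suc n) $ y = (S - real n * of_bool (x n = y)) / (real n * real (Suc n))"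
    unfolding em using np by (simp add: field_simps)
  then have "\<bar>S / real n - emp x (Suc n) $ y\<bar> = \<bar>S - real n * of_bool (x n = y)\<bar> / (real n * real (Suc n))"
    by (simp add: abs_mult)
  also have "\<dots> \<le> real n / (real n * real (Suc n))"
    using S by (intro divide_right_mono) (auto simp: of_bool_def)
  also have "\<dots> = 1 / real (Suc n)" using np by simp
  also have "\<dots> \<le> 1 / real n" using np by (intro frac_le) auto
  finally show ?thesis by (simp add: S_def)
qed

section \<open>Exponential decay near a single path function\<close>

context afp_chain
begin

text \<open>Where the constraints fail, \<open>\<zeta>\<close> is replaced by
  \<open>\<kappa>\<close>, which satisfies them. Within (0, 1] this changes a null set, invisible to
  the integrals and to the cost, and the constraints then hold at every point.\<close>

lemma admissible_version:
  fixes \<zeta> :: "real \<Rightarrow> real ^ ('s \<times> 's)"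
  assumes \<zeta>: "simplex_path \<zeta>"
    and ae1: "AE u\<in>{0<..1} in lborel. marginal1 (\<zeta> u) = marginal2 (\<zeta> u)"
    and ae2: "AE u\<in>{0<..1} in lborel. \<forall>p\<in>- adj_support (afp_adjacency P). \<zeta> u $ p = 0"
  obtains \<xi> where "simplex_path \<xi>" "\<forall>u. marginal1 (\<xi> u) = marginal2 (\<xi> u)"
    "\<forall>u. \<forall>p\<in>- adj_support (afp_adjacency P). \<xi> u $ p = 0"
    "\<And>u. u \<le> 1 \<Longrightarrow> cumulative \<xi> u = cumulative \<zeta> u" "path_cost G \<xi> = path_cost G \<zeta>"
proof -
  let ?A = "afp_adjacency P"
  obtain \<kappa> :: "real ^ ('s \<times> 's)" where \<kappa>: "\<kappa> \<in> prob_simplex" "marginal1 \<kappa> = marginal2 \<kappa>"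
    "\<And>x y. 0 < \<kappa> $ (x, y) \<longleftrightarrow> 0 < Po x y"
    using stationary_pair_measure by metis
  have \<kappa>0: "\<kappa> $ p = 0" if p: "p \<in> - adj_support ?A" for p
  proof -
    obtain x y where xy: "p = (x, y)" by (cases p) auto
    have "\<not> 0 < Po x y" using p P_bounds(1)[of "Some x" None] by (auto simp: xy adj_support_iff)
    then show ?thesis using \<kappa>(3)[of x y] prob_simplexD(1)[OF \<kappa>(1), of p] by (simp add: xy)
  qed
  let ?good = "\<lambda>u. marginal1 (\<zeta> u) = marginal2 (\<zeta> u) \<and> (\<forall>p\<in>- adj_support ?A. \<zeta> u $ p = 0)"
  define \<xi> where "\<xi> = (\<lambda>u. if ?good u then \<zeta> u else \<kappa>)"
  have [measurable]: "\<zeta> \<in> borel_measurable borel" by (rule simplex_pathD(1)[OF \<zeta>])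
  have "{u. ?good u} \<in> sets borel" unfolding vec_eq_iff marginal_nth by measurable
  then have "{u \<in> space borel. ?good u} \<in> sets borel" by simp
  then have "\<xi> \<in> borel_measurable borel"
    unfolding \<xi>_def by (intro measurable_If) simp_all
  then have \<xi>: "simplex_path \<xi>" using \<kappa>(1) simplex_pathD(2)[OF \<zeta>] by (simp add: simplex_path_def \<xi>_def)
  have ae: "AE u in lborel. u \<in> {0<..1} \<longrightarrow> \<xi> u = \<zeta> u"
    using ae1 ae2 by eventually_elim (auto simp: \<xi>_def)
  have ce: "cumulative \<xi> u = cumulative \<zeta> u" if "u \<le> 1" for u
    unfolding cumulative_def set_lebesgue_integral_def vec_eq_iff vec_lambda_beta
  proof
    fix p
    have "AE v in lborel. indicat_real {0<..u} v *\<^sub>R \<xi> v $ p = indicat_real {0<..u} v *\<^sub>R \<zeta> v $ p"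
      using ae by eventually_elim (use that in \<open>auto simp: indicator_def\<close>)
    then show "(\<integral>v. indicat_real {0<..u} v *\<^sub>R \<xi> v $ p \<partial>lborel) = (\<integral>v. indicat_real {0<..u} v *\<^sub>R \<zeta> v $ p \<partial>lborel)"
      using simplex_pathD(5)[OF \<zeta>] simplex_pathD(5)[OF \<xi>] by (intro integral_cong_AE) auto
  qed
  have pe: "path_cost G \<xi> = path_cost G \<zeta>"
    unfolding path_cost_def
  proof (rule nn_integral_cong_AE)
    show "AE u in lborel. step_cost G (\<xi> u) ((1 / u) *\<^sub>R marginal1 (cumulative \<xi> u)) * indicator {0<..1} u =
      step_cost G (\<zeta> u) ((1 / u) *\<^sub>R marginal1 (cumulative \<zeta> u)) * indicator {0<..1} u"
      using ae by eventually_elim (auto simp: indicator_def ce)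
  qed
  show thesis
    by (rule that[OF \<xi> _ _ ce pe]) (use \<kappa>(2) \<kappa>0 in \<open>auto simp: \<xi>_def\<close>)
qed

text \<open>Used in contrapositive form: if the rate at \<open>m\<close> exceeds \<open>a\<close>,
  every candidate limit \<open>N\<close> violates one of these hypotheses. Each of them concerns
  finitely many values of \<open>N\<close>, so its violation is visible in a neighbourhood.\<close>

lemma rate_function_le_of_block_sums:
  fixes N :: "real \<times> ('s \<times> 's) \<Rightarrow> real"
  assumes nn: "\<And>i. 0 \<le> N i"
    and mono: "\<And>u v p. 0 \<le> u \<Longrightarrow> u \<le> v \<Longrightarrow> v \<le> 1 \<Longrightarrow> N (u, p) \<le> N (v, p)"
    and sum: "\<And>u. 0 \<le> u \<Longrightarrow> u \<le> 1 \<Longrightarrow> (\<Sum>p\<in>UNIV. N (u, p)) = u"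
    and bal: "\<And>u y. 0 \<le> u \<Longrightarrow> u \<le> 1 \<Longrightarrow> (\<Sum>z\<in>UNIV. N (u, (y, z))) = (\<Sum>z\<in>UNIV. N (u, (z, y)))"
    and m: "\<And>y. (\<Sum>z\<in>UNIV. N (1, (y, z))) = m $ y"
    and H: "\<And>K \<delta> q. 0 < K \<Longrightarrow> 0 < \<delta> \<Longrightarrow> stochastic_pos q \<Longrightarrow> block_sum K \<delta> q (vec_path N) (vec_path N) \<le> a"
  shows "rate_function (afp_adjacency P) G m \<le> ennreal a"
proof -
  let ?A = "afp_adjacency P"
  obtain \<zeta> where \<zeta>: "simplex_path \<zeta>"
    and cum: "\<And>u p. 0 \<le> u \<Longrightarrow> u \<le> 1 \<Longrightarrow> cumulative \<zeta> u $ p = N (u, p)"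
    using simplex_path_of_monotone[of "\<lambda>u p. N (u, p)"] nn mono sum by metis
  have cv: "cumulative \<zeta> u = vec_path N u" if "0 \<le> u" "u \<le> 1" for u
    using cum[OF that] by (simp add: vec_eq_iff vec_path_def)
  have bs: "block_sum K \<delta> q (cumulative \<zeta>) (cumulative \<zeta>) = block_sum K \<delta> q (vec_path N) (vec_path N)" if "0 < K" for K \<delta> q
  proof -
    have "cumulative \<zeta> (real (Suc b) / K) = vec_path N (real (Suc b) / K)"
      "cumulative \<zeta> (real b / K) = vec_path N (real b / K)" if "b \<in> {1..<K}" for b
      using that by (intro cv; simp)+
    then show ?thesis unfolding block_sum_def by (intro sum.cong refl) (simp del: of_nat_Suc)
  qed
  have cost: "path_cost G \<zeta> \<le> ennreal a"
    by (rule path_cost_le[OF \<zeta>]) (simp add: bs H)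
  have ae1: "AE u\<in>{0<..1} in lborel. marginal1 (\<zeta> u) = marginal2 (\<zeta> u)"
  proof (rule balanced_of_cumulative[OF \<zeta>])
    fix u :: real assume "0 \<le> u" "u \<le> 1"
    then show "marginal1 (cumulative \<zeta> u) = marginal2 (cumulative \<zeta> u)"
      by (simp add: cv vec_eq_iff marginal_nth vec_path_def bal)
  qed
  have ae2: "AE u\<in>{0<..1} in lborel. \<forall>p\<in>- adj_support ?A. \<zeta> u $ p = 0"
  proof -
    have "path_cost G \<zeta> \<noteq> \<infinity>" using cost by (auto simp: top_unique)
    then have "AE u in lborel. step_cost G (\<zeta> u) ((1 / u) *\<^sub>R marginal1 (cumulative \<zeta> u)) * indicator {0<..1} u \<noteq> \<infinity>"
      unfolding path_cost_def by (intro nn_integral_PInf_AE) (use step_cost_measurable[OF \<zeta>] in auto)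
    then show ?thesis
    proof eventually_elim
      fix u assume fin: "step_cost G (\<zeta> u) ((1 / u) *\<^sub>R marginal1 (cumulative \<zeta> u)) * indicator {0<..1} u \<noteq> \<infinity>"
      show "u \<in> {0<..1} \<longrightarrow> (\<forall>p\<in>- adj_support ?A. \<zeta> u $ p = 0)"
      proof (intro impI ballI)
        fix p assume u: "u \<in> {0<..1}" and p: "p \<in> - adj_support ?A"
        have K: "transition_kernel (G ((1 / u) *\<^sub>R marginal1 (cumulative \<zeta> u)))"
          using u by (intro kernel_G average_marginal_simplex[OF \<zeta>]) auto
        obtain x y where xy: "p = (x, y)" by (cases p) auto
        show "\<zeta> u $ p = 0"
          using fin u step_cost_eq[where G=G, OF simplex_pathD(2)[OF \<zeta>] K] G_off_support[of x y] p
          by (auto simp: xy split: if_splits)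
      qed
    qed
  qed
  obtain \<xi> where \<xi>: "simplex_path \<xi>" "\<forall>u. marginal1 (\<xi> u) = marginal2 (\<xi> u)"
    "\<forall>u. \<forall>p\<in>- adj_support ?A. \<xi> u $ p = 0"
    and ce: "\<And>u. u \<le> 1 \<Longrightarrow> cumulative \<xi> u = cumulative \<zeta> u" and pe: "path_cost G \<xi> = path_cost G \<zeta>"
    using admissible_version[OF \<zeta> ae1 ae2] by metis
  have "m = marginal1 (cumulative \<xi> 1)"
    by (simp add: ce cv vec_eq_iff marginal_nth vec_path_def m)
  then have "rate_function ?A G m \<le> path_cost G \<xi>"
    using rate_function_le_path_cost[OF \<xi> step_cost_measurable[OF \<xi>(1)]] by simp
  then show ?thesis using pe cost by simp
qed

definition local_bound :: "'s \<Rightarrow> real ^ 's \<Rightarrow> real \<Rightarrow> (real \<times> ('s \<times> 's) \<Rightarrow> real) set \<Rightarrow> real \<Rightarrow> nat \<Rightarrow> bool" where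
  "local_bound x0 m a W \<rho> n0 \<longleftrightarrow> open W \<and> 0 < \<rho> \<and>
    (\<forall>n\<ge>n0. path_exp (self_kernel G) x0 n (\<lambda>x. of_bool (pair_path n x \<in> W \<and> dist (emp x (Suc n)) m < \<rho>))
      \<le> exp (- real n * a))"

lemma local_bound_impossible:
  assumes "open W" "0 < \<rho>" "\<And>n x. n \<ge> n0 \<Longrightarrow> pair_path n x \<in> W \<Longrightarrow> dist (emp x (Suc n)) m < \<rho> \<Longrightarrow> False"
  shows "local_bound x0 m a W \<rho> n0"
proof -
  have "path_exp (self_kernel G) x0 n (\<lambda>x. of_bool (pair_path n x \<in> W \<and> dist (emp x (Suc n)) m < \<rho>)) \<le> exp (- real n * a)"
    if "n \<ge> n0" for n
  proof -
    have z: "(\<lambda>x. of_bool (pair_path n x \<in> W \<and> dist (emp x (Suc n)) m < \<rho>)) = (\<lambda>x. 0 * 0 :: real)"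
      using assms(3)[OF that] by (auto simp: fun_eq_iff)
    show ?thesis unfolding z path_exp_cmult by simp
  qed
  then show ?thesis using assms by (simp add: local_bound_def)
qed

text \<open>A violated structural constraint persists near \<open>N\<close>, whereas pair paths are
  exactly monotone and satisfy the other constraints up to \<open>1 / n\<close>, together with the
  distance to \<open>m\<close> for the end point. Hence for large \<open>n\<close> they cannot
  enter. If instead a block sum exceeds \<open>a\<close>, this also persists near \<open>N\<close>,
  and the change of measure gives the decay.\<close>

lemma local_neighbourhood:
  fixes N :: "real \<times> ('s \<times> 's) \<Rightarrow> real"
  assumes a: "ennreal a < rate_function (afp_adjacency P) G m" and nn: "\<And>i. 0 \<le> N i"
  shows "\<exists>W \<rho> n0. N \<in> W \<and> local_bound x0 m a W \<rho> n0"
proof -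
  have ev: "continuous_on UNIV (\<lambda>N :: real \<times> ('s \<times> 's) \<Rightarrow> real. N i)" for i by simp
  consider
      u v p where "0 \<le> u" "u \<le> v" "v \<le> 1" "N (v, p) < N (u, p)"
    | u where "0 \<le> u" "u \<le> 1" "(\<Sum>p\<in>UNIV. N (u, p)) \<noteq> u"
    | u y where "0 \<le> u" "u \<le> 1" "(\<Sum>z\<in>UNIV. N (u, (y, z))) \<noteq> (\<Sum>z\<in>UNIV. N (u, (z, y)))"
    | y where "(\<Sum>z\<in>UNIV. N (1, (y, z))) \<noteq> m $ y"
    | K \<delta> q where "0 < K" "0 < \<delta>" "stochastic_pos q" "a < block_sum K \<delta> q (vec_path N) (vec_path N)"
  proof (atomize_elim, rule ccontr, goal_cases)
    case 1
    have m1: "N (u, p) \<le> N (v, p)" if "0 \<le> u" "u \<le> v" "v \<le> 1" for u v p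
      using 1 that by (meson not_le)
    have m2: "(\<Sum>p\<in>UNIV. N (u, p)) = u" if "0 \<le> u" "u \<le> 1" for u
      using 1 that by meson
    have m3: "(\<Sum>z\<in>UNIV. N (u, (y, z))) = (\<Sum>z\<in>UNIV. N (u, (z, y)))" if "0 \<le> u" "u \<le> 1" for u y
      using 1 that by meson
    have m4: "(\<Sum>z\<in>UNIV. N (1, (y, z))) = m $ y" for y
      using 1 by meson
    have m5: "block_sum K \<delta> q (vec_path N) (vec_path N) \<le> a" if "0 < K" "0 < \<delta>" "stochastic_pos q" for K \<delta> q
      using 1 that by (meson not_le)
    have "rate_function (afp_adjacency P) G m \<le> ennreal a"
      by (rule rate_function_le_of_block_sums[OF nn m1 m2 m3 m4 m5]) assumption+
    then show False using a by simp
  qed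
  moreover have ex: "\<exists>W \<rho> n0. N \<in> W \<and> local_bound x0 m a W \<rho> n0" if "local_bound x0 m a W \<rho> n0" "N \<in> W" for W \<rho> n0
    using that by blast
  ultimately show ?thesis
  proof cases
    case (1 u v p)
    have "local_bound x0 m a {N. N (v, p) < N (u, p)} 1 0"
    proof (rule local_bound_impossible)
      fix n x assume "pair_path n x \<in> {N. N (v, p) < N (u, p)}"
      then show False using pair_path_mono[OF 1(1,2), of n x p] by simp
    qed (auto intro!: open_Collect_less ev)
    moreover have "N \<in> {N. N (v, p) < N (u, p)}" using 1 by simp
    ultimately show ?thesis by (rule ex)
  next
    case (2 u)
    define e where "e = \<bar>(\<Sum>p\<in>UNIV. N (u, p)) - u\<bar> / 2"
    have e: "0 < e" using 2 by (simp add: e_def)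
    obtain n0 where n0: "0 < n0" "\<And>n. n \<ge> n0 \<Longrightarrow> 1 / real n < e" using tendsto_one_over_nat[OF e] by blast
    have "local_bound x0 m a {N. e < \<bar>(\<Sum>p\<in>UNIV. N (u, p)) - u\<bar>} 1 n0"
    proof (rule local_bound_impossible)
      fix n and x :: "nat \<Rightarrow> 's" assume n: "n \<ge> n0" and *: "pair_path n x \<in> {N. e < \<bar>(\<Sum>p\<in>UNIV. N (u, p)) - u\<bar>}"
      have np: "0 < real n" using n n0 by simp
      have "0 \<le> real n * u" using 2 by simp
      then have "\<bar>real (nat \<lfloor>real n * u\<rfloor>) - real n * u\<bar> \<le> 1" by linarith
      then have "\<bar>real (nat \<lfloor>real n * u\<rfloor>) - real n * u\<bar> / real n \<le> 1 / real n" using np by (intro divide_right_mono) auto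
      also have "\<bar>real (nat \<lfloor>real n * u\<rfloor>) - real n * u\<bar> / real n = \<bar>real (nat \<lfloor>real n * u\<rfloor>) / real n - u\<bar>"
      proof -
        have eq: "real (nat \<lfloor>real n * u\<rfloor>) / real n - u = (real (nat \<lfloor>real n * u\<rfloor>) - real n * u) / real n"
          using np by (simp add: diff_divide_distrib)
        show ?thesis unfolding eq abs_divide by simp
      qed
      finally have "\<bar>(\<Sum>p\<in>UNIV. pair_path n x (u, p)) - u\<bar> \<le> 1 / real n"
        using 2 by (simp add: pair_path_marginals(3) min_def)
      then show False using * n0(2)[OF n] by simp
    qed (auto intro!: open_Collect_less continuous_intros ev)
    moreover have "N \<in> {N. e < \<bar>(\<Sum>p\<in>UNIV. N (u, p)) - u\<bar>}" using e by (simp add: e_def)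
    ultimately show ?thesis by (rule ex)
  next
    case (3 u y)
    let ?D = "\<lambda>N. \<bar>(\<Sum>z\<in>UNIV. N (u, (y, z))) - (\<Sum>z\<in>UNIV. N (u, (z, y)))\<bar> :: real"
    define e where "e = ?D N / 2"
    have e: "0 < e" using 3 by (simp add: e_def)
    obtain n0 where n0: "0 < n0" "\<And>n. n \<ge> n0 \<Longrightarrow> 1 / real n < e" using tendsto_one_over_nat[OF e] by blast
    have "local_bound x0 m a {N. e < ?D N} 1 n0"
    proof (rule local_bound_impossible)
      fix n and x :: "nat \<Rightarrow> 's" assume n: "n \<ge> n0" and *: "pair_path n x \<in> {N. e < ?D N}"
      have np: "0 < real n" using n n0 by simp
      let ?k = "nat \<lfloor>real n * min 1 u\<rfloor>"
      \<comment> \<open>Departures from \<open>y\<close> and arrivals at \<open>y\<close> differ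
        only by the first and the last state.\<close>
      have "(\<Sum>i<?k. of_bool (x i = y)) - (\<Sum>i<?k. of_bool (x (Suc i) = y)) = (of_bool (x 0 = y) - of_bool (x ?k = y) :: real)"
        unfolding sum_subtractf[symmetric] by (rule sum_lessThan_telescope')
      then have "\<bar>(\<Sum>i<?k. of_bool (x i = y)) - (\<Sum>i<?k. of_bool (x (Suc i) = y))\<bar> \<le> (1 :: real)" by simp
      then have "\<bar>(\<Sum>i<?k. of_bool (x i = y)) - (\<Sum>i<?k. of_bool (x (Suc i) = y))\<bar> / real n \<le> 1 / real n"
        using np by (intro divide_right_mono) auto
      then have "?D (pair_path n x) \<le> 1 / real n"
        using np by (simp only: pair_path_marginals(1,2) diff_divide_distrib[symmetric] abs_divide abs_of_pos)
      then show False using * n0(2)[OF n] by simp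
    qed (auto intro!: open_Collect_less continuous_intros ev)
    moreover have "N \<in> {N. e < ?D N}" using e by (simp add: e_def)
    ultimately show ?thesis by (rule ex)
  next
    case (4 y)
    let ?D = "\<lambda>N. \<bar>(\<Sum>z\<in>UNIV. N (1, (y, z))) - m $ y\<bar> :: real"
    \<comment> \<open>A third of the defect: the ball around \<open>m\<close> uses up one
      \<open>e\<close>, the additional state of the empirical measure less than another.\<close>
    define e where "e = ?D N / 3"
    have e: "0 < e" using 4 by (simp add: e_def)
    obtain n0 where n0: "0 < n0" "\<And>n. n \<ge> n0 \<Longrightarrow> 1 / real n < e" using tendsto_one_over_nat[OF e] by blast
    have "local_bound x0 m a {N. 2 * e < ?D N} e n0"
    proof (rule local_bound_impossible)
      fix n and x :: "nat \<Rightarrow> 's" assume n: "n \<ge> n0" and *: "pair_path n x \<in> {N. 2 * e < ?D N}"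
        and d: "dist (emp x (Suc n)) m < e"
      have np: "0 < real n" using n n0 by simp
      have pp: "(\<Sum>z\<in>UNIV. pair_path n x (1, (y, z))) = (\<Sum>i<n. of_bool (x i = y)) / real n"
        by (simp add: pair_path_marginals(1))
      have "\<bar>(\<Sum>i<n. of_bool (x i = y)) / real n - emp x (Suc n) $ y\<bar> \<le> 1 / real n"
        by (rule emp_Suc_near) (use np in simp)
      moreover have "\<bar>emp x (Suc n) $ y - m $ y\<bar> < e"
        using d component_le_norm_cart[of "emp x (Suc n) - m" y] by (simp add: dist_norm)
      ultimately have "?D (pair_path n x) < 2 * e" using n0(2)[OF n] unfolding pp by linarith
      then show False using * by simp
    qed (use e in \<open>auto intro!: open_Collect_less continuous_intros ev\<close>)
    moreover have "N \<in> {N. 2 * e < ?D N}" using e by (simp add: e_def)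
    ultimately show ?thesis by (rule ex)
  next
    case (5 K \<delta> q)
    let ?m = "\<lambda>N b y. (real K / real b) * (\<Sum>z\<in>UNIV. N (real (Suc b) / real K, (y, z))) :: real"
    \<comment> \<open>Besides the block sum the neighbourhood controls the averages from above,
      because the kernel of the chain has to be dominated by the raised kernel at
      \<open>N\<close>.\<close>
    define W where "W = (\<Inter>b\<in>{1..<K}. \<Inter>y. {N'. ?m N' b y < ?m N b y + \<delta>}) \<inter>
       {N'. a < block_sum K \<delta> q (vec_path N') (vec_path N)}"
    have mm: "?m N' b y = (real K / real b) * marginal1 (vec_path N' (real (Suc b) / K)) $ y" for N' b y
      by (simp add: marginal_nth vec_path_def)
    have "open W" unfolding W_def block_sum_def vec_path_def vec_lambda_beta
      by (intro open_Int open_INT ballI finite open_Collect_less continuous_intros ev) auto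
    moreover have "N \<in> W" using 5 by (simp add: W_def)
    moreover have "path_exp (self_kernel G) x0 n (\<lambda>x. of_bool (pair_path n x \<in> W \<and> dist (emp x (Suc n)) m < 1)) \<le> exp (- real n * a)"
      if "n \<ge> 1" for n
    proof (rule block_change_of_measure[OF 5(1,2,3)])
      show "0 < n" using that by simp
      show "0 \<le> vec_path N u $ p" for u p by (simp add: vec_path_def nn)
      show "(real K / real b) * marginal1 (vec_path (pair_path n x) (real (Suc b) / K)) $ y
         \<le> (real K / real b) * marginal1 (vec_path N (real (Suc b) / K)) $ y + \<delta>"
        if "pair_path n x \<in> W \<and> dist (emp x (Suc n)) m < 1" "b \<in> {1..<K}" for x b y
        using that unfolding mm[symmetric] W_def by (auto intro: less_imp_le)
      show "a \<le> block_sum K \<delta> q (vec_path (pair_path n x)) (vec_path N)"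
        if "pair_path n x \<in> W \<and> dist (emp x (Suc n)) m < 1" for x
        using that unfolding W_def by auto
    qed
    ultimately have "local_bound x0 m a W 1 1" "N \<in> W" by (simp_all add: local_bound_def)
    then show ?thesis by (rule ex)
  qed
qed

lemma compact_unit_cube: "compact {N :: 'i \<Rightarrow> real. \<forall>i. 0 \<le> N i \<and> N i \<le> 1}"
proof -
  have "compactin (product_topology (\<lambda>i. euclidean) UNIV) (PiE UNIV (\<lambda>i :: 'i. {0..1 :: real}))"
    by (subst compactin_PiE) auto
  moreover have "PiE UNIV (\<lambda>i :: 'i. {0..1 :: real}) = {N. \<forall>i. 0 \<le> N i \<and> N i \<le> 1}"
    by (auto simp: PiE_def Pi_def)
  ultimately show ?thesis by (simp add: euclidean_product_topology)
qed

text \<open>The pair paths lie in the compact unit cube, so finitely many neighbourhoods cover them.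
  Their number enters only as the prefactor \<open>r\<close>, which is invisible on the exponential
  scale.\<close>

lemma local_upper_bound:
  assumes a: "ennreal a < rate_function (afp_adjacency P) G m"
  shows "\<exists>\<rho>>0. \<exists>r n0. \<forall>n\<ge>n0. path_exp (self_kernel G) x0 n (\<lambda>x. of_bool (dist (emp x (Suc n)) m < \<rho>))
    \<le> real r * exp (- real n * a)"
proof -
  define C where "C = {N :: real \<times> ('s \<times> 's) \<Rightarrow> real. \<forall>i. 0 \<le> N i \<and> N i \<le> 1}"
  have C: "compact C" unfolding C_def by (rule compact_unit_cube)
  have "\<exists>W \<rho> n0. N \<in> W \<and> local_bound x0 m a W \<rho> n0" if "N \<in> C" for N
    by (rule local_neighbourhood[OF a]) (use that in \<open>unfold C_def, blast\<close>)
  then obtain W \<rho> n0 where W: "\<And>N. N \<in> C \<Longrightarrow> N \<in> W N"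
    "\<And>N. N \<in> C \<Longrightarrow> local_bound x0 m a (W N) (\<rho> N) (n0 N)" by metis
  have op: "\<And>N. N \<in> C \<Longrightarrow> open (W N)" using W(2) by (simp add: local_bound_def)
  have cov: "C \<subseteq> (\<Union>N\<in>C. W N)" using W(1) by blast
  obtain F where F: "F \<subseteq> C" "finite F" "C \<subseteq> (\<Union>N\<in>F. W N)"
    by (rule compactE_image[OF C op cov]) blast+
  have ne: "F \<noteq> {}"
  proof
    assume "F = {}"
    then have "C = {}" using F(3) by simp
    moreover have "(\<lambda>_. 0) \<in> C" by (simp add: C_def)
    ultimately show False by blast
  qed
  define R where "R = Min (\<rho> ` F)"
  define n1 where "n1 = Max (n0 ` F)"
  have R: "0 < R" unfolding R_def
  proof (subst Min_gr_iff)
    show "\<forall>a\<in>\<rho> ` F. 0 < a" using F(1) W(2) by (auto simp: local_bound_def)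
  qed (use F ne in auto)
  have "path_exp (self_kernel G) x0 n (\<lambda>x. of_bool (dist (emp x (Suc n)) m < R)) \<le> real (card F) * exp (- real n * a)"
    if n: "n \<ge> n1" for n
  proof -
    have pt: "of_bool (dist (emp x (Suc n)) m < R) \<le> (\<Sum>N\<in>F. of_bool (pair_path n x \<in> W N \<and> dist (emp x (Suc n)) m < \<rho> N) :: real)" for x
    proof (cases "dist (emp x (Suc n)) m < R")
      case True
      have "pair_path n x \<in> C" unfolding C_def by (intro CollectI allI conjI pair_path_range)
      then obtain N where N: "N \<in> F" "pair_path n x \<in> W N" using F(3) by blast
      have "R \<le> \<rho> N" unfolding R_def using N F by auto
      then have "pair_path n x \<in> W N \<and> dist (emp x (Suc n)) m < \<rho> N" using True N by auto
      then show ?thesis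
        using member_le_sum[of N F "\<lambda>N. of_bool (pair_path n x \<in> W N \<and> dist (emp x (Suc n)) m < \<rho> N) :: real"] N F True by simp
    qed (auto intro: sum_nonneg)
    have "path_exp (self_kernel G) x0 n (\<lambda>x. of_bool (dist (emp x (Suc n)) m < R))
      \<le> path_exp (self_kernel G) x0 n (\<lambda>x. \<Sum>N\<in>F. of_bool (pair_path n x \<in> W N \<and> dist (emp x (Suc n)) m < \<rho> N))"
      by (rule path_exp_mono[OF self_kernel_nonneg pt])
    also have "\<dots> = (\<Sum>N\<in>F. path_exp (self_kernel G) x0 n (\<lambda>x. of_bool (pair_path n x \<in> W N \<and> dist (emp x (Suc n)) m < \<rho> N)))"
      by (rule path_exp_sum[OF F(2)])
    also have "\<dots> \<le> (\<Sum>N\<in>F. exp (- real n * a))"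
    proof (rule sum_mono)
      fix N assume N: "N \<in> F"
      have "n0 N \<le> n1" unfolding n1_def using N F by auto
      then show "path_exp (self_kernel G) x0 n (\<lambda>x. of_bool (pair_path n x \<in> W N \<and> dist (emp x (Suc n)) m < \<rho> N)) \<le> exp (- real n * a)"
        using W(2)[of N] N F(1) n by (auto simp: local_bound_def)
    qed
    finally show ?thesis by simp
  qed
  then show ?thesis using R by blast
qed

end

section \<open>A law of large numbers for block Markov chains\<close>

text \<open>Adding the mean to \<open>h - q h\<close> makes the map injective, so it is onto by finite dimension.\<close>

lemma poisson_equation:
  fixes \<nu> :: "real ^ ('s::finite \<times> 's)"
  assumes \<nu>: "\<nu> \<in> prob_simplex" and bal: "marginal1 \<nu> = marginal2 \<nu>"
    and E: "\<And>x y. (x, y) \<in> E \<Longrightarrow> 0 < \<nu> $ (x, y)" and irr: "\<And>x y. (x, y) \<in> E\<^sup>+"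
    and pos: "\<And>x. 0 < marginal1 \<nu> $ x"
    and f: "(\<Sum>x\<in>UNIV. marginal1 \<nu> $ x * f x) = 0"
  obtains h :: "'s \<Rightarrow> real" where "\<And>x. h x - (\<Sum>y\<in>UNIV. conditional \<nu> x $ y * h y) = f x"
proof -
  let ?q = "\<lambda>x y. conditional \<nu> x $ y"
  have n0: "0 \<le> \<nu> $ p" for p using \<nu> by (simp add: prob_simplexD)
  have q0: "0 \<le> ?q x y" for x y using n0 pos[of x] by (simp add: conditional_nth)
  have q1: "(\<Sum>y\<in>UNIV. ?q x y) = 1" for x
    unfolding conditional_nth sum_divide_distrib[symmetric] marginal_nth[symmetric] using pos[of x] by simp
  have mq: "marginal1 \<nu> $ x * ?q x y = \<nu> $ (x, y)" for x y
    using pos[of x] by (simp add: conditional_nth)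
  define T where "T = (\<lambda>h :: real ^ 's. \<chi> x. h $ x - (\<Sum>y\<in>UNIV. ?q x y * h $ y) + (\<Sum>z\<in>UNIV. marginal1 \<nu> $ z * h $ z))"
  have lin: "linear T"
    by (rule linearI)
       (auto simp: T_def vec_eq_iff algebra_simps sum.distrib sum_distrib_left)
  \<comment> \<open>By stationarity \<open>h\<close> and \<open>q h\<close> have the same mean, so
    \<open>T\<close> preserves the mean. A solution for a right-hand side of mean 0 thus has mean 0,
    and the added term drops out.\<close>
  have mean: "(\<Sum>x\<in>UNIV. marginal1 \<nu> $ x * T h $ x) = (\<Sum>z\<in>UNIV. marginal1 \<nu> $ z * h $ z)" for h
  proof -
    let ?m = "\<Sum>z\<in>UNIV. marginal1 \<nu> $ z * h $ z"
    have "(\<Sum>x\<in>UNIV. marginal1 \<nu> $ x * (\<Sum>y\<in>UNIV. ?q x y * h $ y)) = (\<Sum>x\<in>UNIV. \<Sum>y\<in>UNIV. \<nu> $ (x, y) * h $ y)"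
      by (simp add: sum_distrib_left mq flip: mult.assoc)
    also have "\<dots> = (\<Sum>y\<in>UNIV. marginal2 \<nu> $ y * h $ y)"
      by (subst sum.swap) (simp add: marginal_nth sum_distrib_right)
    finally have a: "(\<Sum>x\<in>UNIV. marginal1 \<nu> $ x * (\<Sum>y\<in>UNIV. ?q x y * h $ y)) = ?m" by (simp add: bal)
    have b: "(\<Sum>x\<in>UNIV. marginal1 \<nu> $ x * ?m) = ?m"
      using prob_simplexD(2)[OF marginal1_simplex[OF \<nu>]] by (simp flip: sum_distrib_right)
    have "(\<Sum>x\<in>UNIV. marginal1 \<nu> $ x * T h $ x)
      = (\<Sum>x\<in>UNIV. marginal1 \<nu> $ x * h $ x - marginal1 \<nu> $ x * (\<Sum>y\<in>UNIV. ?q x y * h $ y) + marginal1 \<nu> $ x * ?m)"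
      by (simp add: T_def algebra_simps)
    also have "\<dots> = ?m - ?m + ?m" by (simp only: sum.distrib sum_subtractf a b)
    finally show ?thesis by simp
  qed
  have inj: "h = 0" if h: "T h = 0" for h
  proof -
    have m0: "(\<Sum>z\<in>UNIV. marginal1 \<nu> $ z * h $ z) = 0" using mean[of h] h by simp
    then have hq: "h $ x = (\<Sum>y\<in>UNIV. ?q x y * h $ y)" for x
    proof -
      have "T h $ x = 0" using h by simp
      then show ?thesis using m0 by (simp add: T_def)
    qed
    \<comment> \<open>Maximum principle: a function equal to its own average can attain its maximum
      at \<open>x\<close> only if it does so at all successors of \<open>x\<close>, so
      irreducibility makes it constant, and mean 0 makes it 0.\<close>
    define c where "c = Max (range (\<lambda>x. h $ x))"
    have le: "h $ x \<le> c" for x unfolding c_def by (intro Max_ge) auto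
    have "c \<in> range (\<lambda>x. h $ x)" unfolding c_def by (intro Max_in) auto
    then obtain x1 where x1: "h $ x1 = c" by auto
    have step: "h $ y = c" if x: "h $ x = c" and xy: "(x, y) \<in> E" for x y
    proof (rule ccontr)
      assume "h $ y \<noteq> c"
      then have lt: "h $ y < c" using le[of y] by simp
      have qp: "0 < ?q x y" using E[OF xy] pos[of x] by (simp add: conditional_nth)
      have "h $ x = (\<Sum>y\<in>UNIV. ?q x y * h $ y)" by (rule hq)
      also have "\<dots> < (\<Sum>y\<in>UNIV. ?q x y * c)"
        by (rule sum_strict_mono_ex1) (use lt qp q0 le in \<open>auto intro!: mult_left_mono mult_strict_left_mono exI[of _ y]\<close>)
      also have "\<dots> = c" using q1[of x] by (simp flip: sum_distrib_right)
      finally show False using x by simp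
    qed
    have all: "h $ y = c" for y
      using irr[of x1 y] by (induction rule: trancl_induct) (use step x1 in blast)+
    have "(\<Sum>z\<in>UNIV. marginal1 \<nu> $ z * c) = c"
      using prob_simplexD(2)[OF marginal1_simplex[OF \<nu>]] by (simp flip: sum_distrib_right)
    then have "c = 0" using m0 by (simp add: all)
    then show "h = 0" by (simp add: vec_eq_iff all)
  qed
  have "inj T" using linear_injective_0[OF lin] inj by blast
  then have "surj T" by (rule linear_injective_imp_surjective[OF lin]) simp
  then obtain h where h: "T h = (\<chi> x. f x)" by (metis surjD)
  have "(\<Sum>z\<in>UNIV. marginal1 \<nu> $ z * h $ z) = 0" using mean[of h] f by (simp add: h)
  then have "h $ x - (\<Sum>y\<in>UNIV. ?q x y * h $ y) = f x" for x
    using h by (simp add: T_def vec_eq_iff)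
  then show thesis by (rule that)
qed

text \<open>\<open>f\<close> is the conditional mean, given the current state, of the centred
  indicator of the transition \<open>p\<close>, and stationarity gives it mean 0. Its Poisson
  solution \<open>h\<close> turns the centred indicators into martingale differences, up to
  telescoping terms.\<close>

lemma pair_corrector:
  fixes \<nu> :: "real ^ ('s::finite \<times> 's)"
  assumes \<nu>: "\<nu> \<in> prob_simplex" and bal: "marginal1 \<nu> = marginal2 \<nu>"
    and E: "\<And>x y. (x, y) \<in> E \<Longrightarrow> 0 < \<nu> $ (x, y)" and irr: "\<And>x y. (x, y) \<in> E\<^sup>+"
    and pos: "\<And>x. 0 < marginal1 \<nu> $ x"
  shows "\<exists>h :: 's \<Rightarrow> real. \<forall>x. (\<Sum>y\<in>UNIV. conditional \<nu> x $ y * (of_bool ((x, y) = p) - \<nu> $ p + h y - h x)) = 0"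
proof -
  obtain a b where p: "p = (a, b)" by (cases p) auto
  let ?q = "\<lambda>x y. conditional \<nu> x $ y"
  have q1: "(\<Sum>y\<in>UNIV. ?q x y) = 1" for x
    unfolding conditional_nth sum_divide_distrib[symmetric] marginal_nth[symmetric] using pos[of x] by simp
  define f where "f = (\<lambda>x. of_bool (x = a) * ?q a b - \<nu> $ p)"
  have "(\<Sum>x\<in>UNIV. marginal1 \<nu> $ x * f x) = (\<Sum>x\<in>UNIV. if x = a then marginal1 \<nu> $ a * ?q a b else 0) - (\<Sum>x\<in>UNIV. marginal1 \<nu> $ x) * \<nu> $ p"
    unfolding sum_distrib_right sum_subtractf[symmetric]
    by (intro sum.cong) (auto simp: f_def algebra_simps)
  also have "\<dots> = 0"
    using pos[of a] prob_simplexD(2)[OF marginal1_simplex[OF \<nu>]] by (simp add: conditional_nth p)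
  finally obtain h where h: "\<And>x. h x - (\<Sum>y\<in>UNIV. ?q x y * h y) = f x"
    using poisson_equation[OF \<nu> bal E irr pos, of f] by metis
  have "(\<Sum>y\<in>UNIV. ?q x y * (of_bool ((x, y) = p) - \<nu> $ p + h y - h x)) = 0" for x
  proof -
    have e: "(\<Sum>y\<in>UNIV. ?q x y * of_bool ((x, y) = p)) = of_bool (x = a) * ?q a b"
      by (cases "x = a") (auto simp: p of_bool_def if_distrib[of "\<lambda>c. _ * c"] cong: if_cong)
    have "(\<Sum>y\<in>UNIV. ?q x y * (of_bool ((x, y) = p) - \<nu> $ p + h y - h x))
      = (\<Sum>y\<in>UNIV. ?q x y * of_bool ((x, y) = p)) - (\<Sum>y\<in>UNIV. ?q x y) * \<nu> $ p
        + (\<Sum>y\<in>UNIV. ?q x y * h y) - (\<Sum>y\<in>UNIV. ?q x y) * h x"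
      by (simp only: sum_distrib_right sum.distrib[symmetric] sum_subtractf[symmetric])
         (intro sum.cong refl, simp add: algebra_simps)
    also have "\<dots> = f x + (\<Sum>y\<in>UNIV. ?q x y * h y) - h x" unfolding e q1 by (simp add: f_def)
    also have "\<dots> = 0" using h[of x] by simp
    finally show ?thesis .
  qed
  then show ?thesis by blast
qed

definition block_kernel :: "(nat \<Rightarrow> real ^ ('s::finite \<times> 's)) \<Rightarrow> nat \<Rightarrow> nat \<Rightarrow> nat \<Rightarrow> (nat \<Rightarrow> 's) \<Rightarrow> 's \<Rightarrow> real" where
  "block_kernel \<nu> K n i x y = conditional (\<nu> (block_of (grid n K) i)) (x i) $ y"

definition block_count :: "nat \<Rightarrow> nat \<Rightarrow> nat \<Rightarrow> (nat \<Rightarrow> 's) \<Rightarrow> 's \<times> 's \<Rightarrow> real" where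
  "block_count n K b x p = (\<Sum>i=grid n K b..<grid n K (Suc b). of_bool ((x i, x (Suc i)) = p))"

text \<open>One irreducible edge set charged in all blocks makes every block kernel irreducible, so
  the Poisson equation is solvable in each of them.\<close>

locale block_chain =
  fixes \<nu> :: "nat \<Rightarrow> real ^ ('s::finite \<times> 's)" and E :: "('s \<times> 's) set" and K :: nat
  assumes \<nu>: "\<And>b. \<nu> b \<in> prob_simplex" and bal: "\<And>b. marginal1 (\<nu> b) = marginal2 (\<nu> b)"
    and E: "\<And>b x y. (x, y) \<in> E \<Longrightarrow> 0 < \<nu> b $ (x, y)" and irr: "\<And>x y. (x, y) \<in> E\<^sup>+"
    and pos: "\<And>b x. 0 < marginal1 (\<nu> b) $ x" and K: "0 < K"
begin

lemma block_kernel_nonneg: "0 \<le> block_kernel \<nu> K n i x y"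
  using \<nu> less_imp_le[OF pos] by (simp add: block_kernel_def conditional_nth prob_simplexD)

lemma block_kernel_sum: "(\<Sum>y\<in>UNIV. block_kernel \<nu> K n i x y) = 1"
  unfolding block_kernel_def conditional_nth sum_divide_distrib[symmetric] marginal_nth[symmetric]
  using pos by (simp add: less_imp_neq[symmetric])

text \<open>With the corrector, the deviation of a count is a martingale plus \<open>h\<close> at
  the two ends of the block. The martingale has second moment at most \<open>B\<^sup>2 * n\<close>,
  and Chebyshev's inequality applies.\<close>

lemma block_count_deviation:
  assumes b: "b < K" and \<delta>: "0 < \<delta>"
  shows "\<exists>C. \<forall>n>0. C / real n \<ge> path_exp (block_kernel \<nu> K n) x0 n (\<lambda>x. of_bool
    (\<delta> * real n + C < \<bar>block_count n K b x p - real (grid n K (Suc b) - grid n K b) * \<nu> b $ p\<bar>))"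
proof -
  obtain h :: "'s \<Rightarrow> real" where
    h: "\<And>x. (\<Sum>y\<in>UNIV. conditional (\<nu> b) x $ y * (of_bool ((x, y) = p) - \<nu> b $ p + h y - h x)) = 0"
    using pair_corrector[OF \<nu>[of b] bal[of b] E[of _ _ b] irr pos[of b], of p] by blast
  define H where "H = (\<Sum>x\<in>UNIV. \<bar>h x\<bar>)"
  have H: "\<bar>h x\<bar> \<le> H" for x unfolding H_def by (rule member_le_sum[of x UNIV "\<lambda>x. \<bar>h x\<bar>"]) auto
  define B where "B = 1 + 2 * H"
  define D where "D = (\<lambda>n i x y. if block_of (grid n K) i = b then of_bool ((x, y) = p) - \<nu> b $ p + h y - h x else 0)"
  have H0: "0 \<le> H" using H[of undefined] by linarith
  have DB: "\<bar>D n i x y\<bar> \<le> B" for n i x y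
    using H[of x] H[of y] H0 prob_simplexD(1,3)[OF \<nu>[of b], of p] by (auto simp: D_def B_def of_bool_def)
  have D0: "(\<Sum>y\<in>UNIV. block_kernel \<nu> K n i x y * D n i (x i) y) = 0" for n i x
    using h[of "x i"] by (cases "block_of (grid n K) i = b") (simp_all add: block_kernel_def D_def)
  have sq: "path_exp (block_kernel \<nu> K n) x0 n (\<lambda>x. (\<Sum>i<n. D n i (x i) (x (Suc i)))\<^sup>2) \<le> B\<^sup>2 * real n" for n
    by (rule path_exp_martingale_square[OF block_kernel_nonneg block_kernel_sum D0 DB])
  have SD: "\<bar>block_count n K b x p - real (grid n K (Suc b) - grid n K b) * \<nu> b $ p\<bar>
      \<le> \<bar>\<Sum>i<n. D n i (x i) (x (Suc i))\<bar> + 2 * H" for n x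
  proof -
    let ?t = "grid n K"
    have le: "?t b \<le> ?t (Suc b)" by (intro monoD[OF mono_grid]) simp
    have "(\<Sum>i<n. D n i (x i) (x (Suc i))) = (\<Sum>b'<K. \<Sum>i=?t b'..<?t (Suc b'). D n i (x i) (x (Suc i)))"
      using sum_blocks[OF mono_grid grid_0, of "\<lambda>i. D n i (x i) (x (Suc i))" n K K] by (simp add: grid_K[OF K])
    also have "\<dots> = (\<Sum>b'<K. if b' = b then \<Sum>i=?t b..<?t (Suc b). of_bool ((x i, x (Suc i)) = p) - \<nu> b $ p + h (x (Suc i)) - h (x i) else 0)"
    proof (intro sum.cong refl)
      fix b' assume "b' \<in> {..<K}"
      have "D n i (x i) (x (Suc i)) = (if b' = b then of_bool ((x i, x (Suc i)) = p) - \<nu> b $ p + h (x (Suc i)) - h (x i) else 0)"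
        if "i \<in> {?t b'..<?t (Suc b')}" for i
      proof -
        have "block_of ?t i = b'" using that by (intro block_of_eq[OF mono_grid]) auto
        then show ?thesis by (simp add: D_def)
      qed
      then show "(\<Sum>i=?t b'..<?t (Suc b'). D n i (x i) (x (Suc i)))
        = (if b' = b then \<Sum>i=?t b..<?t (Suc b). of_bool ((x i, x (Suc i)) = p) - \<nu> b $ p + h (x (Suc i)) - h (x i) else 0)"
        by (cases "b' = b") simp_all
    qed
    also have "\<dots> = (\<Sum>i=?t b..<?t (Suc b). of_bool ((x i, x (Suc i)) = p) - \<nu> b $ p + h (x (Suc i)) - h (x i))"
      using b by simp
    also have "\<dots> = (\<Sum>i=?t b..<?t (Suc b). of_bool ((x i, x (Suc i)) = p)) - (\<Sum>i=?t b..<?t (Suc b). \<nu> b $ p)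
        + (\<Sum>i=?t b..<?t (Suc b). h (x (Suc i)) - h (x i))"
      by (simp only: sum.distrib[symmetric] sum_subtractf[symmetric]) (intro sum.cong refl, simp)
    also have "(\<Sum>i=?t b..<?t (Suc b). h (x (Suc i)) - h (x i)) = h (x (?t (Suc b))) - h (x (?t b))"
      by (rule sum_Suc_diff'[OF le])
    finally have "block_count n K b x p - real (?t (Suc b) - ?t b) * \<nu> b $ p
      = (\<Sum>i<n. D n i (x i) (x (Suc i))) - (h (x (?t (Suc b))) - h (x (?t b)))"
      by (simp add: block_count_def)
    then show ?thesis using H[of "x (?t (Suc b))"] H[of "x (?t b)"] by linarith
  qed
  \<comment> \<open>One constant serves twice: as slack covering the boundary term
    \<open>2 * H\<close>, and as bound for the Chebyshev constant
    \<open>B\<^sup>2 / \<delta>\<^sup>2\<close>.\<close>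
  define C where "C = B\<^sup>2 / \<delta>\<^sup>2 + 2 * H"
  have C0: "0 \<le> B\<^sup>2 / \<delta>\<^sup>2" by simp
  have "path_exp (block_kernel \<nu> K n) x0 n (\<lambda>x. of_bool
    (\<delta> * real n + C < \<bar>block_count n K b x p - real (grid n K (Suc b) - grid n K b) * \<nu> b $ p\<bar>)) \<le> C / real n"
    if n: "0 < n" for n
  proof -
    let ?S = "\<lambda>x. \<Sum>i<n. D n i (x i) (x (Suc i))"
    have dn: "0 < \<delta> * real n" using \<delta> n by simp
    have pt: "of_bool (\<delta> * real n + C < \<bar>block_count n K b x p - real (grid n K (Suc b) - grid n K b) * \<nu> b $ p\<bar>)
      \<le> (1 / (\<delta> * real n)\<^sup>2) * (?S x)\<^sup>2" for x
    proof (cases "\<delta> * real n + C < \<bar>block_count n K b x p - real (grid n K (Suc b) - grid n K b) * \<nu> b $ p\<bar>")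
      case True
      then have "\<delta> * real n \<le> \<bar>?S x\<bar>" using SD[of n x] C0 unfolding C_def by linarith
      then have "(\<delta> * real n)\<^sup>2 \<le> (?S x)\<^sup>2" using dn by (metis abs_le_square_iff abs_of_pos)
      moreover have "0 < (\<delta> * real n)\<^sup>2" using dn by (rule zero_less_power)
      ultimately show ?thesis using True by (simp add: pos_le_divide_eq)
    qed simp
    have "path_exp (block_kernel \<nu> K n) x0 n (\<lambda>x. of_bool
      (\<delta> * real n + C < \<bar>block_count n K b x p - real (grid n K (Suc b) - grid n K b) * \<nu> b $ p\<bar>))
      \<le> path_exp (block_kernel \<nu> K n) x0 n (\<lambda>x. (1 / (\<delta> * real n)\<^sup>2) * (?S x)\<^sup>2)"
      by (rule path_exp_mono[OF block_kernel_nonneg pt])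
    also have "\<dots> \<le> (1 / (\<delta> * real n)\<^sup>2) * (B\<^sup>2 * real n)"
      unfolding path_exp_cmult by (intro mult_left_mono sq) auto
    also have "\<dots> = (B\<^sup>2 / \<delta>\<^sup>2) / real n" using n \<delta> by (simp add: power2_eq_square)
    also have "\<dots> \<le> C / real n" using H0 by (intro divide_right_mono) (auto simp: C_def)
    finally show ?thesis .
  qed
  then show ?thesis by blast
qed

definition typical :: "nat \<Rightarrow> real \<Rightarrow> (nat \<Rightarrow> 's) \<Rightarrow> bool" where
  "typical n \<delta> x \<longleftrightarrow> (\<forall>b<K. \<forall>p. \<bar>block_count n K b x p - real n / real K * \<nu> b $ p\<bar> \<le> \<delta> * real n)"

lemma typical_probability:
  assumes \<delta>: "0 < \<delta>"
  shows "\<exists>n0. \<forall>n\<ge>n0. 1 / 2 \<le> path_exp (block_kernel \<nu> K n) x0 n (\<lambda>x. of_bool (typical n \<delta> x))"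
proof -
  let ?I = "{..<K} \<times> (UNIV :: ('s \<times> 's) set)"
  let ?bad = "\<lambda>\<delta> C n b p x. \<delta> * real n + C < \<bar>block_count n K b x p - real (grid n K (Suc b) - grid n K b) * \<nu> b $ p\<bar>"
  have "\<forall>i\<in>?I. \<exists>C. \<forall>n>0. path_exp (block_kernel \<nu> K n) x0 n (\<lambda>x. of_bool (?bad (\<delta> / 2) C n (fst i) (snd i) x)) \<le> C / real n"
    using block_count_deviation[of _ "\<delta> / 2"] \<delta> by auto
  then obtain C where C: "\<And>i n. i \<in> ?I \<Longrightarrow> 0 < n \<Longrightarrow>
      path_exp (block_kernel \<nu> K n) x0 n (\<lambda>x. of_bool (?bad (\<delta> / 2) (C i) n (fst i) (snd i) x)) \<le> C i / real n"
    by metis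
  define R where "R = (\<Sum>i\<in>?I. \<bar>C i\<bar>)"
  have CR: "C i \<le> R" if "i \<in> ?I" for i
  proof -
    have "\<bar>C i\<bar> \<le> R" unfolding R_def using that by (intro member_le_sum[of i ?I "\<lambda>i. \<bar>C i\<bar>"]) auto
    then show ?thesis by linarith
  qed
  have R0: "0 \<le> R" by (simp add: R_def sum_nonneg)
  \<comment> \<open>Half of the tolerance goes to the martingale deviation. From \<open>n0\<close>
    on the other half covers the constants \<open>C\<close> and the error of at most 1 from rounding
    the block lengths, and the union bound \<open>R / n\<close> is at most 1/2.\<close>
  obtain n0 where n0: "0 < n0" "\<And>n. n \<ge> n0 \<Longrightarrow> 1 / real n < min (\<delta> / (2 * (R + 1))) (1 / (2 * (R + 1)))"
    using tendsto_one_over_nat[of "min (\<delta> / (2 * (R + 1))) (1 / (2 * (R + 1)))"] \<delta> R0 by auto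
  have "1 / 2 \<le> path_exp (block_kernel \<nu> K n) x0 n (\<lambda>x. of_bool (typical n \<delta> x))" if n: "n \<ge> n0" for n
  proof -
    have np: "0 < n" "0 < real n" using n n0 by auto
    have n1: "1 / real n < \<delta> / (2 * (R + 1))" "1 / real n < 1 / (2 * (R + 1))" using n0(2)[OF n] by auto
    have n2: "R + 1 \<le> \<delta> / 2 * real n" "2 * R \<le> real n" 
      using n1 np R0 by (auto simp: field_simps)
    have pt: "1 \<le> of_bool (typical n \<delta> x) + (\<Sum>i\<in>?I. of_bool (?bad (\<delta> / 2) (C i) n (fst i) (snd i) x) :: real)" for x
    proof (cases "\<exists>i\<in>?I. ?bad (\<delta> / 2) (C i) n (fst i) (snd i) x")
      case True
      then obtain i where i: "i \<in> ?I" "?bad (\<delta> / 2) (C i) n (fst i) (snd i) x" by blast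
      have "1 \<le> (\<Sum>i\<in>?I. of_bool (?bad (\<delta> / 2) (C i) n (fst i) (snd i) x) :: real)"
        using member_le_sum[of i ?I "\<lambda>i. of_bool (?bad (\<delta> / 2) (C i) n (fst i) (snd i) x) :: real"] i by simp
      then show ?thesis by (simp add: add_increasing)
    next
      case False
      have "\<bar>block_count n K b x p - real n / real K * \<nu> b $ p\<bar> \<le> \<delta> * real n" if b: "b < K" for b p
      proof -
        have "\<bar>block_count n K b x p - real (grid n K (Suc b) - grid n K b) * \<nu> b $ p\<bar> \<le> \<delta> / 2 * real n + C (b, p)"
        proof -
          have "(b, p) \<in> ?I" using b by simp
          then have "\<not> ?bad (\<delta> / 2) (C (b, p)) n (fst (b, p)) (snd (b, p)) x" using False by blast
          then show ?thesis by (simp add: not_less)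
        qed
        moreover have "C (b, p) \<le> R" using CR[of "(b, p)"] b by simp
        moreover have "\<bar>real (grid n K (Suc b) - grid n K b) * \<nu> b $ p - real n / real K * \<nu> b $ p\<bar> \<le> 1"
        proof -
          have le: "grid n K b \<le> grid n K (Suc b)" by (intro monoD[OF mono_grid]) simp
          have "real n * real (Suc b) / real K - real n * real b / real K = real n / real K"
            by (simp add: algebra_simps add_divide_distrib)
          then have "\<bar>real (grid n K (Suc b) - grid n K b) - real n / real K\<bar> \<le> 1"
            using grid_bounds[OF K, of n b] grid_bounds[OF K, of n "Suc b"] le by (simp add: of_nat_diff abs_le_iff)
          then have "\<bar>real (grid n K (Suc b) - grid n K b) - real n / real K\<bar> * \<bar>\<nu> b $ p\<bar> \<le> 1 * 1"
            using prob_simplexD(1,3)[OF \<nu>[of b], of p] by (intro mult_mono) auto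
          then show ?thesis by (simp add: left_diff_distrib flip: abs_mult)
        qed
        ultimately show ?thesis using n2(1) by linarith
      qed
      then have "typical n \<delta> x" by (simp add: typical_def)
      then show ?thesis by (simp add: sum_nonneg)
    qed
    have "1 = path_exp (block_kernel \<nu> K n) x0 n (\<lambda>x. 1)" by (simp add: path_exp_const[OF block_kernel_sum])
    also have "\<dots> \<le> path_exp (block_kernel \<nu> K n) x0 n (\<lambda>x. of_bool (typical n \<delta> x)
        + (\<Sum>i\<in>?I. of_bool (?bad (\<delta> / 2) (C i) n (fst i) (snd i) x)))"
      by (rule path_exp_mono[OF block_kernel_nonneg pt])
    also have "\<dots> = path_exp (block_kernel \<nu> K n) x0 n (\<lambda>x. of_bool (typical n \<delta> x))
        + (\<Sum>i\<in>?I. path_exp (block_kernel \<nu> K n) x0 n (\<lambda>x. of_bool (?bad (\<delta> / 2) (C i) n (fst i) (snd i) x)))"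
      by (subst path_exp_add, subst path_exp_sum) auto
    also have "(\<Sum>i\<in>?I. path_exp (block_kernel \<nu> K n) x0 n (\<lambda>x. of_bool (?bad (\<delta> / 2) (C i) n (fst i) (snd i) x)))
        \<le> (\<Sum>i\<in>?I. \<bar>C i\<bar> / real n)"
      by (intro sum_mono order_trans[OF C[OF _ np(1)]] divide_right_mono) auto
    also have "\<dots> = R / real n" by (simp add: R_def sum_divide_distrib)
    also have "R / real n \<le> 1 / 2" using n2(2) np by (simp add: field_simps)
    finally show ?thesis by simp
  qed
  then show ?thesis by blast
qed

end

section \<open>The lower bound\<close>

lemma occupation_eq_block_counts:
  fixes x :: "nat \<Rightarrow> 's::finite"
  shows "(\<Sum>j<grid n K b. of_bool (x j = y)) = (\<Sum>c<b. \<Sum>z\<in>UNIV. block_count n K c x (y, z))"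
proof -
  have "(\<Sum>j<grid n K b. of_bool (x j = y) :: real) = (\<Sum>c<b. \<Sum>i=grid n K c..<grid n K (Suc c). of_bool (x i = y))"
    by (rule sum_blocks[OF mono_grid grid_0])
  also have "\<dots> = (\<Sum>c<b. \<Sum>i=grid n K c..<grid n K (Suc c). \<Sum>z\<in>UNIV. of_bool ((x i, x (Suc i)) = (y, z)))"
    by (simp only: sum_of_bool_pair(1))
  also have "\<dots> = (\<Sum>c<b. \<Sum>z\<in>UNIV. block_count n K c x (y, z))"
    unfolding block_count_def by (intro sum.cong refl sum.swap)
  finally show ?thesis .
qed

context block_chain
begin

text \<open>The value that the empirical measure of a typical path has at the start of block
  \<open>b\<close>.\<close>

definition block_mean :: "nat \<Rightarrow> real ^ 's" where
  "block_mean b = (1 / real b) *\<^sub>R (\<Sum>j<b. marginal1 (\<nu> j))"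

lemma typical_occupation:
  assumes x: "typical n \<delta> x" and b: "0 < b" "b \<le> K"
  shows "\<bar>(\<Sum>j<grid n K b. of_bool (x j = y)) - real n * (real b / real K) * block_mean b $ y\<bar>
    \<le> real K * real CARD('s) * \<delta> * real n"
proof -
  have e: "real n * (real b / real K) * block_mean b $ y = (\<Sum>c<b. \<Sum>z\<in>UNIV. real n / real K * \<nu> c $ (y, z))"
    using b by (simp add: block_mean_def marginal_nth sum_distrib_left sum_divide_distrib)
  have \<delta>n: "0 \<le> \<delta> * real n"
    using x b K unfolding typical_def by (meson abs_ge_zero order_trans)
  have "\<bar>(\<Sum>c<b. \<Sum>z\<in>UNIV. block_count n K c x (y, z)) - (\<Sum>c<b. \<Sum>z\<in>UNIV. real n / real K * \<nu> c $ (y, z))\<bar>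
    \<le> (\<Sum>c<b. \<Sum>z\<in>UNIV. \<bar>block_count n K c x (y, z) - real n / real K * \<nu> c $ (y, z)\<bar>)"
    unfolding sum_subtractf[symmetric] by (intro order_trans[OF sum_abs] sum_mono sum_abs)
  also have "\<dots> \<le> (\<Sum>c<b. \<Sum>z\<in>(UNIV :: 's set). \<delta> * real n)"
    using x b by (intro sum_mono) (simp add: typical_def)
  also have "\<dots> = real b * (real CARD('s) * (\<delta> * real n))" by simp
  also have "\<dots> \<le> real K * (real CARD('s) * (\<delta> * real n))"
    using b \<delta>n by (intro mult_right_mono) auto
  finally show ?thesis unfolding e occupation_eq_block_counts by (simp add: mult.assoc)
qed

end

text \<open>A crude bound for harmonic sums, by induction from
  \<open>1 / j \<le> 2 * (sqrt j - sqrt (j - 1))\<close>; any bound of order o(j) would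
  serve.\<close>

lemma sum_inverse_le_sqrt: "(\<Sum>b=1..<Suc j. 1 / real b) \<le> 2 * sqrt (real j)"
proof (induction j)
  case (Suc j)
  let ?a = "sqrt (real (Suc j))" and ?b = "sqrt (real j)"
  have "(?a - ?b) * (?a + ?b) = 1" by (simp add: algebra_simps)
  moreover have ab: "?b \<le> ?a" "0 < ?a" by auto
  have "1 \<le> real (Suc j)" by simp
  then have "?a * 1 \<le> ?a * ?a" by (intro mult_left_mono) auto
  then have "?a \<le> real (Suc j)" by simp
  then have "?a + ?b \<le> 2 * real (Suc j)" using ab by (smt (verit))
  ultimately have "1 \<le> (?a - ?b) * (2 * real (Suc j))"
    using ab by (metis diff_ge_0_iff_ge mult_left_mono)
  then have "1 / real (Suc j) \<le> 2 * (?a - ?b)" by (simp add: pos_divide_le_eq mult_ac del: of_nat_Suc)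
  then show ?case using Suc by simp
qed simp

section \<open>Probability of following a block chain\<close>

context afp_chain
begin

text \<open>A lower bound for the kernel of the chain along typical paths. In block 0 only the part
  independent of the empirical measure can be trusted. Later, \<open>b / (b + 1)\<close> pays for
  the time elapsed inside the block and \<open>1 - \<tau>\<close> for fluctuations.\<close>

definition kernel_floor :: "real \<Rightarrow> real ^ 's \<Rightarrow> nat \<Rightarrow> 's \<Rightarrow> 's \<Rightarrow> real" where
  "kernel_floor \<tau> m b x y = (if b = 0 then Po x y else real b / real (Suc b) * (1 - \<tau>) * G m $ x $ y)"

definition log_ratio :: "real ^ ('s \<times> 's) \<Rightarrow> ('s \<Rightarrow> 's \<Rightarrow> real) \<Rightarrow> 's \<Rightarrow> 's \<Rightarrow> real" where
  "log_ratio \<nu> g x y = (if \<nu> $ (x, y) = 0 then 0 else ln (conditional \<nu> x $ y / g x y))"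

lemma G_scale:
  assumes "0 \<le> r" "r \<le> 1" "r * m $ y \<le> m' $ y"
  shows "r * G m $ x $ y \<le> G m' $ x $ y"
proof -
  have "r * Po x y \<le> 1 * Po x y" using assms P_bounds by (intro mult_right_mono) auto
  moreover have "Pz x * (r * m $ y) \<le> Pz x * m' $ y" using assms P_bounds by (intro mult_left_mono) auto
  ultimately show ?thesis by (simp add: G_nth algebra_simps)
qed

text \<open>Inside block \<open>b \<ge> 1\<close> the empirical measure is at least \<open>b / (b + 1)\<close> times its value at the
  start of the block. The logarithms of these factors have Cesaro limit \<open>0\<close>, so that even the
  early blocks, where the empirical measure still moves fast, need no separate treatment.\<close>

lemma block_chain_lower_bound:
  assumes bc: "block_chain \<nu> edges K"
    and supp: "\<And>b x y. 0 < \<nu> b $ (x, y) \<Longrightarrow> (x, y) \<in> adj_support (afp_adjacency P)"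
    and \<nu>0: "\<And>x y. 0 < \<nu> 0 $ (x, y) \<Longrightarrow> 0 < Po x y"
    and \<tau>: "0 < \<tau>" "\<tau> < 1" and \<epsilon>: "0 < \<epsilon>" and \<rho>: "0 < \<rho>"
  defines "M \<equiv> block_chain.block_mean \<nu>"
  defines "w \<equiv> \<lambda>b. log_ratio (\<nu> b) (kernel_floor \<tau> (M b) b)"
  defines "S \<equiv> (1 / real K) * (\<Sum>b<K. \<Sum>x\<in>UNIV. \<Sum>y\<in>UNIV. \<nu> b $ (x, y) * w b x y)"
  shows "\<exists>n0. \<forall>n\<ge>n0. exp (- real n * (S + \<epsilon>)) / 2
    \<le> path_exp (self_kernel G) x0 n (\<lambda>x. of_bool (\<forall>y. \<bar>emp x (Suc n) $ y - M K $ y\<bar> < \<rho>))"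
proof -
  interpret block_chain \<nu> edges K by (rule bc)
  let ?k = "self_kernel G"
  let ?d = "real CARD('s)"
  have M_nth: "M b $ y = (1 / real b) * (\<Sum>j<b. marginal1 (\<nu> j) $ y)" for b y
    by (simp add: M_def block_mean_def)
  \<comment> \<open>The visits in block 0 alone secure this share of every later block mean,
    whatever the other blocks do.\<close>
  define \<mu> where "\<mu> = Min (range (\<lambda>y. marginal1 (\<nu> 0) $ y)) / real K"
  have \<mu>: "0 < \<mu>" unfolding \<mu>_def using K by (intro divide_pos_pos) (simp_all add: Min_gr_iff pos)
  have \<mu>M: "\<mu> \<le> M b $ y" if b: "0 < b" "b \<le> K" for b y
  proof -
    have "\<mu> \<le> marginal1 (\<nu> 0) $ y / real K" unfolding \<mu>_def by (intro divide_right_mono Min_le) auto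
    also have "\<dots> \<le> (\<Sum>j<b. marginal1 (\<nu> j) $ y) / real K"
      using b less_imp_le[OF pos] by (intro divide_right_mono member_le_sum[of 0 "{..<b}" "\<lambda>j. marginal1 (\<nu> j) $ y"]) auto
    also have "\<dots> \<le> (\<Sum>j<b. marginal1 (\<nu> j) $ y) / real b"
      using b less_imp_le[OF pos] by (intro divide_left_mono sum_nonneg) auto
    finally show ?thesis by (simp add: M_nth)
  qed
  define W where "W = (\<Sum>b<K. \<Sum>x\<in>UNIV. \<Sum>y\<in>UNIV. \<bar>w b x y\<bar>)"
  have W0: "0 \<le> W" unfolding W_def by (intro sum_nonneg) simp
  \<comment> \<open>The coefficients of \<delta> in three errors are collected: the occupation
    against \<open>\<tau> * \<mu>\<close>, where the second factor \<open>K\<close> comes from the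
    earliest start \<open>1 / K\<close> of a block; the log density against
    \<open>\<epsilon>\<close>; and the end point against \<open>\<rho>\<close>. The factor 2 makes
    the last estimate strict.\<close>
  define C where "C = 2 * (real K * real K * ?d + W + 1)"
  have C: "0 < C" using W0 by (simp add: C_def add_nonneg_pos)
  define e where "e = min (\<tau> * \<mu>) (min \<rho> \<epsilon>)"
  have e: "0 < e" "e \<le> \<tau> * \<mu>" "e \<le> \<rho>" "e \<le> \<epsilon>" using \<tau> \<mu> \<rho> \<epsilon> by (auto simp: e_def)
  define \<delta> where "\<delta> = e / C"
  have \<delta>: "0 < \<delta>" using e C by (simp add: \<delta>_def)
  define A where "A = real K * real K * ?d * \<delta>"
  have "C * \<delta> = e" using C by (simp add: \<delta>_def)
  then have C\<delta>: "2 * (A + W * \<delta> + \<delta>) = e" by (simp add: C_def A_def algebra_simps)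
  define B where "B = W * \<delta>"
  have nn: "0 \<le> A" "0 \<le> W * \<delta>" using \<delta> W0 by (auto simp: A_def)
  have "1 * (real K * ?d * \<delta>) \<le> real K * (real K * ?d * \<delta>)"
    using K \<delta> by (intro mult_right_mono) auto
  then have KK: "real K * ?d * \<delta> \<le> A" by (simp add: A_def mult.assoc)
  have d1: "A \<le> \<tau> * \<mu>" using C\<delta> nn \<delta> e(1,2) by argo
  have d2: "W * \<delta> \<le> \<epsilon>" using C\<delta> nn \<delta> e(1,4) unfolding B_def[symmetric] by (smt (verit))
  have d3: "real K * ?d * \<delta> + \<delta> < \<rho>" using C\<delta> nn \<delta> e(1,3) KK by argo
  obtain n1 where n1: "\<And>n. n \<ge> n1 \<Longrightarrow> 1 / 2 \<le> path_exp (block_kernel \<nu> K n) x0 n (\<lambda>x. of_bool (typical n \<delta> x))"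
    using typical_probability[OF \<delta>] by blast
  obtain n2 where n2: "0 < n2" "\<And>n. n \<ge> n2 \<Longrightarrow> 1 / real n < \<delta>" using tendsto_one_over_nat[OF \<delta>] by blast
  have "exp (- real n * (S + \<epsilon>)) / 2 \<le> path_exp ?k x0 n (\<lambda>x. of_bool (\<forall>y. \<bar>emp x (Suc n) $ y - M K $ y\<bar> < \<rho>))"
    if n: "n \<ge> max n1 n2" for n
  proof -
    have np: "0 < n" "0 < real n" "1 / real n < \<delta>" using n n2 by auto
    let ?t = "grid n K"
    let ?b = "block_of ?t"
    let ?Q = "block_kernel \<nu> K n"
    \<comment> \<open>The value 1 where the block kernel vanishes matches the value 0 of
      \<open>log_ratio\<close> there.\<close>
    define r where "r = (\<lambda>i x y. if ?Q i x y = 0 then 1 else ?k i x y / ?Q i x y)"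
    have r0: "0 \<le> r i x y" for i x y
      unfolding r_def using block_kernel_nonneg self_kernel_nonneg by simp
    have Q_cong: "?Q i x = ?Q i x'" if "x i = x' i" for i x x' using that by (simp add: block_kernel_def fun_eq_iff)
    have r_ad: "adapted r"
      unfolding adapted_def
    proof (intro allI impI)
      fix i and x x' :: "nat \<Rightarrow> 's" assume "\<forall>j\<le>i. x j = x' j"
      then show "r i x = r i x'"
        using self_kernel_cong[of i x x' G] Q_cong[of x i x'] by (simp add: r_def fun_eq_iff)
    qed
    have rQ: "?Q i x y * r i x y \<le> ?k i x y" for i x y
      using self_kernel_nonneg[of i x y] by (simp add: r_def)
    have floor: "kernel_floor \<tau> (M (?b i)) (?b i) (x i) y \<le> ?k i x y"
      if x: "typical n \<delta> x" and i: "i < n" for x i y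
    proof (cases "?b i = 0")
      case True
      then show ?thesis
        using P_bounds prob_simplexD(1)[OF emp_simplex[of "Suc i" x], of y]
        by (simp add: kernel_floor_def self_kernel_def G_nth)
    next
      case False
      let ?c = "?b i"
      have b: "?c < K" "?t ?c \<le> i" "i < ?t (Suc ?c)"
        using block_of_bounds[OF mono_grid grid_0, of i n K K] i grid_K[OF K] by auto
      have cp: "0 < ?c" "0 < real ?c" using False by auto
      let ?r = "real ?c / real (Suc ?c) * (1 - \<tau>)"
      have r0: "0 \<le> ?r" using \<tau> by (intro mult_nonneg_nonneg) auto
      have "?r \<le> 1 * 1" using \<tau> by (intro mult_mono) auto
      then have r1: "?r \<le> 1" by simp
      have mu: "\<mu> \<le> M ?c $ y" using \<mu>M[of ?c y] cp b by simp
      have Suc: "real (Suc i) \<le> real n * real (Suc ?c) / real K"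
        using grid_bounds(1)[OF K, of n "Suc ?c"] b(3) by simp
      \<comment> \<open>At the start of the block the count of \<open>y\<close> is at least
        \<open>1 - \<tau>\<close> times its typical value, because the permitted deviation is at
        most \<open>\<tau>\<close> times the guaranteed share \<open>\<mu>\<close>. Counts only grow
        from there to time \<open>i\<close>.\<close>
      have "(1 - \<tau>) * M ?c $ y * (real n * (real ?c / real K)) \<le> (M ?c $ y - \<tau> * \<mu>) * (real n * (real ?c / real K))"
        using mu \<tau> by (intro mult_right_mono) (auto simp: algebra_simps)
      also have "\<dots> = real n * (real ?c / real K) * M ?c $ y - \<tau> * \<mu> * (real n * (real ?c / real K))"
        unfolding left_diff_distrib by (simp only: mult.commute[of "M ?c $ y"])
      also have "\<dots> \<le> (\<Sum>j<?t ?c. of_bool (x j = y))"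
      proof -
        have "real K * ?d * \<delta> * real n = A * (real n * (1 / real K))"
          using K by (simp add: A_def)
        also have "\<dots> \<le> \<tau> * \<mu> * (real n * (real ?c / real K))"
        proof (rule mult_mono[OF d1])
          show "real n * (1 / real K) \<le> real n * (real ?c / real K)"
            using cp by (intro mult_left_mono divide_right_mono) auto
        qed (use \<tau> \<mu> in auto)
        finally show ?thesis
          using typical_occupation[OF x cp(1) less_imp_le[OF b(1)], of y] by (simp add: M_def abs_le_iff)
      qed
      also have "\<dots> \<le> (\<Sum>j<Suc i. of_bool (x j = y))"
        using b(2) by (intro sum_mono2) auto
      finally have cnt: "(1 - \<tau>) * M ?c $ y * (real n * (real ?c / real K)) \<le> (\<Sum>j<Suc i. of_bool (x j = y))" .
      have mnn: "0 \<le> (1 - \<tau>) * M ?c $ y" using mu \<mu> \<tau> by simp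
      have "?r * M ?c $ y = (1 - \<tau>) * M ?c $ y * (real n * (real ?c / real K)) / (real n * real (Suc ?c) / real K)"
      proof -
        have "c / s * t * v = t * v * (m * (c / k)) / (m * s / k)" if "m \<noteq> 0" "k \<noteq> 0" "s \<noteq> 0" for c s t v m k :: real
          using that by (simp add: field_simps)
        then show ?thesis using np(2) K by simp
      qed
      also have "\<dots> \<le> (\<Sum>j<Suc i. of_bool (x j = y)) / real (Suc i)"
        using cnt mnn Suc by (intro frac_le) (auto intro: order_trans[OF _ cnt])
      finally have "?r * M ?c $ y \<le> emp x (Suc i) $ y" by (simp add: emp_nth)
      from G_scale[OF r0 r1 this, of "x i"] show ?thesis
        using False by (simp add: kernel_floor_def self_kernel_def)
    qed
    have Z: "exp (- real n * (S + \<epsilon>)) \<le> (\<Prod>i<n. r i x (x (Suc i)))" if x: "typical n \<delta> x" for x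
    proof -
      have ri: "exp (- w (?b i) (x i) (x (Suc i))) \<le> r i x (x (Suc i))" if i: "i < n" for i
      proof (cases "\<nu> (?b i) $ (x i, x (Suc i)) = 0")
        case True
        then show ?thesis by (simp add: w_def log_ratio_def r_def block_kernel_def conditional_nth)
      next
        case False
        let ?y = "x (Suc i)"
        have \<nu>p: "0 < \<nu> (?b i) $ (x i, ?y)" using False prob_simplexD(1)[OF \<nu>[of "?b i"], of "(x i, ?y)"] by simp
        then have Qp: "0 < ?Q i x ?y" using pos by (simp add: block_kernel_def conditional_nth)
        have f0: "0 < kernel_floor \<tau> (M (?b i)) (?b i) (x i) ?y"
        proof (cases "?b i = 0")
          case True
          then show ?thesis using \<nu>0 \<nu>p by (simp add: kernel_floor_def)
        next
          case False
          have "?b i < K" using block_of_bounds(1)[OF mono_grid grid_0, of i n K K] i grid_K[OF K] by simp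
          then have M0: "0 < M (?b i) $ ?y" using \<mu>M[of "?b i" ?y] \<mu> False by simp
          have "0 < Po (x i) ?y + Pz (x i)" using supp[OF \<nu>p] by (simp add: adj_support_iff)
          then have "0 < Po (x i) ?y \<or> 0 < Pz (x i)" by linarith
          then have "0 < G (M (?b i)) $ x i $ ?y"
            using M0 P_bounds(1)[of "Some (x i)" "Some ?y"] P_bounds(1)[of "Some (x i)" None]
            by (auto simp: G_nth intro: add_pos_nonneg add_nonneg_pos)
          then show ?thesis using False \<tau> by (simp add: kernel_floor_def)
        qed
        have "exp (- w (?b i) (x i) ?y) = kernel_floor \<tau> (M (?b i)) (?b i) (x i) ?y / ?Q i x ?y"
          using False Qp f0 by (simp add: w_def log_ratio_def block_kernel_def exp_minus)
        also have "\<dots> \<le> ?k i x ?y / ?Q i x ?y"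
          using floor[OF x i] Qp by (intro divide_right_mono) auto
        finally show ?thesis using Qp by (simp add: r_def)
      qed
      have "(\<Sum>i<n. w (?b i) (x i) (x (Suc i))) = (\<Sum>b<K. \<Sum>z\<in>UNIV. \<Sum>y\<in>UNIV. block_count n K b x (z, y) * w b z y)"
        unfolding block_count_def by (rule sum_over_blocks[OF K])
      also have "\<dots> \<le> (\<Sum>b<K. \<Sum>z\<in>UNIV. \<Sum>y\<in>UNIV. real n / real K * (\<nu> b $ (z, y) * w b z y) + \<delta> * real n * \<bar>w b z y\<bar>)"
      proof (intro sum_mono)
        fix b z y assume "b \<in> {..<K}"
        then have "\<bar>block_count n K b x (z, y) - real n / real K * \<nu> b $ (z, y)\<bar> \<le> \<delta> * real n"
          using x by (simp add: typical_def)
        then have "\<bar>block_count n K b x (z, y) - real n / real K * \<nu> b $ (z, y)\<bar> * \<bar>w b z y\<bar> \<le> \<delta> * real n * \<bar>w b z y\<bar>"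
          by (intro mult_right_mono) auto
        then have "(block_count n K b x (z, y) - real n / real K * \<nu> b $ (z, y)) * w b z y \<le> \<delta> * real n * \<bar>w b z y\<bar>"
          by (metis abs_le_D1 abs_mult)
        then show "block_count n K b x (z, y) * w b z y \<le> real n / real K * (\<nu> b $ (z, y) * w b z y) + \<delta> * real n * \<bar>w b z y\<bar>"
          by (simp add: left_diff_distrib mult.assoc)
      qed
      also have "\<dots> = real n * S + real n * (W * \<delta>)"
        unfolding S_def W_def sum.distrib sum_distrib_left[symmetric] by simp
      also have "\<dots> \<le> real n * (S + \<epsilon>)"
        using mult_left_mono[OF d2, of "real n"] by (simp add: distrib_left)
      finally have "exp (- real n * (S + \<epsilon>)) \<le> exp (- (\<Sum>i<n. w (?b i) (x i) (x (Suc i))))" by simp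
      also have "\<dots> = (\<Prod>i<n. exp (- w (?b i) (x i) (x (Suc i))))"
        by (simp add: exp_sum sum_negf[symmetric] del: sum_negf)
      also have "\<dots> \<le> (\<Prod>i<n. r i x (x (Suc i)))"
        by (intro prod_mono) (use ri in auto)
      finally show ?thesis .
    qed
    have target: "\<bar>emp x (Suc n) $ y - M K $ y\<bar> < \<rho>" if x: "typical n \<delta> x" for x y
    proof -
      have "\<bar>(\<Sum>j<n. of_bool (x j = y)) - real n * M K $ y\<bar> \<le> real K * ?d * \<delta> * real n"
        using typical_occupation[OF x K order_refl, of y] K by (simp add: M_def grid_K[OF K])
      then have "\<bar>(\<Sum>j<n. of_bool (x j = y)) - real n * M K $ y\<bar> / real n \<le> real K * ?d * \<delta>"
        using np by (simp add: pos_divide_le_eq)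
      moreover have "(\<Sum>j<n. of_bool (x j = y)) / real n - M K $ y = ((\<Sum>j<n. of_bool (x j = y)) - real n * M K $ y) / real n"
        using np by (simp add: diff_divide_distrib)
      ultimately have "\<bar>(\<Sum>j<n. of_bool (x j = y)) / real n - M K $ y\<bar> \<le> real K * ?d * \<delta>"
        by (simp add: abs_divide)
      then show ?thesis using emp_Suc_near[OF np(1), of x y] np(3) d3 by linarith
    qed
    let ?\<Phi> = "\<lambda>x. of_bool (\<forall>y. \<bar>emp x (Suc n) $ y - M K $ y\<bar> < \<rho>) :: real"
    have "exp (- real n * (S + \<epsilon>)) * (1 / 2) \<le> exp (- real n * (S + \<epsilon>)) * path_exp ?Q x0 n (\<lambda>x. of_bool (typical n \<delta> x))"
      using n1[of n] n by (intro mult_left_mono) auto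
    also have "\<dots> = path_exp ?Q x0 n (\<lambda>x. exp (- real n * (S + \<epsilon>)) * of_bool (typical n \<delta> x))"
      by (rule path_exp_cmult[symmetric])
    also have "\<dots> \<le> path_exp ?Q x0 n (\<lambda>x. (\<Prod>i<n. r i x (x (Suc i))) * ?\<Phi> x)"
    proof (rule path_exp_mono[OF block_kernel_nonneg])
      fix x
      show "exp (- real n * (S + \<epsilon>)) * of_bool (typical n \<delta> x) \<le> (\<Prod>i<n. r i x (x (Suc i))) * ?\<Phi> x"
      proof (cases "typical n \<delta> x")
        case True
        then show ?thesis using Z[OF True] target[OF True] by simp
      next
        case False
        have "0 \<le> (\<Prod>i<n. r i x (x (Suc i)))" by (intro prod_nonneg) (simp add: r0)
        then show ?thesis using False by simp
      qed
    qed
    also have "\<dots> \<le> path_exp ?k x0 n ?\<Phi>"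
      by (rule path_exp_change_ge[OF block_kernel_nonneg self_kernel_nonneg r_ad r0 rQ]) simp
    finally show ?thesis by simp
  qed
  then show ?thesis by blast
qed

section \<open>Entropy of smoothed blocks\<close>

lemma finite_path_cost:
  fixes \<zeta> :: "real \<Rightarrow> real ^ ('s \<times> 's)"
  assumes \<zeta>: "simplex_path \<zeta>" and fin: "path_cost G \<zeta> < \<infinity>"
  defines "\<phi> \<equiv> \<lambda>u. enn2real (step_cost G (\<zeta> u) ((1 / u) *\<^sub>R marginal1 (cumulative \<zeta> u)))"
  shows "set_integrable lborel {0<..1} \<phi>" "(LINT u:{0<..1}|lborel. \<phi> u) = enn2real (path_cost G \<zeta>)"
    "AE u\<in>{0<..1} in lborel. step_cost G (\<zeta> u) ((1 / u) *\<^sub>R marginal1 (cumulative \<zeta> u)) = ennreal (\<phi> u)"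
proof -
  let ?c = "\<lambda>u. step_cost G (\<zeta> u) ((1 / u) *\<^sub>R marginal1 (cumulative \<zeta> u)) * indicator {0<..1} u"
  have m: "?c \<in> borel_measurable lborel" using step_cost_measurable[OF \<zeta>] by simp
  have ae: "AE u in lborel. ?c u \<noteq> \<infinity>"
    using fin m unfolding path_cost_def by (intro nn_integral_PInf_AE) auto
  have e: "indicat_real {0<..1} u *\<^sub>R \<phi> u = enn2real (?c u)" for u
    by (simp add: \<phi>_def indicator_def)
  have "AE u in lborel. ennreal (enn2real (?c u)) = ?c u"
    using ae by eventually_elim (simp add: less_top)
  then have nn: "(\<integral>\<^sup>+u. ennreal (enn2real (?c u)) \<partial>lborel) = path_cost G \<zeta>"
    unfolding path_cost_def by (intro nn_integral_cong_AE) simp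
  have int: "integrable lborel (\<lambda>u. enn2real (?c u))"
    by (rule integrableI_nonneg) (use m nn fin in auto)
  then show "set_integrable lborel {0<..1} \<phi>" unfolding set_integrable_def e .
  show "(LINT u:{0<..1}|lborel. \<phi> u) = enn2real (path_cost G \<zeta>)"
    unfolding set_lebesgue_integral_def e nn[symmetric]
    by (rule integral_eq_nn_integral) (use m in auto)
  show "AE u\<in>{0<..1} in lborel. step_cost G (\<zeta> u) ((1 / u) *\<^sub>R marginal1 (cumulative \<zeta> u)) = ennreal (\<phi> u)"
    using ae by eventually_elim (auto simp: \<phi>_def less_top)
qed

text \<open>Gibbs' inequality with a fixed kernel \<open>Q\<close> throughout the block takes the place of Jensen's
  inequality. Where \<open>Q\<close> vanishes it is replaced by a small constant.\<close>

lemma pointwise_gibbs: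
  fixes \<nu> :: "real ^ ('s \<times> 's)" and Q :: "'s \<Rightarrow> 's \<Rightarrow> real"
  assumes \<nu>: "\<nu> \<in> prob_simplex" and m: "m \<in> prob_simplex"
    and fin: "\<And>x y. G m $ x $ y = 0 \<Longrightarrow> \<nu> $ (x, y) = 0"
    and Q: "\<And>x y. 0 \<le> Q x y" "\<And>x. (\<Sum>y\<in>UNIV. Q x y) = 1" and e: "0 < e"
    and \<Lambda>: "1 \<le> \<Lambda>" "\<And>y. m $ y \<le> \<Lambda> * m' $ y"
    and pos: "\<And>x y. \<nu> $ (x, y) \<noteq> 0 \<Longrightarrow> 0 < G m' $ x $ y"
  shows "(\<Sum>x\<in>UNIV. \<Sum>y\<in>UNIV. \<nu> $ (x, y) * ln ((if Q x y = 0 then e else Q x y) / G m' $ x $ y))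
    \<le> pair_entropy \<nu> (\<lambda>x y. G m $ x $ y) + ln \<Lambda> + real CARD('s) * e"
proof -
  let ?Q = "\<lambda>x y. if Q x y = 0 then e else Q x y"
  let ?S = "\<lambda>x. marginal1 \<nu> $ x"
  have n0: "0 \<le> \<nu> $ p" for p using \<nu> by (simp add: prob_simplexD)
  have Qp: "0 < ?Q x y" for x y using Q(1)[of x y] e by (auto simp: less_le)
  have "\<nu> $ (x, y) * ln (?Q x y / G m' $ x $ y)
      \<le> \<nu> $ (x, y) * ln (\<nu> $ (x, y) / ?S x / G m $ x $ y) + \<nu> $ (x, y) * ln \<Lambda> - (\<nu> $ (x, y) - ?S x * ?Q x y)" for x y
  proof (cases "\<nu> $ (x, y) = 0")
    case True
    have "0 \<le> ?S x" unfolding marginal_nth by (intro sum_nonneg n0)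
    then have "0 \<le> ?S x * ?Q x y" using Qp[of x y] by (intro mult_nonneg_nonneg) auto
    then show ?thesis using True by simp
  next
    case False
    then have n: "0 < \<nu> $ (x, y)" using n0[of "(x, y)"] by simp
    then have S: "0 < ?S x" using le_marginal1[OF \<nu>, of x y] by simp
    have "G m $ x $ y \<noteq> 0" using fin[of x y] False by auto
    moreover have "0 \<le> G m $ x $ y" using kernel_G[OF m] prob_simplexD(1) by (auto simp: transition_kernel_def)
    ultimately have g: "0 < G m $ x $ y" by simp
    have g': "0 < G m' $ x $ y" by (rule pos[OF False])
    \<comment> \<open>\<open>\<Lambda> \<ge> 1\<close> lets the part of the kernel that does not
      depend on \<open>m\<close> be scaled along, so the passage from \<open>m\<close> to
      \<open>m'\<close> costs \<open>ln \<Lambda>\<close>.\<close>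
    have "Po x y \<le> \<Lambda> * Po x y" using \<Lambda>(1) P_bounds(1) by (metis mult_le_cancel_right1 not_less)
    moreover have "Pz x * m $ y \<le> Pz x * (\<Lambda> * m' $ y)" using \<Lambda>(2) P_bounds(1) by (intro mult_left_mono) auto
    ultimately have "G m $ x $ y \<le> \<Lambda> * G m' $ x $ y" by (simp add: G_nth algebra_simps)
    then have "ln (G m $ x $ y) \<le> ln (\<Lambda> * G m' $ x $ y)" using g \<Lambda>(1) g' by (intro ln_mono) auto
    also have "\<dots> = ln \<Lambda> + ln (G m' $ x $ y)" using \<Lambda>(1) g' by (intro ln_mult_pos) auto
    finally have lg: "ln (G m $ x $ y) - ln (G m' $ x $ y) \<le> ln \<Lambda>" by simp
    have "\<nu> $ (x, y) - ?S x * ?Q x y \<le> \<nu> $ (x, y) * ln (\<nu> $ (x, y) / (?S x * ?Q x y))"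
      using n0 S Qp by (intro ln_ge_one_minus_inverse mult_pos_pos) auto
    also have "ln (\<nu> $ (x, y) / (?S x * ?Q x y)) = ln (\<nu> $ (x, y)) - ln (?S x) - ln (?Q x y)"
      using n S Qp[of x y] by (simp add: ln_div ln_mult_pos)
    finally have a: "\<nu> $ (x, y) - ?S x * ?Q x y \<le> \<nu> $ (x, y) * (ln (\<nu> $ (x, y)) - ln (?S x) - ln (?Q x y))" .
    have b: "ln (?Q x y / G m' $ x $ y) = ln (?Q x y) - ln (G m' $ x $ y)" using Qp[of x y] g' by (rule ln_divide_pos)
    have c: "ln (\<nu> $ (x, y) / ?S x / G m $ x $ y) = ln (\<nu> $ (x, y)) - ln (?S x) - ln (G m $ x $ y)"
      using n S g by (simp add: ln_divide_pos divide_pos_pos del: divide_divide_eq_left)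
    have "\<nu> $ (x, y) * (ln (?Q x y) - ln (G m' $ x $ y)) \<le> \<nu> $ (x, y) * ((ln (\<nu> $ (x, y)) - ln (?S x) - ln (G m $ x $ y)) + ln \<Lambda>
        - (ln (\<nu> $ (x, y)) - ln (?S x) - ln (?Q x y)))"
      using lg n0[of "(x, y)"] by (intro mult_left_mono) auto
    then have "\<nu> $ (x, y) * (ln (?Q x y) - ln (G m' $ x $ y)) \<le> \<nu> $ (x, y) * (ln (\<nu> $ (x, y)) - ln (?S x) - ln (G m $ x $ y))
        + \<nu> $ (x, y) * ln \<Lambda> - \<nu> $ (x, y) * (ln (\<nu> $ (x, y)) - ln (?S x) - ln (?Q x y))"
      by (simp only: distrib_left right_diff_distrib)
    then show ?thesis unfolding b c using a by linarith
  qed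
  then have "(\<Sum>x\<in>UNIV. \<Sum>y\<in>UNIV. \<nu> $ (x, y) * ln (?Q x y / G m' $ x $ y))
    \<le> (\<Sum>x\<in>UNIV. \<Sum>y\<in>UNIV. \<nu> $ (x, y) * ln (\<nu> $ (x, y) / ?S x / G m $ x $ y) + \<nu> $ (x, y) * ln \<Lambda> - (\<nu> $ (x, y) - ?S x * ?Q x y))"
    by (intro sum_mono)
  also have "\<dots> = pair_entropy \<nu> (\<lambda>x y. G m $ x $ y) + (\<Sum>x\<in>UNIV. \<Sum>y\<in>UNIV. \<nu> $ (x, y)) * ln \<Lambda>
      - ((\<Sum>x\<in>UNIV. \<Sum>y\<in>UNIV. \<nu> $ (x, y)) - (\<Sum>x\<in>UNIV. ?S x * (\<Sum>y\<in>UNIV. ?Q x y)))"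
    by (simp only: sum.distrib sum_subtractf sum_distrib_left sum_distrib_right pair_entropy_def)
  also have "(\<Sum>x\<in>UNIV. \<Sum>y\<in>UNIV. \<nu> $ (x, y)) = 1"
    using prob_simplexD(2)[OF \<nu>] by (simp add: sum_pairs)
  also have "(\<Sum>x\<in>UNIV. ?S x * (\<Sum>y\<in>UNIV. ?Q x y)) \<le> 1 + real CARD('s) * e"
  proof -
    have "(\<Sum>y\<in>UNIV. ?Q x y) \<le> (\<Sum>y\<in>UNIV. Q x y + e)" for x
      using e Q(1) by (intro sum_mono) auto
    then have r: "(\<Sum>y\<in>UNIV. ?Q x y) \<le> 1 + real CARD('s) * e" for x by (simp add: sum.distrib Q(2))
    have "(\<Sum>x\<in>UNIV. ?S x * (\<Sum>y\<in>UNIV. ?Q x y)) \<le> (\<Sum>x\<in>UNIV. ?S x * (1 + real CARD('s) * e))"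
      by (intro sum_mono mult_left_mono r) (simp add: marginal_nth n0 sum_nonneg)
    also have "\<dots> = 1 + real CARD('s) * e"
      using prob_simplexD(2)[OF marginal1_simplex[OF \<nu>]] by (simp flip: sum_distrib_right)
    finally show ?thesis .
  qed
  finally show ?thesis by simp
qed

text \<open>The pointwise inequality is integrated over the block. A transition on which
  \<open>Q\<close> vanishes has no mass in the block, so the left side does not see the filling
  constant \<open>e\<close>; its price \<open>CARD('s) * e\<close> is the arbitrary
  \<open>\<epsilon>\<close> of the proof.\<close>

lemma block_gibbs:
  fixes \<zeta> :: "real \<Rightarrow> real ^ ('s \<times> 's)" and Q :: "'s \<Rightarrow> 's \<Rightarrow> real"
  assumes \<zeta>: "simplex_path \<zeta>" and fin: "path_cost G \<zeta> < \<infinity>"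
    and st: "0 \<le> s" "s \<le> t" "t \<le> 1"
    and Q: "\<And>x y. 0 \<le> Q x y" "\<And>x. (\<Sum>y\<in>UNIV. Q x y) = 1"
    and Q0: "\<And>x y. Q x y = 0 \<Longrightarrow> cumulative \<zeta> t $ (x, y) = cumulative \<zeta> s $ (x, y)"
    and \<Lambda>: "1 \<le> \<Lambda>" "\<And>u y. s < u \<Longrightarrow> u \<le> t \<Longrightarrow> (1 / u) * marginal1 (cumulative \<zeta> u) $ y \<le> \<Lambda> * m' $ y"
    and pos: "\<And>u x y. \<zeta> u $ (x, y) \<noteq> 0 \<Longrightarrow> 0 < G m' $ x $ y"
  shows "(\<Sum>x\<in>UNIV. \<Sum>y\<in>UNIV. (cumulative \<zeta> t $ (x, y) - cumulative \<zeta> s $ (x, y)) * (if Q x y = 0 then 0 else ln (Q x y / G m' $ x $ y)))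
    \<le> (LINT u:{s<..t}|lborel. enn2real (step_cost G (\<zeta> u) ((1 / u) *\<^sub>R marginal1 (cumulative \<zeta> u)))) + (t - s) * ln \<Lambda>"
proof (rule field_le_epsilon)
  fix \<epsilon> :: real assume \<epsilon>: "0 < \<epsilon>"
  define e where "e = \<epsilon> / real CARD('s)"
  have e: "0 < e" "real CARD('s) * e = \<epsilon>" using \<epsilon> by (simp_all add: e_def)
  let ?\<phi> = "\<lambda>u. enn2real (step_cost G (\<zeta> u) ((1 / u) *\<^sub>R marginal1 (cumulative \<zeta> u)))"
  let ?Q = "\<lambda>x y. if Q x y = 0 then e else Q x y"
  let ?A = "{s<..t}"
  note fp = finite_path_cost[OF \<zeta> fin]
  have A: "?A \<subseteq> {0<..1}" using st by auto
  have i\<phi>: "set_integrable lborel ?A ?\<phi>" by (rule set_integrable_subset[OF fp(1) _ A]) simp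
  have ic: "set_integrable lborel ?A (\<lambda>u. ln \<Lambda> + \<epsilon>)" by (rule bounded_set_integrable[where B="\<bar>ln \<Lambda> + \<epsilon>\<bar>"]) auto
  have il: "set_integrable lborel ?A (\<lambda>u. \<Sum>x\<in>UNIV. \<Sum>y\<in>UNIV. \<zeta> u $ (x, y) * ln (?Q x y / G m' $ x $ y))"
  proof -
    have "set_integrable lborel ?A (\<lambda>u. \<zeta> u $ (x, y) * ln (?Q x y / G m' $ x $ y))" for x y
      using set_integrable_mult_left[of "ln (?Q x y / G m' $ x $ y)" lborel ?A "\<lambda>u. \<zeta> u $ (x, y)"]
        simplex_path_integrable[OF \<zeta>, of ?A "(x, y)"] by simp
    then show ?thesis unfolding set_integrable_def scaleR_sum_right by (intro Bochner_Integration.integrable_sum)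
  qed
  have "(\<Sum>x\<in>UNIV. \<Sum>y\<in>UNIV. (cumulative \<zeta> t $ (x, y) - cumulative \<zeta> s $ (x, y)) * (if Q x y = 0 then 0 else ln (Q x y / G m' $ x $ y)))
    = (\<Sum>x\<in>UNIV. \<Sum>y\<in>UNIV. (LINT u:?A|lborel. \<zeta> u $ (x, y)) * ln (?Q x y / G m' $ x $ y))"
    using Q0 by (intro sum.cong refl) (auto simp: cumulative_diff[OF \<zeta> st(1,2), symmetric])
  also have "\<dots> = (LINT u:?A|lborel. \<Sum>x\<in>UNIV. \<Sum>y\<in>UNIV. \<zeta> u $ (x, y) * ln (?Q x y / G m' $ x $ y))"
    by (rule set_integral_pair_sum[OF \<zeta>, symmetric]) auto
  also have "\<dots> \<le> (LINT u:?A|lborel. ?\<phi> u + (ln \<Lambda> + \<epsilon>))"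
  proof (rule set_integral_mono_AE[OF il set_integral_add(1)[OF i\<phi> ic]])
    show "AE u\<in>?A in lborel. (\<Sum>x\<in>UNIV. \<Sum>y\<in>UNIV. \<zeta> u $ (x, y) * ln (?Q x y / G m' $ x $ y)) \<le> ?\<phi> u + (ln \<Lambda> + \<epsilon>)"
      using fp(3)
    proof eventually_elim
      fix u assume sc: "u \<in> {0<..1} \<longrightarrow> step_cost G (\<zeta> u) ((1 / u) *\<^sub>R marginal1 (cumulative \<zeta> u)) = ennreal (?\<phi> u)"
      show "u \<in> ?A \<longrightarrow> (\<Sum>x\<in>UNIV. \<Sum>y\<in>UNIV. \<zeta> u $ (x, y) * ln (?Q x y / G m' $ x $ y)) \<le> ?\<phi> u + (ln \<Lambda> + \<epsilon>)"
      proof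
        assume u: "u \<in> ?A"
        let ?m = "(1 / u) *\<^sub>R marginal1 (cumulative \<zeta> u)"
        have u01: "u \<in> {0<..1}" using u A by blast
        have m: "?m \<in> prob_simplex" using u01 by (intro average_marginal_simplex[OF \<zeta>]) auto
        have ne: "step_cost G (\<zeta> u) ?m \<noteq> \<infinity>" using sc u01 by (metis ennreal_neq_top infinity_ennreal_def)
        note ce = step_cost_eq[where G=G, OF simplex_pathD(2)[OF \<zeta>] kernel_G[OF m], of u]
        have f0: "\<forall>x y. G ?m $ x $ y = 0 \<longrightarrow> \<zeta> u $ (x, y) = 0" using ce ne by (auto split: if_splits)
        have pe: "0 \<le> pair_entropy (\<zeta> u) (\<lambda>x y. G ?m $ x $ y)"
          by (rule pair_entropy_nonneg[OF simplex_pathD(2)[OF \<zeta>] kernel_G[OF m]]) (use f0 in auto)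
        have \<phi>: "?\<phi> u = pair_entropy (\<zeta> u) (\<lambda>x y. G ?m $ x $ y)" using ce f0 pe by simp
        have "(\<Sum>x\<in>UNIV. \<Sum>y\<in>UNIV. \<zeta> u $ (x, y) * ln (?Q x y / G m' $ x $ y))
            \<le> pair_entropy (\<zeta> u) (\<lambda>x y. G ?m $ x $ y) + ln \<Lambda> + real CARD('s) * e"
        proof (rule pointwise_gibbs[OF simplex_pathD(2)[OF \<zeta>] m _ Q e(1) \<Lambda>(1)])
          show "?m $ y \<le> \<Lambda> * m' $ y" for y using \<Lambda>(2)[of u y] u by simp
        qed (use f0 pos in auto)
        then show "(\<Sum>x\<in>UNIV. \<Sum>y\<in>UNIV. \<zeta> u $ (x, y) * ln (?Q x y / G m' $ x $ y)) \<le> ?\<phi> u + (ln \<Lambda> + \<epsilon>)"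
          unfolding \<phi> e(2) by simp
      qed
    qed
  qed
  also have "\<dots> = (LINT u:?A|lborel. ?\<phi> u) + (t - s) * (ln \<Lambda> + \<epsilon>)"
    unfolding set_integral_add(2)[OF i\<phi> ic] using st by (simp add: set_integral_const_Ioc)
  also have "\<dots> \<le> (LINT u:?A|lborel. ?\<phi> u) + (t - s) * ln \<Lambda> + \<epsilon>"
  proof -
    have "(t - s) * \<epsilon> \<le> 1 * \<epsilon>" using st \<epsilon> by (intro mult_right_mono) auto
    then show ?thesis by (simp add: distrib_left)
  qed
  finally show "(\<Sum>x\<in>UNIV. \<Sum>y\<in>UNIV. (cumulative \<zeta> t $ (x, y) - cumulative \<zeta> s $ (x, y)) * (if Q x y = 0 then 0 else ln (Q x y / G m' $ x $ y)))
    \<le> (LINT u:?A|lborel. ?\<phi> u) + (t - s) * ln \<Lambda> + \<epsilon>" .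
qed

end

text \<open>Averaging \<open>\<zeta>\<close> over the blocks \<open>(b / K, (b + 1) / K]\<close> and mixing with a stationary pair
  measure \<open>\<kappa>\<close> of full support gives irreducible block kernels. In block \<open>0\<close>, where the
  empirical measure may still be degenerate, the chain just follows \<open>\<kappa>\<close>.\<close>

locale smoothed_path = afp_chain P
  for P :: "real ^ 's option ^ 's::finite option" +
  fixes \<zeta> :: "real \<Rightarrow> real ^ ('s \<times> 's)" and \<kappa> :: "real ^ ('s \<times> 's)" and \<theta> p0 k0 :: real and K :: nat
  assumes \<zeta>: "simplex_path \<zeta>" and \<zeta>_bal: "\<forall>u. marginal1 (\<zeta> u) = marginal2 (\<zeta> u)"
    and \<zeta>_supp: "\<forall>u. \<forall>p\<in>- adj_support (afp_adjacency P). \<zeta> u $ p = 0"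
    and fin: "path_cost G \<zeta> < \<infinity>"
    and \<kappa>: "\<kappa> \<in> prob_simplex" "marginal1 \<kappa> = marginal2 \<kappa>" "\<And>x y. 0 < \<kappa> $ (x, y) \<longleftrightarrow> 0 < Po x y"
    and \<theta>: "0 < \<theta>" "\<theta> < 1" and K: "0 < K"
    and p0: "0 < p0" "p0 \<le> 1" "\<And>x y. 0 < Po x y \<Longrightarrow> p0 \<le> Po x y"
    and k0: "0 < k0" "k0 \<le> 1" "\<And>x. k0 \<le> marginal1 \<kappa> $ x"
begin

definition average :: "nat \<Rightarrow> real ^ ('s \<times> 's)" where
  "average b = real K *\<^sub>R (cumulative \<zeta> (real (Suc b) / real K) - cumulative \<zeta> (real b / real K))"

text \<open>Blocks \<open>b \<ge> K\<close> lie beyond the time interval of the path and get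
  \<open>\<kappa>\<close> as a default, so that the hypotheses of \<open>block_chain\<close> make
  sense at every index.\<close>

definition smooth :: "nat \<Rightarrow> real ^ ('s \<times> 's)" where
  "smooth b = (if b = 0 \<or> K \<le> b then \<kappa> else (1 - \<theta>) *\<^sub>R average b + \<theta> *\<^sub>R \<kappa>)"

abbreviation occupation :: "real \<Rightarrow> real ^ 's" where
  "occupation u \<equiv> marginal1 (cumulative \<zeta> u)"

lemma occupation_diff_bounds:
  assumes "0 \<le> u" "u \<le> v"
  shows "occupation u $ y \<le> occupation v $ y" "occupation v $ y - occupation u $ y \<le> v - u"
  using cumulative_diff_bounds[OF simplex_path_marginal1[OF \<zeta>] assms, of y]
  by (simp_all add: cumulative_marginal1[OF \<zeta>])

lemma average_simplex_block: "average b \<in> prob_simplex"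
proof -
  have le: "real b / real K \<le> real (Suc b) / real K" by (intro divide_right_mono) auto
  have "0 \<le> average b $ p" for p
    unfolding average_def using cumulative_diff_bounds(1)[OF \<zeta> _ le, of p] by simp
  moreover have "(\<Sum>p\<in>UNIV. average b $ p) = real K * (real (Suc b) / real K - real b / real K)"
    unfolding average_def by (simp only: vector_scaleR_component vector_minus_component real_scaleR_def
        sum_distrib_left[symmetric] sum_subtractf cumulative_sum[OF \<zeta>] divide_nonneg_nonneg of_nat_0_le_iff)
  ultimately show ?thesis using K by (simp add: prob_simplex_def flip: diff_divide_distrib)
qed

lemma marginal_average:
  "marginal1 (average b) $ y = real K * (occupation (real (Suc b) / real K) $ y - occupation (real b / real K) $ y)"
  "marginal2 (average b) = marginal1 (average b)"
proof -
  show 1: "marginal1 (average b) $ y = real K * (occupation (real (Suc b) / real K) $ y - occupation (real b / real K) $ y)" for y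
    by (simp add: average_def marginal_nth sum_subtractf flip: sum_distrib_left)
  have "marginal2 (average b) $ y = real K * (marginal2 (cumulative \<zeta> (real (Suc b) / real K)) $ y - marginal2 (cumulative \<zeta> (real b / real K)) $ y)" for y
    by (simp add: average_def marginal_nth sum_subtractf flip: sum_distrib_left)
  then show "marginal2 (average b) = marginal1 (average b)"
    unfolding vec_eq_iff 1 cumulative_marginal2[OF \<zeta> \<zeta>_bal] by simp
qed

lemma smooth_nth:
  assumes "0 < b" "b < K"
  shows "smooth b $ p = (1 - \<theta>) * average b $ p + \<theta> * \<kappa> $ p"
    "marginal1 (smooth b) $ y = (1 - \<theta>) * marginal1 (average b) $ y + \<theta> * marginal1 \<kappa> $ y"
  using assms by (simp_all add: smooth_def marginal_nth sum.distrib flip: sum_distrib_left)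

lemma average_nonneg: "0 \<le> average b $ p" "0 \<le> marginal1 (average b) $ y"
  using prob_simplexD(1)[OF average_simplex_block] prob_simplexD(1)[OF marginal1_simplex[OF average_simplex_block]] .

lemma \<kappa>_nonneg: "0 \<le> \<kappa> $ p"
  using prob_simplexD(1)[OF \<kappa>(1)] .

lemma smooth_lower: "\<theta> * \<kappa> $ p \<le> smooth b $ p" "\<theta> * k0 \<le> marginal1 (smooth b) $ y"
proof -
  have "\<theta> * \<kappa> $ p \<le> 1 * \<kappa> $ p" "\<theta> * k0 \<le> 1 * k0" "\<theta> * k0 \<le> \<theta> * marginal1 \<kappa> $ y"
    using \<theta> k0 \<kappa>_nonneg by (intro mult_right_mono mult_left_mono; simp)+
  moreover have "0 \<le> (1 - \<theta>) * average b $ p" "0 \<le> (1 - \<theta>) * marginal1 (average b) $ y"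
    using \<theta> average_nonneg by simp_all
  ultimately have *: "b = 0 \<or> K \<le> b \<or> 0 < b \<and> b < K" "\<theta> * \<kappa> $ p \<le> \<kappa> $ p" "\<theta> * k0 \<le> marginal1 \<kappa> $ y"
    "0 \<le> (1 - \<theta>) * average b $ p" "\<theta> * k0 \<le> (1 - \<theta>) * marginal1 (average b) $ y + \<theta> * marginal1 \<kappa> $ y"
    using k0(3)[of y] by linarith+
  show "\<theta> * \<kappa> $ p \<le> smooth b $ p" "\<theta> * k0 \<le> marginal1 (smooth b) $ y"
    using * by (auto simp: smooth_nth) (auto simp: smooth_def)
qed

lemma smooth_support:
  assumes "smooth b $ (x, y) \<noteq> 0"
  shows "(x, y) \<in> adj_support (afp_adjacency P)"
proof (rule ccontr)
  assume n: "(x, y) \<notin> adj_support (afp_adjacency P)"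
  then have "cumulative \<zeta> u $ (x, y) = 0" for u using \<zeta>_supp by (simp add: cumulative_def)
  then have "average b $ (x, y) = 0" by (simp add: average_def)
  moreover have "\<kappa> $ (x, y) = 0"
    using n \<kappa>(3)[of x y] \<kappa>_nonneg[of "(x, y)"] P_bounds(1)[of "Some x" None] by (force simp: adj_support_iff)
  ultimately show False using assms by (simp add: smooth_def split: if_splits)
qed

lemma block_chain_smooth: "block_chain smooth edges K"
proof
  fix b
  have s: "(\<Sum>p\<in>UNIV. smooth b $ p) = 1"
    using prob_simplexD(2)[OF \<kappa>(1)] prob_simplexD(2)[OF average_simplex_block]
    by (simp add: smooth_def sum.distrib flip: sum_distrib_left)
  have "0 \<le> smooth b $ p" for p
    using smooth_lower(1)[of p b] \<kappa>_nonneg[of p] \<theta> by (meson mult_nonneg_nonneg less_imp_le order_trans)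
  then show "smooth b \<in> prob_simplex" using s by (simp add: prob_simplex_def)
  have m2: "marginal2 (smooth b) $ y = (1 - \<theta>) * marginal2 (average b) $ y + \<theta> * marginal2 \<kappa> $ y" if "0 < b" "b < K" for y
    using that by (simp add: smooth_def marginal_nth sum.distrib flip: sum_distrib_left)
  show "marginal1 (smooth b) = marginal2 (smooth b)"
  proof (cases "0 < b \<and> b < K")
    case True
    then show ?thesis unfolding vec_eq_iff by (simp add: smooth_nth m2 marginal_average(2) \<kappa>(2))
  next
    case False
    then show ?thesis using \<kappa>(2) by (auto simp: smooth_def)
  qed
next
  fix b x y assume "(x, y) \<in> edges"
  then have "0 < \<theta> * \<kappa> $ (x, y)" using \<kappa>(3) \<theta> by (simp add: edges_def)
  then show "0 < smooth b $ (x, y)" using smooth_lower(1)[of "(x, y)" b] by linarith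
next
  fix b x
  have "0 < \<theta> * k0" using \<theta> k0 by simp
  then show "0 < marginal1 (smooth b) $ x" using smooth_lower(2)[of b x] by linarith
qed (use edges_trancl K in auto)

sublocale block_chain smooth edges K
  by (rule block_chain_smooth)

lemma block_mean_nth: "block_mean b $ y = (\<Sum>j<b. marginal1 (smooth j) $ y) / real b"
  by (simp add: block_mean_def)

lemma block_mean_lower:
  assumes b: "0 < b"
  shows "\<theta> * k0 \<le> block_mean b $ y"
proof -
  have "real b * (\<theta> * k0) = (\<Sum>j<b. \<theta> * k0)" by simp
  also have "\<dots> \<le> (\<Sum>j<b. marginal1 (smooth j) $ y)" by (intro sum_mono smooth_lower)
  finally show ?thesis using b by (simp add: block_mean_nth pos_le_divide_eq mult.commute)
qed

text \<open>The \<open>- 1\<close> pays for block 0, where the occupation by \<open>\<zeta>\<close>,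
  at most 1 in units of \<open>1 / K\<close>, has been replaced by that of
  \<open>\<kappa>\<close>.\<close>

lemma occupation_le_sum:
  assumes "b \<le> K"
  shows "(1 - \<theta>) * (real K * occupation (real b / real K) $ y - 1) \<le> (\<Sum>j<b. marginal1 (smooth j) $ y)"
  using assms
proof (induction b)
  case 0
  show ?case using \<theta> by (simp add: cumulative_0 marginal_nth)
next
  case (Suc b)
  show ?case
  proof (cases "b = 0")
    case True
    have "occupation (1 / real K) $ y \<le> 1 / real K"
      using occupation_diff_bounds(2)[of 0 "1 / real K" y] by (simp add: cumulative_0 marginal_nth)
    then have "real K * occupation (1 / real K) $ y \<le> real K * (1 / real K)" by (intro mult_left_mono) auto
    then have "(1 - \<theta>) * (real K * occupation (1 / real K) $ y - 1) \<le> 0"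
      using \<theta> K by (intro mult_nonneg_nonpos) auto
    also have "0 \<le> marginal1 (smooth 0) $ y" using pos[of 0 y] by simp
    finally show ?thesis using True by simp
  next
    case False
    then have "(1 - \<theta>) * marginal1 (average b) $ y \<le> marginal1 (smooth b) $ y"
      using Suc.prems \<theta> k0(1) k0(3)[of y] by (simp add: smooth_nth)
    moreover have "(1 - \<theta>) * (real K * occupation (real (Suc b) / real K) $ y - 1)
      = (1 - \<theta>) * (real K * occupation (real b / real K) $ y - 1) + (1 - \<theta>) * marginal1 (average b) $ y"
      unfolding marginal_average by (simp add: algebra_simps)
    ultimately show ?thesis using Suc by simp
  qed
qed

text \<open>This supplies \<open>\<Lambda>\<close> for \<open>block_gibbs\<close>. Mixing costs the
  factor \<open>1 / (1 - \<theta>)\<close>. Two unit errors, one for block 0 and one for the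
  position of \<open>u\<close> inside its block, become multiplicative through the lower bound
  \<open>\<theta> * k0\<close> of the block mean.\<close>

lemma occupation_le_block_mean:
  assumes b: "0 < b" "b < K" and u: "real b / real K < u" "u \<le> real (Suc b) / real K"
  shows "(1 / u) * occupation u $ y \<le> (1 / (1 - \<theta>) + 2 / (real b * \<theta> * k0)) * block_mean b $ y"
proof -
  let ?M = "block_mean b $ y" and ?v = "real b / real K"
  have v: "0 < ?v" using b by simp
  have "u \<le> ?v + 1 / real K" using u(2) by (simp add: add_divide_distrib)
  then have "occupation u $ y \<le> occupation ?v $ y + 1 / real K"
    using occupation_diff_bounds(2)[of ?v u y] u v by simp
  then have "real K * occupation u $ y \<le> real K * (occupation ?v $ y + 1 / real K)"
    by (intro mult_left_mono) auto
  also have "\<dots> = real K * occupation ?v $ y + 1" using K by (simp add: distrib_left)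
  also have "\<dots> \<le> real b * ?M / (1 - \<theta>) + 2"
  proof -
    have "(1 - \<theta>) * (real K * occupation ?v $ y - 1) \<le> real b * ?M"
      using occupation_le_sum[of b y] b by (simp add: block_mean_nth)
    then have "real K * occupation ?v $ y - 1 \<le> real b * ?M / (1 - \<theta>)"
      using \<theta> by (simp add: pos_le_divide_eq mult.commute)
    then show ?thesis by simp
  qed
  finally have K1: "real K * occupation u $ y \<le> real b * ?M / (1 - \<theta>) + 2" .
  have o0: "0 \<le> occupation u $ y"
    using cumulative_nonneg[OF \<zeta>] u v by (auto simp: marginal_nth intro!: sum_nonneg)
  have "1 / u \<le> 1 / ?v" using u v by (intro frac_le) auto
  then have "(1 / u) * occupation u $ y \<le> (real K / real b) * occupation u $ y"
    using o0 by (intro mult_right_mono) auto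
  also have "\<dots> = (1 / real b) * (real K * occupation u $ y)" by simp
  also have "\<dots> \<le> (1 / real b) * (real b * ?M / (1 - \<theta>) + 2)" using K1 by (intro mult_left_mono) auto
  also have "\<dots> = (1 / (1 - \<theta>)) * ?M + 2 / real b * 1" using b by (simp add: distrib_left)
  also have "2 / real b * 1 \<le> 2 / real b * (?M / (\<theta> * k0))"
    using block_mean_lower[OF b(1), of y] \<theta> k0 by (intro mult_left_mono) (auto simp: pos_le_divide_eq)
  also have "(1 / (1 - \<theta>)) * ?M + 2 / real b * (?M / (\<theta> * k0)) = (1 / (1 - \<theta>) + 2 / (real b * \<theta> * k0)) * ?M"
    by (simp add: distrib_right mult.assoc)
  finally show ?thesis by simp
qed

lemma smooth_simplex: "smooth b \<in> prob_simplex"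
  using \<nu> .

lemma conditional_smooth: "0 \<le> conditional (smooth b) x $ y" "conditional (smooth b) x $ y \<le> 1"
  "conditional (smooth b) x $ y = 0 \<longleftrightarrow> smooth b $ (x, y) = 0" "(\<Sum>y\<in>UNIV. conditional (smooth b) x $ y) = 1"
  using prob_simplexD(1)[OF smooth_simplex, of b "(x, y)"] pos[of b x] le_marginal1[OF smooth_simplex, of b x y]
  by (simp_all add: conditional_nth pos_divide_le_eq flip: sum_divide_distrib marginal_nth)

text \<open>\<open>\<kappa>\<close> charges only transitions of \<open>P\<^sup>o\<close>, where
  every kernel \<open>g\<close> considered is at least \<open>p0\<close>. The share of the cost due
  to \<open>\<kappa>\<close> is thus bounded independently of the path.\<close>

lemma ln_conditional_le:
  assumes k: "\<kappa> $ (x, y) \<noteq> 0" and g: "Po x y \<le> g"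
  shows "ln (conditional (smooth b) x $ y / g) \<le> - ln p0"
proof -
  have k: "0 < \<kappa> $ (x, y)" using k \<kappa>_nonneg[of "(x, y)"] by simp
  then have p: "p0 \<le> Po x y" using \<kappa>(3) p0(3) by blast
  have "0 < smooth b $ (x, y)" using smooth_lower(1)[of "(x, y)" b] k \<theta> by (meson mult_pos_pos less_le_trans)
  then have c: "0 < conditional (smooth b) x $ y"
    using conditional_smooth(1,3)[of b x y] by (auto simp: less_le)
  have "conditional (smooth b) x $ y / g \<le> 1 / p0"
    using conditional_smooth(2) c p g p0 by (intro frac_le) auto
  then have "ln (conditional (smooth b) x $ y / g) \<le> ln (1 / p0)"
    using c p g p0 by (intro ln_mono divide_pos_pos) auto
  then show ?thesis using p0 by (simp add: ln_div)
qed

definition step_rate :: "real \<Rightarrow> real" where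
  "step_rate u = enn2real (step_cost G (\<zeta> u) ((1 / u) *\<^sub>R marginal1 (cumulative \<zeta> u)))"

lemma initial_block_cost:
  "(\<Sum>x\<in>UNIV. \<Sum>y\<in>UNIV. smooth 0 $ (x, y) * log_ratio (smooth 0) (kernel_floor \<theta> m 0) x y) \<le> - ln p0"
proof -
  have s0: "smooth 0 = \<kappa>" by (simp add: smooth_def)
  have "(\<Sum>x\<in>UNIV. \<Sum>y\<in>UNIV. smooth 0 $ (x, y) * log_ratio (smooth 0) (kernel_floor \<theta> m 0) x y)
    \<le> (\<Sum>x\<in>UNIV. \<Sum>y\<in>UNIV. \<kappa> $ (x, y) * (- ln p0))"
  proof (intro sum_mono)
    fix x y
    show "smooth 0 $ (x, y) * log_ratio (smooth 0) (kernel_floor \<theta> m 0) x y \<le> \<kappa> $ (x, y) * (- ln p0)"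
    proof (cases "\<kappa> $ (x, y) = 0")
      case False
      then have "log_ratio (smooth 0) (kernel_floor \<theta> m 0) x y \<le> - ln p0"
        using ln_conditional_le[of x y "Po x y" 0] by (simp add: s0 log_ratio_def kernel_floor_def)
      then show ?thesis unfolding s0 using \<kappa>_nonneg by (intro mult_left_mono)
    qed (simp add: s0)
  qed
  also have "\<dots> = - ln p0" unfolding sum_distrib_right[symmetric]
    using prob_simplexD(2)[OF \<kappa>(1)] by (simp add: sum_pairs)
  finally show ?thesis .
qed

text \<open>For a fixed logarithm the cost is linear in the mixture: the averaged part is handled by
  \<open>block_gibbs\<close> with \<open>Q\<close> the conditional of the mixture itself, the
  \<open>\<kappa>\<close> part by \<open>- ln p0\<close>. One \<open>- ln (1 - \<theta>)\<close>
  comes from \<open>\<Lambda>\<close> and one from the kernel floor. In the coefficient of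
  \<open>1 / b\<close>, the term \<open>2 / (\<theta> * k0)\<close> comes from
  \<open>\<Lambda>\<close> and 1 from \<open>ln (1 + 1 / b) \<le> 1 / b\<close>.\<close>

lemma later_block_cost:
  assumes b: "0 < b" "b < K"
  shows "(\<Sum>x\<in>UNIV. \<Sum>y\<in>UNIV. smooth b $ (x, y) * log_ratio (smooth b) (kernel_floor \<theta> (block_mean b) b) x y)
    \<le> real K * (LINT u:{real b / K<..real (Suc b) / K}|lborel. step_rate u)
      + (- 2 * ln (1 - \<theta>) - \<theta> * ln p0) + (2 / (\<theta> * k0) + 1) * (1 / real b)"
proof -
  let ?I = "LINT u:{real b / K<..real (Suc b) / K}|lborel. step_rate u"
  let ?Q = "\<lambda>x y. conditional (smooth b) x $ y" and ?g = "\<lambda>x y. G (block_mean b) $ x $ y"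
  define l where "l = (\<lambda>x y. if ?Q x y = 0 then 0 else ln (?Q x y / ?g x y))"
  define r where "r = real b / real (Suc b) * (1 - \<theta>)"
  define \<Lambda> where "\<Lambda> = 1 / (1 - \<theta>) + 2 / (real b * \<theta> * k0)"
  have r: "0 < r" using b \<theta> by (simp add: r_def)
  have "1 \<le> 1 / (1 - \<theta>)" "0 \<le> 2 / (real b * \<theta> * k0)" using \<theta> k0 by simp_all
  then have \<Lambda>1: "1 \<le> \<Lambda>" unfolding \<Lambda>_def by linarith
  have M0: "0 < block_mean b $ y" for y
    using block_mean_lower[OF b(1), of y] \<theta> k0 by (meson mult_pos_pos less_le_trans)
  have Po_le: "Po x y \<le> ?g x y" for x y
    using M0[of y] P_bounds(1)[of "Some x" None] by (simp add: G_nth)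
  have gpos: "0 < ?g x y" if "(x, y) \<in> adj_support (afp_adjacency P)" for x y
  proof (cases "0 < Po x y")
    case True then show ?thesis using Po_le[of x y] by linarith
  next
    case False
    then have "0 < Pz x" using that by (simp add: adj_support_iff)
    then have "0 < Pz x * block_mean b $ y" using M0 by simp
    then show ?thesis using P_bounds(1)[of "Some x" "Some y"] by (simp add: G_nth)
  qed
  have split: "smooth b $ (x, y) * log_ratio (smooth b) (kernel_floor \<theta> (block_mean b) b) x y
      = smooth b $ (x, y) * l x y + smooth b $ (x, y) * (- ln r)" for x y
  proof (cases "smooth b $ (x, y) = 0")
    case False
    then have q: "0 < ?Q x y" using conditional_smooth(1,3)[of b x y] by (auto simp: less_le)
    have g: "0 < ?g x y" by (rule gpos[OF smooth_support[OF False]])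
    have "?Q x y / (r * ?g x y) = ?Q x y / ?g x y / r" by (simp add: mult.commute)
    then have "ln (?Q x y / (r * ?g x y)) = ln (?Q x y / ?g x y) - ln r"
      using ln_divide_pos[OF divide_pos_pos[OF q g] r] by (simp only:)
    then show ?thesis using False q b by (simp add: log_ratio_def kernel_floor_def l_def r_def distrib_left right_diff_distrib)
  qed simp
  have "(\<Sum>x\<in>UNIV. \<Sum>y\<in>UNIV. smooth b $ (x, y) * log_ratio (smooth b) (kernel_floor \<theta> (block_mean b) b) x y)
    = (\<Sum>x\<in>UNIV. \<Sum>y\<in>UNIV. smooth b $ (x, y) * l x y) + (\<Sum>x\<in>UNIV. \<Sum>y\<in>UNIV. smooth b $ (x, y)) * (- ln r)"
    unfolding split by (simp only: sum.distrib sum_distrib_right)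
  also have "(\<Sum>x\<in>UNIV. \<Sum>y\<in>UNIV. smooth b $ (x, y)) = 1"
    using prob_simplexD(2)[OF smooth_simplex[of b]] by (simp add: sum_pairs)
  also have "(\<Sum>x\<in>UNIV. \<Sum>y\<in>UNIV. smooth b $ (x, y) * l x y)
    = (1 - \<theta>) * (\<Sum>x\<in>UNIV. \<Sum>y\<in>UNIV. average b $ (x, y) * l x y) + \<theta> * (\<Sum>x\<in>UNIV. \<Sum>y\<in>UNIV. \<kappa> $ (x, y) * l x y)"
    unfolding smooth_nth(1)[OF b] by (simp add: distrib_right sum.distrib sum_distrib_left mult.assoc)
  also have "(\<Sum>x\<in>UNIV. \<Sum>y\<in>UNIV. \<kappa> $ (x, y) * l x y) \<le> - ln p0"
  proof -
    have "\<kappa> $ (x, y) * l x y \<le> \<kappa> $ (x, y) * (- ln p0)" for x y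
    proof (cases "\<kappa> $ (x, y) = 0")
      case False
      have "0 < \<theta> * \<kappa> $ (x, y)" using False \<kappa>_nonneg[of "(x, y)"] \<theta> by (simp add: less_le)
      then have "?Q x y \<noteq> 0" using smooth_lower(1)[of "(x, y)" b] by (simp add: conditional_smooth(3))
      then have "l x y \<le> - ln p0" using ln_conditional_le[OF False Po_le] by (simp add: l_def)
      then show ?thesis using \<kappa>_nonneg by (intro mult_left_mono)
    qed simp
    then have "(\<Sum>x\<in>UNIV. \<Sum>y\<in>UNIV. \<kappa> $ (x, y) * l x y) \<le> (\<Sum>x\<in>UNIV. \<Sum>y\<in>UNIV. \<kappa> $ (x, y) * (- ln p0))"
      by (intro sum_mono)
    also have "\<dots> = - ln p0" unfolding sum_distrib_right[symmetric]
      using prob_simplexD(2)[OF \<kappa>(1)] by (simp add: sum_pairs)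
    finally show ?thesis .
  qed
  also have "(\<Sum>x\<in>UNIV. \<Sum>y\<in>UNIV. average b $ (x, y) * l x y) \<le> real K * ?I + ln \<Lambda>"
  proof -
    have "(\<Sum>x\<in>UNIV. \<Sum>y\<in>UNIV. (cumulative \<zeta> (real (Suc b) / K) $ (x, y) - cumulative \<zeta> (real b / K) $ (x, y)) * l x y)
      \<le> ?I + (real (Suc b) / K - real b / K) * ln \<Lambda>"
      unfolding l_def step_rate_def
    proof (rule block_gibbs[OF \<zeta> fin])
      fix x y
      assume "?Q x y = 0"
      \<comment> \<open>A zero of the conditional of the mixture is a zero of both nonnegative
        parts, and \<open>\<theta> < 1\<close> makes the averaged one vanish.\<close>
      then have "(1 - \<theta>) * average b $ (x, y) + \<theta> * \<kappa> $ (x, y) = 0"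
        using smooth_nth(1)[OF b] by (simp add: conditional_smooth(3))
      moreover have "0 \<le> (1 - \<theta>) * average b $ (x, y)" "0 \<le> \<theta> * \<kappa> $ (x, y)"
        using \<theta> average_nonneg \<kappa>_nonneg by simp_all
      ultimately have "(1 - \<theta>) * average b $ (x, y) = 0" by linarith
      then show "cumulative \<zeta> (real (Suc b) / K) $ (x, y) = cumulative \<zeta> (real b / K) $ (x, y)"
        using \<theta> K by (simp add: average_def)
    next
      fix u y assume "real b / K < u" "u \<le> real (Suc b) / K"
      then show "(1 / u) * occupation u $ y \<le> \<Lambda> * block_mean b $ y"
        unfolding \<Lambda>_def by (rule occupation_le_block_mean[OF b])
    next
      fix u x y assume "\<zeta> u $ (x, y) \<noteq> 0"
      then show "0 < ?g x y" using \<zeta>_supp gpos by auto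
    next
      show "real b / K \<le> real (Suc b) / K" by (intro divide_right_mono) auto
      show "real (Suc b) / K \<le> 1" using b by simp
    qed (use conditional_smooth \<Lambda>1 in auto)
    then have "real K * (\<Sum>x\<in>UNIV. \<Sum>y\<in>UNIV. (cumulative \<zeta> (real (Suc b) / K) $ (x, y) - cumulative \<zeta> (real b / K) $ (x, y)) * l x y)
      \<le> real K * (?I + (real (Suc b) / K - real b / K) * ln \<Lambda>)" by (intro mult_left_mono) auto
    moreover have "real K * (?I + (real (Suc b) / K - real b / K) * ln \<Lambda>) = real K * ?I + ln \<Lambda>"
      using K by (simp add: distrib_left add_divide_distrib)
    ultimately show ?thesis by (simp add: average_def sum_distrib_left mult.assoc)
  qed
  finally have *: "(\<Sum>x\<in>UNIV. \<Sum>y\<in>UNIV. smooth b $ (x, y) * log_ratio (smooth b) (kernel_floor \<theta> (block_mean b) b) x y)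
    \<le> (1 - \<theta>) * (real K * ?I + ln \<Lambda>) + \<theta> * (- ln p0) + 1 * (- ln r)"
    using \<theta> by simp
  have "0 \<le> ?I" unfolding set_lebesgue_integral_def
    by (intro integral_nonneg_AE AE_I2) (simp add: step_rate_def)
  then have "(1 - \<theta>) * (real K * ?I + ln \<Lambda>) \<le> 1 * (real K * ?I + ln \<Lambda>)"
    using \<theta> \<Lambda>1 by (intro mult_right_mono add_nonneg_nonneg) auto
  moreover have "ln \<Lambda> \<le> - ln (1 - \<theta>) + 2 / (\<theta> * k0) * (1 / real b)"
  proof -
    let ?z = "2 / (real b * \<theta> * k0)"
    have z0: "0 \<le> ?z" using \<theta> k0 by simp
    have "(1 - \<theta>) * ?z \<le> 1 * ?z" using \<theta> by (intro mult_right_mono[OF _ z0]) simp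
    note z = z0 this
    have "\<Lambda> = (1 + (1 - \<theta>) * ?z) / (1 - \<theta>)"
      using \<theta> unfolding \<Lambda>_def add_divide_distrib by (simp del: times_divide_eq_right)
    moreover have "0 \<le> (1 - \<theta>) * ?z" using z \<theta> by (intro mult_nonneg_nonneg) auto
    ultimately have "ln \<Lambda> = ln (1 + (1 - \<theta>) * ?z) - ln (1 - \<theta>)"
      using \<theta> ln_divide_pos[of "1 + (1 - \<theta>) * ?z" "1 - \<theta>"] by simp
    also have "ln (1 + (1 - \<theta>) * ?z) \<le> (1 - \<theta>) * ?z" using \<open>0 \<le> (1 - \<theta>) * ?z\<close> by (rule ln_add_one_self_le_self)
    finally have "ln \<Lambda> \<le> - ln (1 - \<theta>) + ?z" using z by linarith
    then show ?thesis by (simp add: mult_ac)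
  qed
  moreover have "- ln r \<le> 1 / real b - ln (1 - \<theta>)"
  proof -
    have "r = (1 - \<theta>) / (1 + 1 / real b)" using b by (simp add: r_def field_simps)
    then have "ln r = ln (1 - \<theta>) - ln (1 + 1 / real b)"
      using \<theta> ln_divide_pos[of "1 - \<theta>" "1 + 1 / real b"] by (simp add: add_pos_nonneg)
    then show ?thesis using ln_add_one_self_le_self[of "1 / real b"] by simp
  qed
  ultimately show ?thesis using * unfolding distrib_right by simp
qed

text \<open>After division by \<open>K\<close> the integrals over the blocks are at most the cost of
  the path, block 0 contributes \<open>- ln p0 / K\<close>, and the errors of order
  \<open>1 / b\<close> contribute a harmonic sum divided by \<open>K\<close>.\<close>

lemma total_block_cost:
  "(1 / real K) * (\<Sum>b<K. \<Sum>x\<in>UNIV. \<Sum>y\<in>UNIV. smooth b $ (x, y) * log_ratio (smooth b) (kernel_floor \<theta> (block_mean b) b) x y)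
    \<le> enn2real (path_cost G \<zeta>) + (- 2 * ln (1 - \<theta>) - \<theta> * ln p0) + (2 * (2 / (\<theta> * k0) + 1) - ln p0) / sqrt (real K)"
proof -
  define D where "D = - 2 * ln (1 - \<theta>) - \<theta> * ln p0"
  define C where "C = 2 / (\<theta> * k0) + 1"
  define I where "I = (\<lambda>b. LINT u:{real b / K<..real (Suc b) / K}|lborel. step_rate u)"
  define T where "T = (\<lambda>b. \<Sum>x\<in>UNIV. \<Sum>y\<in>UNIV. smooth b $ (x, y) * log_ratio (smooth b) (kernel_floor \<theta> (block_mean b) b) x y)"
  have lp: "0 \<le> - ln p0" using p0 by simp
  have D0: "0 \<le> D"
  proof -
    have "0 \<le> - ln (1 - \<theta>)" "0 \<le> \<theta> * (- ln p0)" using \<theta> lp by (simp, intro mult_nonneg_nonneg) auto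
    then show ?thesis by (simp add: D_def)
  qed
  have C0: "0 \<le> C" using \<theta> k0 by (simp add: C_def)
  have I0: "0 \<le> I b" for b unfolding I_def set_lebesgue_integral_def
    by (intro integral_nonneg_AE AE_I2) (simp add: step_rate_def)
  have split: "(\<Sum>b<K. f b) = f 0 + (\<Sum>b=1..<K. f b)" for f :: "nat \<Rightarrow> real"
    using K by (simp add: lessThan_atLeast0 sum.atLeast_Suc_lessThan)
  have "(\<Sum>b<K. T b) \<le> - ln p0 + (\<Sum>b=1..<K. real K * I b + D + C * (1 / real b))"
    unfolding split
  proof (intro add_mono sum_mono)
    show "T 0 \<le> - ln p0" unfolding T_def by (rule initial_block_cost)
    fix b assume "b \<in> {1..<K}"
    then show "T b \<le> real K * I b + D + C * (1 / real b)"
      unfolding T_def I_def D_def C_def by (intro later_block_cost) auto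
  qed
  also have "(\<Sum>b=1..<K. real K * I b + D + C * (1 / real b))
      = real K * (\<Sum>b=1..<K. I b) + real (K - 1) * D + C * (\<Sum>b=1..<K. 1 / real b)"
    by (simp only: sum.distrib sum_distrib_left sum_constant card_atLeastLessThan)
  also have "(\<Sum>b=1..<K. I b) \<le> enn2real (path_cost G \<zeta>)"
  proof -
    have "(\<Sum>b=1..<K. I b) \<le> (\<Sum>b<K. I b)" using I0[of 0] unfolding split by simp
    also have "\<dots> = (LINT u:{0<..1}|lborel. step_rate u)"
      unfolding I_def step_rate_def by (rule set_integral_Ioc_blocks[OF finite_path_cost(1)[OF \<zeta> fin] K, symmetric])
    also have "\<dots> = enn2real (path_cost G \<zeta>)"
      unfolding step_rate_def by (rule finite_path_cost(2)[OF \<zeta> fin])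
    finally show ?thesis .
  qed
  also have "real (K - 1) * D \<le> real K * D" using D0 by (intro mult_right_mono) auto
  also have "(\<Sum>b=1..<K. 1 / real b) \<le> 2 * sqrt (real K)"
  proof -
    have "(\<Sum>b=1..<K. 1 / real b) \<le> (\<Sum>b=1..<Suc K. 1 / real b)" by (intro sum_mono2) auto
    then show ?thesis using sum_inverse_le_sqrt[of K] by linarith
  qed
  finally have "(\<Sum>b<K. T b) \<le> - ln p0 + (real K * enn2real (path_cost G \<zeta>) + real K * D + C * (2 * sqrt (real K)))"
    using C0 by (simp add: mult_left_mono)
  then have "(1 / real K) * (\<Sum>b<K. T b)
      \<le> (1 / real K) * (- ln p0 + (real K * enn2real (path_cost G \<zeta>) + real K * D + C * (2 * sqrt (real K))))"
    by (intro mult_left_mono) auto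
  also have "\<dots> = enn2real (path_cost G \<zeta>) + D + (2 * C * (sqrt (real K) / real K) + (- ln p0) * (1 / real K))"
    using K by (simp add: field_simps)
  also have "sqrt (real K) / real K = 1 / sqrt (real K)" using K by (simp add: field_simps)
  also have "(- ln p0) * (1 / real K) \<le> (- ln p0) * (1 / sqrt (real K))"
  proof (intro mult_left_mono lp divide_left_mono)
    have "1 * sqrt (real K) \<le> sqrt (real K) * sqrt (real K)" using K by (intro mult_right_mono) auto
    then show "sqrt (real K) \<le> real K" by simp
  qed (use K in auto)
  finally show ?thesis unfolding T_def D_def C_def by (simp add: add_divide_distrib diff_divide_distrib)
qed

text \<open>The averages telescope to the end point. Mixing moves each block by at most
  \<open>\<theta>\<close>, and block 0, replaced altogether, contributes at most one more block,
  that is \<open>1 / K\<close>.\<close>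

lemma block_mean_total: "\<bar>block_mean K $ y - occupation 1 $ y\<bar> \<le> \<theta> + 1 / real K"
proof -
  have "(\<Sum>b<K. marginal1 (average b) $ y) = real K * (\<Sum>b<K. occupation (real (Suc b) / real K) $ y - occupation (real b / real K) $ y)"
    by (simp only: marginal_average sum_distrib_left)
  also have "\<dots> = real K * occupation 1 $ y"
    unfolding sum_lessThan_telescope[of "\<lambda>b. occupation (real b / real K) $ y"] using K by (simp add: cumulative_0 marginal_nth)
  finally have a: "(\<Sum>b<K. marginal1 (average b) $ y) = real K * occupation 1 $ y" .
  have "\<bar>marginal1 (smooth b) $ y - marginal1 (average b) $ y\<bar> \<le> \<theta> + of_bool (b = 0)" if "b < K" for b
  proof -
    have u: "0 \<le> marginal1 (average b) $ y" "marginal1 (average b) $ y \<le> 1" "0 \<le> marginal1 \<kappa> $ y" "marginal1 \<kappa> $ y \<le> 1"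
      using prob_simplexD(1,3)[OF marginal1_simplex[OF average_simplex_block]] prob_simplexD(1,3)[OF marginal1_simplex[OF \<kappa>(1)]] by blast+
    show ?thesis
    proof (cases "b = 0")
      case True
      then show ?thesis using u \<theta> by (simp add: smooth_def abs_le_iff)
    next
      case False
      then have "marginal1 (smooth b) $ y - marginal1 (average b) $ y = \<theta> * (marginal1 \<kappa> $ y - marginal1 (average b) $ y)"
        using that by (simp add: smooth_nth algebra_simps)
      also have "\<bar>\<dots>\<bar> \<le> \<theta> * 1" unfolding abs_mult using u \<theta> by (intro mult_mono) auto
      finally show ?thesis using False by simp
    qed
  qed
  then have "(\<Sum>b<K. \<bar>marginal1 (smooth b) $ y - marginal1 (average b) $ y\<bar>) \<le> (\<Sum>b<K. \<theta> + of_bool (b = 0))"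
    by (intro sum_mono) auto
  also have "\<dots> = real K * \<theta> + 1"
  proof -
    have "{..<K} \<inter> {b. b = 0} = {0}" using K by auto
    then show ?thesis by (simp add: sum.distrib)
  qed
  finally have "\<bar>(\<Sum>b<K. marginal1 (smooth b) $ y - marginal1 (average b) $ y)\<bar> \<le> real K * \<theta> + 1"
    using sum_abs[of "\<lambda>b. marginal1 (smooth b) $ y - marginal1 (average b) $ y" "{..<K}"] by linarith
  then have "\<bar>real K * block_mean K $ y - real K * occupation 1 $ y\<bar> \<le> real K * \<theta> + 1"
    using K by (simp add: block_mean_nth sum_subtractf a)
  then have "real K * \<bar>block_mean K $ y - occupation 1 $ y\<bar> \<le> real K * (\<theta> + 1 / real K)"
    using K by (simp add: abs_mult distrib_left flip: right_diff_distrib)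
  then show ?thesis using K by simp
qed

end

section \<open>Local lower bound for the empirical measure\<close>

context afp_chain
begin

lemma path_lower_bound:
  fixes \<zeta> :: "real \<Rightarrow> real ^ ('s \<times> 's)"
  assumes \<zeta>: "simplex_path \<zeta>" and bal: "\<forall>u. marginal1 (\<zeta> u) = marginal2 (\<zeta> u)"
    and supp: "\<forall>u. \<forall>p\<in>- adj_support (afp_adjacency P). \<zeta> u $ p = 0"
    and a: "path_cost G \<zeta> < ennreal a" and \<rho>: "0 < \<rho>"
  shows "\<exists>n0. \<forall>n\<ge>n0. exp (- real n * a) / 2
    \<le> path_exp (self_kernel G) x0 n (\<lambda>x. of_bool (dist (emp x (Suc n)) (marginal1 (cumulative \<zeta> 1)) < \<rho>))"
proof -
  let ?d = "real CARD('s)"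
  obtain \<kappa> :: "real ^ ('s \<times> 's)" where \<kappa>: "\<kappa> \<in> prob_simplex" "marginal1 \<kappa> = marginal2 \<kappa>"
    "\<And>x y. 0 < \<kappa> $ (x, y) \<longleftrightarrow> 0 < Po x y" "\<And>x. 0 < marginal1 \<kappa> $ x"
    using stationary_pair_measure by blast
  define k0 where "k0 = Min (range (\<lambda>x. marginal1 \<kappa> $ x))"
  have k0: "0 < k0" "\<And>x. k0 \<le> marginal1 \<kappa> $ x" using \<kappa>(4) by (auto simp: k0_def Min_gr_iff)
  have k1: "k0 \<le> 1" using k0(2) prob_simplexD(3)[OF marginal1_simplex[OF \<kappa>(1)]] order_trans by blast
  \<comment> \<open>Inserting 1 makes the minimum at most 1, so that \<open>- ln p0\<close> is
    nonnegative.\<close>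
  define S where "S = insert 1 ((\<lambda>(x, y). Po x y) ` edges)"
  define p0 where "p0 = Min S"
  have S: "finite S" "1 \<in> S" by (auto simp: S_def)
  have "\<forall>s\<in>S. 0 < s" by (auto simp: S_def edges_def)
  moreover have "p0 \<in> S" unfolding p0_def using S by (intro Min_in) auto
  ultimately have p0: "0 < p0" "p0 \<le> 1" using S by (auto simp: p0_def)
  have p1: "p0 \<le> Po x y" if "0 < Po x y" for x y
    unfolding p0_def using that S(1) by (intro Min_le) (force simp: S_def edges_def)+
  define c where "c = enn2real (path_cost G \<zeta>)"
  have fin: "path_cost G \<zeta> < \<infinity>" using a by (metis ennreal_less_top infinity_ennreal_def less_trans)
  then have "ennreal c < ennreal a" using a by (simp add: c_def)
  then have ca: "c < a" by (simp add: c_def ennreal_less_iff)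
  \<comment> \<open>The gap is quartered: one part each for the smoothing, the mesh and the
    fluctuations; the fourth remains as slack.\<close>
  define g where "g = (a - c) / 4"
  have g: "0 < g" "a = c + g * 4" using ca by (simp_all add: g_def field_simps)
  \<comment> \<open>The distance is bounded by the sum of \<open>CARD('s)\<close> coordinate errors.
    Each is below \<open>2 * \<rho>'\<close>, half from fluctuations and half from
    \<open>block_mean_total\<close>.\<close>
  define \<rho>' where "\<rho>' = \<rho> / (2 * ?d)"
  have \<rho>': "0 < \<rho>'" "\<rho> = 2 * ?d * \<rho>'" using \<rho> by (auto simp: \<rho>'_def)
  have "((\<lambda>\<theta>. - 2 * ln (1 - \<theta>) - \<theta> * ln p0) \<longlongrightarrow> - 2 * ln (1 - 0) - 0 * ln p0) (at_right 0)"
    by (intro tendsto_intros) auto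
  then have "\<forall>\<^sub>F \<theta> in at_right 0. - 2 * ln (1 - \<theta>) - \<theta> * ln p0 < g"
    using g(1) by (intro order_tendstoD(2)) auto
  moreover have "\<forall>\<^sub>F \<theta> in at_right (0::real). \<theta> < min 1 (\<rho>' / 2)"
    using order_tendstoD(2)[OF tendsto_ident_at, of 0 "min 1 (\<rho>' / 2)"] \<rho>' by simp
  moreover have "\<forall>\<^sub>F \<theta> in at_right (0::real). 0 < \<theta>" by (rule eventually_at_right_less)
  ultimately have "\<forall>\<^sub>F \<theta> in at_right 0. - 2 * ln (1 - \<theta>) - \<theta> * ln p0 < g \<and> \<theta> < min 1 (\<rho>' / 2) \<and> 0 < \<theta>"
    by eventually_elim auto
  then obtain \<theta> where th: "- 2 * ln (1 - \<theta>) - \<theta> * ln p0 < g" "\<theta> < min 1 (\<rho>' / 2)" "0 < \<theta>"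
    using eventually_happens'[OF trivial_limit_at_right_real] by blast
  \<comment> \<open>\<open>\<theta>\<close> is fixed before \<open>K\<close> because this constant
    grows without bound as \<open>\<theta>\<close> tends to 0.\<close>
  define B where "B = 2 * (2 / (\<theta> * k0) + 1) - ln p0"
  have "(\<lambda>K. B / sqrt (real K)) \<longlonglongrightarrow> 0"
    by (intro tendsto_divide_0[OF tendsto_const] filterlim_at_top_imp_at_infinity
        filterlim_compose[OF sqrt_at_top filterlim_real_sequentially])
  then have "\<forall>\<^sub>F K in sequentially. B / sqrt (real K) < g" using g(1) by (rule order_tendstoD(2))
  moreover have "\<forall>\<^sub>F K in sequentially. 1 / real K < \<rho>' / 2"
    using \<rho>' by (intro order_tendstoD(2)[OF lim_1_over_n]) auto
  ultimately have "\<forall>\<^sub>F K in sequentially. B / sqrt (real K) < g \<and> 1 / real K < \<rho>' / 2 \<and> 0 < K"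
    using eventually_gt_at_top[of 0] by eventually_elim auto
  then obtain K where Kf: "B / sqrt (real K) < g" "1 / real K < \<rho>' / 2" "0 < K"
    using eventually_happens'[OF sequentially_bot] by blast
  interpret smoothed_path P \<zeta> \<kappa> \<theta> p0 k0 K
    by unfold_locales (use \<zeta> bal supp fin \<kappa> th Kf k0 k1 p0 p1 in auto)
  define T where "T = (1 / real K) * (\<Sum>b<K. \<Sum>x\<in>UNIV. \<Sum>y\<in>UNIV. smooth b $ (x, y) * log_ratio (smooth b) (kernel_floor \<theta> (block_mean b) b) x y)"
  have T: "T \<le> c + g + g"
    using total_block_cost th(1) Kf(1) unfolding T_def c_def B_def by linarith
  have "\<exists>n0. \<forall>n\<ge>n0. exp (- real n * (T + g)) / 2
    \<le> path_exp (self_kernel G) x0 n (\<lambda>x. of_bool (\<forall>y. \<bar>emp x (Suc n) $ y - block_mean K $ y\<bar> < \<rho>'))"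
    unfolding T_def
  proof (rule block_chain_lower_bound[OF block_chain_smooth])
    show "(x, y) \<in> adj_support (afp_adjacency P)" if "0 < smooth b $ (x, y)" for b x y
      using that by (intro smooth_support[of b]) simp
    show "0 < Po x y" if "0 < smooth 0 $ (x, y)" for x y using that \<kappa>(3) by (simp add: smooth_def)
  qed (use th g \<rho>' in auto)
  then obtain n0 where n0: "\<And>n. n \<ge> n0 \<Longrightarrow> exp (- real n * (T + g)) / 2
    \<le> path_exp (self_kernel G) x0 n (\<lambda>x. of_bool (\<forall>y. \<bar>emp x (Suc n) $ y - block_mean K $ y\<bar> < \<rho>'))" by blast
  have near: "dist v (occupation 1) < \<rho>" if v: "\<forall>y. \<bar>v $ y - block_mean K $ y\<bar> < \<rho>'" for v :: "real ^ 's"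
  proof -
    have "\<bar>v $ y - occupation 1 $ y\<bar> < 2 * \<rho>'" for y
      using v[rule_format, of y] block_mean_total[of y] th(2) Kf(2) by linarith
    then have "(\<Sum>y\<in>UNIV. \<bar>(v - occupation 1) $ y\<bar>) < (\<Sum>y\<in>(UNIV::'s set). 2 * \<rho>')"
      by (intro sum_strict_mono) auto
    also have "\<dots> = \<rho>" by (simp add: \<rho>'(2))
    finally show ?thesis using norm_le_l1_cart[of "v - occupation 1"] by (simp add: dist_norm)
  qed
  have "exp (- real n * a) / 2 \<le> path_exp (self_kernel G) x0 n (\<lambda>x. of_bool (dist (emp x (Suc n)) (occupation 1) < \<rho>))"
    if "n \<ge> n0" for n
  proof -
    have "real n * (T + g) \<le> real n * a" using T g by (intro mult_left_mono) auto
    then have "exp (- real n * a) / 2 \<le> exp (- real n * (T + g)) / 2" by simp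
    also note n0[OF that]
    also have "path_exp (self_kernel G) x0 n (\<lambda>x. of_bool (\<forall>y. \<bar>emp x (Suc n) $ y - block_mean K $ y\<bar> < \<rho>'))
      \<le> path_exp (self_kernel G) x0 n (\<lambda>x. of_bool (dist (emp x (Suc n)) (occupation 1) < \<rho>))"
      using near by (intro path_exp_mono self_kernel_nonneg) (auto simp: of_bool_def)
    finally show ?thesis .
  qed
  then show ?thesis by blast
qed

lemma local_lower_bound:
  assumes m: "rate_function (afp_adjacency P) G m < ennreal a" and \<rho>: "0 < \<rho>"
  shows "\<exists>n0. \<forall>n\<ge>n0. exp (- real n * a) / 2
    \<le> path_exp (self_kernel G) x0 n (\<lambda>x. of_bool (dist (emp x (Suc n)) m < \<rho>))"
proof -
  obtain \<eta> M where \<eta>: "\<eta> \<in> admissible_controls (afp_adjacency P) m" "solves m \<eta> M" and c: "control_cost G \<eta> M < ennreal a"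
    using m unfolding rate_function_def INF_less_iff by auto
  obtain \<zeta> where \<zeta>: "simplex_path \<zeta>" "AE u\<in>{0<..1} in lborel. marginal1 (\<zeta> u) = marginal2 (\<zeta> u)"
    "AE u\<in>{0<..1} in lborel. \<forall>p\<in>- adj_support (afp_adjacency P). \<zeta> u $ p = 0"
    "m = marginal1 (cumulative \<zeta> 1)" "control_cost G \<eta> M = path_cost G \<zeta>"
    using admissible_control_path[OF \<eta> step_cost_measurable] by blast
  obtain \<xi> where \<xi>: "simplex_path \<xi>" "\<forall>u. marginal1 (\<xi> u) = marginal2 (\<xi> u)"
    "\<forall>u. \<forall>p\<in>- adj_support (afp_adjacency P). \<xi> u $ p = 0"
    "\<And>u. u \<le> 1 \<Longrightarrow> cumulative \<xi> u = cumulative \<zeta> u" "path_cost G \<xi> = path_cost G \<zeta>"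
    using admissible_version[OF \<zeta>(1-3)] by metis
  show ?thesis
    using path_lower_bound[OF \<xi>(1-3) _ \<rho>, of a x0] c unfolding \<xi>(4)[OF order_refl] \<zeta>(4) \<xi>(5) \<zeta>(5) by blast
qed

end

section \<open>From local bounds to the large deviation principle\<close>

lemma limsup_log_prob_le:
  assumes C: "0 < C" and p: "\<And>n. n \<ge> n0 \<Longrightarrow> p n \<le> C * exp (- real n * a)" "\<And>n. 0 \<le> p n"
  shows "limsup (\<lambda>n. ereal (1 / real n) * log_prob (p n)) \<le> ereal (- a)"
proof -
  have "\<forall>\<^sub>F n in sequentially. ereal (1 / real n) * log_prob (p n) \<le> ereal (ln C * (1 / real n) - a)"
    using eventually_ge_at_top[of "max 1 n0"]
  proof eventually_elim
    case (elim n)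
    show ?case
    proof (cases "p n = 0")
      case True
      then show ?thesis using elim by (simp add: log_prob_def)
    next
      case False
      then have "ln (p n) \<le> ln (C * exp (- real n * a))" using p elim C by (intro ln_mono) (auto simp: less_le)
      also have "\<dots> = ln C - real n * a" using C by (simp add: ln_mult_pos)
      finally have "(1 / real n) * ln (p n) \<le> (1 / real n) * (ln C - real n * a)" by (intro mult_left_mono) auto
      also have "\<dots> = ln C * (1 / real n) - a" using elim by (simp add: field_simps)
      finally show ?thesis using False by (simp add: log_prob_def)
    qed
  qed
  then have "limsup (\<lambda>n. ereal (1 / real n) * log_prob (p n)) \<le> limsup (\<lambda>n. ereal (ln C * (1 / real n) - a))"
    by (rule Limsup_mono)
  also have "\<dots> = ereal (ln C * 0 - a)"
    by (intro lim_imp_Limsup sequentially_bot tendsto_ereal tendsto_diff tendsto_mult tendsto_const lim_1_over_n)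
  finally show ?thesis by simp
qed

lemma liminf_log_prob_ge:
  assumes C: "0 < C" and p: "\<And>n. n \<ge> n0 \<Longrightarrow> C * exp (- real n * a) \<le> p n"
  shows "ereal (- a) \<le> liminf (\<lambda>n. ereal (1 / real n) * log_prob (p n))"
proof -
  have "ereal (- a) = ereal (ln C * 0 - a)" by simp
  also have "\<dots> = liminf (\<lambda>n. ereal (ln C * (1 / real n) - a))"
    by (intro lim_imp_Liminf[symmetric] sequentially_bot tendsto_ereal tendsto_diff tendsto_mult tendsto_const lim_1_over_n)
  also have "\<dots> \<le> liminf (\<lambda>n. ereal (1 / real n) * log_prob (p n))"
  proof (rule Liminf_mono)
    show "\<forall>\<^sub>F n in sequentially. ereal (ln C * (1 / real n) - a) \<le> ereal (1 / real n) * log_prob (p n)"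
      using eventually_ge_at_top[of "max 1 n0"]
    proof eventually_elim
      case (elim n)
      have q: "0 < C * exp (- real n * a)" using C by simp
      have pn: "0 < p n" using q p[of n] elim by simp
      have "ln C * (1 / real n) - a = (1 / real n) * (ln C - real n * a)" using elim by (simp add: field_simps)
      also have "ln C - real n * a = ln (C * exp (- real n * a))" using C by (simp add: ln_mult_pos)
      also have "(1 / real n) * ln (C * exp (- real n * a)) \<le> (1 / real n) * ln (p n)"
        using p[of n] q elim by (intro mult_left_mono ln_mono) auto
      finally show ?case using pn by (simp add: log_prob_def)
    qed
  qed
  finally show ?thesis .
qed

lemma exp_decay_contradiction:
  assumes "b < a" and le: "\<And>n. n \<ge> n0 \<Longrightarrow> exp (- real n * b) / 2 \<le> C * exp (- real n * a)"
  shows False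
proof -
  obtain n where n: "2 * \<bar>C\<bar> / (a - b) < real n" using reals_Archimedean2 by blast
  define N where "N = max n n0"
  have "exp (- real N * b) / 2 * exp (real N * a) \<le> C * exp (- real N * a) * exp (real N * a)"
    using le[of N] by (intro mult_right_mono) (auto simp: N_def)
  then have "exp (real N * a - real N * b) \<le> C * 2"
    by (simp add: mult.assoc exp_minus exp_diff field_simps)
  moreover have "2 * \<bar>C\<bar> < real N * (a - b)"
  proof -
    have "2 * \<bar>C\<bar> < real n * (a - b)" using n assms(1) by (simp add: pos_divide_less_eq)
    also have "\<dots> \<le> real N * (a - b)" using assms(1) by (intro mult_right_mono) (auto simp: N_def)
    finally show ?thesis .
  qed
  moreover have "1 + (real N * a - real N * b) \<le> exp (real N * a - real N * b)" by (rule exp_ge_add_one_self)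
  ultimately show False unfolding right_diff_distrib by (smt (verit))
qed

text \<open>On a compact space local exponential bounds on both sides give the full principle, including
  the compactness of the sublevel sets.\<close>

lemma large_deviation_principle_of_local_bounds:
  fixes Y :: "nat \<Rightarrow> 'w \<Rightarrow> 'a::metric_space" and I :: "'a \<Rightarrow> ennreal"
  assumes \<Omega>: "prob_space \<Omega>" and meas: "\<And>n S. {\<omega> \<in> space \<Omega>. Y n \<omega> \<in> S} \<in> sets \<Omega>"
    and T: "compact T" and YT: "\<And>n \<omega>. Y n \<omega> \<in> T"
    and upper: "\<And>m a. m \<in> T \<Longrightarrow> 0 \<le> a \<Longrightarrow> ennreal a < I m \<Longrightarrow>
      \<exists>\<rho>>0. \<exists>r n0. \<forall>n\<ge>n0. measure \<Omega> {\<omega> \<in> space \<Omega>. dist (Y n \<omega>) m < \<rho>} \<le> real r * exp (- real n * a)"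
    and lower: "\<And>m a \<rho>. m \<in> T \<Longrightarrow> I m < ennreal a \<Longrightarrow> 0 < \<rho> \<Longrightarrow>
      \<exists>n0. \<forall>n\<ge>n0. exp (- real n * a) / 2 \<le> measure \<Omega> {\<omega> \<in> space \<Omega>. dist (Y n \<omega>) m < \<rho>}"
  shows "large_deviation_principle \<Omega> (top_of_set T) Y I"
proof -
  interpret prob_space \<Omega> by (rule \<Omega>)
  have ball: "{\<omega> \<in> space \<Omega>. dist (Y n \<omega>) m < \<rho>} \<in> sets \<Omega>" for n m \<rho>
    using meas[of n "{y. dist y m < \<rho>}"] by simp
  have "compact {m \<in> T. I m \<le> ennreal c}" for c
  proof -
    define S where "S = {m \<in> T. I m \<le> ennreal c}"
    \<comment> \<open>Otherwise there are rates \<open>b < a\<close> with \<open>c < b\<close> and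
      \<open>a < I x\<close>. Some \<open>y\<close> of the sublevel set lies so close to
      \<open>x\<close> that a ball around \<open>y\<close> is contained in the ball of the upper
      bound at \<open>x\<close>. The lower bound at \<open>y\<close> with rate \<open>b\<close> then
      contradicts the upper bound with rate \<open>a\<close>.\<close>
    have "x \<in> S" if x: "x \<in> closure S" for x
    proof (rule ccontr)
      assume xS: "x \<notin> S"
      have "closure S \<subseteq> T" by (rule closure_minimal[OF _ compact_imp_closed[OF T]]) (auto simp: S_def)
      then have xT: "x \<in> T" using x by blast
      then have "ennreal c < I x" using xS by (auto simp: S_def)
      then obtain e where e: "ennreal c < e" "e < I x" using dense by blast
      then obtain f where f: "ennreal c < f" "f < e" using dense by blast
      obtain a b where ab: "e = ennreal a" "0 \<le> a" "f = ennreal b" "0 \<le> b"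
        using e f by (metis ennreal_cases less_top order.strict_trans2 top_greatest not_less_iff_gr_or_eq)
      have "b < a" using f(2) ab by (simp add: ennreal_less_iff)
      obtain \<rho> r n0 where \<rho>: "0 < \<rho>" and up: "\<And>n. n \<ge> n0 \<Longrightarrow>
          measure \<Omega> {\<omega> \<in> space \<Omega>. dist (Y n \<omega>) x < \<rho>} \<le> real r * exp (- real n * a)"
        using upper[OF xT ab(2)] e(2) ab(1) by blast
      obtain y where y: "y \<in> S" "dist y x < \<rho> / 2"
        using x \<rho> unfolding closure_approachable by (meson half_gt_zero)
      have "y \<in> T" "I y < ennreal b" using y f(1) ab(3) by (auto simp: S_def)
      then obtain n1 where lo: "\<And>n. n \<ge> n1 \<Longrightarrow>
          exp (- real n * b) / 2 \<le> measure \<Omega> {\<omega> \<in> space \<Omega>. dist (Y n \<omega>) y < \<rho> / 2}"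
        using lower[of y b "\<rho> / 2"] \<rho> by auto
      have "exp (- real n * b) / 2 \<le> real r * exp (- real n * a)" if n: "n \<ge> max n0 n1" for n
      proof -
        have "measure \<Omega> {\<omega> \<in> space \<Omega>. dist (Y n \<omega>) y < \<rho> / 2} \<le> measure \<Omega> {\<omega> \<in> space \<Omega>. dist (Y n \<omega>) x < \<rho>}"
        proof (rule finite_measure_mono[OF _ ball], safe)
          fix \<omega> assume "dist (Y n \<omega>) y < \<rho> / 2"
          then show "dist (Y n \<omega>) x < \<rho>" using y(2) dist_triangle[of "Y n \<omega>" x y] by simp
        qed
        then show ?thesis using up[of n] lo[of n] n by simp
      qed
      then show False by (rule exp_decay_contradiction[OF \<open>b < a\<close>, of "max n0 n1"])
    qed
    then have "closed S" using closure_subset_eq[of S] by blast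
    then have "compact (T \<inter> S)" using T by (rule compact_Int_closed[rotated])
    moreover have "T \<inter> S = S" by (auto simp: S_def)
    ultimately show ?thesis by (simp add: S_def)
  qed
  then have 1: "\<forall>c. compactin (top_of_set T) {m \<in> topspace (top_of_set T). I m \<le> ennreal c}"
    by (auto simp: compactin_subtopology)
  have 2: "limsup (\<lambda>n. ereal (1 / real n) * log_prob (measure \<Omega> {\<omega> \<in> space \<Omega>. Y n \<omega> \<in> F})) \<le> - (INF m\<in>F. enn2ereal (I m))"
    if F: "closedin (top_of_set T) F" for F
  proof (rule ccontr)
    let ?L = "limsup (\<lambda>n. ereal (1 / real n) * log_prob (measure \<Omega> {\<omega> \<in> space \<Omega>. Y n \<omega> \<in> F}))"
    assume "\<not> ?thesis"
    then obtain z where z: "- (INF m\<in>F. enn2ereal (I m)) < ereal z" "ereal z < ?L"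
      using ereal_dense2[of "- (INF m\<in>F. enn2ereal (I m))" ?L] by (auto simp: not_le)
    define a where "a = - z"
    have a: "ereal a < enn2ereal (I m)" if "m \<in> F" for m
    proof -
      have "ereal a < (INF m\<in>F. enn2ereal (I m))" using z(1) by (simp add: a_def ereal_uminus_less_reorder flip: uminus_ereal.simps)
      also have "\<dots> \<le> enn2ereal (I m)" using that by (rule INF_lower)
      finally show ?thesis .
    qed
    have FT: "F \<subseteq> T" using F closedin_subset by fastforce
    have F_compact: "compact F" using F T by (rule closedin_compact[rotated])
    have "\<exists>C n0. 0 < C \<and> (\<forall>n\<ge>n0. measure \<Omega> {\<omega> \<in> space \<Omega>. Y n \<omega> \<in> F} \<le> C * exp (- real n * a))"
    proof (cases "0 \<le> a")
      \<comment> \<open>For negative \<open>a\<close> the claimed bound is at least 1, so it holds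
        trivially; the local bounds are available for \<open>a \<ge> 0\<close> only.\<close>
      case False
      have "measure \<Omega> {\<omega> \<in> space \<Omega>. Y n \<omega> \<in> F} \<le> 1 * exp (- real n * a)" for n
      proof -
        have "0 \<le> - real n * a" using False by (simp add: mult_nonneg_nonpos)
        then have "1 \<le> exp (- real n * a)" by simp
        then show ?thesis using prob_le_1[of "{\<omega> \<in> space \<Omega>. Y n \<omega> \<in> F}"] by linarith
      qed
      then show ?thesis by (intro exI[of _ 1] exI[of _ 0]) simp
    next
      case True
      have "\<forall>m\<in>F. \<exists>\<rho> r n0. 0 < \<rho> \<and> (\<forall>n\<ge>n0. measure \<Omega> {\<omega> \<in> space \<Omega>. dist (Y n \<omega>) m < \<rho>} \<le> real r * exp (- real n * a))"
      proof
        fix m assume m: "m \<in> F"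
        have "ennreal a < I m" using a[OF m] True by (simp add: less_ennreal.rep_eq enn2ereal_ennreal)
        then show "\<exists>\<rho> r n0. 0 < \<rho> \<and> (\<forall>n\<ge>n0. measure \<Omega> {\<omega> \<in> space \<Omega>. dist (Y n \<omega>) m < \<rho>} \<le> real r * exp (- real n * a))"
          using upper[of m a] m FT True by blast
      qed
      from bchoice[OF this] obtain \<rho> where "\<forall>m\<in>F. \<exists>r n0. 0 < \<rho> m \<and>
          (\<forall>n\<ge>n0. measure \<Omega> {\<omega> \<in> space \<Omega>. dist (Y n \<omega>) m < \<rho> m} \<le> real r * exp (- real n * a))" by blast
      from bchoice[OF this] obtain r where "\<forall>m\<in>F. \<exists>n0. 0 < \<rho> m \<and>
          (\<forall>n\<ge>n0. measure \<Omega> {\<omega> \<in> space \<Omega>. dist (Y n \<omega>) m < \<rho> m} \<le> real (r m) * exp (- real n * a))" by blast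
      from bchoice[OF this] obtain n0 where n0: "\<forall>m\<in>F. 0 < \<rho> m \<and>
          (\<forall>n\<ge>n0 m. measure \<Omega> {\<omega> \<in> space \<Omega>. dist (Y n \<omega>) m < \<rho> m} \<le> real (r m) * exp (- real n * a))" by blast
      have \<rho>: "0 < \<rho> m" if "m \<in> F" for m using n0 that by blast
      have up: "measure \<Omega> {\<omega> \<in> space \<Omega>. dist (Y n \<omega>) m < \<rho> m} \<le> real (r m) * exp (- real n * a)"
        if "m \<in> F" "n \<ge> n0 m" for m n using n0 that by blast
      have "F \<subseteq> (\<Union>m\<in>F. ball m (\<rho> m))" using \<rho> by force
      then obtain D where D: "D \<subseteq> F" "finite D" "F \<subseteq> (\<Union>m\<in>D. ball m (\<rho> m))"
        using compactE_image[OF F_compact, of F "\<lambda>m. ball m (\<rho> m)"] by blast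
      \<comment> \<open>The sum of the thresholds exceeds each of them, and the added 1 keeps the
        constant positive even for an empty cover.\<close>
      have "measure \<Omega> {\<omega> \<in> space \<Omega>. Y n \<omega> \<in> F} \<le> ((\<Sum>m\<in>D. real (r m)) + 1) * exp (- real n * a)"
        if n: "n \<ge> (\<Sum>m\<in>D. n0 m)" for n
      proof -
        have "measure \<Omega> {\<omega> \<in> space \<Omega>. Y n \<omega> \<in> F} \<le> measure \<Omega> (\<Union>m\<in>D. {\<omega> \<in> space \<Omega>. dist (Y n \<omega>) m < \<rho> m})"
        proof (intro finite_measure_mono sets.finite_UN D(2) ball subsetI)
          fix \<omega> assume \<omega>: "\<omega> \<in> {\<omega> \<in> space \<Omega>. Y n \<omega> \<in> F}"
          then obtain m where "m \<in> D" "Y n \<omega> \<in> ball m (\<rho> m)" using D(3) by blast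
          then show "\<omega> \<in> (\<Union>m\<in>D. {\<omega> \<in> space \<Omega>. dist (Y n \<omega>) m < \<rho> m})"
            using \<omega> by (auto simp: dist_commute)
        qed
        also have "\<dots> \<le> (\<Sum>m\<in>D. measure \<Omega> {\<omega> \<in> space \<Omega>. dist (Y n \<omega>) m < \<rho> m})"
          using ball by (intro finite_measure_subadditive_finite D(2)) auto
        also have "\<dots> \<le> (\<Sum>m\<in>D. real (r m) * exp (- real n * a))"
        proof (rule sum_mono)
          fix m assume m: "m \<in> D"
          have "n0 m \<le> (\<Sum>m\<in>D. n0 m)" using m D(2) by (intro member_le_sum) auto
          then show "measure \<Omega> {\<omega> \<in> space \<Omega>. dist (Y n \<omega>) m < \<rho> m} \<le> real (r m) * exp (- real n * a)"
            using up[of m n] m D(1) n by auto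
        qed
        also have "\<dots> \<le> ((\<Sum>m\<in>D. real (r m)) + 1) * exp (- real n * a)"
          unfolding sum_distrib_right[symmetric] by (intro mult_right_mono) auto
        finally show ?thesis .
      qed
      moreover have "0 < (\<Sum>m\<in>D. real (r m)) + 1" by (intro add_nonneg_pos sum_nonneg) auto
      ultimately show ?thesis by blast
    qed
    then obtain C n0 where C: "0 < C" "\<And>n. n \<ge> n0 \<Longrightarrow> measure \<Omega> {\<omega> \<in> space \<Omega>. Y n \<omega> \<in> F} \<le> C * exp (- real n * a)"
      by blast
    have "?L \<le> ereal (- a)" by (rule limsup_log_prob_le[of C n0]) (use C in auto)
    then show False using z(2) by (simp add: a_def)
  qed
  have 3: "- (INF m\<in>U. enn2ereal (I m)) \<le> liminf (\<lambda>n. ereal (1 / real n) * log_prob (measure \<Omega> {\<omega> \<in> space \<Omega>. Y n \<omega> \<in> U}))"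
    if U: "openin (top_of_set T) U" for U
  proof (rule ccontr)
    let ?L = "liminf (\<lambda>n. ereal (1 / real n) * log_prob (measure \<Omega> {\<omega> \<in> space \<Omega>. Y n \<omega> \<in> U}))"
    assume "\<not> ?thesis"
    then obtain z where z: "?L < ereal z" "ereal z < - (INF m\<in>U. enn2ereal (I m))"
      using ereal_dense2[of ?L "- (INF m\<in>U. enn2ereal (I m))"] by (auto simp: not_le)
    define a where "a = - z"
    have "(INF m\<in>U. enn2ereal (I m)) < ereal a" using z(2) by (simp add: a_def ereal_less_uminus_reorder flip: uminus_ereal.simps)
    then obtain m where m: "m \<in> U" "enn2ereal (I m) < ereal a" unfolding INF_less_iff by blast
    have "0 \<le> a" using m(2) enn2ereal_nonneg[of "I m"] by (metis ereal_less_eq(5) less_imp_le order_trans)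
    then have Im: "I m < ennreal a" using m(2) by (simp add: less_ennreal.rep_eq enn2ereal_ennreal)
    obtain \<rho> where \<rho>: "0 < \<rho>" "ball m \<rho> \<inter> T \<subseteq> U"
      using U m(1) unfolding openin_contains_ball by blast
    have "m \<in> T" using U m(1) openin_subset by fastforce
    then obtain n0 where n0: "\<And>n. n \<ge> n0 \<Longrightarrow> exp (- real n * a) / 2 \<le> measure \<Omega> {\<omega> \<in> space \<Omega>. dist (Y n \<omega>) m < \<rho>}"
      using lower[OF _ Im \<rho>(1)] by blast
    have "1 / 2 * exp (- real n * a) \<le> measure \<Omega> {\<omega> \<in> space \<Omega>. Y n \<omega> \<in> U}" if "n \<ge> n0" for n
    proof -
      have "measure \<Omega> {\<omega> \<in> space \<Omega>. dist (Y n \<omega>) m < \<rho>} \<le> measure \<Omega> {\<omega> \<in> space \<Omega>. Y n \<omega> \<in> U}"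
        using \<rho>(2) YT by (intro finite_measure_mono meas) (auto simp: dist_commute)
      then show ?thesis using n0[OF that] by simp
    qed
    then have "ereal (- a) \<le> ?L" by (intro liminf_log_prob_ge[of "1 / 2" n0]) auto
    then show False using z(1) by (simp add: a_def)
  qed
  show ?thesis unfolding large_deviation_principle_def using 1 2 3 by blast
qed

theorem mainTheorem2:
  fixes P :: "real ^ 's option ^ ('s::finite) option"
    and \<Omega> :: "'w measure"
    and X :: "nat \<Rightarrow> 'w \<Rightarrow> 's"
    and x\<^sub>0 :: 's
  assumes "transition_kernel P"
    and "irreducible_matrix (interior_part P)"
    and "self_interacting_chain \<Omega> (afp_kernel P) x\<^sub>0 X"
  shows "large_deviation_principle \<Omega> weak_topology
    (\<lambda>n. empirical_measure X (Suc n))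
    (rate_function (afp_adjacency P) (afp_kernel P))"
proof -
  interpret afp_chain P by unfold_locales (rule assms)+
  have emp: "C (emp x (Suc n)) = C (emp x' (Suc n))" if "\<forall>i\<le>n. x i = x' i" for C :: "real ^ 's \<Rightarrow> bool" and x x' n
  proof -
    have "emp x (Suc n) = emp x' (Suc n)" using that by (simp add: emp_def)
    then show ?thesis by simp
  qed
  have prob: "measure \<Omega> {\<omega> \<in> space \<Omega>. C (empirical_measure X (Suc n) \<omega>)}
      = path_exp (self_kernel G) x\<^sub>0 n (\<lambda>x. of_bool (C (emp x (Suc n))))"
    and meas: "{\<omega> \<in> space \<Omega>. C (empirical_measure X (Suc n) \<omega>)} \<in> sets \<Omega>" for C n
    unfolding empirical_measure_eq_emp by (rule prob_chain_eq_path_exp[OF assms(3)], rule emp, assumption)+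
  have prob_ball: "measure \<Omega> {\<omega> \<in> space \<Omega>. dist (empirical_measure X (Suc n) \<omega>) m < \<rho>}
      = path_exp (self_kernel G) x\<^sub>0 n (\<lambda>x. of_bool (dist (emp x (Suc n)) m < \<rho>))" for n m \<rho>
    by (rule prob[where C = "\<lambda>v. dist v m < \<rho>"])
  \<comment> \<open>On a finite state space the weak topology is the Euclidean one on a compact
    simplex, so the metric criterion applies.\<close>
  show ?thesis
    unfolding weak_topology_eq
  proof (rule large_deviation_principle_of_local_bounds)
    show "prob_space \<Omega>" using assms(3) by (simp add: self_interacting_chain_def)
    show "empirical_measure X (Suc n) \<omega> \<in> prob_simplex" for n \<omega>
      unfolding empirical_measure_eq_emp by (rule emp_simplex) simp
    show "{\<omega> \<in> space \<Omega>. empirical_measure X (Suc n) \<omega> \<in> S} \<in> sets \<Omega>" for n S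
      by (rule meas)
    show "\<exists>\<rho>>0. \<exists>r n0. \<forall>n\<ge>n0. measure \<Omega> {\<omega> \<in> space \<Omega>. dist (empirical_measure X (Suc n) \<omega>) m < \<rho>} \<le> real r * exp (- real n * a)"
      if "ennreal a < rate_function (afp_adjacency P) G m" for m a
      unfolding prob_ball by (rule local_upper_bound[OF that])
    show "\<exists>n0. \<forall>n\<ge>n0. exp (- real n * a) / 2 \<le> measure \<Omega> {\<omega> \<in> space \<Omega>. dist (empirical_measure X (Suc n) \<omega>) m < \<rho>}"
      if "rate_function (afp_adjacency P) G m < ennreal a" "0 < \<rho>" for m a \<rho>
      unfolding prob_ball by (rule local_lower_bound[OF that])
  qed (rule compact_prob_simplex)
qed

end
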